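(* Let $n\ge 3$ and let $M$ be a catenoid in $\mathbb{R}^{n+1}$. Then the (Morse) index of $M$ as a minimal hypersurface is $1$.
   Context: Catenoid: let $n\ge 3$ and $\phi_0>0$. Let $\phi$ be the solution of $$\frac{\phi''}{(1+\phi'^2)^{3/2}}-\frac{n-1}{\phi(1+\phi'^2)^{1/2}}=0,\qquad \phi(0)=\phi_0,\qquad \phi'(0)=0 .$$ It is an even smooth positive function defined on the maximal interval $I=(-S,S)$, where $S=S(\phi_0)=\int_{\phi_0}^{\infty}\frac{d\tau}{(a\tau^{2(n-1)}-1)^{1/2}}<\infty$ and $a=\phi_0^{-2(n-1)}$. A catenoid in $\mathbb{R}^{n+1}$ is the image of the embedding $F:I\times\mathbb{S}^{n-1}\to\mathbb{R}^{n+1}$, $F(s,\omega)=(\phi(s)\omega,s)$, where $\mathbb{S}^{n-1}\subset\mathbb{R}^n$ is the unit sphere, or any hypersurface obtained from such an image by a rigid motion of $\mathbb{R}^{n+1}$. It is a complete minimal hypersurface. Index: let $A$ be the second fundamental form of $M$, $|A|$ its norm, $\Delta$ the Laplacian of $M$, and $L=\Delta+|A|^2$ the stability operator. For a bounded (relatively compact) domain $D\subset M$, the eigenvalues of $L$ on $D$ are the numbers $\lambda$ for which $Lf=-\lambda f$ in $D$, $f|_{\partial D}=0$ has a nonzero solution. The index of $M$ is the supremum over all such $D$ of the number (counted with multiplicity) of negative Dirichlet eigenvalues of $L$ on $D$; equivalently, the maximal dimension of a linear subspace of $C_0^\infty(M)$ on which the quadratic form $\int_M(|\nabla f|^2-|A|^2f^2)$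 is negative definite. *)

theory Defs
  imports "HOL-Analysis.Analysis" "HOL-Library.Function_Algebras" "HOL-Library.Extended_Nat"
begin

section \<open>Calculus on a hypersurface of a Euclidean space\<close>

text \<open>
  A hypersurface is a subset \<open>M\<close> of a Euclidean space. Functions and vector fields on \<open>M\<close> are
  functions on the ambient space of which only the values on \<open>M\<close> matter: all derivatives are
  taken \<^emph>\<open>within\<close> \<open>M\<close>. A derivative within \<open>M\<close> at \<open>p\<close> is a linear map on the
  ambient space that is determined only on the tangent space at \<open>p\<close>; below it is only ever applied
  to tangent vectors, where it is the differential of the function on \<open>M\<close>.
\<close>

definition tangent_space :: "'a::euclidean_space set \<Rightarrow> 'a \<Rightarrow> 'a set" where
  "tangent_space M p =
     {v. \<exists>\<gamma> :: real \<Rightarrow> 'a. (\<forall>t. \<gamma> t \<in> M) \<and> \<gamma> 0 = p \<and> (\<gamma> has_vector_derivative v) (at 0)}"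

definition is_tangent_frame :: "'a::euclidean_space set \<Rightarrow> 'a \<Rightarrow> 'a set \<Rightarrow> bool" where
  "is_tangent_frame M p B \<longleftrightarrow>
     pairwise orthogonal B \<and> (\<forall>e\<in>B. norm e = 1) \<and> span B = tangent_space M p"

text \<open>None of the quantities defined below depends on which orthonormal frame is chosen.\<close>

definition tangent_frame :: "'a::euclidean_space set \<Rightarrow> 'a \<Rightarrow> 'a set" where
  "tangent_frame M p = (SOME B. is_tangent_frame M p B)"

definition surface_gradient :: "'a::euclidean_space set \<Rightarrow> ('a \<Rightarrow> real) \<Rightarrow> 'a \<Rightarrow> 'a" where
  "surface_gradient M f p =
     (\<Sum>e\<in>tangent_frame M p. frechet_derivative f (at p within M) e *\<^sub>R e)"

definition surface_divergence :: "'a::euclidean_space set \<Rightarrow> ('a \<Rightarrow> 'a) \<Rightarrow> 'a \<Rightarrow> real" where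
  "surface_divergence M X p =
     (\<Sum>e\<in>tangent_frame M p. frechet_derivative X (at p within M) e \<bullet> e)"

definition surface_laplacian :: "'a::euclidean_space set \<Rightarrow> ('a \<Rightarrow> real) \<Rightarrow> 'a \<Rightarrow> real" where
  "surface_laplacian M f = surface_divergence M (surface_gradient M f)"

text \<open>\<open>C\<^sup>k\<close> functions on a relatively open subset \<open>D\<close> of \<open>M\<close>.\<close>

primrec surface_Ck_on :: "nat \<Rightarrow> 'a::euclidean_space set \<Rightarrow> 'a set \<Rightarrow> ('a \<Rightarrow> real) \<Rightarrow> bool" where
  "surface_Ck_on 0 M D f \<longleftrightarrow> continuous_on D f"
| "surface_Ck_on (Suc k) M D f \<longleftrightarrow>
     (\<forall>p\<in>D. f differentiable (at p within M)) \<and>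
     (\<forall>b\<in>Basis. surface_Ck_on k M D (\<lambda>p. surface_gradient M f p \<bullet> b))"

definition unit_normal_near :: "'a::euclidean_space set \<Rightarrow> 'a \<Rightarrow> ('a \<Rightarrow> 'a) \<Rightarrow> bool" where
  "unit_normal_near M p N \<longleftrightarrow>
     (\<exists>U. open U \<and> p \<in> U \<and> continuous_on (M \<inter> U) N \<and>
        (\<forall>q\<in>M \<inter> U. norm (N q) = 1 \<and> (\<forall>v\<in>tangent_space M q. N q \<bullet> v = 0)))"

text \<open>
  The second fundamental form \<open>A\<^sub>p(u, v) = - \<langle>D\<^sub>u N, v\<rangle>\<close>. Its sign depends on the
  choice of the local unit normal field \<open>N\<close>; its norm does not.
\<close>

definition second_fundamental_form :: "'a::euclidean_space set \<Rightarrow> 'a \<Rightarrow> 'a \<Rightarrow> 'a \<Rightarrow> real" where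
  "second_fundamental_form M p u v =
     - (frechet_derivative (SOME N. unit_normal_near M p N) (at p within M) u \<bullet> v)"

definition norm_second_fundamental_form :: "'a::euclidean_space set \<Rightarrow> 'a \<Rightarrow> real" where
  "norm_second_fundamental_form M p =
     sqrt (\<Sum>e\<in>tangent_frame M p. \<Sum>e'\<in>tangent_frame M p. (second_fundamental_form M p e e')\<^sup>2)"

definition stability_operator :: "'a::euclidean_space set \<Rightarrow> ('a \<Rightarrow> real) \<Rightarrow> 'a \<Rightarrow> real" where
  "stability_operator M f p =
     surface_laplacian M f p + (norm_second_fundamental_form M p)\<^sup>2 * f p"


section \<open>Dirichlet eigenvalues and the Morse index\<close>

definition bounded_domain :: "'a::euclidean_space set \<Rightarrow> 'a set \<Rightarrow> bool" where
  "bounded_domain M D \<longleftrightarrow>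
     D \<noteq> {} \<and> openin (top_of_set M) D \<and> connected D \<and> compact (closure D) \<and> closure D \<subseteq> M"

text \<open>
  The classical solutions of \<open>L f = - \<mu> f\<close> in \<open>D\<close> with \<open>f = 0\<close> on the boundary. A function
  on the closure of \<open>D\<close> is represented by its extension by \<open>0\<close>, so that different elements are
  different functions on \<open>D\<close>.
\<close>

definition dirichlet_eigenspace ::
    "'a::euclidean_space set \<Rightarrow> 'a set \<Rightarrow> real \<Rightarrow> ('a \<Rightarrow> real) set" where
  "dirichlet_eigenspace M D \<mu> =
     {f. surface_Ck_on 2 M D f \<and> continuous_on (closure D) f \<and> (\<forall>p. p \<notin> D \<longrightarrow> f p = 0) \<and>
         (\<forall>p\<in>D. stability_operator M f p = - \<mu> * f p)}"

text \<open>
  The dimension of a space of real-valued functions, as an extended natural number (the library's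
  \<^const>\<open>dim\<close> does not distinguish infinite dimension from dimension \<open>0\<close>).
\<close>

definition function_space_dim :: "('a \<Rightarrow> real) set \<Rightarrow> enat" where
  "function_space_dim V =
     (SUP B \<in> {B. finite B \<and> B \<subseteq> V \<and> \<not> module.dependent (\<lambda>c f x. c * f x) B}. enat (card B))"

text \<open>
  A real number that is not an eigenvalue has multiplicity \<open>0\<close>, so summing over all finite sets of
  negative reals counts the negative eigenvalues with multiplicity.
\<close>

definition num_negative_eigenvalues :: "'a::euclidean_space set \<Rightarrow> 'a set \<Rightarrow> enat" where
  "num_negative_eigenvalues M D =
     (SUP \<Lambda> \<in> {\<Lambda>. finite \<Lambda> \<and> \<Lambda> \<subseteq> {..<0}}.
        \<Sum>\<mu>\<in>\<Lambda>. function_space_dim (dirichlet_eigenspace M D \<mu>))"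

definition morse_index :: "'a::euclidean_space set \<Rightarrow> enat" where
  "morse_index M = (SUP D \<in> {D. bounded_domain M D}. num_negative_eigenvalues M D)"


section \<open>Catenoids\<close>

definition catenoid_half_height :: "nat \<Rightarrow> real \<Rightarrow> real" where
  "catenoid_half_height n \<phi>\<^sub>0 =
     (let a = 1 / \<phi>\<^sub>0 ^ (2 * (n - 1))
      in integral {\<phi>\<^sub>0<..} (\<lambda>\<tau>. 1 / sqrt (a * \<tau> ^ (2 * (n - 1)) - 1)))"

definition catenoid_profile :: "nat \<Rightarrow> real \<Rightarrow> real \<Rightarrow> (real \<Rightarrow> real) \<Rightarrow> bool" where
  "catenoid_profile n \<phi>\<^sub>0 S \<phi> \<longleftrightarrow>
     S = catenoid_half_height n \<phi>\<^sub>0 \<and> \<phi> 0 = \<phi>\<^sub>0 \<and>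
     (\<exists>\<phi>' \<phi>''. \<phi>' 0 = 0 \<and>
        (\<forall>s\<in>{-S<..<S}.
           \<phi> s > 0 \<and>
           (\<phi> has_real_derivative \<phi>' s) (at s) \<and>
           (\<phi>' has_real_derivative \<phi>'' s) (at s) \<and>
           \<phi>'' s / (1 + (\<phi>' s)\<^sup>2) powr (3 / 2)
             - (real n - 1) / (\<phi> s * (1 + (\<phi>' s)\<^sup>2) powr (1 / 2)) = 0))"

text \<open>\<open>\<real>\<^sup>n\<^sup>+\<^sup>1\<close> is the product \<open>\<real>\<^sup>n \<times> \<real>\<close>, with \<open>n\<close> the cardinality of the index type.\<close>

definition standard_catenoid :: "real \<Rightarrow> (real \<Rightarrow> real) \<Rightarrow> ((real ^ 'n) \<times> real) set" where
  "standard_catenoid S \<phi> = (\<lambda>(s, \<omega>). (\<phi> s *\<^sub>R \<omega>, s)) ` ({-S<..<S} \<times> sphere 0 1)"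

definition rigid_motion :: "('a::euclidean_space \<Rightarrow> 'a) \<Rightarrow> bool" where
  "rigid_motion T \<longleftrightarrow> (\<exists>c Q. orthogonal_transformation Q \<and> T = (\<lambda>x. c + Q x))"

definition catenoid :: "((real ^ 'n) \<times> real) set \<Rightarrow> bool" where
  "catenoid M \<longleftrightarrow>
     (\<exists>\<phi>\<^sub>0 S \<phi> T. \<phi>\<^sub>0 > 0 \<and> catenoid_profile CARD('n) \<phi>\<^sub>0 S \<phi> \<and>
        rigid_motion T \<and> M = T ` standard_catenoid S \<phi>)"

end

theory Submission
  imports Defs
begin

text \<open>
  The catenoid is conformal to the punctured space \<open>\<real>\<^sup>n - {0}\<close>. There its stability form becomes
  \<open>Q(u) = \<integral> P |grad u|\<^sup>2 - q u\<^sup>2\<close> with radial weights, and by Jacobi's argument \<open>Q\<close> is nonnegative on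
  functions supported where some Jacobi field has no zeros. The fields of horizontal translations
  vanish only on hyperplanes, so averaging a function with its mirror image does not increase
  \<open>Q\<close>. Iterated averaging makes a function nearly constant on the waist sphere; if its mean there is
  zero it becomes nearly zero on the waist, which is the zero set of the field of the vertical
  translation, and so \<open>Q \<ge> 0\<close>. Two eigenfunctions with negative eigenvalues would span a plane on
  which \<open>Q\<close> is negative definite, and this plane contains a function of mean zero. All this is done
  with cutoffs and pointwise inequalities, because the boundary of the domain is arbitrary.

  Conversely, the field of the dilations is radial and changes sign. So does the solution of the radial
  equation for a small negative eigenvalue, which is an eigenfunction on its nodal annulus.
\<close>

section \<open>Gradients, divergences and the divergence theorem\<close>

text \<open>The boundary of the domain has no regularity: an eigenfunction is only continuous up to
  it, and its energy is not known to be finite. Every integration by parts therefore takes place on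
  a superlevel set of \<open>f1\<^sup>2 + f2\<^sup>2\<close>. Since the cutoff is an increasing
  function of this sum and is shared by both functions, its contribution to the energy identity has
  a good sign; this first makes the energy integrable, and the energy density then dominates all
  other error terms. The cut-off combinations have means that tend to zero without being zero, hence
  the stability estimate in the quantitative form
  \<open>Q h \<ge> - 4 * \<bar>mean h\<bar> * N h\<close>. Reflections replace averaging over the
  rotation group because the odd part of a function under one reflection vanishes on one hyperplane,
  the zero set of a single Jacobi field. Compactness of the unit sphere shows that finitely many
  reflections suffice up to any error. The Lipschitz constant on the sphere and the weighted L1 norm
  \<open>N\<close>, which control the errors, do not grow along the way.\<close>

definition gr :: "('a::euclidean_space \<Rightarrow> real) \<Rightarrow> 'a \<Rightarrow> 'a" where
  "gr f x = (\<Sum>b\<in>Basis. frechet_derivative f (at x) b *\<^sub>R b)"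

lemma gderiv_gr: "f differentiable (at x) \<Longrightarrow> GDERIV f x :> gr f x"
proof -
  assume "f differentiable (at x)"
  then have d: "(f has_derivative frechet_derivative f (at x)) (at x)"
    using frechet_derivative_works by blast
  then have l: "linear (frechet_derivative f (at x))"
    using has_derivative_linear by blast
  have "frechet_derivative f (at x) v = v \<bullet> gr f x" for v
  proof -
    have "frechet_derivative f (at x) v = frechet_derivative f (at x) (\<Sum>b\<in>Basis. (v \<bullet> b) *\<^sub>R b)"
      by (simp add: euclidean_representation)
    also have "\<dots> = (\<Sum>b\<in>Basis. (v \<bullet> b) * frechet_derivative f (at x) b)"
      using l by (simp add: linear_sum linear_cmul)
    also have "\<dots> = v \<bullet> gr f x"
      by (simp add: gr_def inner_sum_right mult.commute)
    finally show ?thesis .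
  qed
  then have "frechet_derivative f (at x) = (\<lambda>v. v \<bullet> gr f x)" by auto
  with d show ?thesis unfolding gderiv_def by simp
qed

lemma gderiv_imp_gr: "GDERIV f x :> D \<Longrightarrow> gr f x = D"
proof -
  assume "GDERIV f x :> D"
  then have "frechet_derivative f (at x) = (\<lambda>h. h \<bullet> D)"
    unfolding gderiv_def using frechet_derivative_at by metis
  then show ?thesis
    by (simp add: gr_def inner_commute[of _ D] euclidean_representation)
qed

lemma gderiv_differentiable: "GDERIV f x :> D \<Longrightarrow> f differentiable (at x)"
  unfolding gderiv_def differentiable_def by blast

lemma gderiv_transform_open:
  "GDERIV f x :> D \<Longrightarrow> open S \<Longrightarrow> x \<in> S \<Longrightarrow> (\<And>y. y \<in> S \<Longrightarrow> f y = g y) \<Longrightarrow> GDERIV g x :> D"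
  unfolding gderiv_def by (rule has_derivative_transform_within_open)

lemma gr_cong_open:
  assumes "open S" "x \<in> S" "\<And>y. y \<in> S \<Longrightarrow> f y = g y"
  shows "gr f x = gr g x"
proof -
  have "(f has_derivative d) (at x) \<longleftrightarrow> (g has_derivative d) (at x)" for d
    using has_derivative_transform_within_open[of f d x UNIV S g]
      has_derivative_transform_within_open[of g d x UNIV S f] assms by auto
  then show ?thesis unfolding gr_def frechet_derivative_def by simp
qed

definition C1_on :: "'a::euclidean_space set \<Rightarrow> ('a \<Rightarrow> real) \<Rightarrow> bool" where
  "C1_on S f \<longleftrightarrow> (\<forall>x\<in>S. f differentiable (at x)) \<and> continuous_on S (gr f)"

lemma C1_onI:
  assumes "\<And>x. x \<in> S \<Longrightarrow> GDERIV f x :> g x" "continuous_on S g"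
  shows "C1_on S f"
proof -
  have "gr f x = g x" if "x \<in> S" for x using assms(1)[OF that] by (rule gderiv_imp_gr)
  then show ?thesis unfolding C1_on_def
    using assms gderiv_differentiable[of f _ "g _"] continuous_on_cong[of S S "gr f" g]
    by (metis (no_types, lifting))
qed

lemma C1_onD: "C1_on S f \<Longrightarrow> x \<in> S \<Longrightarrow> GDERIV f x :> gr f x"
  unfolding C1_on_def using gderiv_gr by blast

lemma C1_on_gr: "C1_on S f \<Longrightarrow> continuous_on S (gr f)"
  unfolding C1_on_def by blast

lemma C1_on_imp_continuous_on: "C1_on S f \<Longrightarrow> continuous_on S f"
  unfolding C1_on_def
  by (meson continuous_at_imp_continuous_on differentiable_imp_continuous_within)

lemma C1_on_subset: "C1_on S f \<Longrightarrow> T \<subseteq> S \<Longrightarrow> C1_on T f"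
  unfolding C1_on_def using continuous_on_subset by blast

lemma C1_on_cong:
  assumes "open S" "\<And>x. x \<in> S \<Longrightarrow> f x = g x" "C1_on S f"
  shows "C1_on S g"
  using assms by (intro C1_onI[of S g "gr f"] gderiv_transform_open[of f _ _ S g] C1_on_gr C1_onD) auto

lemma C1_on_const: "C1_on S (\<lambda>x. c)"
  by (rule C1_onI[where g="\<lambda>x. 0"]) (auto simp: gderiv_def)

lemma C1_on_inner: "C1_on S (\<lambda>x. x \<bullet> c)"
  by (rule C1_onI[where g="\<lambda>x. c"])
     (auto simp: gderiv_def intro!: derivative_eq_intros)

lemma C1_on_add: "C1_on S f \<Longrightarrow> C1_on S g \<Longrightarrow> C1_on S (\<lambda>x. f x + g x)"
  by (rule C1_onI[where g="\<lambda>x. gr f x + gr g x"])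
     (auto intro!: GDERIV_add C1_onD continuous_intros C1_on_gr)

lemma C1_on_diff: "C1_on S f \<Longrightarrow> C1_on S g \<Longrightarrow> C1_on S (\<lambda>x. f x - g x)"
  by (rule C1_onI[where g="\<lambda>x. gr f x - gr g x"])
     (auto intro!: GDERIV_diff C1_onD continuous_intros C1_on_gr)

lemma gr_mult:
  assumes "f differentiable (at x)" "g differentiable (at x)"
  shows "gr (\<lambda>x. f x * g x) x = f x *\<^sub>R gr g x + g x *\<^sub>R gr f x"
  using GDERIV_mult[OF gderiv_gr[OF assms(1)] gderiv_gr[OF assms(2)]]
  by (intro gderiv_imp_gr) simp

lemma gr_add:
  assumes "f differentiable (at x)" "g differentiable (at x)"
  shows "gr (\<lambda>x. f x + g x) x = gr f x + gr g x"
  using GDERIV_add[OF gderiv_gr[OF assms(1)] gderiv_gr[OF assms(2)]]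
  by (intro gderiv_imp_gr)

lemma gr_cmult:
  assumes "f differentiable (at x)"
  shows "gr (\<lambda>x. c * f x) x = c *\<^sub>R gr f x"
  using GDERIV_mult[OF _ gderiv_gr[OF assms], of "\<lambda>_. c" 0]
  by (intro gderiv_imp_gr) (simp add: gderiv_def)

lemma C1_on_mult: "C1_on S f \<Longrightarrow> C1_on S g \<Longrightarrow> C1_on S (\<lambda>x. f x * g x)"
proof (rule C1_onI[where g="\<lambda>x. f x *\<^sub>R gr g x + g x *\<^sub>R gr f x"])
  assume a: "C1_on S f" "C1_on S g"
  show "GDERIV (\<lambda>x. f x * g x) x :> f x *\<^sub>R gr g x + g x *\<^sub>R gr f x" if "x \<in> S" for x
    using GDERIV_mult[OF C1_onD[OF a(1) that] C1_onD[OF a(2) that]] by simp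
  show "continuous_on S (\<lambda>x. f x *\<^sub>R gr g x + g x *\<^sub>R gr f x)"
    using a by (intro continuous_intros C1_on_gr C1_on_imp_continuous_on)
qed

lemma C1_on_compose:
  assumes "C1_on S f" "\<And>x. x \<in> S \<Longrightarrow> (h has_real_derivative h' (f x)) (at (f x))"
    "continuous_on (f ` S) h'"
  shows "C1_on S (\<lambda>x. h (f x))"
proof (rule C1_onI[where g="\<lambda>x. h' (f x) *\<^sub>R gr f x"])
  show "GDERIV (\<lambda>x. h (f x)) x :> h' (f x) *\<^sub>R gr f x" if "x \<in> S" for x
    by (rule GDERIV_DERIV_compose[OF C1_onD[OF assms(1) that] assms(2)[OF that]])
  show "continuous_on S (\<lambda>x. h' (f x) *\<^sub>R gr f x)"
    using assms by (intro continuous_intros C1_on_gr continuous_on_compose2[OF assms(3)]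
        C1_on_imp_continuous_on) auto
qed

lemma C1_on_sum:
  assumes "finite I" "\<And>i. i \<in> I \<Longrightarrow> C1_on S (f i)"
  shows "C1_on S (\<lambda>x. \<Sum>i\<in>I. f i x)"
  using assms by (induction I rule: finite_induct) (auto intro: C1_on_const C1_on_add)

lemma C1_on_Un: "open S \<Longrightarrow> open T \<Longrightarrow> C1_on S f \<Longrightarrow> C1_on T f \<Longrightarrow> C1_on (S \<union> T) f"
  unfolding C1_on_def by (auto intro: continuous_on_open_Un)

lemma C1_on_zero_open: "open T \<Longrightarrow> (\<And>x. x \<in> T \<Longrightarrow> f x = 0) \<Longrightarrow> C1_on T f"
  using C1_on_cong[of T "\<lambda>x. 0" f] C1_on_const by auto

text \<open>The trace of the derivative, written through the gradients of the components, so that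
  product rule and continuity reduce to the scalar case.\<close>

definition dv :: "('a::euclidean_space \<Rightarrow> 'a) \<Rightarrow> 'a \<Rightarrow> real" where
  "dv \<xi> x = (\<Sum>b\<in>Basis. gr (\<lambda>y. \<xi> y \<bullet> b) x \<bullet> b)"

definition C1_field :: "'a::euclidean_space set \<Rightarrow> ('a \<Rightarrow> 'a) \<Rightarrow> bool" where
  "C1_field S \<xi> \<longleftrightarrow> (\<forall>b\<in>Basis. C1_on S (\<lambda>x. \<xi> x \<bullet> b))"

lemma dv_has_derivative:
  assumes "(\<xi> has_derivative \<xi>') (at x)"
  shows "dv \<xi> x = (\<Sum>b\<in>Basis. \<xi>' b \<bullet> b)"
proof -
  have "gr (\<lambda>y. \<xi> y \<bullet> b) x \<bullet> b = \<xi>' b \<bullet> b" if "b \<in> Basis" for b :: 'a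
  proof -
    have 1: "((\<lambda>y. \<xi> y \<bullet> b) has_derivative (\<lambda>v. \<xi>' v \<bullet> b)) (at x)"
      using assms by (auto intro!: derivative_eq_intros)
    then have "GDERIV (\<lambda>y. \<xi> y \<bullet> b) x :> gr (\<lambda>y. \<xi> y \<bullet> b) x"
      using gderiv_gr differentiable_def by blast
    with 1 have "(\<lambda>v. \<xi>' v \<bullet> b) = (\<lambda>v. v \<bullet> gr (\<lambda>y. \<xi> y \<bullet> b) x)"
      unfolding gderiv_def by (rule has_derivative_unique)
    then show ?thesis by (metis inner_commute)
  qed
  then show ?thesis unfolding dv_def by simp
qed

lemma gr_zero_open: "open T \<Longrightarrow> x \<in> T \<Longrightarrow> (\<And>y. y \<in> T \<Longrightarrow> f y = 0) \<Longrightarrow> gr f x = 0"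
  by (rule gderiv_imp_gr) (rule gderiv_transform_open[of "\<lambda>_. 0" x 0 T], auto simp: gderiv_def)

lemma dv_scale:
  assumes "f differentiable (at x)" "\<And>b. b \<in> Basis \<Longrightarrow> (\<lambda>y. \<xi> y \<bullet> b) differentiable (at x)"
  shows "dv (\<lambda>y. f y *\<^sub>R \<xi> y) x = gr f x \<bullet> \<xi> x + f x * dv \<xi> x"
proof -
  have "gr (\<lambda>y. (f y *\<^sub>R \<xi> y) \<bullet> b) x \<bullet> b
      = f x * (gr (\<lambda>y. \<xi> y \<bullet> b) x \<bullet> b) + (\<xi> x \<bullet> b) * (gr f x \<bullet> b)" if "b \<in> Basis" for b
    using gr_mult[OF assms(1) assms(2)[OF that]] by (simp add: inner_add_left)
  then have "dv (\<lambda>y. f y *\<^sub>R \<xi> y) x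
      = f x * dv \<xi> x + (\<Sum>b\<in>Basis. (\<xi> x \<bullet> b) * (gr f x \<bullet> b))"
    unfolding dv_def by (simp add: sum.distrib sum_distrib_left)
  moreover have "gr f x \<bullet> \<xi> x = (\<Sum>b\<in>Basis. (\<xi> x \<bullet> b) * (gr f x \<bullet> b))"
    by (subst euclidean_inner) (simp add: mult.commute)
  ultimately show ?thesis by simp
qed

lemma C1_field_scale: "C1_on S f \<Longrightarrow> C1_field S \<xi> \<Longrightarrow> C1_field S (\<lambda>x. f x *\<^sub>R \<xi> x)"
  unfolding C1_field_def by (auto intro: C1_on_mult)

lemma C1_field_dv_continuous: "C1_field S \<xi> \<Longrightarrow> continuous_on S (dv \<xi>)"
  unfolding dv_def[abs_def] C1_field_def by (auto intro!: continuous_intros dest: C1_on_gr)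

lemma C1_field_continuous_on: "C1_field S \<xi> \<Longrightarrow> continuous_on S \<xi>"
  unfolding C1_field_def
  by (subst continuous_on_componentwise) (auto intro: C1_on_imp_continuous_on)

lemma C1_field_Un: "open S \<Longrightarrow> open T \<Longrightarrow> C1_field S \<xi> \<Longrightarrow> C1_field T \<xi> \<Longrightarrow> C1_field (S \<union> T) \<xi>"
  unfolding C1_field_def by (auto intro: C1_on_Un)

lemma C1_field_zero_open: "open T \<Longrightarrow> (\<And>x. x \<in> T \<Longrightarrow> \<xi> x = 0) \<Longrightarrow> C1_field T \<xi>"
  unfolding C1_field_def by (auto intro: C1_on_zero_open)

section \<open>Integrals of compactly supported functions and of divergences\<close>

lemma integrable_compact_support:
  fixes f :: "'a::euclidean_space \<Rightarrow> real"
  assumes "continuous_on UNIV f" "compact K" "\<And>x. x \<notin> K \<Longrightarrow> f x = 0"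
  shows "integrable lborel f"
proof -
  have "integrable lborel (\<lambda>x. indicator K x *\<^sub>R f x)"
    using assms by (intro borel_integrable_compact) (auto intro: continuous_on_subset)
  moreover have "(\<lambda>x. indicator K x *\<^sub>R f x) = f"
    using assms(3) by (force simp: indicator_def fun_eq_iff)
  ultimately show ?thesis by simp
qed

lemma integral_lborel_translation:
  fixes f :: "'a::euclidean_space \<Rightarrow> real"
  assumes [measurable]: "f \<in> borel_measurable borel"
  shows "(\<integral>x. f (c + x) \<partial>lborel) = (\<integral>x. f x \<partial>lborel)"
proof -
  have "(\<integral>x. f x \<partial>lborel) = (\<integral>x. f x \<partial>(distr lborel borel ((+) c)))"
    by (simp only: lborel_distr_plus)
  also have "\<dots> = (\<integral>x. f (c + x) \<partial>lborel)"
    by (subst integral_distr) auto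
  finally show ?thesis by simp
qed

lemma integrable_lborel_translation:
  fixes f :: "'a::euclidean_space \<Rightarrow> real"
  assumes "integrable lborel f"
  shows "integrable lborel (\<lambda>x. f (c + x))"
proof -
  have [measurable]: "f \<in> borel_measurable borel" using assms by auto
  have "integrable (distr lborel borel ((+) c)) f"
    using assms by (simp only: lborel_distr_plus)
  then show ?thesis by (subst (asm) integrable_distr_eq) auto
qed

text \<open>The difference quotients of a compactly supported function integrate to zero, by translation
  invariance of Lebesgue measure.\<close>

lemma integral_directional_derivative_zero:
  fixes h :: "'a::euclidean_space \<Rightarrow> real"
  assumes h: "C1_on UNIV h" and K: "compact K" "\<And>x. x \<notin> K \<Longrightarrow> h x = 0"
  shows "(\<integral>x. gr h x \<bullet> v \<partial>lborel) = 0"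
proof -
  define s where "s k x = real (Suc k) * (h ((1 / real (Suc k)) *\<^sub>R v + x) - h x)" for k :: nat and x
  have ch: "continuous_on UNIV h" using h by (rule C1_on_imp_continuous_on)
  then have mh[measurable]: "h \<in> borel_measurable borel" by (rule borel_measurable_continuous_onI)
  have ih: "integrable lborel h" by (rule integrable_compact_support[OF ch K])
  have g0: "gr h x = 0" if "x \<notin> K" for x
    using that K compact_imp_closed by (intro gr_zero_open[of "- K"]) auto
  have cg: "continuous_on UNIV (\<lambda>x. gr h x \<bullet> v)"
    using h by (intro continuous_intros C1_on_gr)
  obtain B where B: "\<And>x. \<bar>gr h x \<bullet> v\<bar> \<le> B" "B \<ge> 0"
  proof -
    have "compact ((\<lambda>x. gr h x \<bullet> v) ` K)"
      using cg K(1) by (intro compact_continuous_image) (auto intro: continuous_on_subset)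
    then obtain B where "\<forall>y\<in>(\<lambda>x. gr h x \<bullet> v) ` K. norm y \<le> B"
      using compact_imp_bounded bounded_iff by metis
    then have "\<bar>gr h x \<bullet> v\<bar> \<le> max B 0" for x
      using g0[of x] by (cases "x \<in> K") force+
    then show ?thesis using that[of "max B 0"] by auto
  qed
  \<comment> \<open>All points from which a displacement \<open>a *\<^sub>R v\<close> with a in
    [0, 1] can reach the support. It carries one dominating function for all difference
    quotients.\<close>
  define K' where "K' = (\<lambda>z. fst z - snd z *\<^sub>R v) ` (K \<times> {0..1})"
  have cK': "compact K'" unfolding K'_def
    by (intro compact_continuous_image compact_Times K compact_Icc continuous_intros)
  have inK': "x \<in> K'" if "a *\<^sub>R v + x \<in> K" "0 \<le> a" "a \<le> 1" for x a
    unfolding K'_def using that by (intro image_eqI[of _ _ "(a *\<^sub>R v + x, a)"]) auto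
  have line: "((\<lambda>t. h (t *\<^sub>R v + x)) has_real_derivative (gr h (t *\<^sub>R v + x) \<bullet> v)) (at t)" for x t
  proof -
    have "(h has_derivative (\<lambda>w. w \<bullet> gr h (t *\<^sub>R v + x))) (at (t *\<^sub>R v + x))"
      using C1_onD[OF h] by (auto simp: gderiv_def)
    moreover have "((\<lambda>t. t *\<^sub>R v + x) has_derivative (\<lambda>s. s *\<^sub>R v)) (at t)"
      by (auto intro!: derivative_eq_intros)
    ultimately have "((\<lambda>t. h (t *\<^sub>R v + x)) has_derivative (\<lambda>s. (s *\<^sub>R v) \<bullet> gr h (t *\<^sub>R v + x))) (at t)"
      using has_derivative_compose[of "\<lambda>t. t *\<^sub>R v + x" "\<lambda>s. s *\<^sub>R v" t UNIV h] by blast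
    moreover have "(\<lambda>s. (s *\<^sub>R v) \<bullet> gr h (t *\<^sub>R v + x)) = (*) (gr h (t *\<^sub>R v + x) \<bullet> v)"
      by (auto simp: inner_commute mult.commute)
    ultimately show ?thesis by (simp add: has_field_derivative_def)
  qed
  have sb: "\<bar>s k x\<bar> \<le> indicator K' x * B" for k x
  proof -
    define a where "a = 1 / real (Suc k)"
    have a: "a > 0" "a \<le> 1" "real (Suc k) * a = 1" by (auto simp: a_def field_simps)
    obtain z where z: "0 < z" "z < a" "h (a *\<^sub>R v + x) - h (0 *\<^sub>R v + x) = (a - 0) * (gr h (z *\<^sub>R v + x) \<bullet> v)"
      using MVT2[of 0 a "\<lambda>t. h (t *\<^sub>R v + x)" "\<lambda>t. gr h (t *\<^sub>R v + x) \<bullet> v"] a line by auto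
    have e: "s k x = gr h (z *\<^sub>R v + x) \<bullet> v"
      using z(3) a(3) unfolding s_def a_def[symmetric]
      by (metis add_0 diff_zero mult.assoc mult_1 scaleR_zero_left)
    show ?thesis
    proof (cases "x \<in> K'")
      case True then show ?thesis using B e by auto
    next
      case False
      then have "z *\<^sub>R v + x \<notin> K" using inK' z a by force
      then show ?thesis using e g0 B(2) by (auto simp: indicator_def)
    qed
  qed
  have "(\<lambda>k. \<integral>x. s k x \<partial>lborel) \<longlonglongrightarrow> (\<integral>x. gr h x \<bullet> v \<partial>lborel)"
  proof (rule integral_dominated_convergence[where w="\<lambda>x. indicator K' x * B"])
    show "(\<lambda>x. gr h x \<bullet> v) \<in> borel_measurable lborel"
      using cg borel_measurable_continuous_onI by auto
    show "s k \<in> borel_measurable lborel" for k unfolding s_def by measurable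
    show "integrable lborel (\<lambda>x. indicator K' x * B)"
      using cK' by (auto intro!: emeasure_compact_finite borel_compact integrable_mult_left)
    show "AE x in lborel. norm (s k x) \<le> indicator K' x * B" for k using sb by auto
    show "AE x in lborel. (\<lambda>k. s k x) \<longlonglongrightarrow> gr h x \<bullet> v"
    proof (rule AE_I2)
      fix x
      have "((\<lambda>t. (h (t *\<^sub>R v + x) - h x) / t) \<longlongrightarrow> gr h x \<bullet> v) (at 0)"
        using line[of x 0] unfolding has_field_derivative_iff by simp
      moreover have "filterlim (\<lambda>k. 1 / real (Suc k)) (at 0) sequentially"
        unfolding filterlim_at using LIMSEQ_inverse_real_of_nat by (auto simp: inverse_eq_divide)
      ultimately have "(\<lambda>k. (h ((1 / real (Suc k)) *\<^sub>R v + x) - h x) / (1 / real (Suc k))) \<longlonglongrightarrow> gr h x \<bullet> v"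
        by (rule filterlim_compose)
      then show "(\<lambda>k. s k x) \<longlonglongrightarrow> gr h x \<bullet> v" unfolding s_def by (simp add: mult.commute)
    qed
  qed
  moreover have "(\<integral>x. s k x \<partial>lborel) = 0" for k
    unfolding s_def using ih integrable_lborel_translation[OF ih]
    by (simp add: integral_lborel_translation)
  ultimately have "(\<lambda>k::nat. 0::real) \<longlonglongrightarrow> (\<integral>x. gr h x \<bullet> v \<partial>lborel)" by simp
  then show ?thesis by (metis LIMSEQ_const_iff)
qed

lemma integral_dv_zero:
  fixes \<xi> :: "'a::euclidean_space \<Rightarrow> 'a"
  assumes "C1_field UNIV \<xi>" and K: "compact K" "\<And>x. x \<notin> K \<Longrightarrow> \<xi> x = 0"
  shows "(\<integral>x. dv \<xi> x \<partial>lborel) = 0"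
proof -
  have c: "C1_on UNIV (\<lambda>x. \<xi> x \<bullet> b)" if "b \<in> Basis" for b
    using assms that by (auto simp: C1_field_def)
  have "integrable lborel (\<lambda>x. gr (\<lambda>y. \<xi> y \<bullet> b) x \<bullet> b)" if "b \<in> Basis" for b
  proof (rule integrable_compact_support[OF _ K(1)])
    show "continuous_on UNIV (\<lambda>x. gr (\<lambda>y. \<xi> y \<bullet> b) x \<bullet> b)"
      using c[OF that] by (intro continuous_intros C1_on_gr)
    show "gr (\<lambda>y. \<xi> y \<bullet> b) x \<bullet> b = 0" if "x \<notin> K" for x
    proof -
      have "gr (\<lambda>y. \<xi> y \<bullet> b) x = 0"
        using K compact_imp_closed[OF K(1)] that by (intro gr_zero_open[of "- K"]) auto
      then show ?thesis by simp
    qed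
  qed
  then show ?thesis unfolding dv_def
    using integral_directional_derivative_zero[OF c K(1)] K(2)
    by (subst Bochner_Integration.integral_sum) auto
qed

section \<open>Cutoff functions and reflections\<close>

text \<open>Squaring removes the corner of the positive part; this is the source of the C1
  regularity of the cutoff functions.\<close>

lemma has_real_derivative_max0_power2:
  "((\<lambda>s::real. (max 0 s)\<^sup>2) has_real_derivative 2 * max 0 s) (at s)"
proof -
  consider "s > 0" | "s < 0" | "s = 0" by linarith
  then show ?thesis
  proof cases
    case 1
    have "((\<lambda>s::real. s\<^sup>2) has_real_derivative 2 * max 0 s) (at s)"
      using 1 by (auto intro!: derivative_eq_intros)
    then show ?thesis
      by (rule has_field_derivative_transform_within_open[of _ _ _ "{0<..}"]) (use 1 in auto)
  next
    case 2
    have "((\<lambda>s::real. 0) has_real_derivative 2 * max 0 s) (at s)"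
      using 2 by (auto intro!: derivative_eq_intros)
    then show ?thesis
      by (rule has_field_derivative_transform_within_open[of _ _ _ "{..<0}"]) (use 2 in auto)
  next
    case 3
    have "((\<lambda>h::real. (max 0 h)\<^sup>2 / h) \<longlongrightarrow> 0) (at 0)"
    proof (rule Lim_null_comparison)
      show "\<forall>\<^sub>F h in at (0::real). norm ((max 0 h)\<^sup>2 / h) \<le> \<bar>h\<bar>"
        by (auto simp: power2_eq_square max_def intro!: eventuallyI)
      show "((\<lambda>h::real. \<bar>h\<bar>) \<longlongrightarrow> 0) (at 0)"
        by (rule tendsto_eq_intros | simp)+
    qed
    then show ?thesis using 3 by (simp add: has_field_derivative_iff)
  qed
qed

text \<open>For t > \<epsilon> the value is t - 2 \<epsilon> + \<epsilon>^2 / t. The derivative lies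
  in [0, 1], so composition with \<open>trunc \<epsilon>\<close> does not increase gradients, and
  values move by at most 2 \<epsilon>. Functions that are small outside an open set thereby become
  supported inside it.\<close>

definition trunc :: "real \<Rightarrow> real \<Rightarrow> real" where
  "trunc \<epsilon> t = t * (1 - \<epsilon> / max \<epsilon> \<bar>t\<bar>)\<^sup>2"

definition cutoff :: "real \<Rightarrow> real \<Rightarrow> real" where
  "cutoff \<epsilon> y = (1 - \<epsilon> / max \<epsilon> y)\<^sup>2"

lemma has_real_derivative_cutoff:
  assumes e: "\<epsilon> > 0"
  shows "(cutoff \<epsilon> has_real_derivative 2 * (1 - \<epsilon> / max \<epsilon> y) * \<epsilon> / (max \<epsilon> y)\<^sup>2) (at y)"
proof (cases "y > 0")
  case True
  have "((\<lambda>y. 1 - \<epsilon> / y) has_real_derivative \<epsilon> / y\<^sup>2) (at y)"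
    using True by (auto intro!: derivative_eq_intros simp: power2_eq_square)
  from DERIV_chain2[OF has_real_derivative_max0_power2 this]
  have "((\<lambda>y. (max 0 (1 - \<epsilon> / y))\<^sup>2) has_real_derivative 2 * max 0 (1 - \<epsilon> / y) * (\<epsilon> / y\<^sup>2)) (at y)" .
  moreover have "2 * max 0 (1 - \<epsilon> / y) * (\<epsilon> / y\<^sup>2) = 2 * (1 - \<epsilon> / max \<epsilon> y) * \<epsilon> / (max \<epsilon> y)\<^sup>2"
    using True e by (auto simp: max_def field_simps)
  ultimately show ?thesis
    by (simp only:, elim has_field_derivative_transform_within_open[of _ _ _ "{0<..}"])
      (use True e in \<open>auto simp: cutoff_def max_def field_simps\<close>)
next
  case False
  then have y: "y < \<epsilon>" using e by auto
  have "((\<lambda>y. 0) has_real_derivative 2 * (1 - \<epsilon> / max \<epsilon> y) * \<epsilon> / (max \<epsilon> y)\<^sup>2) (at y)"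
    using y e by (auto simp: max_def)
  then show ?thesis
    by (rule has_field_derivative_transform_within_open[of _ _ _ "{..<\<epsilon>}"])
       (use y e in \<open>auto simp: cutoff_def max_def\<close>)
qed

lemma cutoff_zero: "\<epsilon> > 0 \<Longrightarrow> y \<le> \<epsilon> \<Longrightarrow> cutoff \<epsilon> y = 0"
  by (auto simp: cutoff_def max_def)

lemma cutoff_nonneg: "0 \<le> cutoff \<epsilon> y" by (simp add: cutoff_def)

lemma cutoff_le_1: "\<epsilon> > 0 \<Longrightarrow> cutoff \<epsilon> y \<le> 1"
  unfolding cutoff_def by (rule power_le_one) (auto simp: max_def field_simps)

lemma has_real_derivative_trunc:
  assumes e: "\<epsilon> > 0"
  shows "(trunc \<epsilon> has_real_derivative 1 - \<epsilon>\<^sup>2 / (max \<epsilon> \<bar>t\<bar>)\<^sup>2) (at t)"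
proof -
  have pos: "((\<lambda>t. t * cutoff \<epsilon> t) has_real_derivative 1 - \<epsilon>\<^sup>2 / (max \<epsilon> t)\<^sup>2) (at t)" if "t > 0" for t
  proof (rule DERIV_cong[OF DERIV_mult[OF DERIV_ident has_real_derivative_cutoff[OF e, of t]]])
    show "1 * cutoff \<epsilon> t + 2 * (1 - \<epsilon> / max \<epsilon> t) * \<epsilon> / (max \<epsilon> t)\<^sup>2 * t = 1 - \<epsilon>\<^sup>2 / (max \<epsilon> t)\<^sup>2"
      using e that by (cases "t \<le> \<epsilon>") (auto simp: cutoff_def max_def field_simps power2_eq_square)
  qed
  consider "t > 0" | "t < 0" | "t = 0" by linarith
  then show ?thesis
  proof cases
    case 1
    show ?thesis
      using has_field_derivative_transform_within_open[OF pos[OF 1], of "{0<..}" "trunc \<epsilon>"] 1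
      by (auto simp: trunc_def cutoff_def)
  next
    case 2
    have "((\<lambda>s. (- s) * cutoff \<epsilon> (- s)) has_real_derivative (1 - \<epsilon>\<^sup>2 / (max \<epsilon> (- t))\<^sup>2) * (-1)) (at t)"
      using pos[of "- t"] 2
      by (intro DERIV_chain2[where f="\<lambda>t. t * cutoff \<epsilon> t" and g=uminus]) (auto intro!: derivative_eq_intros)
    from DERIV_minus[OF this]
    have "((\<lambda>t. - ((- t) * cutoff \<epsilon> (- t))) has_real_derivative 1 - \<epsilon>\<^sup>2 / (max \<epsilon> (- t))\<^sup>2) (at t)"
      by simp
    then show ?thesis
      using has_field_derivative_transform_within_open[of "\<lambda>t. - ((- t) * cutoff \<epsilon> (- t))" _ t "{..<0}" "trunc \<epsilon>"] 2
      by (auto simp: trunc_def cutoff_def)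
  next
    case 3
    have "((\<lambda>y. 0) has_real_derivative 1 - \<epsilon>\<^sup>2 / (max \<epsilon> \<bar>t\<bar>)\<^sup>2) (at t)"
      using 3 e by (auto simp: max_def)
    then show ?thesis
      by (rule has_field_derivative_transform_within_open[of _ _ _ "{-\<epsilon><..<\<epsilon>}"])
       (use 3 e in \<open>auto simp: trunc_def max_def\<close>)
  qed
qed

lemma trunc_zero: "\<epsilon> > 0 \<Longrightarrow> \<bar>t\<bar> \<le> \<epsilon> \<Longrightarrow> trunc \<epsilon> t = 0"
  by (auto simp: trunc_def max_def)

text \<open>With a the unsquared factor, \<open>trunc \<epsilon> t\<close> is t a^2, and the
  difference is t^2 (1 - a^4). Here (1 - a) \<bar>t\<bar> is at most \<epsilon>, and the remaining
  factor (1 + a) (1 + a^2) is at most 4.\<close>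

lemma trunc_square_ge:
  assumes e: "\<epsilon> > 0"
  shows "t\<^sup>2 - (trunc \<epsilon> t)\<^sup>2 \<le> 4 * \<epsilon> * \<bar>t\<bar>"
proof -
  define a where "a = 1 - \<epsilon> / max \<epsilon> \<bar>t\<bar>"
  have a: "0 \<le> a" "a \<le> 1" using e by (auto simp: a_def max_def field_simps)
  have b: "(1 - a) * \<bar>t\<bar> \<le> \<epsilon>" using e by (auto simp: a_def max_def field_simps)
  have "t\<^sup>2 - (trunc \<epsilon> t)\<^sup>2 = \<bar>t\<bar> * ((1 - a) * \<bar>t\<bar>) * ((1 + a) * (1 + a\<^sup>2))"
  proof -
    have "t\<^sup>2 - (trunc \<epsilon> t)\<^sup>2 = t\<^sup>2 * (1 - a) * ((1 + a) * (1 + a\<^sup>2))"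
      unfolding trunc_def a_def[symmetric] by algebra
    moreover have "\<bar>t\<bar> * ((1 - a) * \<bar>t\<bar>) = t\<^sup>2 * (1 - a)"
      by (metis abs_mult_self_eq mult.assoc mult.commute power2_eq_square)
    ultimately show ?thesis by (simp only:)
  qed
  also have "\<dots> \<le> \<bar>t\<bar> * \<epsilon> * 4"
  proof (rule mult_mono)
    show "\<bar>t\<bar> * ((1 - a) * \<bar>t\<bar>) \<le> \<bar>t\<bar> * \<epsilon>" using b by (intro mult_left_mono) auto
    have "a\<^sup>2 \<le> 1" using a by (simp add: power_le_one)
    then have "(1 + a) * (1 + a\<^sup>2) \<le> 2 * 2" using a by (intro mult_mono) auto
    then show "(1 + a) * (1 + a\<^sup>2) \<le> 4" by simp
  qed (use a e in auto)
  finally show ?thesis by (simp add: mult_ac)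
qed

text \<open>For weights such as \<open>P\<close> and \<open>q\<close>, which are continuous only
  away from the origin, multiplied by functions supported away from it.\<close>

lemma continuous_on_compact_support:
  fixes g :: "'a::euclidean_space \<Rightarrow> real"
  assumes "open U" "continuous_on U a" "continuous_on U g" "compact K" "K \<subseteq> U"
    "\<And>x. x \<notin> K \<Longrightarrow> g x = 0"
  shows "continuous_on UNIV (\<lambda>x. a x * g x)"
proof -
  have "continuous_on (U \<union> - K) (\<lambda>x. a x * g x)"
  proof (rule continuous_on_open_Un)
    show "continuous_on (- K) (\<lambda>x. a x * g x)"
      using assms(6) by (subst continuous_on_cong[of _ "- K" _ "\<lambda>x. 0"]) auto
  qed (use assms compact_imp_closed in \<open>auto intro!: continuous_intros\<close>)
  moreover have "U \<union> - K = UNIV" using assms(5) by auto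
  ultimately show ?thesis by simp
qed

text \<open>For \<open>e = 0\<close> this is the identity, since division by zero gives zero.\<close>

definition mirror :: "'a::euclidean_space \<Rightarrow> 'a \<Rightarrow> 'a" where
  "mirror e x = x - (2 * (x \<bullet> e) / (e \<bullet> e)) *\<^sub>R e"

lemma mirror_linear: "linear (mirror e)"
  unfolding mirror_def by (intro linearI) (auto simp: inner_add_left algebra_simps add_divide_distrib)

lemma mirror_sym: "mirror e v \<bullet> w = v \<bullet> mirror e w"
  by (simp add: mirror_def inner_diff_left inner_diff_right inner_commute)

lemma mirror_mirror [simp]: "mirror e (mirror e x) = x"
  by (cases "e = 0") (auto simp: mirror_def inner_diff_left algebra_simps simp flip: scaleR_add_left)

lemma mirror_inner: "mirror e v \<bullet> mirror e w = v \<bullet> w"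
  using mirror_sym[of e v "mirror e w"] by simp

lemma norm_mirror [simp]: "norm (mirror e x) = norm x"
  by (simp add: norm_eq_sqrt_inner mirror_inner)

text \<open>For equal norms the square of the length of x - p is 2 x . (x - p), so the subtracted
  multiple of x - p is exactly 1. Thus any point of a sphere can be moved to any other one by a
  single reflection.\<close>

lemma mirror_swap:
  assumes "norm x = norm p" shows "mirror (x - p) x = p"
proof (cases "x = p")
  case False
  have *: "(x - p) \<bullet> (x - p) = 2 * (x \<bullet> (x - p))"
    using assms by (simp add: inner_diff_left inner_diff_right inner_commute norm_eq_sqrt_inner)
  moreover have "x \<bullet> (x - p) \<noteq> 0"
    using * False by (metis inner_eq_zero_iff mult_zero_right right_minus_eq)
  ultimately have **: "2 * (x \<bullet> (x - p)) / ((x - p) \<bullet> (x - p)) = 1" by simp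
  show ?thesis unfolding mirror_def ** by simp
qed (simp add: mirror_def)

lemma mirror_fixed: "x \<bullet> e = 0 \<Longrightarrow> mirror e x = x"
  by (simp add: mirror_def)

lemma mirror_diff: "mirror e (x - y) = mirror e x - mirror e y"
  using mirror_linear by (rule linear_diff)

lemma continuous_on_mirror [continuous_intros]:
  "continuous_on S f \<Longrightarrow> continuous_on S (\<lambda>x. mirror e (f x))"
  unfolding mirror_def divide_inverse by (intro continuous_intros)

lemma borel_measurable_mirror [measurable]: "mirror e \<in> borel_measurable borel"
  using continuous_on_mirror[OF continuous_on_id, of UNIV e] by (intro borel_measurable_continuous_onI) simp

lemma nn_integral_lborel_translation:
  fixes f :: "'a::euclidean_space \<Rightarrow> ennreal"
  assumes [measurable]: "f \<in> borel_measurable borel"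
  shows "(\<integral>\<^sup>+x. f (c + x) \<partial>lborel) = (\<integral>\<^sup>+x. f x \<partial>lborel)"
proof -
  have "(\<integral>\<^sup>+x. f x \<partial>lborel) = (\<integral>\<^sup>+x. f x \<partial>(distr lborel borel ((+) c)))"
    by (simp only: lborel_distr_plus)
  also have "\<dots> = (\<integral>\<^sup>+x. f (c + x) \<partial>lborel)"
    by (subst nn_integral_distr) auto
  finally show ?thesis by simp
qed

lemma nn_integral_lborel_reflect_point:
  fixes f :: "'a::euclidean_space \<Rightarrow> ennreal"
  assumes [measurable]: "f \<in> borel_measurable borel"
  shows "(\<integral>\<^sup>+x. f (c - x) \<partial>lborel) = (\<integral>\<^sup>+x. f x \<partial>lborel)"
proof -
  have *: "(lborel :: 'a measure) = distr lborel borel (\<lambda>x. c - x)"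
    using lborel_affine[of "-1" c] by (simp add: density_1)
  have "(\<integral>\<^sup>+x. f x \<partial>lborel) = (\<integral>\<^sup>+x. f x \<partial>(distr lborel borel (\<lambda>x. c - x)))"
    by (simp only: *[symmetric])
  also have "\<dots> = (\<integral>\<^sup>+x. f (c - x) \<partial>lborel)"
    by (subst nn_integral_distr) auto
  finally show ?thesis by simp
qed

text \<open>Uniqueness of translation-invariant measures, tested against the unit ball, which is
  invariant under the reflection.\<close>

lemma nn_integral_mirror:
  fixes g :: "'a::euclidean_space \<Rightarrow> ennreal"
  assumes [measurable]: "g \<in> borel_measurable borel"
  shows "(\<integral>\<^sup>+x. g (mirror e x) \<partial>lborel) = (\<integral>\<^sup>+x. g x \<partial>lborel)"
proof -
  define k :: "'a \<Rightarrow> ennreal" where "k = indicator (ball 0 1)"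
  have [measurable]: "k \<in> borel_measurable borel" unfolding k_def by (intro borel_measurable_indicator) simp
  have kr: "k (mirror e x) = k x" for x by (simp add: k_def indicator_def)
  define I where "I = (\<integral>\<^sup>+x. k x \<partial>lborel)"
  have I: "I = emeasure lborel (ball 0 1 :: 'a set)" by (simp add: I_def k_def)
  have I0: "I \<noteq> 0"
    using emeasure_lborel_ball_finite[of "0::'a" 1] content_ball_pos[of 1 "0::'a"] unfolding I
    by (auto simp: measure_def)
  have I1: "I \<noteq> \<infinity>" unfolding I using emeasure_lborel_ball_finite[of "0::'a" 1] by simp
  have "(\<integral>\<^sup>+x. g (mirror e x) \<partial>lborel) * I = (\<integral>\<^sup>+y. (\<integral>\<^sup>+x. g (mirror e x) * k y \<partial>lborel) \<partial>lborel)"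
    unfolding I_def by (simp add: nn_integral_cmult nn_integral_multc)
  \<comment> \<open>The translation turns the argument of \<open>g\<close> into
    \<open>mirror e x - y\<close>. After exchanging the order of integration, y can be replaced by
    this difference, which moves the reflection from \<open>g\<close> to \<open>k\<close>, where it
    has no effect.\<close>
  also have "\<dots> = (\<integral>\<^sup>+y. (\<integral>\<^sup>+x. g (mirror e (- mirror e y + x)) * k y \<partial>lborel) \<partial>lborel)"
    by (subst nn_integral_lborel_translation) auto
  also have "\<dots> = (\<integral>\<^sup>+y. (\<integral>\<^sup>+x. g (mirror e x - y) * k y \<partial>lborel) \<partial>lborel)"
    using mirror_diff[of e] by (simp add: add.commute[of "- _"])
  also have "\<dots> = (\<integral>\<^sup>+x. (\<integral>\<^sup>+y. g (mirror e x - y) * k y \<partial>lborel) \<partial>lborel)"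
    by (rule lborel_pair.Fubini') measurable
  also have "\<dots> = (\<integral>\<^sup>+x. (\<integral>\<^sup>+y. g (mirror e x - (mirror e x - y)) * k (mirror e x - y) \<partial>lborel) \<partial>lborel)"
    by (subst nn_integral_lborel_reflect_point) auto
  also have "\<dots> = (\<integral>\<^sup>+x. (\<integral>\<^sup>+y. g y * k (mirror e x - y) \<partial>lborel) \<partial>lborel)"
    by simp
  also have "\<dots> = (\<integral>\<^sup>+y. (\<integral>\<^sup>+x. g y * k (mirror e x - y) \<partial>lborel) \<partial>lborel)"
    by (rule lborel_pair.Fubini') measurable
  also have "\<dots> = (\<integral>\<^sup>+y. (\<integral>\<^sup>+x. g y * k (mirror e (mirror e y + x) - y) \<partial>lborel) \<partial>lborel)"
    by (subst nn_integral_lborel_translation) auto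
  also have "\<dots> = (\<integral>\<^sup>+y. (\<integral>\<^sup>+x. g y * k x \<partial>lborel) \<partial>lborel)"
    by (simp add: linear_add[OF mirror_linear[of e]] kr)
  also have "\<dots> = (\<integral>\<^sup>+x. g x \<partial>lborel) * I"
    unfolding I_def by (simp add: nn_integral_cmult nn_integral_multc)
  finally show ?thesis
    using I0 I1 by (simp add: ennreal_mult_cancel_left mult.commute[of _ I])
qed

lemma lborel_distr_mirror: "distr lborel borel (mirror e) = lborel"
proof (rule measure_eqI)
  fix A assume "A \<in> sets (distr lborel borel (mirror e))"
  then have [measurable]: "A \<in> sets borel" by simp
  have "emeasure (distr lborel borel (mirror e)) A = (\<integral>\<^sup>+x. indicator A x \<partial>(distr lborel borel (mirror e)))"
    by simp
  also have "\<dots> = (\<integral>\<^sup>+x. indicator A (mirror e x) \<partial>lborel)" by (rule nn_integral_distr) auto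
  also have "\<dots> = (\<integral>\<^sup>+x. indicator A x \<partial>lborel)" by (rule nn_integral_mirror) simp
  finally show "emeasure (distr lborel borel (mirror e)) A = emeasure lborel A" by simp
qed simp

lemma integral_mirror:
  fixes g :: "'a::euclidean_space \<Rightarrow> real"
  assumes [measurable]: "g \<in> borel_measurable borel"
  shows "(\<integral>x. g (mirror e x) \<partial>lborel) = (\<integral>x. g x \<partial>lborel)"
proof -
  have "(\<integral>x. g x \<partial>lborel) = (\<integral>x. g x \<partial>(distr lborel borel (mirror e)))"
    by (simp only: lborel_distr_mirror)
  also have "\<dots> = (\<integral>x. g (mirror e x) \<partial>lborel)" by (subst integral_distr) auto
  finally show ?thesis by simp
qed

lemma GDERIV_mirror:
  assumes "GDERIV u (mirror e x) :> D"
  shows "GDERIV (\<lambda>x. u (mirror e x)) x :> mirror e D"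
proof -
  have "(mirror e has_derivative mirror e) (at x)"
    using mirror_linear linear_linear by (intro bounded_linear_imp_has_derivative) blast
  from has_derivative_compose[OF this assms[unfolded gderiv_def]]
  show ?thesis unfolding gderiv_def mirror_sym .
qed

lemma C1_on_mirror:
  assumes "C1_on UNIV u" shows "C1_on UNIV (\<lambda>x. u (mirror e x))"
proof (rule C1_onI)
  show "GDERIV (\<lambda>x. u (mirror e x)) x :> mirror e (gr u (mirror e x))" for x
    using assms by (intro GDERIV_mirror C1_onD) auto
  show "continuous_on UNIV (\<lambda>x. mirror e (gr u (mirror e x)))"
    by (intro continuous_intros continuous_on_compose2[OF C1_on_gr[OF assms]] continuous_on_id) auto
qed

section \<open>The weighted quadratic form\<close>

text \<open>\<open>ln (norm x)\<close> is the axial coordinate t of the cylinder to which the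
  punctured space is conformal; all radial data of the catenoid are functions of it.\<close>

lemma GDERIV_radial:
  assumes "x \<noteq> 0" "(h has_real_derivative d) (at (ln (norm x)))"
  shows "GDERIV (\<lambda>x. h (ln (norm x))) x :> (d / (norm x)\<^sup>2) *\<^sub>R x"
proof -
  have "(ln has_real_derivative 1 / norm x) (at (norm x))"
    using assms(1) by (auto intro!: derivative_eq_intros)
  from GDERIV_DERIV_compose[OF GDERIV_norm[OF assms(1)] this]
  have "GDERIV (\<lambda>x. ln (norm x)) x :> (1 / (norm x)\<^sup>2) *\<^sub>R x"
    by (simp add: sgn_div_norm power2_eq_square inverse_eq_divide)
  from GDERIV_DERIV_compose[OF this assms(2)] show ?thesis by simp
qed

lemma C1_on_radial:
  assumes "\<And>x. x \<in> S \<Longrightarrow> x \<noteq> 0" "\<And>x. x \<in> S \<Longrightarrow> (h has_real_derivative h' (ln (norm x))) (at (ln (norm x)))"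
    "continuous_on ((\<lambda>x. ln (norm x)) ` S) h'"
  shows "C1_on S (\<lambda>x. h (ln (norm x)))"
proof (rule C1_onI[OF GDERIV_radial])
  have "continuous_on S (\<lambda>x. h' (ln (norm x)))"
    by (rule continuous_on_compose2[OF assms(3)]) (auto intro!: continuous_intros dest: assms(1))
  then show "continuous_on S (\<lambda>x. (h' (ln (norm x)) / (norm x)\<^sup>2) *\<^sub>R x)"
    by (intro continuous_intros) (auto dest: assms(1))
qed (use assms in auto)

lemma has_real_derivative_tanh_scaled:
  "((\<lambda>t::real. tanh (a * t)) has_real_derivative a * (1 - (tanh (a * t))\<^sup>2)) (at t)"
  by (auto intro!: derivative_eq_intros simp: cosh_real_nonzero)

lemma test_bound:
  fixes h :: "'a::euclidean_space \<Rightarrow> real"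
  assumes "continuous_on UNIV h" "compact K" "\<And>x. x \<notin> K \<Longrightarrow> h x = 0"
  obtains B where "B > 0" "\<And>x. \<bar>h x\<bar> \<le> B"
proof -
  have "compact (h ` K)"
    using assms by (intro compact_continuous_image) (auto intro: continuous_on_subset)
  then obtain B where "\<forall>y\<in>h ` K. norm y \<le> B"
    using compact_imp_bounded bounded_iff by metis
  then have "\<bar>h x\<bar> \<le> max B 1" for x
    using assms(3)[of x] by (cases "x \<in> K") force+
  then show ?thesis using that[of "max B 1"] by auto
qed

lemma C1_field_differentiable: "C1_field S \<xi> \<Longrightarrow> x \<in> S \<Longrightarrow> b \<in> Basis \<Longrightarrow> (\<lambda>y. \<xi> y \<bullet> b) differentiable (at x)"
  unfolding C1_field_def C1_on_def by blast

lemma integrable_supported: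
  fixes F :: "'a::euclidean_space \<Rightarrow> real"
  assumes "open U" "continuous_on U F" "compact L" "L \<subseteq> U" "\<And>x. x \<notin> L \<Longrightarrow> F x = 0"
  shows "integrable lborel F"
  by (rule integrable_compact_support[OF _ assms(3)])
    (use assms continuous_on_compact_support[of U "\<lambda>_. 1" F L] in auto)

text \<open>The field \<open>g x *\<^sub>R \<zeta> x\<close>, extended by zero, is C1 on
  \<open>U\<close> and on the complement of \<open>L\<close>, hence everywhere, and its divergence
  integrates to zero. This is the only form in which the divergence theorem is used from here
  on.\<close>

lemma integral_parts_compact:
  fixes g :: "'a::euclidean_space \<Rightarrow> real"
  assumes U: "open U" and g: "C1_on UNIV g" "compact L" "L \<subseteq> U" "\<And>x. x \<notin> L \<Longrightarrow> g x = 0"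
    and z: "C1_field U \<zeta>"
  shows "integrable lborel (\<lambda>x. gr g x \<bullet> \<zeta> x)" "integrable lborel (\<lambda>x. g x * dv \<zeta> x)"
    "(\<integral>x. gr g x \<bullet> \<zeta> x \<partial>lborel) + (\<integral>x. g x * dv \<zeta> x \<partial>lborel) = 0"
proof -
  define Y where "Y x = (if x \<in> U then g x *\<^sub>R \<zeta> x else 0)" for x
  have oL: "open (- L)" using g compact_imp_closed by auto
  have UL: "U \<union> - L = UNIV" using g by auto
  have g0: "gr g x = 0" if "x \<notin> L" for x
    using that g(4) by (intro gr_zero_open[OF oL]) auto
  have gU: "C1_on U g" using C1_on_subset[OF g(1)] by auto
  have YU: "C1_field U Y"
    unfolding C1_field_def
  proof
    fix b :: 'a assume "b \<in> Basis"
    then have "C1_on U (\<lambda>x. (g x *\<^sub>R \<zeta> x) \<bullet> b)"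
      using C1_field_scale[OF gU z] unfolding C1_field_def by blast
    then show "C1_on U (\<lambda>x. Y x \<bullet> b)"
      by (rule C1_on_cong[OF U, rotated]) (simp add: Y_def)
  qed
  have "C1_field (- L) Y" by (rule C1_field_zero_open[OF oL]) (simp add: Y_def g(4))
  then have YC: "C1_field UNIV Y" using C1_field_Un[OF U oL YU] UL by simp
  have dvY: "dv Y x = gr g x \<bullet> \<zeta> x + g x * dv \<zeta> x" for x
  proof (cases "x \<in> U")
    case True
    have "gr (\<lambda>y. Y y \<bullet> b) x = gr (\<lambda>y. (g y *\<^sub>R \<zeta> y) \<bullet> b) x" for b
      by (rule gr_cong_open[OF U True]) (simp add: Y_def)
    then have "dv Y x = dv (\<lambda>x. g x *\<^sub>R \<zeta> x) x" by (simp add: dv_def)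
    also have "\<dots> = gr g x \<bullet> \<zeta> x + g x * dv \<zeta> x"
      using C1_field_differentiable[OF z True] g(1) by (intro dv_scale) (auto simp: C1_on_def)
    finally show ?thesis .
  next
    case False
    then have x: "x \<notin> L" using g by auto
    then have "gr (\<lambda>y. Y y \<bullet> b) x = 0" for b
      by (intro gr_zero_open[OF oL]) (auto simp: Y_def g(4))
    then show ?thesis using g0[OF x] g(4)[OF x] by (simp add: dv_def)
  qed
  show 1: "integrable lborel (\<lambda>x. gr g x \<bullet> \<zeta> x)"
    by (rule integrable_supported[OF U _ g(2,3)])
      (auto intro!: continuous_on_inner C1_on_gr[OF gU] C1_field_continuous_on[OF z] simp: g0)
  show 2: "integrable lborel (\<lambda>x. g x * dv \<zeta> x)"
    by (rule integrable_supported[OF U _ g(2,3)])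
      (auto intro!: continuous_on_mult C1_on_imp_continuous_on[OF gU] C1_field_dv_continuous[OF z] simp: g(4))
  have "(\<integral>x. dv Y x \<partial>lborel) = 0"
    by (rule integral_dv_zero[OF YC g(2)]) (simp add: Y_def g(4))
  then show "(\<integral>x. gr g x \<bullet> \<zeta> x \<partial>lborel) + (\<integral>x. g x * dv \<zeta> x \<partial>lborel) = 0"
    using 1 2 by (simp add: dvY)
qed

text \<open>\<open>P\<close> stands for lam^(m - 1), where the catenoid has dimension m + 1 and
  metric lam^2 |dx|^2 on the punctured space, so that the integral of P |grad u|^2 is the Dirichlet
  energy. In t = ln |x| the logarithmic derivative of lam is \<open>tanh (real m * t) - 1\<close>,
  which explains the last assumption.\<close>

locale catenoid_weight =
  fixes m :: nat and P :: "'a::euclidean_space \<Rightarrow> real"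
  assumes dim: "DIM('a) = Suc m" and m_pos: "m \<ge> 1"
    and P_pos: "x \<noteq> 0 \<Longrightarrow> P x > 0"
    and P_norm: "norm x = norm y \<Longrightarrow> P x = P y"
    and P_gderiv: "x \<noteq> 0 \<Longrightarrow>
      GDERIV P x :> ((real m - 1) * P x * (tanh (real m * ln (norm x)) - 1) / (norm x)\<^sup>2) *\<^sub>R x"
begin

definition th :: "'a \<Rightarrow> real" where "th x = tanh (real m * ln (norm x))"

text \<open>The squared norm of the second fundamental form times the volume density: the former is
  m (m + 1) (1 - th^2) / Phi^2, the latter P lam^2, and lam = Phi / |x|.\<close>

definition q :: "'a \<Rightarrow> real" where
  "q x = P x * (real m * (real m + 1)) * (1 - (th x)\<^sup>2) / (norm x)\<^sup>2"

definition test :: "('a \<Rightarrow> real) \<Rightarrow> bool" where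
  "test u \<longleftrightarrow> C1_on UNIV u \<and> (\<exists>K. compact K \<and> 0 \<notin> K \<and> (\<forall>x. x \<notin> K \<longrightarrow> u x = 0))"

definition Q :: "('a \<Rightarrow> real) \<Rightarrow> real" where
  "Q u = (\<integral>x. P x * (norm (gr u x))\<^sup>2 - q x * (u x)\<^sup>2 \<partial>lborel)"

text \<open>The weighted L1 norm that measures the loss in \<open>Q\<close> caused by
  truncation.\<close>

definition N :: "('a \<Rightarrow> real) \<Rightarrow> real" where
  "N u = (\<integral>x. q x * \<bar>u x\<bar> \<partial>lborel)"

lemma GDERIV_th: "x \<noteq> 0 \<Longrightarrow> GDERIV th x :> (real m * (1 - (th x)\<^sup>2) / (norm x)\<^sup>2) *\<^sub>R x"
  unfolding th_def[abs_def] by (rule GDERIV_radial has_real_derivative_tanh_scaled | assumption)+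

lemma th_less_1: "(th x)\<^sup>2 < 1"
proof -
  have "\<bar>th x\<bar> < 1" unfolding th_def
    using tanh_real_lt_1[of "real m * ln (norm x)"] tanh_real_gt_neg1[of "real m * ln (norm x)"] by linarith
  then show ?thesis by (simp add: abs_square_less_1)
qed

lemma q_pos: "x \<noteq> 0 \<Longrightarrow> q x > 0"
  unfolding q_def using P_pos[of x] th_less_1[of x] m_pos by (auto intro!: mult_pos_pos divide_pos_pos)

lemma q_nonneg: "0 \<le> q x"
  using q_pos[of x] by (cases "x = 0") (auto simp: q_def)

lemma q_norm: "norm x = norm y \<Longrightarrow> q x = q y"
  unfolding q_def th_def using P_norm[of x y] by simp

lemma continuous_on_th: "continuous_on (- {0}) th"
  unfolding th_def[abs_def] by (auto intro!: continuous_intros simp: cosh_real_nonzero)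

lemma continuous_on_P: "continuous_on (- {0}) P"
  using P_gderiv unfolding gderiv_def
  by (auto intro!: continuous_at_imp_continuous_on has_derivative_continuous)

lemma C1_on_P: "C1_on (- {0}) P"
  by (rule C1_onI[OF P_gderiv])
    (auto intro!: continuous_intros continuous_on_P continuous_on_th[unfolded th_def[abs_def]])

lemma gr_P: "x \<noteq> 0 \<Longrightarrow> gr P x = ((real m - 1) * P x * (th x - 1) / (norm x)\<^sup>2) *\<^sub>R x"
  unfolding th_def by (rule gderiv_imp_gr[OF P_gderiv])

lemma continuous_on_q: "continuous_on (- {0}) q"
  unfolding q_def[abs_def] by (auto intro!: continuous_intros continuous_on_P continuous_on_th)

lemma integrable_weighted:
  fixes a g :: "'a \<Rightarrow> real"
  assumes "continuous_on (- {0}) a" "continuous_on (- {0}) g" "compact K" "0 \<notin> K" "\<And>x. x \<notin> K \<Longrightarrow> g x = 0"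
  shows "integrable lborel (\<lambda>x. a x * g x)"
  by (rule integrable_compact_support[OF continuous_on_compact_support[of "- {0}" a g K] assms(3)])
    (use assms in auto)

lemma testE:
  assumes "test u"
  obtains K where "C1_on UNIV u" "compact K" "0 \<notin> K" "\<And>x. x \<notin> K \<Longrightarrow> u x = 0" "\<And>x. x \<notin> K \<Longrightarrow> gr u x = 0"
proof -
  obtain K where K: "C1_on UNIV u" "compact K" "0 \<notin> K" "\<And>x. x \<notin> K \<Longrightarrow> u x = 0"
    using assms unfolding test_def by blast
  have "gr u x = 0" if "x \<notin> K" for x
    by (rule gr_zero_open[of "- K"]) (use K that compact_imp_closed in auto)
  from that[OF K this] show ?thesis .
qed

lemma testI: "C1_on UNIV u \<Longrightarrow> compact K \<Longrightarrow> 0 \<notin> K \<Longrightarrow> (\<And>x. x \<notin> K \<Longrightarrow> u x = 0) \<Longrightarrow> test u"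
  unfolding test_def by blast

lemma test_add: "test u \<Longrightarrow> test v \<Longrightarrow> test (\<lambda>x. u x + v x)"
proof -
  assume a: "test u" "test v"
  obtain K where "C1_on UNIV u" "compact K" "0 \<notin> K" "\<And>x. x \<notin> K \<Longrightarrow> u x = 0"
    by (rule testE[OF a(1)]) (rule that)
  moreover obtain L where "C1_on UNIV v" "compact L" "0 \<notin> L" "\<And>x. x \<notin> L \<Longrightarrow> v x = 0"
    by (rule testE[OF a(2)]) (rule that)
  ultimately show ?thesis by (intro testI[of _ "K \<union> L"] C1_on_add) auto
qed

lemma test_cmult: "test u \<Longrightarrow> test (\<lambda>x. c * u x)"
  by (erule testE, rule testI) (auto intro: C1_on_mult C1_on_const)

lemma test_mirror: assumes "test u" shows "test (\<lambda>x. u (mirror e x))"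
proof -
  obtain K where K: "C1_on UNIV u" "compact K" "0 \<notin> K" "\<And>x. x \<notin> K \<Longrightarrow> u x = 0"
    by (rule testE[OF assms]) (rule that)
  show ?thesis
  proof (rule testI[of _ "mirror e ` K"])
    show "compact (mirror e ` K)"
      by (intro compact_continuous_image K continuous_intros continuous_on_id)
    show "0 \<notin> mirror e ` K" using K(3) by (metis imageE norm_eq_zero norm_mirror)
    show "u (mirror e x) = 0" if "x \<notin> mirror e ` K" for x
      using that K(4) by (metis imageI mirror_mirror)
  qed (rule C1_on_mirror[OF K(1)])
qed

lemma test_diff: "test u \<Longrightarrow> test v \<Longrightarrow> test (\<lambda>x. u x - v x)"
  using test_add[OF _ test_cmult[of v "-1"]] by simp

lemma test_integrable:
  assumes "test u"
  shows "integrable lborel (\<lambda>x. P x * (norm (gr u x))\<^sup>2)" "integrable lborel (\<lambda>x. q x * (u x)\<^sup>2)"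
    "integrable lborel (\<lambda>x. q x * \<bar>u x\<bar>)"
proof -
  obtain K where K: "C1_on UNIV u" "compact K" "0 \<notin> K" "\<And>x. x \<notin> K \<Longrightarrow> u x = 0" "\<And>x. x \<notin> K \<Longrightarrow> gr u x = 0"
    by (rule testE[OF assms]) (rule that)
  have c: "continuous_on (- {0}) u" "continuous_on (- {0}) (gr u)"
    using C1_on_subset[OF K(1), of "-{0}"] C1_on_gr C1_on_imp_continuous_on by auto
  show "integrable lborel (\<lambda>x. P x * (norm (gr u x))\<^sup>2)" "integrable lborel (\<lambda>x. q x * (u x)\<^sup>2)"
    "integrable lborel (\<lambda>x. q x * \<bar>u x\<bar>)"
    using K by (auto intro!: integrable_weighted[of _ _ K] continuous_on_P continuous_on_q continuous_intros c)
qed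

text \<open>Jacobi's argument: \<open>\<xi>\<close> plays the role of the logarithmic gradient of a solution of the Jacobi
  equation, and the integrand of \<open>Q h\<close> becomes a square up to a divergence.\<close>

lemma Q_nonneg_Riccati:
  assumes U: "open U" "0 \<notin> U" and xi: "C1_field U \<xi>"
    and ric: "\<And>x. x \<in> U \<Longrightarrow> dv (\<lambda>x. P x *\<^sub>R \<xi> x) x + P x * (norm (\<xi> x))\<^sup>2 + q x = 0"
    and h: "C1_on UNIV h" "compact K" "K \<subseteq> U" "\<And>x. x \<notin> K \<Longrightarrow> h x = 0"
  shows "Q h \<ge> 0"
proof -
  have K0: "0 \<notin> K" using U h by auto
  have t: "test h" using h K0 by (intro testI)
  have CPU: "C1_on U P" using C1_on_subset[OF C1_on_P] U by auto
  have fU: "C1_field U (\<lambda>x. P x *\<^sub>R \<xi> x)" by (intro C1_field_scale CPU xi)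
  have h2: "C1_on UNIV (\<lambda>x. (h x)\<^sup>2)" using C1_on_mult[OF h(1) h(1)] by (simp add: power2_eq_square)
  have hK: "(h x)\<^sup>2 = 0" if "x \<notin> K" for x using h(4)[OF that] by simp
  note I = integral_parts_compact[OF U(1) h2 h(2,3) hK fU]
  \<comment> \<open>The divergence of h^2 P \<xi>. Subtracting it under the integral does not change
    \<open>Q h\<close>.\<close>
  let ?Z = "\<lambda>x. gr (\<lambda>x. (h x)\<^sup>2) x \<bullet> (P x *\<^sub>R \<xi> x) + (h x)\<^sup>2 * dv (\<lambda>x. P x *\<^sub>R \<xi> x) x"
  have i: "integrable lborel ?Z" "(\<integral>x. ?Z x \<partial>lborel) = 0"
    using I by (auto simp del: inner_scaleR_right)
  have "Q h = (\<integral>x. P x * (norm (gr h x))\<^sup>2 - q x * (h x)\<^sup>2 \<partial>lborel) - (\<integral>x. ?Z x \<partial>lborel)"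
    unfolding Q_def i(2) by simp
  also have "\<dots> = (\<integral>x. P x * (norm (gr h x))\<^sup>2 - q x * (h x)\<^sup>2 - ?Z x \<partial>lborel)"
    by (rule Bochner_Integration.integral_diff[symmetric]) (use test_integrable[OF t] i(1) in auto)
  also have "\<dots> \<ge> 0"
  proof (rule Bochner_Integration.integral_nonneg)
    fix x
    have g: "gr (\<lambda>x. (h x)\<^sup>2) x = (2 * h x) *\<^sub>R gr h x"
      using gr_mult[of h x h] h(1) by (simp add: power2_eq_square C1_on_def flip: scaleR_add_left)
    show "0 \<le> P x * (norm (gr h x))\<^sup>2 - q x * (h x)\<^sup>2 - ?Z x"
    proof (cases "x \<in> U")
      case True
      have d: "dv (\<lambda>x. P x *\<^sub>R \<xi> x) x = - P x * (norm (\<xi> x))\<^sup>2 - q x"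
        using ric[OF True] by simp
      have "P x * (norm (gr h x))\<^sup>2 - q x * (h x)\<^sup>2 - ?Z x
          = P x * ((norm (gr h x))\<^sup>2 - 2 * h x * (gr h x \<bullet> \<xi> x) + (h x)\<^sup>2 * (norm (\<xi> x))\<^sup>2)"
        unfolding g d by (simp add: algebra_simps)
      also have "\<dots> = P x * (norm (gr h x - h x *\<^sub>R \<xi> x))\<^sup>2"
        unfolding power2_norm_eq_inner
        by (simp add: inner_diff_left inner_diff_right inner_commute power2_eq_square algebra_simps)
      also have "\<dots> \<ge> 0"
        by (intro mult_nonneg_nonneg less_imp_le[OF P_pos]) (use U True in auto)
      finally show ?thesis .
    next
      case False
      then have "x \<notin> K" using h by auto
      then have "h x = 0" "gr h x = 0"
        using gr_zero_open[of "- K" x h] h compact_imp_closed[OF h(2)] by auto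
      then show ?thesis using g by simp
    qed
  qed
  finally show ?thesis .
qed

text \<open>Truncation does not increase the gradient term, and by \<open>trunc_square_ge\<close> it
  lowers the potential term by at most 4 \<epsilon> q \<bar>h\<bar>.\<close>

lemma Q_trunc:
  assumes t: "test h" and e: "\<epsilon> > 0" and n: "Q (\<lambda>x. trunc \<epsilon> (h x)) \<ge> 0"
  shows "Q h \<ge> - 4 * \<epsilon> * N h"
proof -
  obtain K where K: "C1_on UNIV h" "compact K" "0 \<notin> K" "\<And>x. x \<notin> K \<Longrightarrow> h x = 0" "\<And>x. x \<notin> K \<Longrightarrow> gr h x = 0"
    by (rule testE[OF t]) (rule that)
  have pm: "max \<epsilon> \<bar>s\<bar> > 0" for s using e by auto
  have C: "C1_on UNIV (\<lambda>x. trunc \<epsilon> (h x))"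
    by (rule C1_on_compose[OF K(1) has_real_derivative_trunc[OF e]])
      (use pm in \<open>auto intro!: continuous_intros simp: less_imp_neq[symmetric]\<close>)
  have tt: "test (\<lambda>x. trunc \<epsilon> (h x))"
    by (rule testI[OF C K(2,3)]) (use K(4) e in \<open>auto simp: trunc_def\<close>)
  have "Q (\<lambda>x. trunc \<epsilon> (h x)) \<le> (\<integral>x. P x * (norm (gr h x))\<^sup>2 - q x * (h x)\<^sup>2 + 4 * \<epsilon> * (q x * \<bar>h x\<bar>) \<partial>lborel)"
    unfolding Q_def
  proof (rule integral_mono)
    fix x
    show "P x * (norm (gr (\<lambda>x. trunc \<epsilon> (h x)) x))\<^sup>2 - q x * (trunc \<epsilon> (h x))\<^sup>2
        \<le> P x * (norm (gr h x))\<^sup>2 - q x * (h x)\<^sup>2 + 4 * \<epsilon> * (q x * \<bar>h x\<bar>)"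
    proof (cases "x \<in> K")
      case True
      then have x0: "x \<noteq> 0" using K by auto
      define d where "d = 1 - \<epsilon>\<^sup>2 / (max \<epsilon> \<bar>h x\<bar>)\<^sup>2"
      have d: "0 \<le> d" "d \<le> 1" unfolding d_def using e pm[of "h x"] by (auto simp: power_mono)
      have "gr (\<lambda>x. trunc \<epsilon> (h x)) x = d *\<^sub>R gr h x"
        unfolding d_def by (rule gderiv_imp_gr, rule GDERIV_DERIV_compose[OF C1_onD[OF K(1)]])
          (auto intro: has_real_derivative_trunc e)
      then have "(norm (gr (\<lambda>x. trunc \<epsilon> (h x)) x))\<^sup>2 = d\<^sup>2 * (norm (gr h x))\<^sup>2"
        by (simp add: power_mult_distrib)
      also have "\<dots> \<le> (norm (gr h x))\<^sup>2"
        using d by (intro mult_left_le_one_le) (auto simp: power_le_one)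
      finally have 1: "P x * (norm (gr (\<lambda>x. trunc \<epsilon> (h x)) x))\<^sup>2 \<le> P x * (norm (gr h x))\<^sup>2"
        using P_pos[OF x0] by (intro mult_left_mono) auto
      have "q x * ((h x)\<^sup>2 - (trunc \<epsilon> (h x))\<^sup>2) \<le> q x * (4 * \<epsilon> * \<bar>h x\<bar>)"
        using q_pos[OF x0] trunc_square_ge[OF e] by (intro mult_left_mono) auto
      with 1 show ?thesis by (simp add: algebra_simps)
    next
      case False
      have oK: "open (- K)" using K compact_imp_closed by auto
      have "gr (\<lambda>x. trunc \<epsilon> (h x)) x = 0"
        by (rule gr_zero_open[OF oK]) (use False K e in \<open>auto simp: trunc_def\<close>)
      then show ?thesis using False K e by (simp add: trunc_def)
    qed
  qed (use test_integrable[OF t] test_integrable[OF tt] in auto)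
  also have "\<dots> = Q h + 4 * \<epsilon> * N h"
    unfolding Q_def N_def using test_integrable[OF t] by simp
  finally show ?thesis using n by simp
qed

text \<open>Truncating above the size of \<open>h\<close> off \<open>U\<close> leaves a function
  with compact support in \<open>U\<close>, where the Riccati field lives. In the applications
  \<open>U\<close> is the complement of the zero set of a Jacobi field, and \<open>h\<close> is zero
  or nearly constant on that set.\<close>

lemma Q_ge_outside:
  assumes U: "open U" "0 \<notin> U" and xi: "C1_field U \<xi>"
    and ric: "\<And>x. x \<in> U \<Longrightarrow> dv (\<lambda>x. P x *\<^sub>R \<xi> x) x + P x * (norm (\<xi> x))\<^sup>2 + q x = 0"
    and t: "test h" and e: "\<epsilon> > \<delta>" "\<delta> \<ge> 0" and small: "\<And>x. x \<noteq> 0 \<Longrightarrow> x \<notin> U \<Longrightarrow> \<bar>h x\<bar> \<le> \<delta>"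
  shows "Q h \<ge> - 4 * \<epsilon> * N h"
proof (rule Q_trunc[OF t])
  show e0: "\<epsilon> > 0" using e by simp
  obtain K where K: "C1_on UNIV h" "compact K" "0 \<notin> K" "\<And>x. x \<notin> K \<Longrightarrow> h x = 0"
    by (rule testE[OF t]) (rule that)
  have pm: "max \<epsilon> \<bar>s\<bar> > 0" for s using e0 by auto
  define L where "L = K \<inter> {x. \<epsilon> \<le> \<bar>h x\<bar>}"
  have "closed {x. \<epsilon> \<le> \<bar>h x\<bar>}"
    using C1_on_imp_continuous_on[OF K(1)] by (intro closed_Collect_le continuous_intros) auto
  then have L: "compact L" unfolding L_def using K by blast
  show "Q (\<lambda>x. trunc \<epsilon> (h x)) \<ge> 0"
  proof (rule Q_nonneg_Riccati[OF U xi ric])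
    show "C1_on UNIV (\<lambda>x. trunc \<epsilon> (h x))"
      by (rule C1_on_compose[OF K(1) has_real_derivative_trunc[OF e0]])
        (use pm in \<open>auto intro!: continuous_intros simp: less_imp_neq[symmetric]\<close>)
    show "compact L" by (rule L)
    show "L \<subseteq> U"
    proof
      fix x assume x: "x \<in> L"
      then have "x \<noteq> 0" "\<epsilon> \<le> \<bar>h x\<bar>" using K(3) unfolding L_def by auto
      then show "x \<in> U" using small[of x] e by force
    qed
    show "trunc \<epsilon> (h x) = 0" if "x \<notin> L" for x
      using that K(4)[of x] e0 by (cases "x \<in> K") (auto simp: L_def trunc_zero)
  qed
qed

end

section \<open>Averaging over reflections\<close>

text \<open>Finite sequences of averagings. Continuity, mean, Lipschitz constant and upper bounds on
  the unit sphere survive each step, as does the property of being a test function; all of this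
  transfers by rule induction.\<close>

inductive reach :: "('a::euclidean_space \<Rightarrow> real) \<Rightarrow> ('a \<Rightarrow> real) \<Rightarrow> bool" for u where
  reach_refl: "reach u u"
| reach_step: "reach u w \<Longrightarrow> reach u (\<lambda>x. (w x + w (mirror e x)) / 2)"

lemma reach_trans: "reach v w \<Longrightarrow> reach u v \<Longrightarrow> reach u w"
  by (induction rule: reach.induct) (auto intro: reach.intros)

lemma reach_uminus: "reach (\<lambda>x. - u x) w \<Longrightarrow> reach u (\<lambda>x. - w x)"
proof (induction rule: reach.induct)
  case reach_refl
  then show ?case by (auto intro: reach.intros)
next
  case (reach_step w e)
  have "(\<lambda>x. (- w x + - w (mirror e x)) / 2) = (\<lambda>x. - ((w x + w (mirror e x)) / 2))"
    by (auto simp: field_simps)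
  then show ?case using reach.reach_step[OF reach_step.IH, of e] by simp
qed

lemma reach_le:
  "reach u w \<Longrightarrow> \<forall>x. norm x = 1 \<longrightarrow> u x \<le> A \<Longrightarrow> \<forall>x. norm x = 1 \<longrightarrow> w x \<le> A"
proof (induction rule: reach.induct)
  case (reach_step w e)
  show ?case
  proof (intro allI impI)
    fix x :: 'a assume "norm x = 1"
    then have "w x \<le> A" "w (mirror e x) \<le> A" using reach_step.IH[OF reach_step.prems] by auto
    then show "(w x + w (mirror e x)) / 2 \<le> A" by simp
  qed
qed

definition Lip_sphere :: "real \<Rightarrow> ('a::euclidean_space \<Rightarrow> real) \<Rightarrow> bool" where
  "Lip_sphere L f \<longleftrightarrow> (\<forall>x y. norm x = 1 \<longrightarrow> norm y = 1 \<longrightarrow> \<bar>f x - f y\<bar> \<le> L * norm (x - y))"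

lemma reach_Lip: "reach u w \<Longrightarrow> Lip_sphere L u \<Longrightarrow> Lip_sphere L w"
proof (induction rule: reach.induct)
  case (reach_step w e)
  show ?case unfolding Lip_sphere_def
  proof (intro allI impI)
    fix x y :: 'a assume xy: "norm x = 1" "norm y = 1"
    have "\<bar>w x - w y\<bar> \<le> L * norm (x - y)"
      using reach_step xy unfolding Lip_sphere_def by blast
    moreover have "\<bar>w (mirror e x) - w (mirror e y)\<bar> \<le> L * norm (mirror e x - mirror e y)"
      using reach_step xy unfolding Lip_sphere_def by simp
    moreover have "norm (mirror e x - mirror e y) = norm (x - y)"
      by (simp flip: mirror_diff)
    ultimately show "\<bar>(w x + w (mirror e x)) / 2 - (w y + w (mirror e y)) / 2\<bar> \<le> L * norm (x - y)"
      by (simp add: field_simps)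
  qed
qed

lemma reach_continuous: "reach u w \<Longrightarrow> continuous_on UNIV u \<Longrightarrow> continuous_on UNIV w"
proof (induction rule: reach.induct)
  case (reach_step w e)
  show ?case
    using reach_step by (intro continuous_intros continuous_on_compose2[of UNIV w _ "mirror e"] continuous_on_id) auto
qed

section \<open>Spherical means and convergence of the averages\<close>

definition shell :: "'a::euclidean_space set" where
  "shell = cball 0 2 - ball 0 1"

text \<open>The spherical mean on the unit sphere, computed with Lebesgue measure: \<open>u\<close>
  is extended from the sphere as a function homogeneous of degree zero and averaged over a shell.
  The invariance under reflections then follows from \<open>integral_mirror\<close>.\<close>

definition mean :: "('a::euclidean_space \<Rightarrow> real) \<Rightarrow> real" where
  "mean u = (\<integral>x. indicator shell x * u (x /\<^sub>R norm x) \<partial>lborel) / measure lborel (shell :: 'a set)"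

lemma compact_shell: "compact (shell :: 'a::euclidean_space set)"
  unfolding shell_def by (intro compact_diff) auto

lemma norm_shell: "x \<in> shell \<Longrightarrow> norm x \<ge> 1"
  by (auto simp: shell_def)

lemma measure_shell_pos: "measure lborel (shell :: 'a::euclidean_space set) > 0"
proof -
  define a where "a = (SOME b. b \<in> (Basis :: 'a set))"
  have a: "norm a = 1" unfolding a_def by (simp add: SOME_Basis)
  have "ball ((3/2) *\<^sub>R a) (1/2) \<subseteq> shell"
  proof
    fix x assume "x \<in> ball ((3/2) *\<^sub>R a) (1/2)"
    then have "norm ((3/2) *\<^sub>R a - x) < 1/2" by (simp add: dist_norm)
    then show "x \<in> shell"
      using a norm_triangle_ineq2[of "(3/2) *\<^sub>R a" x] norm_triangle_ineq2[of x "(3/2) *\<^sub>R a"]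
      by (auto simp: shell_def norm_minus_commute)
  qed
  then have "measure lborel (ball ((3/2) *\<^sub>R a) (1/2)) \<le> measure lborel (shell :: 'a set)"
    using compact_shell emeasure_compact_finite[OF compact_shell]
    by (intro measure_mono_fmeasurable) (auto simp: fmeasurable_def intro: borel_compact)
  moreover have "measure lborel (ball ((3/2) *\<^sub>R a) (1/2)) > 0" by (simp add: content_ball_pos)
  ultimately show ?thesis by linarith
qed

lemma mean_integrable:
  fixes u :: "'a::euclidean_space \<Rightarrow> real"
  assumes "continuous_on UNIV u"
  shows "integrable lborel (\<lambda>x. indicator shell x * u (x /\<^sub>R norm x))"
proof -
  have "continuous_on shell (\<lambda>x::'a. u (x /\<^sub>R norm x))"
    by (rule continuous_on_compose2[OF assms]) (force intro!: continuous_intros dest: norm_shell)+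
  from borel_integrable_compact[OF compact_shell this] show ?thesis by simp
qed

lemma mean_const: "mean (\<lambda>x::'a::euclidean_space. c) = c"
proof -
  have "(\<integral>x. indicator (shell :: 'a set) x * c \<partial>lborel) = measure lborel (shell :: 'a set) * c"
    using compact_shell by simp
  then show ?thesis
    using measure_shell_pos[where ?'a = 'a] unfolding mean_def by simp
qed

lemma mean_add:
  "continuous_on UNIV u \<Longrightarrow> continuous_on UNIV v \<Longrightarrow> mean (\<lambda>x. u x + v x) = mean u + mean v"
  unfolding mean_def by (simp add: mean_integrable distrib_left add_divide_distrib)

lemma mean_cmult: "mean (\<lambda>x. c * u x) = c * mean u"
  unfolding mean_def by (simp add: mult.left_commute)

lemma mean_uminus: "mean (\<lambda>x. - u x) = - mean u"
  using mean_cmult[of "-1" u] by simp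

lemma mean_mono:
  fixes u v :: "'a::euclidean_space \<Rightarrow> real"
  assumes "continuous_on UNIV u" "continuous_on UNIV v" "\<And>x. norm x = 1 \<Longrightarrow> u x \<le> v x"
  shows "mean u \<le> mean v"
  unfolding mean_def
proof (rule divide_right_mono[OF integral_mono])
  show "indicator shell x * u (x /\<^sub>R norm x) \<le> indicator shell x * v (x /\<^sub>R norm x)" for x
  proof (cases "x \<in> shell")
    case True
    then have "norm x \<noteq> 0" using norm_shell[of x] by linarith
    then have "norm (x /\<^sub>R norm x) = 1" by simp
    then show ?thesis using assms(3) by (intro mult_left_mono) auto
  qed simp
qed (use assms mean_integrable in auto)

lemma mean_mirror:
  assumes "continuous_on UNIV u" shows "mean (\<lambda>x. u (mirror e x)) = mean u"
proof -
  have *: "indicator shell x * u (mirror e (x /\<^sub>R norm x))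
      = indicator shell (mirror e x) * u (mirror e x /\<^sub>R norm (mirror e x))" for x
    by (simp add: shell_def indicator_def linear_cmul[OF mirror_linear])
  have "(\<lambda>x. indicator shell x * u (x /\<^sub>R norm x)) \<in> borel_measurable borel"
    using mean_integrable[OF assms] by auto
  from integral_mirror[OF this, of e] show ?thesis
    unfolding mean_def * by simp
qed

lemma reach_mean: "reach u w \<Longrightarrow> continuous_on UNIV u \<Longrightarrow> mean w = mean u"
proof (induction rule: reach.induct)
  case (reach_step w e)
  have c: "continuous_on UNIV w" using reach_continuous reach_step by blast
  then have "continuous_on UNIV (\<lambda>x. w (mirror e x))"
    by (rule continuous_on_compose2) (auto intro!: continuous_intros)
  then have "mean (\<lambda>x. (1/2) * (w x + w (mirror e x))) = (1/2) * (mean w + mean w)"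
    unfolding mean_cmult by (simp add: mean_add c mean_mirror)
  then show ?case using reach_step by simp
qed simp

lemma exists_le_mean:
  fixes u :: "'a::euclidean_space \<Rightarrow> real"
  assumes "continuous_on UNIV u"
  shows "\<exists>p. norm p = 1 \<and> u p \<le> mean u"
proof -
  have "\<exists>x\<in>sphere 0 1. \<forall>y\<in>sphere 0 (1::real). u x \<le> u y"
    using assms by (intro continuous_attains_inf) (auto intro: continuous_on_subset)
  then obtain p where p: "norm p = 1" "\<And>y. norm y = 1 \<Longrightarrow> u p \<le> u y" by auto
  have "mean (\<lambda>x::'a. u p) \<le> mean u" using p assms by (intro mean_mono) auto
  then show ?thesis using p mean_const[where ?'a = 'a, of "u p"] by auto
qed

text \<open>The alternative \<open>f x \<le> A - d\<close> is what makes the induction work: if the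
  new reflection takes x to a point where \<open>f\<close> is small, the inductive bound applies at
  \<open>mirror e x\<close> through this alternative. One good value out of two halves the gain,
  hence the power of 2.\<close>

lemma reach_list:
  assumes A: "\<And>x. norm x = 1 \<Longrightarrow> f x \<le> A" and d: "d > 0"
  shows "\<exists>w. reach f w \<and> (\<forall>x. norm x = 1 \<longrightarrow> w x \<le> A) \<and>
     (\<forall>x. norm x = 1 \<longrightarrow> (f x \<le> A - d \<or> (\<exists>e\<in>set es. f (mirror e x) \<le> A - d)) \<longrightarrow> w x \<le> A - d / 2 ^ length es)"
proof (induction es)
  case Nil
  then show ?case using A by (intro exI[of _ f]) (auto intro: reach.intros)
next
  case (Cons e es)
  then obtain w where w: "reach f w" "\<And>x. norm x = 1 \<Longrightarrow> w x \<le> A"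
    "\<And>x. norm x = 1 \<Longrightarrow> (f x \<le> A - d \<or> (\<exists>e\<in>set es. f (mirror e x) \<le> A - d)) \<Longrightarrow> w x \<le> A - d / 2 ^ length es"
    by blast
  have h: "d / 2 ^ length (e # es) = (d / 2 ^ length es) / 2" by simp
  show ?case unfolding h
  proof (intro exI[of _ "\<lambda>x. (w x + w (mirror e x)) / 2"] conjI allI impI)
    show "reach f (\<lambda>x. (w x + w (mirror e x)) / 2)" by (rule reach_step[OF w(1)])
    fix x :: 'a assume x: "norm x = 1"
    have b: "w x \<le> A" "w (mirror e x) \<le> A" using w(2) x by auto
    then show "(w x + w (mirror e x)) / 2 \<le> A" by simp
    assume "f x \<le> A - d \<or> (\<exists>e\<in>set (e # es). f (mirror e x) \<le> A - d)"
    then consider "f x \<le> A - d \<or> (\<exists>e\<in>set es. f (mirror e x) \<le> A - d)" | "f (mirror e x) \<le> A - d" by auto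
    then have "w x \<le> A - d / 2 ^ length es \<or> w (mirror e x) \<le> A - d / 2 ^ length es"
      by cases (use w(3)[of x] w(3)[of "mirror e x"] x in auto)
    moreover have "(s + t) / 2 \<le> A - D / 2" if "s \<le> A - D \<or> t \<le> A - D" "s \<le> A" "t \<le> A" for s t D
      using that by (auto simp: field_simps)
    ultimately show "(w x + w (mirror e x)) / 2 \<le> A - d / 2 ^ length es / 2" using b by blast
  qed
qed

text \<open>The gain \<open>\<rho>\<close> depends only on \<open>L\<close> and \<open>\<delta>\<close>, which makes the decrease of the maximum in
  \<open>reach_upper\<close> effective.\<close>

lemma reach_drop:
  assumes L: "L > 0" and \<delta>: "\<delta> > 0"
  shows "\<exists>\<rho>>0. \<forall>(f::'a::euclidean_space \<Rightarrow> real) A p.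
    Lip_sphere L f \<longrightarrow> (\<forall>x. norm x = 1 \<longrightarrow> f x \<le> A) \<longrightarrow> norm p = 1 \<longrightarrow> f p \<le> A - \<delta>
      \<longrightarrow> (\<exists>w. reach f w \<and> (\<forall>x. norm x = 1 \<longrightarrow> w x \<le> A - \<rho>))"
proof -
  \<comment> \<open>Chosen so that \<open>L * r = \<delta> / 2\<close>: a function below A -
    \<delta> at p stays below A - \<delta> / 2 within distance r of p.\<close>
  define r where "r = \<delta> / (2 * L)"
  have r: "r > 0" using L \<delta> by (simp add: r_def)
  have "compact (sphere (0::'a) 1)" by simp
  then obtain X where X: "X \<subseteq> sphere (0::'a) 1" "finite X" "sphere 0 1 \<subseteq> (\<Union>y\<in>X. ball y r)"
    using r by (elim compactE_image[of _ _ "\<lambda>y. ball y r"]) auto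
  obtain ys where ys: "set ys = X" using finite_list[OF X(2)] by blast
  define \<rho> where "\<rho> = (\<delta> / 2) / 2 ^ length ys"
 show ?thesis
  proof (intro exI[of _ \<rho>] conjI allI impI)
    show "\<rho> > 0" using \<delta> by (simp add: \<rho>_def)
    fix f :: "'a \<Rightarrow> real" and A p
    assume f: "Lip_sphere L f" "\<forall>x. norm x = 1 \<longrightarrow> f x \<le> A" and p: "norm p = 1" "f p \<le> A - \<delta>"
    obtain w where w: "reach f w"
      "\<And>x. norm x = 1 \<Longrightarrow> (\<exists>e\<in>set (map (\<lambda>y. y - p) ys). f (mirror e x) \<le> A - \<delta> / 2)
        \<Longrightarrow> w x \<le> A - (\<delta> / 2) / 2 ^ length (map (\<lambda>y. y - p) ys)"
      using reach_list[where f=f and A=A and d="\<delta>/2" and es="map (\<lambda>y. y - p) ys"] f(2) \<delta> by auto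
    have "w x \<le> A - \<rho>" if x: "norm x = 1" for x
    proof -
      obtain y where y: "y \<in> X" "norm (y - x) < r" using X(3) x by (auto simp: dist_norm)
      have ny: "norm y = 1" using X y by auto
      \<comment> \<open>The reflection attached to the net point y near x takes y to p, and being an
        isometry it takes x to a point within r of p.\<close>
      have sw: "mirror (y - p) y = p" using ny p by (intro mirror_swap) simp
      have "norm (mirror (y - p) x - p) = norm (x - y)"
        using mirror_diff[of "y - p" x y] norm_mirror[of "y - p" "x - y"] sw by simp
      moreover have "\<bar>f (mirror (y - p) x) - f p\<bar> \<le> L * norm (mirror (y - p) x - p)"
        using f(1) x p unfolding Lip_sphere_def by simp
      moreover have "L * norm (x - y) \<le> L * r"
        using y L by (intro mult_left_mono) (auto simp: norm_minus_commute)
      moreover have "L * r = \<delta> / 2" using L by (simp add: r_def)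
      ultimately have "f (mirror (y - p) x) \<le> A - \<delta> / 2" using p(2) by (simp add: abs_le_iff)
      then have "\<exists>e\<in>set (map (\<lambda>y. y - p) ys). f (mirror e x) \<le> A - \<delta> / 2"
        using y ys by auto
      from w(2)[OF x this] show ?thesis by (simp add: \<rho>_def)
    qed
    with w(1) show "\<exists>w. reach f w \<and> (\<forall>x. norm x = 1 \<longrightarrow> w x \<le> A - \<rho>)" by blast
  qed
qed

text \<open>\<open>\<A>\<close> consists of the upper bounds attained by averages of
  \<open>f\<close>; all are at least the mean. If their infimum exceeded the mean by a gap, an
  average with a bound near the infimum would lie below that bound by the gap at some point, and
  \<open>reach_drop\<close> would push the bound past the infimum.\<close>

lemma reach_upper:
  fixes f :: "'a::euclidean_space \<Rightarrow> real"
  assumes c: "continuous_on UNIV f" and L: "Lip_sphere L f" "L > 0" and e: "\<epsilon> > 0"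
  shows "\<exists>w. reach f w \<and> (\<forall>x. norm x = 1 \<longrightarrow> w x \<le> mean f + \<epsilon>)"
proof -
  define \<A> where "\<A> = {A. \<exists>w. reach f w \<and> (\<forall>x. norm x = 1 \<longrightarrow> w x \<le> A)}"
  have ge: "mean f \<le> A" if "A \<in> \<A>" for A
  proof -
    obtain w where w: "reach f w" "\<forall>x. norm x = 1 \<longrightarrow> w x \<le> A" using \<open>A \<in> \<A>\<close> \<A>_def by auto
    have "mean w \<le> mean (\<lambda>x::'a. A)"
      using w reach_continuous[OF w(1) c] by (intro mean_mono) auto
    then show ?thesis using reach_mean[OF w(1) c] by (simp add: mean_const)
  qed
  have "\<exists>x\<in>sphere 0 1. \<forall>y\<in>sphere 0 (1::real). f y \<le> f x"
    using c by (intro continuous_attains_sup) (auto intro: continuous_on_subset)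
  then obtain z where "\<forall>y\<in>sphere 0 1. f y \<le> f z" by blast
  then have "\<forall>y. norm y = 1 \<longrightarrow> f y \<le> f z" by (metis mem_sphere_0)
  then have "f z \<in> \<A>" unfolding \<A>_def using reach_refl[of f] by blast
  then have ne: "\<A> \<noteq> {}" by blast
  have bb: "bdd_below \<A>" using ge by (rule bdd_belowI)
  have "Inf \<A> \<le> mean f"
  proof (rule ccontr)
    assume "\<not> Inf \<A> \<le> mean f"
    then have \<delta>: "Inf \<A> - mean f > 0" by simp
    obtain \<rho> where \<rho>: "\<rho> > 0"
      "\<forall>(g::'a \<Rightarrow> real) A p. Lip_sphere L g \<longrightarrow> (\<forall>x. norm x = 1 \<longrightarrow> g x \<le> A) \<longrightarrow> norm p = 1
        \<longrightarrow> g p \<le> A - (Inf \<A> - mean f) \<longrightarrow> (\<exists>w. reach g w \<and> (\<forall>x. norm x = 1 \<longrightarrow> w x \<le> A - \<rho>))"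
      using reach_drop[OF L(2) \<delta>, where ?'a = 'a] by blast
    obtain A where A: "A \<in> \<A>" "A < Inf \<A> + \<rho>"
      using cInf_lessD[OF ne, of "Inf \<A> + \<rho>"] \<rho>(1) by auto
    then obtain w where w: "reach f w" "\<And>x. norm x = 1 \<Longrightarrow> w x \<le> A" using \<A>_def by auto
    obtain p where p: "norm p = 1" "w p \<le> mean w" using exists_le_mean[OF reach_continuous[OF w(1) c]] by blast
    have "w p \<le> A - (Inf \<A> - mean f)"
      using p(2) reach_mean[OF w(1) c] cInf_lower[OF A(1) bb] by simp
    then obtain w' where w': "reach w w'" "\<forall>x. norm x = 1 \<longrightarrow> w' x \<le> A - \<rho>"
      using \<rho>(2)[rule_format, of w A p] reach_Lip[OF w(1) L(1)] w(2) p(1) by blast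
    have "A - \<rho> \<in> \<A>" unfolding \<A>_def using w' reach_trans[OF w'(1) w(1)] by blast
    from cInf_lower[OF this bb] A(2) show False by simp
  qed
  then obtain A where "A \<in> \<A>" "A < mean f + \<epsilon>" using cInf_lessD[OF ne, of "mean f + \<epsilon>"] e by auto
  then show ?thesis unfolding \<A>_def by force
qed

text \<open>The one-sided statement is used twice, first for \<open>f\<close> and then for the
  negative of the average obtained; further averaging keeps the upper bound already reached.\<close>

lemma reach_near_mean:
  fixes f :: "'a::euclidean_space \<Rightarrow> real"
  assumes c: "continuous_on UNIV f" and L: "Lip_sphere L f" "L > 0" and e: "\<epsilon> > 0"
  shows "\<exists>w. reach f w \<and> (\<forall>x. norm x = 1 \<longrightarrow> \<bar>w x - mean f\<bar> \<le> \<epsilon>)"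
proof -
  obtain w where w: "reach f w" "\<forall>x. norm x = 1 \<longrightarrow> w x \<le> mean f + \<epsilon>"
    using reach_upper[OF assms] by blast
  have cw: "continuous_on UNIV (\<lambda>x. - w x)"
    using reach_continuous[OF w(1) c] by (intro continuous_intros)
  have "Lip_sphere L (\<lambda>x. - w x)"
    using reach_Lip[OF w(1) L(1)] unfolding Lip_sphere_def by (simp add: abs_minus_commute)
  from reach_upper[OF cw this L(2) e] obtain v where
    v: "reach (\<lambda>x. - w x) v" "\<forall>x. norm x = 1 \<longrightarrow> v x \<le> - mean w + \<epsilon>"
    by (auto simp: mean_uminus)
  have r: "reach w (\<lambda>x. - v x)" by (rule reach_uminus[OF v(1)])
  have "\<forall>x. norm x = 1 \<longrightarrow> - v x \<le> mean f + \<epsilon>" by (rule reach_le[OF r w(2)])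
  then show ?thesis
    using reach_trans[OF r w(1)] v(2) reach_mean[OF w(1) c]
    by (intro exI[of _ "\<lambda>x. - v x"]) (force simp: abs_le_iff)
qed

section \<open>Jacobi fields of translations\<close>

lemma dv_id: "dv (\<lambda>x. x) (x::'a::euclidean_space) = real DIM('a)"
  by (subst dv_has_derivative[OF has_derivative_ident]) simp

lemma C1_field_const: "C1_field S (\<lambda>x. c)"
  unfolding C1_field_def by (auto intro: C1_on_const)

lemma C1_field_id: "C1_field S (\<lambda>x. x)"
  unfolding C1_field_def by (auto intro: C1_on_inner)

lemma C1_field_diff: "C1_field S \<xi> \<Longrightarrow> C1_field S \<zeta> \<Longrightarrow> C1_field S (\<lambda>x. \<xi> x - \<zeta> x)"
  unfolding C1_field_def by (auto simp: inner_diff_left intro: C1_on_diff)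

lemma dv_diff:
  assumes "C1_field S \<xi>" "C1_field S \<zeta>" "x \<in> S"
  shows "dv (\<lambda>x. \<xi> x - \<zeta> x) x = dv \<xi> x - dv \<zeta> x"
proof -
  have "gr (\<lambda>y. (\<xi> y - \<zeta> y) \<bullet> b) x = gr (\<lambda>y. \<xi> y \<bullet> b) x - gr (\<lambda>y. \<zeta> y \<bullet> b) x" if "b \<in> Basis" for b
    using GDERIV_diff[OF gderiv_gr[OF C1_field_differentiable[OF assms(1,3) that]]
        gderiv_gr[OF C1_field_differentiable[OF assms(2,3) that]]]
    by (intro gderiv_imp_gr) (simp add: inner_diff_left)
  then show ?thesis unfolding dv_def by (simp add: inner_diff_left sum_subtractf)
qed

lemma GDERIV_inverse_norm_square:
  "x \<noteq> 0 \<Longrightarrow> GDERIV (\<lambda>x. 1 / (norm x)\<^sup>2) x :> (- 2 / (norm x)^4) *\<^sub>R x"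
proof -
  assume x: "x \<noteq> 0"
  have "((\<lambda>r. 1 / r\<^sup>2) has_real_derivative (- 2 / (norm x)^3)) (at (norm x))"
    using x by (auto intro!: derivative_eq_intros simp: field_simps power_numeral_reduce)
  from GDERIV_DERIV_compose[OF GDERIV_norm[OF x] this] show ?thesis
    by (simp add: sgn_div_norm power_numeral_reduce field_simps)
qed

lemma C1_on_inverse_norm_square: "C1_on (- {0}) (\<lambda>x. 1 / (norm x)\<^sup>2)"
  by (rule C1_onI[OF GDERIV_inverse_norm_square]) (auto intro!: continuous_intros)

lemma dv_unit_radial:
  fixes x :: "'a::euclidean_space"
  assumes x: "x \<noteq> 0"
  shows "dv (\<lambda>x. (1 / (norm x)\<^sup>2) *\<^sub>R x) x = (real DIM('a) - 2) / (norm x)\<^sup>2"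
proof -
  have "gr (\<lambda>x. 1 / (norm x)\<^sup>2) x = (- 2 / (norm x)^4) *\<^sub>R x"
    by (rule gderiv_imp_gr[OF GDERIV_inverse_norm_square[OF x]])
  then have "dv (\<lambda>x. (1 / (norm x)\<^sup>2) *\<^sub>R x) x = (- 2 / (norm x)^4) * (norm x)\<^sup>2 + 1 / (norm x)\<^sup>2 * real DIM('a)"
    using C1_field_differentiable[OF C1_field_id, of x UNIV]
      gderiv_differentiable[OF GDERIV_inverse_norm_square[OF x]]
    by (subst dv_scale) (auto simp: dv_id power2_norm_eq_inner)
  also have "\<dots> = (real DIM('a) - 2) / (norm x)\<^sup>2"
    using x by (simp add: field_simps power_numeral_reduce)
  finally show ?thesis .
qed

lemma C1_field_unit_radial: "C1_field (- {0}) (\<lambda>x. (1 / (norm x)\<^sup>2) *\<^sub>R x)"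
  by (rule C1_field_scale[OF C1_on_inverse_norm_square C1_field_id])

context catenoid_weight
begin

text \<open>In t = ln |x| a radial field has a divergence with first-order coefficient (m - 1)
  \<open>th x\<close>: the summand -1 in the logarithmic derivative of lam cancels against the
  dimension term of \<open>dv_unit_radial\<close>.\<close>

lemma dv_radial:
  assumes x: "x \<noteq> 0" and k: "GDERIV k x :> (k' / (norm x)\<^sup>2) *\<^sub>R x"
  shows "dv (\<lambda>x. P x *\<^sub>R (k x *\<^sub>R ((1 / (norm x)\<^sup>2) *\<^sub>R x))) x
    = P x / (norm x)\<^sup>2 * (k' + (real m - 1) * th x * k x)"
proof -
  let ?w = "\<lambda>x::'a. (1 / (norm x)\<^sup>2) *\<^sub>R x"
  have r: "x \<bullet> x = (norm x)\<^sup>2" by (simp add: power2_norm_eq_inner)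
  have r0: "(norm x)\<^sup>2 \<noteq> 0" using x by simp
  have d: "P differentiable (at x)" "k differentiable (at x)"
    using P_gderiv[OF x] k gderiv_differentiable by blast+
  have dw: "b \<in> Basis \<Longrightarrow> (\<lambda>y. ?w y \<bullet> b) differentiable (at x)" for b
    using C1_field_differentiable[OF C1_field_unit_radial, of x b] x by simp
  have "dv (\<lambda>x. (P x * k x) *\<^sub>R ?w x) x = gr (\<lambda>x. P x * k x) x \<bullet> ?w x + P x * k x * dv ?w x"
    using d dw by (intro dv_scale) auto
  also have "gr (\<lambda>x. P x * k x) x = P x *\<^sub>R ((k' / (norm x)\<^sup>2) *\<^sub>R x)
      + k x *\<^sub>R (((real m - 1) * P x * (th x - 1) / (norm x)\<^sup>2) *\<^sub>R x)"
    using gr_mult[OF d] gr_P[OF x] gderiv_imp_gr[OF k] by simp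
  also have "dv ?w x = (real m - 1) / (norm x)\<^sup>2" using dv_unit_radial[OF x] dim by simp
  finally have "dv (\<lambda>x. (P x * k x) *\<^sub>R ?w x) x = P x / (norm x)\<^sup>2 * (k' + (real m - 1) * th x * k x)"
    using r0 by (simp add: inner_add_left r) (simp add: field_simps)
  then show ?thesis by simp
qed

text \<open>The logarithmic gradient of \<open>th\<close>, which up to sign is the vertical
  component of the unit normal, hence the Jacobi field of vertical translation. It is defined off
  the waist.\<close>

definition xi_axial :: "'a \<Rightarrow> 'a" where
  "xi_axial x = (real m * (1 / th x - th x)) *\<^sub>R ((1 / (norm x)\<^sup>2) *\<^sub>R x)"

lemma th_zero_iff: "x \<noteq> 0 \<Longrightarrow> th x = 0 \<longleftrightarrow> norm x = 1"
  using m_pos by (simp add: th_def)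

lemma GDERIV_axial:
  assumes x: "x \<noteq> 0" "norm x \<noteq> 1"
  shows "GDERIV (\<lambda>x. real m * (1 / th x - th x)) x :>
    ((real m * (- 1 / (th x)\<^sup>2 - 1)) * (real m * (1 - (th x)\<^sup>2)) / (norm x)\<^sup>2) *\<^sub>R x"
proof -
  have "((\<lambda>s. real m * (1 / s - s)) has_real_derivative real m * (- 1 / (th x)\<^sup>2 - 1)) (at (th x))"
    using x th_zero_iff by (auto intro!: derivative_eq_intros simp: power2_eq_square)
  from GDERIV_DERIV_compose[OF GDERIV_th[OF x(1)] this] show ?thesis by simp
qed

lemma C1_field_axial: "C1_field {x. x \<noteq> 0 \<and> norm x \<noteq> 1} xi_axial"
  unfolding xi_axial_def[abs_def]
proof (rule C1_field_scale)
  show "C1_on {x. x \<noteq> 0 \<and> norm x \<noteq> 1} (\<lambda>x. real m * (1 / th x - th x))"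
    by (rule C1_onI[OF GDERIV_axial])
      (auto intro!: continuous_intros continuous_on_subset[OF continuous_on_th] simp: th_zero_iff)
  show "C1_field {x. x \<noteq> 0 \<and> norm x \<noteq> 1} (\<lambda>x::'a. (1 / (norm x)\<^sup>2) *\<^sub>R x)"
    using C1_field_unit_radial unfolding C1_field_def by (auto intro: C1_on_subset)
qed

lemma Riccati_axial:
  assumes x: "x \<noteq> 0" "norm x \<noteq> 1"
  shows "dv (\<lambda>x. P x *\<^sub>R xi_axial x) x + P x * (norm (xi_axial x))\<^sup>2 + q x = 0"
proof -
  have t0: "th x \<noteq> 0" using x th_zero_iff by simp
  have r0: "(norm x)\<^sup>2 \<noteq> 0" using x by simp
  have n: "(norm (xi_axial x))\<^sup>2 = (real m * (1 / th x - th x))\<^sup>2 / (norm x)\<^sup>2"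
    using x unfolding xi_axial_def by (simp add: power_mult_distrib power2_eq_square field_simps)
  have "dv (\<lambda>x. P x *\<^sub>R xi_axial x) x + P x * (norm (xi_axial x))\<^sup>2 + q x =
    P x / (norm x)\<^sup>2 * ((real m * (- 1 / (th x)\<^sup>2 - 1)) * (real m * (1 - (th x)\<^sup>2))
      + (real m - 1) * th x * (real m * (1 / th x - th x)) + (real m * (1 / th x - th x))\<^sup>2
      + real m * (real m + 1) * (1 - (th x)\<^sup>2))"
    unfolding n unfolding xi_axial_def dv_radial[OF x(1) GDERIV_axial[OF x]] q_def
    by (simp add: distrib_left)
  also have "(real m * (- 1 / (th x)\<^sup>2 - 1)) * (real m * (1 - (th x)\<^sup>2))
      + (real m - 1) * th x * (real m * (1 / th x - th x)) + (real m * (1 / th x - th x))\<^sup>2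
      + real m * (real m + 1) * (1 - (th x)\<^sup>2) = 0"
    using t0 by (simp add: field_simps power2_eq_square)
  finally show ?thesis by simp
qed

text \<open>The logarithmic gradient of (x . e) / (norm x cosh (m ln (norm x))), the component of
  the unit normal in the horizontal direction e, which vanishes on the hyperplane orthogonal to
  e.\<close>

definition xi_lateral :: "'a \<Rightarrow> 'a \<Rightarrow> 'a" where
  "xi_lateral e x = (1 / (x \<bullet> e)) *\<^sub>R e - (1 + real m * th x) *\<^sub>R ((1 / (norm x)\<^sup>2) *\<^sub>R x)"

lemma GDERIV_lateral:
  assumes x: "x \<noteq> 0"
  shows "GDERIV (\<lambda>x. 1 + real m * th x) x :> (real m * (real m * (1 - (th x)\<^sup>2)) / (norm x)\<^sup>2) *\<^sub>R x"
proof -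
  have "((\<lambda>s. 1 + real m * s) has_real_derivative real m) (at (th x))"
    by (auto intro!: derivative_eq_intros)
  from GDERIV_DERIV_compose[OF GDERIV_th[OF x] this] show ?thesis by simp
qed

lemma GDERIV_inverse_inner:
  assumes x: "x \<bullet> e \<noteq> 0"
  shows "GDERIV (\<lambda>x. 1 / (x \<bullet> e)) x :> (- 1 / (x \<bullet> e)\<^sup>2) *\<^sub>R e"
proof -
  have "((\<lambda>s. 1 / s) has_real_derivative - 1 / (x \<bullet> e)\<^sup>2) (at (x \<bullet> e))"
    using x by (auto intro!: derivative_eq_intros simp: power2_eq_square)
  moreover have "GDERIV (\<lambda>x. x \<bullet> e) x :> e"
    unfolding gderiv_def by (auto intro!: derivative_eq_intros)
  ultimately show ?thesis using GDERIV_DERIV_compose by blast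
qed

lemma C1_field_lateral_parts:
  "C1_field {x. x \<bullet> e \<noteq> 0} (\<lambda>x. (1 / (x \<bullet> e)) *\<^sub>R e)"
  "C1_field {x. x \<bullet> e \<noteq> 0} (\<lambda>x. (1 + real m * th x) *\<^sub>R ((1 / (norm x)\<^sup>2) *\<^sub>R x))"
proof -
  have s: "{x. x \<bullet> e \<noteq> 0} \<subseteq> - {0}" by auto
  show "C1_field {x. x \<bullet> e \<noteq> 0} (\<lambda>x. (1 / (x \<bullet> e)) *\<^sub>R e)"
    by (rule C1_field_scale[OF C1_onI[OF GDERIV_inverse_inner] C1_field_const])
      (auto intro!: continuous_intros)
  show "C1_field {x. x \<bullet> e \<noteq> 0} (\<lambda>x. (1 + real m * th x) *\<^sub>R ((1 / (norm x)\<^sup>2) *\<^sub>R x))"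
  proof (rule C1_field_scale)
    show "C1_on {x. x \<bullet> e \<noteq> 0} (\<lambda>x. 1 + real m * th x)"
      by (rule C1_onI[OF GDERIV_lateral])
        (use s in \<open>auto intro!: continuous_intros continuous_on_subset[OF continuous_on_th]\<close>)
    show "C1_field {x. x \<bullet> e \<noteq> 0} (\<lambda>x::'a. (1 / (norm x)\<^sup>2) *\<^sub>R x)"
      using C1_field_unit_radial s unfolding C1_field_def by (auto intro: C1_on_subset)
  qed
qed

text \<open>The terms in |e|^2 coming from the divergence and from the square cancel; what remains
  is a polynomial identity in \<open>th x\<close>.\<close>

lemma Riccati_lateral:
  assumes x: "x \<bullet> e \<noteq> 0"
  shows "dv (\<lambda>x. P x *\<^sub>R xi_lateral e x) x + P x * (norm (xi_lateral e x))\<^sup>2 + q x = 0"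
proof -
  have x0: "x \<noteq> 0" using x by auto
  define r where "r = (norm x)\<^sup>2"
  define s where "s = x \<bullet> e"
  define T where "T = th x"
  define E where "E = e \<bullet> e"
  define p where "p = P x"
  have r0: "r \<noteq> 0" using x0 by (simp add: r_def)
  have s0: "s \<noteq> 0" using x by (simp add: s_def)
  have xx: "x \<bullet> x = r" by (simp add: r_def power2_norm_eq_inner)
  have n: "(norm (xi_lateral e x))\<^sup>2 = E / s\<^sup>2 - 2 * (1 + real m * T) / r + (1 + real m * T)\<^sup>2 / r"
    unfolding xi_lateral_def power2_norm_eq_inner r_def[symmetric] T_def[symmetric] s_def[symmetric]
    using r0 s0
    by (simp add: inner_diff_left inner_diff_right inner_commute[of e x] xx s_def[symmetric] E_def[symmetric])
      (simp add: field_simps power2_eq_square)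
  have sU: "open {x::'a. x \<bullet> e \<noteq> 0}" by (intro open_Collect_neq continuous_intros)
  have d: "P differentiable (at x)" using P_gderiv[OF x0] gderiv_differentiable by blast
  have CP: "C1_on {x. x \<bullet> e \<noteq> 0} P" by (rule C1_on_subset[OF C1_on_P]) auto
  have "dv (\<lambda>x. P x *\<^sub>R xi_lateral e x) x =
      dv (\<lambda>x. P x *\<^sub>R (1 / (x \<bullet> e)) *\<^sub>R e) x
      - dv (\<lambda>x. P x *\<^sub>R (1 + real m * th x) *\<^sub>R ((1 / (norm x)\<^sup>2) *\<^sub>R x)) x"
    unfolding xi_lateral_def scaleR_diff_right
    by (rule dv_diff[OF C1_field_scale[OF CP C1_field_lateral_parts(1)[of e]]
          C1_field_scale[OF CP C1_field_lateral_parts(2)[of e]]]) (use x in auto)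
  also have "dv (\<lambda>x. P x *\<^sub>R (1 / (x \<bullet> e)) *\<^sub>R e) x
      = gr P x \<bullet> ((1 / (x \<bullet> e)) *\<^sub>R e) + P x * dv (\<lambda>x. (1 / (x \<bullet> e)) *\<^sub>R e) x"
    using C1_field_differentiable[OF C1_field_lateral_parts(1)[of e]] x by (intro dv_scale d) auto
  also have "dv (\<lambda>x. (1 / (x \<bullet> e)) *\<^sub>R e) x = ((- 1 / s\<^sup>2) *\<^sub>R e) \<bullet> e"
    using gderiv_differentiable[OF GDERIV_inverse_inner[OF x]] gderiv_imp_gr[OF GDERIV_inverse_inner[OF x]]
      dv_has_derivative[OF has_derivative_const[of e]]
    by (subst dv_scale) (auto simp: s_def)
  also have "gr P x = ((real m - 1) * p * (T - 1) / r) *\<^sub>R x"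
    using gr_P[OF x0] by (simp add: p_def T_def r_def)
  also note dv_radial[OF x0 GDERIV_lateral[OF x0]]
  finally have dvf: "dv (\<lambda>x. P x *\<^sub>R xi_lateral e x) x = (real m - 1) * p * (T - 1) / r - p * E / s\<^sup>2
     - p / r * (real m * (real m * (1 - T\<^sup>2)) + (real m - 1) * T * (1 + real m * T))"
    using s0 by (simp add: s_def[symmetric] p_def[symmetric] T_def[symmetric] r_def[symmetric] E_def[symmetric])
  show ?thesis unfolding dvf n q_def p_def[symmetric] T_def[symmetric] r_def[symmetric]
    using r0 s0 by (simp add: field_simps power2_eq_square)
qed

section \<open>Symmetrization by reflections and the lower bound for \<open>Q\<close>\<close>

lemma gr_half_sum:
  assumes "C1_on UNIV u" "C1_on UNIV v"
  shows "gr (\<lambda>x. (u x + v x) / 2) x = (1/2) *\<^sub>R (gr u x + gr v x)"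
    "gr (\<lambda>x. (u x - v x) / 2) x = (1/2) *\<^sub>R (gr u x - gr v x)"
proof -
  note g = C1_onD[OF assms(1), of x, simplified] C1_onD[OF assms(2), of x, simplified]
  have half: "((\<lambda>s. s / 2) has_real_derivative 1/2) (at y)" for y :: real
    by (auto intro!: derivative_eq_intros)
  show "gr (\<lambda>x. (u x + v x) / 2) x = (1/2) *\<^sub>R (gr u x + gr v x)"
    by (rule gderiv_imp_gr[OF GDERIV_DERIV_compose[OF GDERIV_add[OF g] half]])
  show "gr (\<lambda>x. (u x - v x) / 2) x = (1/2) *\<^sub>R (gr u x - gr v x)"
    by (rule gderiv_imp_gr[OF GDERIV_DERIV_compose[OF GDERIV_diff[OF g] half]])
qed

lemma test_half: "test u \<Longrightarrow> test v \<Longrightarrow> test (\<lambda>x. (u x + v x) / 2)" "test u \<Longrightarrow> test v \<Longrightarrow> test (\<lambda>x. (u x - v x) / 2)"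
  using test_cmult[OF test_add, of u v "1/2"] test_cmult[OF test_diff, of u v "1/2"] by simp_all

lemma test_C1: "test u \<Longrightarrow> C1_on UNIV u"
  by (simp add: test_def)

text \<open>For \<open>u\<close> and its mirror image, which have the same \<open>Q\<close>, this
  says that \<open>Q u\<close> is the sum of the values of \<open>Q\<close> at the even and odd
  parts of \<open>u\<close>.\<close>

lemma parallelogram:
  assumes u: "test u" and v: "test v"
  shows "Q (\<lambda>x. (u x + v x) / 2) + Q (\<lambda>x. (u x - v x) / 2) = (Q u + Q v) / 2"
proof -
  note i = test_integrable[OF u] test_integrable[OF v] test_integrable[OF test_half(1)[OF u v]]
    test_integrable[OF test_half(2)[OF u v]]
  have "Q (\<lambda>x. (u x + v x) / 2) + Q (\<lambda>x. (u x - v x) / 2)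
    = (\<integral>x. (P x * (norm (gr (\<lambda>x. (u x + v x) / 2) x))\<^sup>2 - q x * ((u x + v x) / 2)\<^sup>2)
      + (P x * (norm (gr (\<lambda>x. (u x - v x) / 2) x))\<^sup>2 - q x * ((u x - v x) / 2)\<^sup>2) \<partial>lborel)"
    unfolding Q_def using i by (intro Bochner_Integration.integral_add[symmetric] Bochner_Integration.integrable_diff)
  also have "\<dots> = (\<integral>x. ((P x * (norm (gr u x))\<^sup>2 - q x * (u x)\<^sup>2) + (P x * (norm (gr v x))\<^sup>2 - q x * (v x)\<^sup>2)) / 2 \<partial>lborel)"
  proof (rule Bochner_Integration.integral_cong[OF HOL.refl])
    fix x
    have "(norm ((1/2) *\<^sub>R (a + b)))\<^sup>2 + (norm ((1/2) *\<^sub>R (a - b)))\<^sup>2 = ((norm a)\<^sup>2 + (norm b)\<^sup>2) / 2" for a b :: 'a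
      unfolding power2_norm_eq_inner
      by (simp add: inner_add_left inner_add_right inner_diff_left inner_diff_right inner_commute[of b a] field_simps)
    from this[of "gr u x" "gr v x"]
    have 1: "P x * (norm (gr (\<lambda>x. (u x + v x) / 2) x))\<^sup>2 + P x * (norm (gr (\<lambda>x. (u x - v x) / 2) x))\<^sup>2
        = P x * (((norm (gr u x))\<^sup>2 + (norm (gr v x))\<^sup>2) / 2)"
      unfolding gr_half_sum[OF test_C1[OF u] test_C1[OF v]] by (metis distrib_left)
    have 2: "((u x + v x) / 2)\<^sup>2 + ((u x - v x) / 2)\<^sup>2 = ((u x)\<^sup>2 + (v x)\<^sup>2) / 2"
      by (simp add: power2_eq_square field_simps)
    have "(P x * (norm (gr (\<lambda>x. (u x + v x) / 2) x))\<^sup>2 - q x * ((u x + v x) / 2)\<^sup>2)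
      + (P x * (norm (gr (\<lambda>x. (u x - v x) / 2) x))\<^sup>2 - q x * ((u x - v x) / 2)\<^sup>2)
      = P x * (((norm (gr u x))\<^sup>2 + (norm (gr v x))\<^sup>2) / 2) - q x * (((u x)\<^sup>2 + (v x)\<^sup>2) / 2)"
      unfolding 1[symmetric] 2[symmetric] by (simp add: distrib_left)
    then show "(P x * (norm (gr (\<lambda>x. (u x + v x) / 2) x))\<^sup>2 - q x * ((u x + v x) / 2)\<^sup>2)
      + (P x * (norm (gr (\<lambda>x. (u x - v x) / 2) x))\<^sup>2 - q x * ((u x - v x) / 2)\<^sup>2)
      = ((P x * (norm (gr u x))\<^sup>2 - q x * (u x)\<^sup>2) + (P x * (norm (gr v x))\<^sup>2 - q x * (v x)\<^sup>2)) / 2"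
      by (simp add: field_simps)
  qed
  also have "\<dots> = (Q u + Q v) / 2" unfolding Q_def using i by simp
  finally show ?thesis .
qed

lemma Q_mirror: assumes u: "test u" shows "Q (\<lambda>x. u (mirror e x)) = Q u"
proof -
  have "gr (\<lambda>x. u (mirror e x)) x = mirror e (gr u (mirror e x))" for x
    using test_C1[OF u] by (intro gderiv_imp_gr GDERIV_mirror C1_onD) auto
  then have "Q (\<lambda>x. u (mirror e x)) = (\<integral>x. P (mirror e x) * (norm (gr u (mirror e x)))\<^sup>2
     - q (mirror e x) * (u (mirror e x))\<^sup>2 \<partial>lborel)"
    unfolding Q_def by (simp add: P_norm[of "mirror e _"] q_norm[of "mirror e _"])
  also have "\<dots> = Q u" unfolding Q_def
    by (rule integral_mirror[where g="\<lambda>x. P x * (norm (gr u x))\<^sup>2 - q x * (u x)\<^sup>2"])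
      (use test_integrable[OF u] in \<open>auto intro!: borel_measurable_diff\<close>)
  finally show ?thesis .
qed

lemma N_mirror: assumes u: "test u" shows "N (\<lambda>x. u (mirror e x)) = N u"
proof -
  have "N (\<lambda>x. u (mirror e x)) = (\<integral>x. q (mirror e x) * \<bar>u (mirror e x)\<bar> \<partial>lborel)"
    unfolding N_def by (simp add: q_norm[of "mirror e _"])
  also have "\<dots> = N u" unfolding N_def
    by (rule integral_mirror[where g="\<lambda>x. q x * \<bar>u x\<bar>"]) (use test_integrable[OF u] in auto)
  finally show ?thesis .
qed

lemma nonneg_if_small: 
  assumes "\<And>\<epsilon>::real. \<epsilon> > 0 \<Longrightarrow> a \<ge> - \<epsilon> * C" shows "a \<ge> (0::real)"
proof (rule ccontr)
  assume a: "\<not> 0 \<le> a"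
  define \<epsilon> where "\<epsilon> = - a / (2 * (\<bar>C\<bar> + 1))"
  have e: "\<epsilon> > 0" unfolding \<epsilon>_def using a by (intro divide_pos_pos) auto
  have "\<epsilon> * C \<le> \<epsilon> * (\<bar>C\<bar> + 1)" using e by (intro mult_left_mono) auto
  also have "\<dots> = - a / 2" unfolding \<epsilon>_def by (simp add: field_simps)
  finally show False using assms[OF e] a by simp
qed

text \<open>The odd part of \<open>u\<close> with respect to a reflection vanishes on the mirror, off which a horizontal
  translation provides a Jacobi field without zeros.\<close>

lemma Q_symmetrize:
  assumes u: "test u"
  shows "Q (\<lambda>x. (u x + u (mirror e x)) / 2) \<le> Q u"
proof -
  let ?h = "\<lambda>x. (u x - u (mirror e x)) / 2"
  have t: "test ?h" by (intro test_half u test_mirror)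
  have "Q ?h \<ge> - \<epsilon> * (4 * N ?h)" if "\<epsilon> > 0" for \<epsilon>
  proof -
    have "Q ?h \<ge> - 4 * \<epsilon> * N ?h"
    proof (rule Q_ge_outside[where U="{x. x \<bullet> e \<noteq> 0}" and \<xi>="xi_lateral e" and \<delta>=0])
      show "open {x. x \<bullet> e \<noteq> 0}" by (intro open_Collect_neq continuous_intros)
      show "C1_field {x. x \<bullet> e \<noteq> 0} (xi_lateral e)"
        unfolding xi_lateral_def[abs_def] by (intro C1_field_diff C1_field_lateral_parts)
      show "dv (\<lambda>x. P x *\<^sub>R xi_lateral e x) x + P x * (norm (xi_lateral e x))\<^sup>2 + q x = 0"
        if "x \<in> {x. x \<bullet> e \<noteq> 0}" for x using Riccati_lateral that by simp
    qed (use that t mirror_fixed[of _ e] in auto)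
    then show ?thesis by simp
  qed
  then have "Q ?h \<ge> 0" by (rule nonneg_if_small)
  then show ?thesis using parallelogram[OF u test_mirror[OF u, of e]] Q_mirror[OF u, of e] by simp
qed

text \<open>\<open>N\<close> does not grow by the triangle inequality and invariance under
  reflections. This bounds the truncation error in \<open>Q_lower_bound\<close> independently of the
  number of averagings.\<close>

lemma reach_test: "reach u w \<Longrightarrow> test u \<Longrightarrow> test w \<and> Q w \<le> Q u \<and> N w \<le> N u"
proof (induction rule: reach.induct)
  case (reach_step w e)
  then have w: "test w" "Q w \<le> Q u" "N w \<le> N u" by auto
  have wm: "test (\<lambda>x. w (mirror e x))" by (rule test_mirror[OF w(1)])
  have t: "test (\<lambda>x. (w x + w (mirror e x)) / 2)"
    by (rule test_half(1)[OF w(1) wm])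
  have "N (\<lambda>x. (w x + w (mirror e x)) / 2) \<le> (\<integral>x. (q x * \<bar>w x\<bar> + q x * \<bar>w (mirror e x)\<bar>) / 2 \<partial>lborel)"
    unfolding N_def
  proof (rule integral_mono)
    show "q x * \<bar>(w x + w (mirror e x)) / 2\<bar> \<le> (q x * \<bar>w x\<bar> + q x * \<bar>w (mirror e x)\<bar>) / 2" for x
    proof -
      have "q x * \<bar>(w x + w (mirror e x)) / 2\<bar> \<le> q x * ((\<bar>w x\<bar> + \<bar>w (mirror e x)\<bar>) / 2)"
        using q_nonneg by (intro mult_left_mono) auto
      then show ?thesis by (simp add: distrib_left)
    qed
  qed (use test_integrable[OF t] test_integrable[OF w(1)] test_integrable[OF wm] in auto)
  also have "\<dots> = (N w + N (\<lambda>x. w (mirror e x))) / 2"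
    unfolding N_def using test_integrable[OF w(1)] test_integrable[OF wm] by simp
  also have "\<dots> \<le> N u" using w N_mirror[OF w(1)] by simp
  finally show ?case using t Q_symmetrize[OF w(1), of e] w by auto
qed simp

lemma test_Lip:
  assumes u: "test u" obtains L where "L > 0" "Lip_sphere L u"
proof -
  obtain K where K: "C1_on UNIV u" "compact K" "0 \<notin> K" "\<And>x. x \<notin> K \<Longrightarrow> u x = 0" "\<And>x. x \<notin> K \<Longrightarrow> gr u x = 0"
    by (rule testE[OF u]) (rule that)
  have "continuous_on UNIV (\<lambda>x. norm (gr u x))" by (intro continuous_intros C1_on_gr K)
  from test_bound[OF this K(2)] K(5) obtain B where B: "B > 0" "\<And>x. norm (gr u x) \<le> B" by auto
  have "norm (u x - u y) \<le> B * norm (x - y)" for x y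
  proof (rule differentiable_bound[of UNIV u "\<lambda>x v. v \<bullet> gr u x"])
    show "(u has_derivative (\<lambda>v. v \<bullet> gr u x)) (at x)" for x
      using C1_onD[OF K(1), of x] by (simp add: gderiv_def)
    show "onorm (\<lambda>v. v \<bullet> gr u x) \<le> B" for x
    proof (rule onorm_bound)
      show "norm (v \<bullet> gr u x) \<le> B * norm v" for v
      proof -
        have "\<bar>v \<bullet> gr u x\<bar> \<le> norm v * norm (gr u x)" by (rule Cauchy_Schwarz_ineq2)
        also have "\<dots> \<le> norm v * B" by (intro mult_left_mono B) simp
        finally show ?thesis by (simp add: mult.commute)
      qed
    qed (use B in simp)
  qed auto
  then have "Lip_sphere B u" by (simp add: Lip_sphere_def)
  with B(1) that show ?thesis by blast
qed

text \<open>The Jacobi field of the vertical translation vanishes exactly on the waist, where the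
  symmetrization of \<open>h\<close> is close to its mean.\<close>

theorem Q_lower_bound:
  assumes h: "test h"
  shows "Q h \<ge> - 4 * \<bar>mean h\<bar> * N h"
proof -
  have c: "continuous_on UNIV h" using C1_on_imp_continuous_on[OF test_C1[OF h]] .
  obtain L where L: "L > 0" "Lip_sphere L h" by (rule test_Lip[OF h])
  have "Q h + 4 * \<bar>mean h\<bar> * N h \<ge> - \<epsilon> * (8 * N h)" if e: "\<epsilon> > 0" for \<epsilon>
  proof -
    obtain w where w: "reach h w" "\<And>x. norm x = 1 \<Longrightarrow> \<bar>w x - mean h\<bar> \<le> \<epsilon>"
      using reach_near_mean[OF c L(2,1) e] by blast
    have t: "test w" "Q w \<le> Q h" "N w \<le> N h" using reach_test[OF w(1) h] by auto
    \<comment> \<open>On the waist \<open>w\<close> is bounded by \<bar>mean h\<bar> + \<epsilon>;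
      the truncation level has to lie strictly above that bound, hence the second
      \<epsilon>.\<close>
    have "Q w \<ge> - 4 * (\<bar>mean h\<bar> + 2 * \<epsilon>) * N w"
    proof (rule Q_ge_outside[where U="{x. x \<noteq> 0 \<and> norm x \<noteq> 1}" and \<xi>=xi_axial and \<delta>="\<bar>mean h\<bar> + \<epsilon>"])
      show "open {x::'a. x \<noteq> 0 \<and> norm x \<noteq> 1}"
        by (intro open_Collect_conj open_Collect_neq continuous_intros)
      show "\<bar>w x\<bar> \<le> \<bar>mean h\<bar> + \<epsilon>" if "x \<noteq> 0" "x \<notin> {x. x \<noteq> 0 \<and> norm x \<noteq> 1}" for x
        using w(2)[of x] that by auto
    qed (use e t C1_field_axial Riccati_axial in auto)
    moreover have "(\<bar>mean h\<bar> + 2 * \<epsilon>) * N w \<le> (\<bar>mean h\<bar> + 2 * \<epsilon>) * N h"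
      using t e by (intro mult_left_mono) auto
    ultimately show ?thesis using t(2) by (simp add: algebra_simps)
  qed
  then have "Q h + 4 * \<bar>mean h\<bar> * N h \<ge> 0" by (rule nonneg_if_small)
  then show ?thesis by simp
qed

end

section \<open>Eigenfunctions with negative eigenvalues\<close>

lemma integral_pos_continuous:
  fixes F :: "'a::euclidean_space \<Rightarrow> real"
  assumes c: "continuous_on UNIV F" and i: "integrable lborel F" and n: "\<And>x. F x \<ge> 0" and p: "F z > 0"
  shows "(\<integral>x. F x \<partial>lborel) > 0"
proof -
  have "open {x. F x > F z / 2}" using c by (intro open_Collect_less continuous_intros) auto
  then obtain r where r: "r > 0" "ball z r \<subseteq> {x. F x > F z / 2}"
    using p by (elim openE[of _ z]) auto
  have "0 < F z / 2 * measure lborel (ball z r)"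
    using p r(1) by (intro mult_pos_pos) (auto simp: content_ball_pos)
  also have "\<dots> = (\<integral>x. indicator (ball z r) x * (F z / 2) \<partial>lborel)" by simp
  also have "\<dots> \<le> (\<integral>x. F x \<partial>lborel)"
  proof (rule integral_mono)
    show "integrable lborel (\<lambda>x. indicator (ball z r) x * (F z / 2))"
      using emeasure_lborel_ball_finite[of z r] by (intro integrable_mult_left integrable_real_indicator) auto
    show "indicator (ball z r) x * (F z / 2) \<le> F x" for x
      using r(2) n[of x] by (cases "x \<in> ball z r") auto
  qed (rule i)
  finally show ?thesis .
qed

definition dcutoff :: "real \<Rightarrow> real \<Rightarrow> real" where
  "dcutoff \<epsilon> y = 2 * (1 - \<epsilon> / max \<epsilon> y) * \<epsilon> / (max \<epsilon> y)\<^sup>2"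

lemma dcutoff_nonneg: "\<epsilon> > 0 \<Longrightarrow> 0 \<le> dcutoff \<epsilon> y"
  unfolding dcutoff_def by (intro divide_nonneg_nonneg mult_nonneg_nonneg) (auto simp: max_def)

lemma dcutoff_zero: "\<epsilon> > 0 \<Longrightarrow> y \<le> \<epsilon> \<Longrightarrow> dcutoff \<epsilon> y = 0"
  by (auto simp: dcutoff_def max_def)

text \<open>With z = \<epsilon> / y the product is 2 z (1 - z), independent of scale. The bound is
  therefore uniform in \<epsilon>, which is what dominated convergence needs.\<close>

lemma dcutoff_mult_le: "\<epsilon> > 0 \<Longrightarrow> 0 \<le> y \<Longrightarrow> dcutoff \<epsilon> y * y \<le> 1/2"
proof (cases "y \<le> \<epsilon>")
  case False
  assume e: "\<epsilon> > 0"
  define z where "z = \<epsilon> / y"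
  have "dcutoff \<epsilon> y * y = 2 * (1 - z) * z"
    using False e by (simp add: dcutoff_def z_def max_def power2_eq_square field_simps)
  also have "\<dots> = 1/2 - 2 * (z - 1/2)\<^sup>2" by (simp add: power2_eq_square field_simps)
  also have "\<dots> \<le> 1/2" by simp
  finally show ?thesis .
qed (simp add: dcutoff_zero)

lemma cutoff_antimono: "0 < \<epsilon> \<Longrightarrow> \<epsilon> \<le> \<delta> \<Longrightarrow> cutoff \<delta> y \<le> cutoff \<epsilon> y"
proof -
  assume e: "0 < \<epsilon>" "\<epsilon> \<le> \<delta>"
  have "\<epsilon> / max \<epsilon> y \<le> \<delta> / max \<delta> y"
    using e by (auto simp: max_def field_simps)
  moreover have "\<delta> / max \<delta> y \<le> 1" using e by (auto simp: max_def field_simps)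
  ultimately show ?thesis unfolding cutoff_def by (intro power_mono) auto
qed

lemma cutoff_limits:
  assumes "y > 0"
  shows "(\<lambda>k. cutoff (1 / real (Suc k)) y) \<longlonglongrightarrow> 1"
    "(\<lambda>k. dcutoff (1 / real (Suc k)) y) \<longlonglongrightarrow> 0"
proof -
  have e: "(\<lambda>k. 1 / real (Suc k)) \<longlonglongrightarrow> 0"
    using LIMSEQ_inverse_real_of_nat by (simp add: inverse_eq_divide)
  have m: "max 0 y = y" using assms by simp
  have "(\<lambda>k. cutoff (1 / real (Suc k)) y) \<longlonglongrightarrow> (1 - 0 / max 0 y)\<^sup>2"
    unfolding cutoff_def using assms by (intro tendsto_intros e) auto
  then show "(\<lambda>k. cutoff (1 / real (Suc k)) y) \<longlonglongrightarrow> 1" by simp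
  have "(\<lambda>k. dcutoff (1 / real (Suc k)) y) \<longlonglongrightarrow> 2 * (1 - 0 / max 0 y) * 0 / (max 0 y)\<^sup>2"
    unfolding dcutoff_def using assms by (intro tendsto_intros e) auto
  then show "(\<lambda>k. dcutoff (1 / real (Suc k)) y) \<longlonglongrightarrow> 0" by simp
qed

lemma C1_field_lincomb:
  "C1_field S \<xi> \<Longrightarrow> C1_field S \<zeta> \<Longrightarrow> C1_field S (\<lambda>x. a *\<^sub>R \<xi> x + b *\<^sub>R \<zeta> x)"
  unfolding C1_field_def by (auto simp: inner_add_left intro!: C1_on_add C1_on_mult C1_on_const)

lemma dv_lincomb:
  assumes "C1_field S \<xi>" "C1_field S \<zeta>" "x \<in> S"
  shows "dv (\<lambda>x. a *\<^sub>R \<xi> x + b *\<^sub>R \<zeta> x) x = a * dv \<xi> x + b * dv \<zeta> x"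
proof -
  have "gr (\<lambda>y. (a *\<^sub>R \<xi> y + b *\<^sub>R \<zeta> y) \<bullet> e) x = a *\<^sub>R gr (\<lambda>y. \<xi> y \<bullet> e) x + b *\<^sub>R gr (\<lambda>y. \<zeta> y \<bullet> e) x"
    if "e \<in> Basis" for e
  proof -
    have d: "(\<lambda>y. \<xi> y \<bullet> e) differentiable (at x)" "(\<lambda>y. \<zeta> y \<bullet> e) differentiable (at x)"
      using C1_field_differentiable assms that by blast+
    then have "gr (\<lambda>y. a * (\<xi> y \<bullet> e) + b * (\<zeta> y \<bullet> e)) x = a *\<^sub>R gr (\<lambda>y. \<xi> y \<bullet> e) x + b *\<^sub>R gr (\<lambda>y. \<zeta> y \<bullet> e) x"
      by (subst gr_add) (auto simp: gr_cmult)
    then show ?thesis by (simp add: inner_add_left)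
  qed
  then show ?thesis
    unfolding dv_def by (simp add: inner_add_left sum.distrib sum_distrib_left)
qed

text \<open>Two eigenfunctions in the chart, with eigenvalues -c1 and -c2, possibly equal, extended
  by zero. \<open>\<rho>\<close> is the volume density. The set \<open>\<Omega>\<close> is an
  arbitrary open subset of a compact set avoiding the origin; derivatives are controlled only inside
  it.\<close>

locale eigen_pair = catenoid_weight m P for m :: nat and P :: "'a::euclidean_space \<Rightarrow> real" +
  fixes \<Omega> K :: "'a set" and f1 f2 \<rho> :: "'a \<Rightarrow> real" and c1 c2 :: real
  assumes open_\<Omega>: "open \<Omega>" and K: "compact K" "0 \<notin> K" "\<Omega> \<subseteq> K"
    and cont: "continuous_on UNIV f1" "continuous_on UNIV f2"
    and zero: "\<And>x. x \<notin> \<Omega> \<Longrightarrow> f1 x = 0" "\<And>x. x \<notin> \<Omega> \<Longrightarrow> f2 x = 0"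
    and C1: "C1_on \<Omega> f1" "C1_on \<Omega> f2"
    and C2: "C1_field \<Omega> (gr f1)" "C1_field \<Omega> (gr f2)"
    and \<rho>: "continuous_on (- {0}) \<rho>" "\<And>x. x \<noteq> 0 \<Longrightarrow> \<rho> x > 0"
    and eqn: "\<And>x. x \<in> \<Omega> \<Longrightarrow> dv (\<lambda>x. P x *\<^sub>R gr f1 x) x = (c1 * \<rho> x - q x) * f1 x"
      "\<And>x. x \<in> \<Omega> \<Longrightarrow> dv (\<lambda>x. P x *\<^sub>R gr f2 x) x = (c2 * \<rho> x - q x) * f2 x"
    and c_pos: "c1 > 0" "c2 > 0"
begin

definition F :: "'a \<Rightarrow> real" where "F x = (f1 x)\<^sup>2 + (f2 x)\<^sup>2"

definition D :: "'a \<Rightarrow> real" where "D x = (norm (gr f1 x))\<^sup>2 + (norm (gr f2 x))\<^sup>2"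

lemma \<Omega>0: "x \<in> \<Omega> \<Longrightarrow> x \<noteq> 0" using K by auto

lemma F_nonneg: "0 \<le> F x" by (simp add: F_def)

lemma F_pos_imp: "F x > 0 \<Longrightarrow> x \<in> \<Omega>"
  using zero[of x] by (cases "x \<in> \<Omega>") (auto simp: F_def)

lemma F_zero_imp: "\<not> F x > 0 \<Longrightarrow> f1 x = 0 \<and> f2 x = 0"
  by (simp add: F_def sum_power2_gt_zero_iff)

lemma continuous_F: "continuous_on UNIV F"
  unfolding F_def[abs_def] by (intro continuous_intros cont)

lemma C1_F: "C1_on \<Omega> F"
  using C1_on_add[OF C1_on_mult[OF C1(1) C1(1)] C1_on_mult[OF C1(2) C1(2)]]
  by (simp add: F_def[abs_def] power2_eq_square)

lemma gr_F: "x \<in> \<Omega> \<Longrightarrow> gr F x = 2 *\<^sub>R (f1 x *\<^sub>R gr f1 x + f2 x *\<^sub>R gr f2 x)"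
proof -
  assume x: "x \<in> \<Omega>"
  have d: "f1 differentiable (at x)" "f2 differentiable (at x)" using C1 x by (auto simp: C1_on_def)
  have "gr (\<lambda>x. f1 x * f1 x + f2 x * f2 x) x = (f1 x *\<^sub>R gr f1 x + f1 x *\<^sub>R gr f1 x) + (f2 x *\<^sub>R gr f2 x + f2 x *\<^sub>R gr f2 x)"
    using d by (subst gr_add) (auto simp: gr_mult)
  then show ?thesis by (simp add: F_def[abs_def] power2_eq_square scaleR_2 add_ac)
qed

definition L :: "real \<Rightarrow> 'a set" where "L \<epsilon> = {x. \<epsilon> \<le> F x}"

lemma L: assumes "\<epsilon> > 0" shows "compact (L \<epsilon>)" "L \<epsilon> \<subseteq> \<Omega>"
proof -
  show s: "L \<epsilon> \<subseteq> \<Omega>"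
  proof
    fix x assume "x \<in> L \<epsilon>"
    then have "F x > 0" using assms by (simp add: L_def)
    then show "x \<in> \<Omega>" by (rule F_pos_imp)
  qed
  have "closed (L \<epsilon>)" unfolding L_def
    using continuous_F by (intro closed_Collect_le continuous_intros) auto
  moreover have "L \<epsilon> = K \<inter> L \<epsilon>" using s K by auto
  ultimately show "compact (L \<epsilon>)" using compact_Int_closed[OF K(1)] by metis
qed

lemma cut_zero: "\<epsilon> > 0 \<Longrightarrow> x \<notin> L \<epsilon> \<Longrightarrow> cutoff \<epsilon> (F x) = 0"
  by (rule cutoff_zero) (auto simp: L_def)

lemma C1_cut_\<Omega>: "\<epsilon> > 0 \<Longrightarrow> C1_on \<Omega> (\<lambda>x. cutoff \<epsilon> (F x))"
proof (rule C1_on_compose[OF C1_F has_real_derivative_cutoff])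
  assume e: "\<epsilon> > 0"
  then have "max \<epsilon> y \<noteq> 0" for y by auto
  then show "continuous_on (F ` \<Omega>) (\<lambda>a. 2 * (1 - \<epsilon> / max \<epsilon> a) * \<epsilon> / (max \<epsilon> a)\<^sup>2)"
    by (auto intro!: continuous_intros)
qed

lemma gr_cut: "\<epsilon> > 0 \<Longrightarrow> x \<in> \<Omega> \<Longrightarrow> gr (\<lambda>x. cutoff \<epsilon> (F x)) x = dcutoff \<epsilon> (F x) *\<^sub>R gr F x"
  unfolding dcutoff_def
  by (rule gderiv_imp_gr, rule GDERIV_DERIV_compose[OF C1_onD[OF C1_F] has_real_derivative_cutoff])

text \<open>The cutoff vanishes off the compact set \<open>L \<epsilon>\<close>, which lies inside
  \<open>\<Omega>\<close>, so the product extends by zero across the boundary however irregular that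
  is.\<close>

lemma C1_cut_mult:
  assumes e: "\<epsilon> > 0" and v: "C1_on \<Omega> v"
  shows "C1_on UNIV (\<lambda>x. cutoff \<epsilon> (F x) * v x)"
proof -
  have oL: "open (- L \<epsilon>)" using L[OF e] compact_imp_closed by auto
  have "C1_on (\<Omega> \<union> - L \<epsilon>) (\<lambda>x. cutoff \<epsilon> (F x) * v x)"
    by (intro C1_on_Un open_\<Omega> oL C1_on_mult C1_cut_\<Omega> e v C1_on_zero_open) (auto simp: cut_zero e)
  moreover have "\<Omega> \<union> - L \<epsilon> = UNIV" using L[OF e] by auto
  ultimately show ?thesis by simp
qed

lemma gr_cut_mult:
  assumes e: "\<epsilon> > 0" and v: "C1_on \<Omega> v" and x: "x \<in> \<Omega>"
  shows "gr (\<lambda>x. cutoff \<epsilon> (F x) * v x) x = cutoff \<epsilon> (F x) *\<^sub>R gr v x + (v x * dcutoff \<epsilon> (F x)) *\<^sub>R gr F x"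
  using gr_mult[of "\<lambda>x. cutoff \<epsilon> (F x)" x v] C1_cut_\<Omega>[OF e] v x gr_cut[OF e x] by (auto simp: C1_on_def)

lemma gr_cut_mult_outside:
  assumes e: "\<epsilon> > 0" and x: "x \<notin> \<Omega>"
  shows "gr (\<lambda>x. cutoff \<epsilon> (F x) * v x) x = 0"
proof -
  have "open (- L \<epsilon>)" using L[OF e] compact_imp_closed by auto
  then show ?thesis using x L[OF e] by (intro gr_zero_open[of "- L \<epsilon>"]) (auto simp: cut_zero e)
qed

lemma C1_P: "C1_on \<Omega> P" by (rule C1_on_subset[OF C1_on_P]) (use \<Omega>0 in auto)

lemma flux: "C1_field \<Omega> (\<lambda>x. P x *\<^sub>R gr f1 x)" "C1_field \<Omega> (\<lambda>x. P x *\<^sub>R gr f2 x)"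
  by (intro C1_field_scale C1_P C2)+

lemma dot_bounds:
  fixes s t :: real and v w :: 'a
  shows "(norm (s *\<^sub>R v + t *\<^sub>R w))\<^sup>2 \<le> (s\<^sup>2 + t\<^sup>2) * ((norm v)\<^sup>2 + (norm w)\<^sup>2)"
proof -
  have "norm (s *\<^sub>R v + t *\<^sub>R w) \<le> \<bar>s\<bar> * norm v + \<bar>t\<bar> * norm w"
    using norm_triangle_ineq[of "s *\<^sub>R v" "t *\<^sub>R w"] by simp
  then have "(norm (s *\<^sub>R v + t *\<^sub>R w))\<^sup>2 \<le> (\<bar>s\<bar> * norm v + \<bar>t\<bar> * norm w)\<^sup>2"
    by (intro power_mono) auto
  also have "\<dots> \<le> (s\<^sup>2 + t\<^sup>2) * ((norm v)\<^sup>2 + (norm w)\<^sup>2)"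
  proof -
    have "(s\<^sup>2 + t\<^sup>2) * ((norm v)\<^sup>2 + (norm w)\<^sup>2) - (\<bar>s\<bar> * norm v + \<bar>t\<bar> * norm w)\<^sup>2 = (\<bar>s\<bar> * norm w - \<bar>t\<bar> * norm v)\<^sup>2"
      by (simp add: power2_eq_square algebra_simps)
    then show ?thesis by (smt (verit) zero_le_power2)
  qed
  finally show ?thesis .
qed

lemma F_gradient_bound: "x \<in> \<Omega> \<Longrightarrow> (norm (gr F x))\<^sup>2 \<le> 4 * (F x * D x)"
  unfolding gr_F using dot_bounds[of "f1 x" "gr f1 x" "f2 x" "gr f2 x"]
  by (simp add: F_def D_def power_mult_distrib)

text \<open>The energy density of the pair. The condition \<open>F x > 0\<close> confines it to
  points of \<open>\<Omega>\<close>, where the gradients are meaningful; where \<open>F\<close>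
  vanishes all cut-off terms vanish too, so it is exactly the limit of the truncated
  densities.\<close>

definition E :: "'a \<Rightarrow> real" where "E x = (if F x > 0 then P x * D x else 0)"

lemma E_nonneg: "0 \<le> E x"
  using P_pos[OF \<Omega>0[OF F_pos_imp], of x] by (auto simp: E_def D_def)

lemma continuous_f\<Omega>: "continuous_on S f1" "continuous_on S f2" "continuous_on S F"
  using cont continuous_F continuous_on_subset by blast+

lemma continuous_D: "continuous_on \<Omega> D"
  unfolding D_def[abs_def] by (intro continuous_intros C1_on_gr C1)

lemma continuous_P\<Omega>: "continuous_on \<Omega> P" "continuous_on \<Omega> q" "continuous_on \<Omega> \<rho>"
  using continuous_on_P continuous_on_q \<rho>(1) continuous_on_subset[of _ _ \<Omega>] \<Omega>0 by blast+

lemma integrable_K: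
  fixes a g :: "'a \<Rightarrow> real"
  assumes "continuous_on (- {0}) a" "continuous_on (- {0}) g" "\<And>x. x \<notin> \<Omega> \<Longrightarrow> g x = 0"
  shows "integrable lborel (\<lambda>x. a x * g x)"
  using assms K by (intro integrable_weighted[of a g K]) auto

text \<open>Each equation is tested with its own function times the common cutoff. The gradient of
  the cutoff contributes 2 P times its derivative times the square of f1 grad f1 + f2 grad f2, which
  is nonnegative and may be dropped. The right-hand side does not depend on \<epsilon>.\<close>

lemma energy_bound:
  assumes e: "\<epsilon> > 0"
  shows "integrable lborel (\<lambda>x. cutoff \<epsilon> (F x) * (P x * D x))"
    "(\<integral>x. cutoff \<epsilon> (F x) * (P x * D x) \<partial>lborel)
      \<le> (\<integral>x. \<bar>c1 * \<rho> x - q x\<bar> * (f1 x)\<^sup>2 + \<bar>c2 * \<rho> x - q x\<bar> * (f2 x)\<^sup>2 \<partial>lborel)"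
proof -
  note I1 = integral_parts_compact[OF open_\<Omega> C1_cut_mult[OF e C1(1)] L[OF e] _ flux(1)]
  note I2 = integral_parts_compact[OF open_\<Omega> C1_cut_mult[OF e C1(2)] L[OF e] _ flux(2)]
  let ?g1 = "\<lambda>x. cutoff \<epsilon> (F x) * f1 x" and ?g2 = "\<lambda>x. cutoff \<epsilon> (F x) * f2 x"
  let ?A1 = "dv (\<lambda>x. P x *\<^sub>R gr f1 x)" and ?A2 = "dv (\<lambda>x. P x *\<^sub>R gr f2 x)"
  have z: "x \<notin> L \<epsilon> \<Longrightarrow> ?g1 x = 0" "x \<notin> L \<epsilon> \<Longrightarrow> ?g2 x = 0" for x using cut_zero[OF e] by auto
  show i: "integrable lborel (\<lambda>x. cutoff \<epsilon> (F x) * (P x * D x))"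
    by (rule integrable_supported[OF open_\<Omega> _ L[OF e]])
      (auto intro!: continuous_intros C1_on_imp_continuous_on[OF C1_cut_\<Omega>[OF e]] continuous_P\<Omega> continuous_D simp: cut_zero[OF e])
  have iB: "integrable lborel (\<lambda>x. \<bar>c1 * \<rho> x - q x\<bar> * (f1 x)\<^sup>2 + \<bar>c2 * \<rho> x - q x\<bar> * (f2 x)\<^sup>2)"
    by (intro Bochner_Integration.integrable_add integrable_K)
      (auto intro!: continuous_intros \<rho> continuous_on_q continuous_f\<Omega> simp: zero)
  have "(\<integral>x. cutoff \<epsilon> (F x) * (P x * D x) \<partial>lborel)
    \<le> (\<integral>x. gr ?g1 x \<bullet> (P x *\<^sub>R gr f1 x) + gr ?g2 x \<bullet> (P x *\<^sub>R gr f2 x) \<partial>lborel)"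
  proof (rule integral_mono[OF i])
    show "integrable lborel (\<lambda>x. gr ?g1 x \<bullet> (P x *\<^sub>R gr f1 x) + gr ?g2 x \<bullet> (P x *\<^sub>R gr f2 x))"
      using I1(1)[OF z(1)] I2(1)[OF z(2)] by simp
    fix x
    show "cutoff \<epsilon> (F x) * (P x * D x) \<le> gr ?g1 x \<bullet> (P x *\<^sub>R gr f1 x) + gr ?g2 x \<bullet> (P x *\<^sub>R gr f2 x)"
    proof (cases "x \<in> \<Omega>")
      case True
      have "gr ?g1 x \<bullet> (P x *\<^sub>R gr f1 x) + gr ?g2 x \<bullet> (P x *\<^sub>R gr f2 x)
        = cutoff \<epsilon> (F x) * (P x * D x) + P x * (dcutoff \<epsilon> (F x) * (gr F x \<bullet> (f1 x *\<^sub>R gr f1 x + f2 x *\<^sub>R gr f2 x)))"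
        unfolding gr_cut_mult[OF e C1(1) True] gr_cut_mult[OF e C1(2) True] D_def power2_norm_eq_inner
        by (simp add: inner_add_left inner_add_right algebra_simps)
      also have "gr F x \<bullet> (f1 x *\<^sub>R gr f1 x + f2 x *\<^sub>R gr f2 x) = 2 * (norm (f1 x *\<^sub>R gr f1 x + f2 x *\<^sub>R gr f2 x))\<^sup>2"
        unfolding gr_F[OF True] power2_norm_eq_inner by simp
      finally show ?thesis using P_pos[OF \<Omega>0[OF True]] dcutoff_nonneg[OF e, of "F x"] by simp
    next
      case False
      then have "cutoff \<epsilon> (F x) = 0" using L[OF e] cut_zero[OF e] by auto
      then show ?thesis using gr_cut_mult_outside[OF e False] by simp
    qed
  qed
  also have "\<dots> = - (\<integral>x. ?g1 x * ?A1 x \<partial>lborel) - (\<integral>x. ?g2 x * ?A2 x \<partial>lborel)"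
    using I1[OF z(1)] I2[OF z(2)] by simp
  also have "\<dots> = (\<integral>x. - (?g1 x * ?A1 x) - ?g2 x * ?A2 x \<partial>lborel)"
    using I1(2)[OF z(1)] I2(2)[OF z(2)] by simp
  also have "\<dots> \<le> (\<integral>x. \<bar>c1 * \<rho> x - q x\<bar> * (f1 x)\<^sup>2 + \<bar>c2 * \<rho> x - q x\<bar> * (f2 x)\<^sup>2 \<partial>lborel)"
  proof (rule integral_mono[OF _ iB])
    show "integrable lborel (\<lambda>x. - (?g1 x * ?A1 x) - ?g2 x * ?A2 x)"
      using I1(2)[OF z(1)] I2(2)[OF z(2)] by simp
    fix x
    show "- (?g1 x * ?A1 x) - ?g2 x * ?A2 x \<le> \<bar>c1 * \<rho> x - q x\<bar> * (f1 x)\<^sup>2 + \<bar>c2 * \<rho> x - q x\<bar> * (f2 x)\<^sup>2"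
    proof (cases "x \<in> \<Omega>")
      case True
      have *: "- (\<theta> * f * (d * f)) \<le> \<bar>d\<bar> * f\<^sup>2" if "0 \<le> \<theta>" "\<theta> \<le> 1" for \<theta> f d :: real
      proof -
        have "- (\<theta> * f * (d * f)) = \<theta> * (- d * f\<^sup>2)" by (simp add: power2_eq_square)
        also have "\<dots> \<le> \<theta> * (\<bar>d\<bar> * f\<^sup>2)" using that by (intro mult_left_mono mult_right_mono) auto
        also have "\<dots> \<le> \<bar>d\<bar> * f\<^sup>2" using that by (intro mult_left_le_one_le) auto
        finally show ?thesis .
      qed
      show ?thesis using *[OF cutoff_nonneg cutoff_le_1[OF e], of "F x" "f1 x" "c1 * \<rho> x - q x"]
          *[OF cutoff_nonneg cutoff_le_1[OF e], of "F x" "f2 x" "c2 * \<rho> x - q x"]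
        unfolding eqn(1)[OF True] eqn(2)[OF True] by simp
    qed (simp add: zero)
  qed
  finally show "(\<integral>x. cutoff \<epsilon> (F x) * (P x * D x) \<partial>lborel)
      \<le> (\<integral>x. \<bar>c1 * \<rho> x - q x\<bar> * (f1 x)\<^sup>2 + \<bar>c2 * \<rho> x - q x\<bar> * (f2 x)\<^sup>2 \<partial>lborel)" .
qed

abbreviation \<epsilon> :: "nat \<Rightarrow> real" where "\<epsilon> k \<equiv> 1 / real (Suc k)"

lemma cut_nonpos: "\<not> F x > 0 \<Longrightarrow> e > 0 \<Longrightarrow> cutoff e (F x) = 0"
  by (rule cutoff_zero) auto

lemma cut_PD_nonneg: "0 \<le> cutoff (\<epsilon> k) (F x) * (P x * D x)"
proof (cases "F x > 0")
  case True
  then have "0 \<le> P x * D x" using P_pos[OF \<Omega>0[OF F_pos_imp], of x] by (simp add: D_def)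
  then show ?thesis by (rule mult_nonneg_nonneg[OF cutoff_nonneg])
next
  case False
  then show ?thesis by (simp add: cut_nonpos)
qed

text \<open>The truncated energy densities increase to \<open>E\<close> as the cutoff level
  decreases to zero, and their integrals are bounded by \<open>energy_bound\<close>.\<close>

lemma integrable_E: "integrable lborel E"
proof -
  define s where "s k x = cutoff (\<epsilon> k) (F x) * (P x * D x)" for k x
  have i: "integrable lborel (s k)" for k unfolding s_def by (rule energy_bound) simp
  have mono: "mono (\<lambda>k. s k x)" for x
  proof (rule monoI)
    fix j k :: nat assume jk: "j \<le> k"
    have c: "cutoff (\<epsilon> j) (F x) \<le> cutoff (\<epsilon> k) (F x)"
      using jk by (intro cutoff_antimono) (auto simp: field_simps)
    show "s j x \<le> s k x"
    proof (cases "F x > 0")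
      case True
      then show ?thesis unfolding s_def
        using c P_pos[OF \<Omega>0[OF F_pos_imp[OF True]]] by (intro mult_right_mono) (auto simp: D_def)
    qed (simp add: s_def cut_nonpos)
  qed
  have lim: "(\<lambda>k. s k x) \<longlonglongrightarrow> E x" for x
  proof (cases "F x > 0")
    case True
    then show ?thesis using tendsto_mult[OF cutoff_limits(1)[OF True] tendsto_const, of "P x * D x"]
      by (simp add: s_def E_def)
  qed (simp add: s_def E_def cut_nonpos)
  have inc: "incseq (\<lambda>k. integral\<^sup>L lborel (s k))"
    using mono i by (intro monoI integral_mono) (auto dest: monoD)
  have bd: "integral\<^sup>L lborel (s k) \<le> (\<integral>x. \<bar>c1 * \<rho> x - q x\<bar> * (f1 x)\<^sup>2 + \<bar>c2 * \<rho> x - q x\<bar> * (f2 x)\<^sup>2 \<partial>lborel)" for k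
    using energy_bound(2)[of "\<epsilon> k"] unfolding s_def by simp
  obtain l where l: "(\<lambda>k. integral\<^sup>L lborel (s k)) \<longlonglongrightarrow> l"
    using incseq_convergent[OF inc] bd by blast
  show ?thesis
  proof (rule integral_monotone_convergence_nonneg[OF i])
    show "(\<lambda>k. integral\<^sup>L lborel (s k)) \<longlonglongrightarrow> l" by (rule l)
    show "E \<in> borel_measurable lborel"
      by (rule borel_measurable_LIMSEQ_real[OF lim]) (use i in auto)
    show "AE x in lborel. 0 \<le> s k x" for k
      unfolding s_def by (rule AE_I2) (rule cut_PD_nonneg)
  qed (use mono lim in auto)
qed

text \<open>All error terms below have the form of the left-hand side, since the squared gradient of
  \<open>F\<close> is at most 4 F D.\<close>

lemma dcut_E:
  assumes "x \<in> \<Omega>" "e > 0"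
  shows "dcutoff e (F x) * F x * (P x * D x) \<le> E x / 2"
proof (cases "F x > 0")
  case True
  have "0 \<le> P x * D x" using P_pos[OF \<Omega>0[OF assms(1)]] by (simp add: D_def)
  then have "dcutoff e (F x) * F x * (P x * D x) \<le> 1/2 * (P x * D x)"
    using assms F_nonneg by (intro mult_right_mono dcutoff_mult_le) auto
  then show ?thesis using True by (simp add: E_def)
qed (use E_nonneg[of x] F_nonneg[of x] in auto)

text \<open>Eigenfunctions to different eigenvalues are orthogonal; cutting off both with the same function
  of \<open>f1\<^sup>2 + f2\<^sup>2\<close> keeps the error term below the integrable energy density \<open>E\<close>, without any
  information about the zero sets of the individual functions.\<close>

lemma orthogonal_eigen:
  assumes "c1 \<noteq> c2"
  shows "(\<integral>x. \<rho> x * (f1 x * f2 x) \<partial>lborel) = 0"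
proof -
  let ?g1 = "\<lambda>k x. cutoff (\<epsilon> k) (F x) * f1 x" and ?g2 = "\<lambda>k x. cutoff (\<epsilon> k) (F x) * f2 x"
  let ?A1 = "dv (\<lambda>x. P x *\<^sub>R gr f1 x)" and ?A2 = "dv (\<lambda>x. P x *\<^sub>R gr f2 x)"
  have e: "\<epsilon> k > 0" for k by simp
  have z: "x \<notin> L (\<epsilon> k) \<Longrightarrow> ?g1 k x = 0" "x \<notin> L (\<epsilon> k) \<Longrightarrow> ?g2 k x = 0" for k x
    using cut_zero[OF e] by auto
  \<comment> \<open>The terms without derivatives of the cutoff cancel by symmetry, leaving the
    derivative of the cutoff times P grad F . (f1 grad f2 - f2 grad f1).\<close>
  define s where "s k x = gr (?g1 k) x \<bullet> (P x *\<^sub>R gr f2 x) - gr (?g2 k) x \<bullet> (P x *\<^sub>R gr f1 x)" for k x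
  define t where "t k x = ?g2 k x * ?A1 x - ?g1 k x * ?A2 x" for k x
  have ints: "integrable lborel (s k)" and it: "integrable lborel (t k)" and st: "integral\<^sup>L lborel (s k) = integral\<^sup>L lborel (t k)" for k
  proof -
    note I1 = integral_parts_compact[OF open_\<Omega> C1_cut_mult[OF e[of k] C1(1)] L[OF e[of k]] z(1)[of _ k] flux(2)]
    note I2 = integral_parts_compact[OF open_\<Omega> C1_cut_mult[OF e[of k] C1(2)] L[OF e[of k]] z(2)[of _ k] flux(1)]
    show "integrable lborel (s k)" "integrable lborel (t k)"
      unfolding s_def t_def by (intro Bochner_Integration.integrable_diff I1 I2; assumption)+
    show "integral\<^sup>L lborel (s k) = integral\<^sup>L lborel (t k)"
      unfolding s_def t_def using I1(3) I2(3)
      by (subst (1 2) Bochner_Integration.integral_diff) (rule I1(1,2) I2(1,2) | assumption | simp)+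
  qed
  have s_eq: "s k x = (if x \<in> \<Omega> then dcutoff (\<epsilon> k) (F x) * (P x * (gr F x \<bullet> (f1 x *\<^sub>R gr f2 x - f2 x *\<^sub>R gr f1 x))) else 0)" for k x
  proof (cases "x \<in> \<Omega>")
    case True
    show ?thesis unfolding s_def gr_cut_mult[OF e C1(1) True] gr_cut_mult[OF e C1(2) True] using True
      by (simp add: inner_add_left inner_diff_right inner_commute[of "gr f2 x" "gr f1 x"] algebra_simps)
  qed (simp add: s_def gr_cut_mult_outside[OF e] del: of_nat_Suc)
  have t_eq: "t k x = (c1 - c2) * (cutoff (\<epsilon> k) (F x) * (\<rho> x * (f1 x * f2 x)))" for k x
  proof (cases "x \<in> \<Omega>")
    case True
    show ?thesis unfolding t_def eqn(1)[OF True] eqn(2)[OF True] by (simp add: algebra_simps)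
  qed (simp add: t_def zero)
  have i12: "integrable lborel (\<lambda>x. \<rho> x * (f1 x * f2 x))"
    by (intro integrable_K) (auto intro!: continuous_intros \<rho> continuous_f\<Omega> simp: zero)
  have "(\<lambda>k. integral\<^sup>L lborel (s k)) \<longlonglongrightarrow> integral\<^sup>L lborel (\<lambda>x::'a. 0::real)"
  proof (rule integral_dominated_convergence[where w=E])
    show "AE x in lborel. (\<lambda>k. s k x) \<longlonglongrightarrow> 0"
    proof (rule AE_I2)
      fix x
      show "(\<lambda>k. s k x) \<longlonglongrightarrow> 0"
      proof (cases "F x > 0")
        case True
        then show ?thesis
          unfolding s_eq using tendsto_mult[OF cutoff_limits(2)[OF True] tendsto_const] F_pos_imp[OF True]
          by simp
      next
        case False
        then have "gr F x = 0" if "x \<in> \<Omega>" using gr_F[OF that] F_zero_imp by simp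
        then have "s k x = 0" for k unfolding s_eq by (cases "x \<in> \<Omega>") auto
        then show ?thesis by simp
      qed
    qed
    show "AE x in lborel. norm (s k x) \<le> E x" for k
    proof (rule AE_I2)
      fix x
      show "norm (s k x) \<le> E x"
      proof (cases "x \<in> \<Omega>")
        case True
        have p: "P x > 0" using P_pos[OF \<Omega>0[OF True]] .
        let ?w = "f1 x *\<^sub>R gr f2 x - f2 x *\<^sub>R gr f1 x"
        have "(norm ?w)\<^sup>2 \<le> F x * D x"
          using dot_bounds[of "f1 x" "gr f2 x" "- f2 x" "gr f1 x"] by (simp add: F_def D_def add.commute)
        with F_gradient_bound[OF True]
        have "(norm (gr F x))\<^sup>2 * (norm ?w)\<^sup>2 \<le> (4 * (F x * D x)) * (F x * D x)"
          by (intro mult_mono) (auto simp: F_nonneg D_def)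
        then have "(norm (gr F x) * norm ?w)\<^sup>2 \<le> (2 * (F x * D x))\<^sup>2"
          by (simp add: power2_eq_square algebra_simps)
        then have b: "norm (gr F x) * norm ?w \<le> 2 * (F x * D x)"
          by (rule power2_le_imp_le) (auto simp: F_nonneg D_def)
        have "norm (s k x) = dcutoff (\<epsilon> k) (F x) * (P x * \<bar>gr F x \<bullet> ?w\<bar>)"
          unfolding s_eq using True p dcutoff_nonneg[OF e, of k "F x"] by (simp add: abs_mult)
        also have "\<dots> \<le> dcutoff (\<epsilon> k) (F x) * (P x * (2 * (F x * D x)))"
          using b Cauchy_Schwarz_ineq2[of "gr F x" ?w] p dcutoff_nonneg[OF e, of k "F x"]
          by (intro mult_left_mono) auto
        also have "\<dots> \<le> E x" using dcut_E[OF True e, of k] by (simp add: algebra_simps)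
        finally show ?thesis .
      qed (simp add: s_eq E_nonneg)
    qed
  qed (use ints integrable_E in auto)
  then have "(\<lambda>k. integral\<^sup>L lborel (t k)) \<longlonglongrightarrow> 0" using st by simp
  moreover have "(\<lambda>k. integral\<^sup>L lborel (t k)) \<longlonglongrightarrow> integral\<^sup>L lborel (\<lambda>x. (c1 - c2) * (\<rho> x * (f1 x * f2 x)))"
  proof (rule integral_dominated_convergence[where w="\<lambda>x. \<bar>(c1 - c2) * (\<rho> x * (f1 x * f2 x))\<bar>"])
    show "AE x in lborel. (\<lambda>k. t k x) \<longlonglongrightarrow> (c1 - c2) * (\<rho> x * (f1 x * f2 x))"
    proof (rule AE_I2)
      fix x
      show "(\<lambda>k. t k x) \<longlonglongrightarrow> (c1 - c2) * (\<rho> x * (f1 x * f2 x))"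
      proof (cases "F x > 0")
        case True
        have "(\<lambda>k. (c1 - c2) * (cutoff (\<epsilon> k) (F x) * (\<rho> x * (f1 x * f2 x))))
          \<longlonglongrightarrow> (c1 - c2) * (1 * (\<rho> x * (f1 x * f2 x)))"
          by (intro tendsto_intros cutoff_limits True)
        then show ?thesis unfolding t_eq by simp
      qed (use F_zero_imp in \<open>simp add: t_eq\<close>)
    qed
    show "AE x in lborel. norm (t k x) \<le> \<bar>(c1 - c2) * (\<rho> x * (f1 x * f2 x))\<bar>" for k
    proof (rule AE_I2)
      fix x
      have "norm (t k x) = cutoff (\<epsilon> k) (F x) * \<bar>(c1 - c2) * (\<rho> x * (f1 x * f2 x))\<bar>"
        unfolding t_eq by (simp add: abs_mult cutoff_nonneg)
      also have "\<dots> \<le> \<bar>(c1 - c2) * (\<rho> x * (f1 x * f2 x))\<bar>"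
        using cutoff_le_1[OF e] cutoff_nonneg by (intro mult_left_le_one_le) auto
      finally show "norm (t k x) \<le> \<bar>(c1 - c2) * (\<rho> x * (f1 x * f2 x))\<bar>" .
    qed
  qed (use i12 it in auto)
  ultimately have "(c1 - c2) * (\<integral>x. \<rho> x * (f1 x * f2 x) \<partial>lborel) = 0"
    using LIMSEQ_unique by fastforce
  then show ?thesis using assms by simp
qed

text \<open>With \<theta> the cutoff, P |grad (\<theta> u)|^2 = P u^2 |grad \<theta>|^2 + grad
  (\<theta>^2 u) . P grad u. The second term is integrated by parts using the equations; the first
  is dominated by a multiple of \<open>E\<close> and tends to zero pointwise.\<close>

lemma quadratic_form_limit:
  fixes a b :: real
  defines "u \<equiv> \<lambda>x. a * f1 x + b * f2 x"
  shows "(\<lambda>k. Q (\<lambda>x. cutoff (\<epsilon> k) (F x) * u x)) \<longlonglongrightarrow>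
    - (\<integral>x. \<rho> x * (u x * (a * c1 * f1 x + b * c2 * f2 x)) \<partial>lborel)"
    "test (\<lambda>x. cutoff (\<epsilon> k) (F x) * u x)"
proof -
  define w where "w x = a * c1 * f1 x + b * c2 * f2 x" for x
  define \<zeta> where "\<zeta> x = a *\<^sub>R (P x *\<^sub>R gr f1 x) + b *\<^sub>R (P x *\<^sub>R gr f2 x)" for x
  let ?\<theta> = "\<lambda>k x. cutoff (\<epsilon> k) (F x)"
  have e: "\<epsilon> k > 0" for k by simp
  have u: "C1_on \<Omega> u" unfolding u_def by (intro C1_on_add C1_on_mult C1_on_const C1)
  have cu: "continuous_on S u" for S unfolding u_def by (intro continuous_intros continuous_f\<Omega>)
  have u0: "x \<notin> \<Omega> \<Longrightarrow> u x = 0" for x by (simp add: u_def zero)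
  have uF0: "\<not> F x > 0 \<Longrightarrow> u x = 0" for x using F_zero_imp by (simp add: u_def)
  have gru: "gr u x = a *\<^sub>R gr f1 x + b *\<^sub>R gr f2 x" if "x \<in> \<Omega>" for x
  proof -
    have "f1 differentiable (at x)" "f2 differentiable (at x)" using C1 that by (auto simp: C1_on_def)
    then show ?thesis unfolding u_def by (subst gr_add) (auto simp: gr_cmult)
  qed
  have \<zeta>: "C1_field \<Omega> \<zeta>" unfolding \<zeta>_def by (intro C1_field_lincomb flux)
  have dv\<zeta>: "dv \<zeta> x = \<rho> x * w x - q x * u x" if "x \<in> \<Omega>" for x
    unfolding \<zeta>_def dv_lincomb[OF flux that] eqn[OF that] by (simp add: w_def u_def algebra_simps)
  have \<zeta>u: "\<zeta> x = P x *\<^sub>R gr u x" if "x \<in> \<Omega>" for x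
    unfolding gru[OF that] \<zeta>_def by (simp add: scaleR_add_right mult.commute)
  have v: "C1_on \<Omega> (\<lambda>x. ?\<theta> k x * u x)" for k by (intro C1_on_mult C1_cut_\<Omega> e u)
  note I = integral_parts_compact[OF open_\<Omega> C1_cut_mult[OF e v] L[OF e] _ \<zeta>]
  have z: "x \<notin> L (\<epsilon> k) \<Longrightarrow> ?\<theta> k x * (?\<theta> k x * u x) = 0" for k x using cut_zero[OF e] by auto
  have t: "test (\<lambda>x. ?\<theta> k x * u x)" for k
    by (rule testI[OF C1_cut_mult[OF e u] L(1)[OF e, of k]]) (use L[OF e] \<Omega>0 cut_zero[OF e] in force)+
  then show "test (\<lambda>x. cutoff (\<epsilon> k) (F x) * u x)" .
  \<comment> \<open>The error P u^2 |grad \<theta>|^2; the next definition is the part that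
    converges to the integrand of the limit.\<close>
  define s where "s k x = (if x \<in> \<Omega> then P x * ((dcutoff (\<epsilon> k) (F x))\<^sup>2 * (norm (gr F x))\<^sup>2 * (u x)\<^sup>2) else 0)" for k x
  define r where "r k x = (?\<theta> k x)\<^sup>2 * (\<rho> x * (u x * w x))" for k x
  have pt: "P x * (norm (gr (\<lambda>x. ?\<theta> k x * u x) x))\<^sup>2 - q x * (?\<theta> k x * u x)\<^sup>2
     = s k x - r k x + (gr (\<lambda>x. ?\<theta> k x * (?\<theta> k x * u x)) x \<bullet> \<zeta> x + ?\<theta> k x * (?\<theta> k x * u x) * dv \<zeta> x)" for k x
  proof (cases "x \<in> \<Omega>")
    case True
    show ?thesis
      unfolding gr_cut_mult[OF e v True] gr_cut_mult[OF e u True] \<zeta>u[OF True] dv\<zeta>[OF True]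
        s_def r_def power2_norm_eq_inner using True
      by (simp add: inner_add_left inner_add_right inner_commute[of "gr F x" "gr u x"] power2_eq_square algebra_simps)
  next
    case False
    then show ?thesis by (simp add: gr_cut_mult_outside[OF e] s_def r_def u0 del: of_nat_Suc)
  qed
  have irw: "integrable lborel (\<lambda>x. \<rho> x * (u x * w x))"
    by (intro integrable_K) (auto intro!: continuous_intros \<rho> continuous_f\<Omega> cu simp: w_def u0)
  have r_le: "norm (r k x) \<le> \<bar>\<rho> x * (u x * w x)\<bar>" for k x
  proof -
    have "norm (r k x) = (?\<theta> k x)\<^sup>2 * \<bar>\<rho> x * (u x * w x)\<bar>" by (simp add: r_def abs_mult)
    also have "\<dots> \<le> \<bar>\<rho> x * (u x * w x)\<bar>"
      using cutoff_le_1[OF e] cutoff_nonneg by (intro mult_left_le_one_le) (auto simp: power_le_one)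
    finally show ?thesis .
  qed
  have r_lim: "(\<lambda>k. r k x) \<longlonglongrightarrow> \<rho> x * (u x * w x)" for x
  proof (cases "F x > 0")
    case True
    have "(\<lambda>k. r k x) \<longlonglongrightarrow> 1\<^sup>2 * (\<rho> x * (u x * w x))"
      unfolding r_def by (intro tendsto_intros cutoff_limits True)
    then show ?thesis by simp
  qed (simp add: r_def uF0)
  have r_m: "r k \<in> borel_measurable lborel" for k
  proof -
    have "(\<lambda>x. ?\<theta> k x) \<in> borel_measurable borel"
      using C1_on_imp_continuous_on[OF C1_cut_mult[OF e C1_on_const[of \<Omega> 1], of k]]
      by (intro borel_measurable_continuous_onI) simp
    then show ?thesis unfolding r_def using irw by measurable
  qed
  have ir: "integrable lborel (r k)" for k
    by (rule Bochner_Integration.integrable_bound[OF irw r_m]) (use r_le in auto)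
  have s_le: "norm (s k x) \<le> (a\<^sup>2 + b\<^sup>2) * E x" for k x
  proof (cases "x \<in> \<Omega>")
    case True
    define d where "d = dcutoff (\<epsilon> k) (F x)"
    have d: "0 \<le> d" "d * F x \<le> 1/2" unfolding d_def using dcutoff_nonneg[OF e] dcutoff_mult_le[OF e F_nonneg] by auto
    have p: "P x > 0" using P_pos[OF \<Omega>0[OF True]] .
    have uu: "(u x)\<^sup>2 \<le> (a\<^sup>2 + b\<^sup>2) * F x"
    proof -
      have "(a\<^sup>2 + b\<^sup>2) * F x - (u x)\<^sup>2 = (a * f2 x - b * f1 x)\<^sup>2"
        by (simp add: u_def F_def power2_eq_square algebra_simps)
      then show ?thesis by (smt (verit) zero_le_power2)
    qed
    have "s k x = P x * (d\<^sup>2 * ((norm (gr F x))\<^sup>2 * (u x)\<^sup>2))" using True by (simp add: s_def d_def)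
    also have "\<dots> \<le> P x * (d\<^sup>2 * ((4 * (F x * D x)) * ((a\<^sup>2 + b\<^sup>2) * F x)))"
      using p uu F_gradient_bound[OF True] F_nonneg
      by (intro mult_left_mono mult_mono) (auto simp: D_def)
    also have "\<dots> = 4 * (a\<^sup>2 + b\<^sup>2) * (d * F x) * (d * F x * (P x * D x))"
      by (simp add: power2_eq_square algebra_simps)
    also have "\<dots> \<le> 4 * (a\<^sup>2 + b\<^sup>2) * (1/2) * (E x / 2)"
      using d dcut_E[OF True e, of k] E_nonneg p F_nonneg unfolding d_def[symmetric]
      by (intro mult_mono) (auto simp: D_def)
    also have "\<dots> = (a\<^sup>2 + b\<^sup>2) * E x" by simp
    finally have "s k x \<le> (a\<^sup>2 + b\<^sup>2) * E x" .
    moreover have "0 \<le> s k x" using p by (simp add: s_def)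
    ultimately show ?thesis by simp
  qed (simp add: s_def E_nonneg)
  have s_lim: "(\<lambda>k. s k x) \<longlonglongrightarrow> 0" for x
  proof (cases "F x > 0")
    case True
    have "(\<lambda>k. P x * ((dcutoff (\<epsilon> k) (F x))\<^sup>2 * (norm (gr F x))\<^sup>2 * (u x)\<^sup>2)) \<longlonglongrightarrow> P x * (0\<^sup>2 * (norm (gr F x))\<^sup>2 * (u x)\<^sup>2)"
      by (intro tendsto_intros cutoff_limits True)
    then show ?thesis using F_pos_imp[OF True] by (simp add: s_def)
  next
    case False
    then have "s k x = 0" for k using uF0[OF False] unfolding s_def by simp
    then show ?thesis by simp
  qed
  have ints: "integrable lborel (s k)" for k
  proof -
    have "integrable lborel (\<lambda>x. (P x * (norm (gr (\<lambda>x. ?\<theta> k x * u x) x))\<^sup>2 - q x * (?\<theta> k x * u x)\<^sup>2) + r k x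
      - (gr (\<lambda>x. ?\<theta> k x * (?\<theta> k x * u x)) x \<bullet> \<zeta> x + ?\<theta> k x * (?\<theta> k x * u x) * dv \<zeta> x))"
      using I(1,2)[OF z] test_integrable[OF t] ir
      by (intro Bochner_Integration.integrable_add Bochner_Integration.integrable_diff)
    then show ?thesis unfolding pt by simp
  qed
  have Qk: "Q (\<lambda>x. ?\<theta> k x * u x) = integral\<^sup>L lborel (s k) - integral\<^sup>L lborel (r k)" for k
    unfolding Q_def pt using I[OF z, of k] ints ir by simp
  have "(\<lambda>k. integral\<^sup>L lborel (s k)) \<longlonglongrightarrow> integral\<^sup>L lborel (\<lambda>x::'a. 0::real)"
    by (rule integral_dominated_convergence[where w="\<lambda>x. (a\<^sup>2 + b\<^sup>2) * E x"])
      (use s_le s_lim ints integrable_E in auto)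
  moreover have "(\<lambda>k. integral\<^sup>L lborel (r k)) \<longlonglongrightarrow> integral\<^sup>L lborel (\<lambda>x. \<rho> x * (u x * w x))"
    by (rule integral_dominated_convergence[where w="\<lambda>x. \<bar>\<rho> x * (u x * w x)\<bar>"])
      (use r_le r_lim r_m irw in auto)
  ultimately have "(\<lambda>k. integral\<^sup>L lborel (s k) - integral\<^sup>L lborel (r k)) \<longlonglongrightarrow> 0 - integral\<^sup>L lborel (\<lambda>x. \<rho> x * (u x * w x))"
    using tendsto_diff by fastforce
  then show "(\<lambda>k. Q (\<lambda>x. cutoff (\<epsilon> k) (F x) * u x)) \<longlonglongrightarrow>
    - (\<integral>x. \<rho> x * (u x * (a * c1 * f1 x + b * c2 * f2 x)) \<partial>lborel)"
    unfolding Qk w_def by simp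
qed

text \<open>\<open>Q_lower_bound\<close> is applied to the cut-off functions. Their means tend to
  the mean of the combination, which is zero, while \<open>N\<close> stays bounded, so the limit in
  \<open>quadratic_form_limit\<close> is nonnegative.\<close>

lemma mean_zero_bound:
  fixes a b :: real
  assumes m0: "a * mean f1 + b * mean f2 = 0"
  shows "(\<integral>x. \<rho> x * ((a * f1 x + b * f2 x) * (a * c1 * f1 x + b * c2 * f2 x)) \<partial>lborel) \<le> 0"
proof -
  define u where "u x = a * f1 x + b * f2 x" for x
  let ?h = "\<lambda>k x. cutoff (\<epsilon> k) (F x) * u x"
  have e: "\<epsilon> k > 0" for k by simp
  note Ql = quadratic_form_limit(1)[of a b, folded u_def] and t = quadratic_form_limit(2)[of _ a b, folded u_def]
  have cu: "continuous_on S u" for S unfolding u_def by (intro continuous_intros continuous_f\<Omega>)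
  have u0: "x \<notin> \<Omega> \<Longrightarrow> u x = 0" for x by (simp add: u_def zero)
  have mu: "mean u = 0"
  proof -
    have "continuous_on UNIV (\<lambda>x. a * f1 x)" "continuous_on UNIV (\<lambda>x. b * f2 x)"
      by (intro continuous_intros cont)+
    from mean_add[OF this] m0 show ?thesis by (simp add: u_def[abs_def] mean_cmult)
  qed
  have h_le: "\<bar>?h k x\<bar> \<le> \<bar>u x\<bar>" for k x
    using cutoff_le_1[OF e] cutoff_nonneg by (auto simp: abs_mult intro!: mult_left_le_one_le)
  have h_lim: "(\<lambda>k. ?h k x) \<longlonglongrightarrow> u x" for x
  proof (cases "F x > 0")
    case True
    have "(\<lambda>k. ?h k x) \<longlonglongrightarrow> 1 * u x" by (intro tendsto_intros cutoff_limits True)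
    then show ?thesis by simp
  next
    case False
    then show ?thesis using F_zero_imp by (simp add: u_def)
  qed
  have "(\<lambda>k. \<integral>x. indicator shell x * ?h k (x /\<^sub>R norm x) \<partial>lborel) \<longlonglongrightarrow> (\<integral>x. indicator shell x * u (x /\<^sub>R norm x) \<partial>lborel)"
  proof (rule integral_dominated_convergence[where w="\<lambda>x. \<bar>indicator shell x * u (x /\<^sub>R norm x)\<bar>"])
    show "(\<lambda>x. indicator shell x * u (x /\<^sub>R norm x)) \<in> borel_measurable lborel"
      "integrable lborel (\<lambda>x. \<bar>indicator shell x * u (x /\<^sub>R norm x)\<bar>)"
      using mean_integrable[OF cu] by auto
    show "(\<lambda>x. indicator shell x * ?h k (x /\<^sub>R norm x)) \<in> borel_measurable lborel" for k
      using mean_integrable[OF C1_on_imp_continuous_on[OF test_C1[OF t]], of k] by auto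
    show "AE x in lborel. (\<lambda>k. indicator shell x * ?h k (x /\<^sub>R norm x)) \<longlonglongrightarrow> indicator shell x * u (x /\<^sub>R norm x)"
      by (intro AE_I2 tendsto_mult tendsto_const h_lim)
    show "AE x in lborel. norm (indicator shell x * ?h k (x /\<^sub>R norm x)) \<le> \<bar>indicator shell x * u (x /\<^sub>R norm x)\<bar>" for k
      using h_le by (intro AE_I2) (auto simp: abs_mult intro!: mult_left_mono)
  qed
  then have "(\<lambda>k. mean (?h k)) \<longlonglongrightarrow> mean u"
    unfolding mean_def using measure_shell_pos[where ?'a = 'a] by (intro tendsto_divide) auto
  then have ml: "(\<lambda>k. mean (?h k)) \<longlonglongrightarrow> 0" using mu by simp
  have iu: "integrable lborel (\<lambda>x. q x * \<bar>u x\<bar>)"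
    by (intro integrable_K) (auto intro!: continuous_intros continuous_on_q cu simp: u0)
  have Nb: "N (?h k) \<le> N u" for k
    unfolding N_def using test_integrable(3)[OF t[of k]] iu h_le q_nonneg
    by (intro integral_mono mult_left_mono) auto
  have lb: "- 4 * \<bar>mean (?h k)\<bar> * N u \<le> Q (?h k)" for k
  proof -
    have "\<bar>mean (?h k)\<bar> * N (?h k) \<le> \<bar>mean (?h k)\<bar> * N u" using Nb by (intro mult_left_mono) auto
    then show ?thesis using Q_lower_bound[OF t[of k]] by simp
  qed
  have "(\<lambda>k. - 4 * \<bar>mean (?h k)\<bar> * N u) \<longlonglongrightarrow> - 4 * \<bar>0\<bar> * N u"
    by (intro tendsto_intros ml)
  from LIMSEQ_le[OF this Ql] lb show ?thesis unfolding u_def by auto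
qed

text \<open>A combination of mean zero makes the integral in \<open>mean_zero_bound\<close>
  nonpositive. For equal eigenvalues that integral is c1 times a weighted L2 norm; for different
  ones orthogonality removes the mixed term and leaves a positive combination of two such
  norms.\<close>

theorem no_two_negative_directions:
  assumes nz: "f1 z1 \<noteq> 0" "f2 z2 \<noteq> 0"
    and indep: "\<And>a b. c1 = c2 \<Longrightarrow> \<forall>x. a * f1 x + b * f2 x = 0 \<Longrightarrow> a = 0 \<and> b = 0"
  shows False
proof -
  \<comment> \<open>Vanishing mean is one linear condition on a plane.\<close>
  obtain a b where ab: "a \<noteq> 0 \<or> b \<noteq> 0" "a * mean f1 + b * mean f2 = 0"
  proof (cases "mean f1 = 0 \<and> mean f2 = 0")
    case True then show ?thesis using that[of 1 0] by simp
  next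
    case False then show ?thesis using that[of "mean f2" "- mean f1"] by auto
  qed
  have pos: "(\<integral>x. \<rho> x * (u x)\<^sup>2 \<partial>lborel) > 0"
    if u: "continuous_on UNIV u" "\<And>x. x \<notin> \<Omega> \<Longrightarrow> u x = 0" "u z \<noteq> 0" for u z
  proof (rule integral_pos_continuous)
    have cu: "continuous_on S u" for S using u(1) continuous_on_subset by blast
    show "continuous_on UNIV (\<lambda>x. \<rho> x * (u x)\<^sup>2)"
      by (rule continuous_on_compact_support[of "- {0}" \<rho> _ K])
        (use K u \<rho> cu in \<open>auto intro!: continuous_intros\<close>)
    show "integrable lborel (\<lambda>x. \<rho> x * (u x)\<^sup>2)"
      by (rule integrable_K) (use u \<rho> cu in \<open>auto intro!: continuous_intros\<close>)
    show "0 \<le> \<rho> x * (u x)\<^sup>2" for x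
      using \<rho>(2)[of x] u(2)[of x] \<Omega>0[of x] by (cases "x \<in> \<Omega>") auto
    show "0 < \<rho> z * (u z)\<^sup>2" using \<rho>(2)[of z] u(2)[of z] \<Omega>0[of z] u(3) by (cases "z \<in> \<Omega>") auto
  qed
  show False
  proof (cases "c1 = c2")
    case True
    define u where "u x = a * f1 x + b * f2 x" for x
    obtain z where z: "u z \<noteq> 0" using indep[OF True, of a b] ab(1) unfolding u_def by blast
    have "(\<integral>x. \<rho> x * (u x)\<^sup>2 \<partial>lborel) > 0"
      by (rule pos[where u=u, OF _ _ z]) (auto simp: u_def zero intro!: continuous_intros cont)
    moreover have "(\<integral>x. \<rho> x * ((a * f1 x + b * f2 x) * (a * c1 * f1 x + b * c2 * f2 x)) \<partial>lborel)
        = (\<integral>x. c1 * (\<rho> x * (u x)\<^sup>2) \<partial>lborel)"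
      using True by (intro Bochner_Integration.integral_cong) (auto simp: u_def power2_eq_square algebra_simps)
    ultimately show False using mean_zero_bound[OF ab(2)] c_pos(1) by (simp add: mult_le_0_iff)
  next
    case False
    have i: "integrable lborel (\<lambda>x. \<rho> x * (f1 x)\<^sup>2)" "integrable lborel (\<lambda>x. \<rho> x * (f2 x)\<^sup>2)"
      "integrable lborel (\<lambda>x. \<rho> x * (f1 x * f2 x))"
      by (intro integrable_K; auto intro!: continuous_intros \<rho> continuous_f\<Omega> simp: zero)+
    have p: "(\<integral>x. \<rho> x * (f1 x)\<^sup>2 \<partial>lborel) > 0" "(\<integral>x. \<rho> x * (f2 x)\<^sup>2 \<partial>lborel) > 0"
      using pos[OF cont(1) zero(1) nz(1)] pos[OF cont(2) zero(2) nz(2)] by auto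
    have "(\<integral>x. \<rho> x * ((a * f1 x + b * f2 x) * (a * c1 * f1 x + b * c2 * f2 x)) \<partial>lborel)
        = (\<integral>x. a\<^sup>2 * c1 * (\<rho> x * (f1 x)\<^sup>2) + b\<^sup>2 * c2 * (\<rho> x * (f2 x)\<^sup>2) + a * b * (c1 + c2) * (\<rho> x * (f1 x * f2 x)) \<partial>lborel)"
      by (intro Bochner_Integration.integral_cong) (auto simp: power2_eq_square algebra_simps)
    also have "\<dots> = a\<^sup>2 * c1 * (\<integral>x. \<rho> x * (f1 x)\<^sup>2 \<partial>lborel) + b\<^sup>2 * c2 * (\<integral>x. \<rho> x * (f2 x)\<^sup>2 \<partial>lborel)"
      using i orthogonal_eigen[OF False] by simp
    finally have "a\<^sup>2 * c1 * (\<integral>x. \<rho> x * (f1 x)\<^sup>2 \<partial>lborel) + b\<^sup>2 * c2 * (\<integral>x. \<rho> x * (f2 x)\<^sup>2 \<partial>lborel) \<le> 0"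
      using mean_zero_bound[OF ab(2)] by simp
    moreover have "0 \<le> a\<^sup>2 * c1 * (\<integral>x. \<rho> x * (f1 x)\<^sup>2 \<partial>lborel)" "0 \<le> b\<^sup>2 * c2 * (\<integral>x. \<rho> x * (f2 x)\<^sup>2 \<partial>lborel)"
      using p c_pos by (auto intro!: mult_nonneg_nonneg)
    moreover have "0 < a\<^sup>2 * c1 * (\<integral>x. \<rho> x * (f1 x)\<^sup>2 \<partial>lborel)" if "a \<noteq> 0"
      using p c_pos that by (intro mult_pos_pos) auto
    moreover have "0 < b\<^sup>2 * c2 * (\<integral>x. \<rho> x * (f2 x)\<^sup>2 \<partial>lborel)" if "b \<noteq> 0"
      using p c_pos that by (intro mult_pos_pos) auto
    ultimately show False using ab(1) by fastforce
  qed
qed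

end

section \<open>Conformal charts of hypersurfaces\<close>

lemma orthonormal_expansion:
  fixes v :: "'b::euclidean_space"
  assumes B: "finite B" "pairwise orthogonal B" "\<forall>e\<in>B. norm e = 1" and v: "v \<in> span B"
  shows "(\<Sum>c\<in>B. (v \<bullet> c) *\<^sub>R c) = v"
proof -
  let ?w = "v - (\<Sum>c\<in>B. (v \<bullet> c) *\<^sub>R c)"
  have "?w \<bullet> e = 0" if e: "e \<in> B" for e
  proof -
    have ee: "e \<bullet> e = 1" using B(3) e by (simp add: norm_eq_1)
    have "(\<Sum>c\<in>B. (v \<bullet> c) *\<^sub>R c) \<bullet> e = (\<Sum>c\<in>B. (v \<bullet> c) * (c \<bullet> e))"
      by (simp add: inner_sum_left)
    also have "\<dots> = (v \<bullet> e) * (e \<bullet> e) + (\<Sum>c\<in>B - {e}. (v \<bullet> c) * (c \<bullet> e))"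
      using B(1) e by (rule sum.remove)
    also have "(\<Sum>c\<in>B - {e}. (v \<bullet> c) * (c \<bullet> e)) = 0"
      using B(2) e by (intro sum.neutral) (auto simp: pairwise_def orthogonal_def)
    finally show ?thesis by (simp add: inner_diff_left ee)
  qed
  then have "orthogonal ?w e" if "e \<in> B" for e using that by (simp add: orthogonal_def)
  moreover have "?w \<in> span B" by (rule span_diff[OF v], intro span_sum span_scale span_base)
  ultimately have "orthogonal ?w ?w" using orthogonal_to_span by blast
  then show ?thesis by (simp add: orthogonal_def)
qed

text \<open>\<open>tangent_frame\<close> is an arbitrary choice. This lemma replaces it by the
  rescaled coordinate frame of a chart.\<close>

lemma trace_frame_independent:
  fixes \<beta> :: "'b::euclidean_space \<Rightarrow> 'b \<Rightarrow> 'c::real_vector"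
  assumes B: "finite B" "pairwise orthogonal B" "\<forall>e\<in>B. norm e = 1"
    and C: "finite C" "pairwise orthogonal C" "\<forall>e\<in>C. norm e = 1" and s: "span B = span C"
    and l: "\<And>u. linear (\<beta> u)" "\<And>v. linear (\<lambda>u. \<beta> u v)"
  shows "(\<Sum>e\<in>B. \<beta> e e) = (\<Sum>e\<in>C. \<beta> e e)"
proof -
  have "\<beta> e e = (\<Sum>c\<in>C. (e \<bullet> c) *\<^sub>R \<beta> c e)" if "e \<in> B" for e
  proof -
    have "e = (\<Sum>c\<in>C. (e \<bullet> c) *\<^sub>R c)"
      using orthonormal_expansion[OF C] s span_base[OF that] by simp
    then have "\<beta> e e = \<beta> (\<Sum>c\<in>C. (e \<bullet> c) *\<^sub>R c) e" by simp
    also have "\<dots> = (\<Sum>c\<in>C. (e \<bullet> c) *\<^sub>R \<beta> c e)"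
      by (simp add: linear_sum[OF l(2)] linear_cmul[OF l(2)])
    finally show ?thesis .
  qed
  then have "(\<Sum>e\<in>B. \<beta> e e) = (\<Sum>e\<in>B. \<Sum>c\<in>C. (e \<bullet> c) *\<^sub>R \<beta> c e)" by simp
  also have "\<dots> = (\<Sum>c\<in>C. \<Sum>e\<in>B. (c \<bullet> e) *\<^sub>R \<beta> c e)"
    by (subst sum.swap) (simp add: inner_commute)
  also have "\<dots> = (\<Sum>c\<in>C. \<beta> c (\<Sum>e\<in>B. (c \<bullet> e) *\<^sub>R e))"
    by (simp add: linear_sum[OF l(1)] linear_cmul[OF l(1)])
  also have "\<dots> = (\<Sum>c\<in>C. \<beta> c c)"
    using orthonormal_expansion[OF B] s span_base[of _ C] by (intro sum.cong) auto
  finally show ?thesis .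
qed

lemma is_tangent_frame_finite: "is_tangent_frame M p B \<Longrightarrow> finite B"
  unfolding is_tangent_frame_def
  by (intro independent_imp_finite pairwise_orthogonal_independent) force+

text \<open>A parametrization with a differentiable left inverse. The left inverse turns derivatives
  within \<open>M\<close> into ordinary derivatives on the open set \<open>U\<close>, where they are
  unique.\<close>

locale conformal_chart =
  fixes M :: "'b::euclidean_space set" and U :: "'a::euclidean_space set"
    and \<Psi> :: "'a \<Rightarrow> 'b" and D\<Psi> :: "'a \<Rightarrow> 'a \<Rightarrow> 'b" and lam :: "'a \<Rightarrow> real" and coord :: "'b \<Rightarrow> 'a"
  assumes U: "open U" and image: "\<Psi> ` U = M"
    and deriv: "x \<in> U \<Longrightarrow> (\<Psi> has_derivative D\<Psi> x) (at x)"
    and conformal: "x \<in> U \<Longrightarrow> D\<Psi> x v \<bullet> D\<Psi> x w = (lam x)\<^sup>2 * (v \<bullet> w)"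
    and lam_pos: "x \<in> U \<Longrightarrow> lam x > 0"
    and coord: "x \<in> U \<Longrightarrow> coord (\<Psi> x) = x"
    and coord_diff: "x \<in> U \<Longrightarrow> coord differentiable (at (\<Psi> x) within M)"
begin

lemma \<Psi>_in: "x \<in> U \<Longrightarrow> \<Psi> x \<in> M" using image by auto

lemma coord_in: "p \<in> M \<Longrightarrow> coord p \<in> U \<and> \<Psi> (coord p) = p"
  using image coord by auto

lemma continuous_coord: "continuous_on M coord"
  unfolding continuous_on_eq_continuous_within
  using coord_diff coord_in differentiable_imp_continuous_within by metis

lemma continuous_\<Psi>: "continuous_on U \<Psi>"
  using deriv by (auto intro!: continuous_at_imp_continuous_on has_derivative_continuous)

lemma linear_D: "x \<in> U \<Longrightarrow> linear (D\<Psi> x)"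
  using deriv has_derivative_linear by blast

lemma tangent_space_chart:
  assumes x: "x \<in> U"
  shows "tangent_space M (\<Psi> x) = range (D\<Psi> x)"
proof (intro set_eqI iffI)
  fix v assume "v \<in> tangent_space M (\<Psi> x)"
  then obtain \<gamma> where \<gamma>: "\<And>t. \<gamma> t \<in> M" "\<gamma> 0 = \<Psi> x" "(\<gamma> has_vector_derivative v) (at 0)"
    unfolding tangent_space_def by blast
  obtain dcoord where d: "(coord has_derivative dcoord) (at (\<gamma> 0) within M)"
    using coord_diff[OF x] \<gamma>(2) by (auto simp: differentiable_def)
  have "(coord has_derivative dcoord) (at (\<gamma> 0) within range \<gamma>)"
    by (rule has_derivative_subset[OF d]) (use \<gamma>(1) in auto)
  from has_derivative_in_compose[OF \<gamma>(3)[unfolded has_vector_derivative_def] this]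
  have c: "((\<lambda>t. coord (\<gamma> t)) has_derivative (\<lambda>t. dcoord (t *\<^sub>R v))) (at 0)" .
  have "(\<Psi> has_derivative D\<Psi> x) (at (coord (\<gamma> 0)))" using deriv[OF x] coord[OF x] \<gamma>(2) by simp
  from has_derivative_compose[OF c this]
  have "((\<lambda>t. \<Psi> (coord (\<gamma> t))) has_derivative (\<lambda>t. D\<Psi> x (dcoord (t *\<^sub>R v)))) (at 0)" .
  then have "(\<gamma> has_derivative (\<lambda>t. D\<Psi> x (dcoord (t *\<^sub>R v)))) (at 0)"
    using coord_in[OF \<gamma>(1)] by simp
  from has_derivative_unique[OF this \<gamma>(3)[unfolded has_vector_derivative_def]]
  have "D\<Psi> x (dcoord (1 *\<^sub>R v)) = 1 *\<^sub>R v" by (rule fun_cong)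
  then show "v \<in> range (D\<Psi> x)" by (metis rangeI scaleR_one)
next
  fix w assume "w \<in> range (D\<Psi> x)"
  then obtain v where v: "w = D\<Psi> x v" by auto
  obtain \<delta> where \<delta>: "\<delta> > 0" "ball x \<delta> \<subseteq> U" using U x openE by blast
  \<comment> \<open>\<open>tangent_space\<close> asks for curves defined for all times and staying
    in \<open>M\<close>. The reparametrization r t = \<kappa> sin (t / \<kappa>) has derivative 1 at
    0 and keeps the segment in a ball inside \<open>U\<close>.\<close>
  define \<kappa> where "\<kappa> = \<delta> / (2 * (norm v + 1))"
  have \<kappa>: "\<kappa> > 0" using \<delta> by (auto simp: \<kappa>_def intro!: divide_pos_pos add_nonneg_pos)
  define r where "r t = \<kappa> * sin (t / \<kappa>)" for t
  define \<gamma> where "\<gamma> t = \<Psi> (x + r t *\<^sub>R v)" for t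
  have "x + r t *\<^sub>R v \<in> U" for t
  proof -
    have "norm (r t *\<^sub>R v) \<le> \<kappa> * norm v"
      using \<kappa> abs_sin_le_one[of "t / \<kappa>"] by (auto simp: r_def abs_mult mult_le_cancel_right intro!: mult_right_mono)
    also have "\<dots> \<le> \<kappa> * (norm v + 1)" using \<kappa> by simp
    also have "\<dots> = \<delta> / 2" by (simp add: \<kappa>_def field_simps add_nonneg_eq_0_iff)
    finally have "norm (r t *\<^sub>R v) < \<delta>" using \<delta> by simp
    then show ?thesis using \<delta>(2) by (auto simp: dist_norm subset_iff)
  qed
  then have 1: "\<gamma> t \<in> M" for t unfolding \<gamma>_def by (rule \<Psi>_in)
  have "(r has_real_derivative 1) (at 0)"
    unfolding r_def[abs_def] using \<kappa> by (auto intro!: derivative_eq_intros)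
  then have "((\<lambda>t. x + r t *\<^sub>R v) has_derivative (\<lambda>t. t *\<^sub>R v)) (at 0)"
    unfolding has_field_derivative_def by (auto intro!: derivative_eq_intros)
  moreover have "(\<Psi> has_derivative D\<Psi> x) (at (x + r 0 *\<^sub>R v))" using deriv[OF x] by (simp add: r_def)
  ultimately have "(\<gamma> has_derivative (\<lambda>t. D\<Psi> x (t *\<^sub>R v))) (at 0)"
    unfolding \<gamma>_def by (rule has_derivative_compose)
  then have "(\<gamma> has_vector_derivative w) (at 0)"
    unfolding has_vector_derivative_def v by (simp add: linear_cmul[OF linear_D[OF x]])
  moreover have "\<gamma> 0 = \<Psi> x" by (simp add: \<gamma>_def r_def)
  ultimately show "w \<in> tangent_space M (\<Psi> x)" unfolding tangent_space_def using 1 by blast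
qed

definition frame :: "'a \<Rightarrow> 'b set" where
  "frame x = (\<lambda>b. (1 / lam x) *\<^sub>R D\<Psi> x b) ` Basis"

lemma frame_inner: "x \<in> U \<Longrightarrow> ((1 / lam x) *\<^sub>R D\<Psi> x b) \<bullet> ((1 / lam x) *\<^sub>R D\<Psi> x c) = b \<bullet> c"
  using conformal[of x b c] lam_pos[of x] by (simp add: power2_eq_square)

lemma inj_frame: "x \<in> U \<Longrightarrow> inj_on (\<lambda>b. (1 / lam x) *\<^sub>R D\<Psi> x b) Basis"
proof (rule inj_onI)
  fix b c :: 'a assume x: "x \<in> U" and bc: "b \<in> Basis" "c \<in> Basis" "(1 / lam x) *\<^sub>R D\<Psi> x b = (1 / lam x) *\<^sub>R D\<Psi> x c"
  then have "b \<bullet> c = c \<bullet> c" using frame_inner[OF x, of b c] frame_inner[OF x, of c c] by metis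
  then show "b = c" using bc by (simp add: inner_Basis split: if_splits)
qed

lemma frame_is_tangent_frame: "x \<in> U \<Longrightarrow> is_tangent_frame M (\<Psi> x) (frame x)"
  unfolding is_tangent_frame_def
proof (intro conjI ballI)
  assume x: "x \<in> U"
  show "pairwise orthogonal (frame x)"
    unfolding pairwise_def orthogonal_def
  proof (intro ballI impI)
    fix u v assume "u \<in> frame x" "v \<in> frame x" "u \<noteq> v"
    then obtain b c where bc: "b \<in> Basis" "c \<in> Basis" "u = (1 / lam x) *\<^sub>R D\<Psi> x b" "v = (1 / lam x) *\<^sub>R D\<Psi> x c"
      unfolding frame_def by blast
    then have "b \<noteq> c" using \<open>u \<noteq> v\<close> by auto
    then show "u \<bullet> v = 0" unfolding bc(3,4) frame_inner[OF x] using bc by (simp add: inner_Basis)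
  qed
  show "norm e = 1" if "e \<in> frame x" for e
  proof -
    obtain b where b: "b \<in> Basis" "e = (1 / lam x) *\<^sub>R D\<Psi> x b"
      using \<open>e \<in> frame x\<close> unfolding frame_def by blast
    show ?thesis unfolding norm_eq_1 b(2) frame_inner[OF x] using b(1) by (simp add: inner_Basis)
  qed
  have l0: "lam x \<noteq> 0" using lam_pos[OF x] by simp
  have "frame x = (\<lambda>v. D\<Psi> x v) ` ((\<lambda>b. (1 / lam x) *\<^sub>R b) ` Basis)"
    unfolding frame_def image_image by (simp add: linear_cmul[OF linear_D[OF x]])
  then have "span (frame x) = D\<Psi> x ` span ((\<lambda>b. (1 / lam x) *\<^sub>R b) ` Basis)"
    using span_linear_image[OF linear_D[OF x]] by simp
  also have "span ((\<lambda>b::'a. (1 / lam x) *\<^sub>R b) ` Basis) = UNIV"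
    using span_image_scale[of "Basis :: 'a set" "\<lambda>_. 1 / lam x"] l0 by simp
  finally show "span (frame x) = tangent_space M (\<Psi> x)" using tangent_space_chart[OF x] by simp
qed

lemma tangent_frame: "x \<in> U \<Longrightarrow> is_tangent_frame M (\<Psi> x) (tangent_frame M (\<Psi> x))"
  unfolding tangent_frame_def using frame_is_tangent_frame by (rule someI)

lemma sum_tangent_frame:
  fixes \<beta> :: "'b \<Rightarrow> 'b \<Rightarrow> 'c::real_vector"
  assumes x: "x \<in> U" and l: "\<And>u. linear (\<beta> u)" "\<And>v. linear (\<lambda>u. \<beta> u v)"
  shows "(\<Sum>e\<in>tangent_frame M (\<Psi> x). \<beta> e e) = (\<Sum>b\<in>Basis. (1 / (lam x)\<^sup>2) *\<^sub>R \<beta> (D\<Psi> x b) (D\<Psi> x b))"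
proof -
  note t = tangent_frame[OF x] and f = frame_is_tangent_frame[OF x]
  have "(\<Sum>e\<in>tangent_frame M (\<Psi> x). \<beta> e e) = (\<Sum>e\<in>frame x. \<beta> e e)"
    using t f is_tangent_frame_finite[OF t] is_tangent_frame_finite[OF f] l
    unfolding is_tangent_frame_def by (intro trace_frame_independent) auto
  also have "\<dots> = (\<Sum>b\<in>Basis. \<beta> ((1 / lam x) *\<^sub>R D\<Psi> x b) ((1 / lam x) *\<^sub>R D\<Psi> x b))"
    unfolding frame_def by (rule sum.reindex_cong[OF inj_frame[OF x]]) auto
  also have "\<dots> = (\<Sum>b\<in>Basis. (1 / (lam x)\<^sup>2) *\<^sub>R \<beta> (D\<Psi> x b) (D\<Psi> x b))"
    by (simp add: linear_cmul[OF l(1)] linear_cmul[OF l(2)] power2_eq_square)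
  finally show ?thesis .
qed

lemma pullback_has_derivative:
  assumes x: "x \<in> U" and f: "(f has_derivative f') (at (\<Psi> x) within M)"
  shows "((\<lambda>y. f (\<Psi> y)) has_derivative (\<lambda>v. f' (D\<Psi> x v))) (at x)"
proof -
  have "(\<Psi> has_derivative D\<Psi> x) (at x within U)"
    using deriv[OF x] by (rule has_derivative_at_withinI)
  moreover have "(f has_derivative f') (at (\<Psi> x) within \<Psi> ` U)" using f image by simp
  ultimately have "((\<lambda>y. f (\<Psi> y)) has_derivative (\<lambda>v. f' (D\<Psi> x v))) (at x within U)"
    by (rule has_derivative_in_compose)
  then show ?thesis using at_within_open[OF x U] by simp
qed

lemma pushforward_differentiable:
  assumes x: "x \<in> U" and f: "(\<lambda>y. f (\<Psi> y)) differentiable (at x)"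
  shows "f differentiable (at (\<Psi> x) within M)"
proof -
  obtain g' where g: "((\<lambda>y. f (\<Psi> y)) has_derivative g') (at x)" using f by (auto simp: differentiable_def)
  obtain dcoord where d: "(coord has_derivative dcoord) (at (\<Psi> x) within M)"
    using coord_diff[OF x] by (auto simp: differentiable_def)
  have "((\<lambda>y. f (\<Psi> y)) has_derivative g') (at (coord (\<Psi> x)))" using g coord[OF x] by simp
  from has_derivative_compose[OF d this]
  have "((\<lambda>p. f (\<Psi> (coord p))) has_derivative (\<lambda>v. g' (dcoord v))) (at (\<Psi> x) within M)" .
  then have "(f has_derivative (\<lambda>v. g' (dcoord v))) (at (\<Psi> x) within M)"
    by (rule has_derivative_transform[rotated 2]) (use coord_in \<Psi>_in[OF x] in auto)
  then show ?thesis by (auto simp: differentiable_def)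
qed

text \<open>The derivative within \<open>M\<close> is a choice among linear maps that agree on
  tangent vectors only. Composed with \<open>D\<Psi> x\<close> it becomes a derivative at an
  interior point of \<open>U\<close>, which is unique.\<close>

lemma frechet_pullback:
  assumes x: "x \<in> U" and f: "f differentiable (at (\<Psi> x) within M)"
    and g: "((\<lambda>y. f (\<Psi> y)) has_derivative g') (at x)"
  shows "frechet_derivative f (at (\<Psi> x) within M) (D\<Psi> x v) = g' v"
proof -
  have "(f has_derivative frechet_derivative f (at (\<Psi> x) within M)) (at (\<Psi> x) within M)"
    using f frechet_derivative_works by blast
  from has_derivative_unique[OF pullback_has_derivative[OF x this] g] show ?thesis by (rule fun_cong)
qed

lemma linear_frechet: "f differentiable (at p within S) \<Longrightarrow> linear (frechet_derivative f (at p within S))"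
  using frechet_derivative_works has_derivative_linear by blast

lemma surface_gradient_chart:
  assumes x: "x \<in> U" and f: "f differentiable (at (\<Psi> x) within M)"
  shows "(\<lambda>y. f (\<Psi> y)) differentiable (at x)"
    "surface_gradient M f (\<Psi> x) = (1 / (lam x)\<^sup>2) *\<^sub>R D\<Psi> x (gr (\<lambda>y. f (\<Psi> y)) x)"
proof -
  show d: "(\<lambda>y. f (\<Psi> y)) differentiable (at x)"
    using f frechet_derivative_works pullback_has_derivative[OF x] differentiable_def by metis
  let ?f' = "frechet_derivative f (at (\<Psi> x) within M)"
  have l: "linear ?f'" by (rule linear_frechet[OF f])
  have e: "?f' (D\<Psi> x v) = v \<bullet> gr (\<lambda>y. f (\<Psi> y)) x" for v
    using frechet_pullback[OF x f gderiv_gr[OF d, unfolded gderiv_def]] .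
  have "surface_gradient M f (\<Psi> x) = (\<Sum>b\<in>Basis. (1 / (lam x)\<^sup>2) *\<^sub>R (?f' (D\<Psi> x b) *\<^sub>R D\<Psi> x b))"
    unfolding surface_gradient_def
    by (rule sum_tangent_frame[OF x])
      (auto intro!: linearI simp: linear_add[OF l] linear_cmul[OF l] algebra_simps)
  also have "\<dots> = (1 / (lam x)\<^sup>2) *\<^sub>R D\<Psi> x (\<Sum>b\<in>Basis. (gr (\<lambda>y. f (\<Psi> y)) x \<bullet> b) *\<^sub>R b)"
    by (simp add: linear_sum[OF linear_D[OF x]] linear_cmul[OF linear_D[OF x]] e inner_commute scaleR_sum_right)
  finally show "surface_gradient M f (\<Psi> x) = (1 / (lam x)\<^sup>2) *\<^sub>R D\<Psi> x (gr (\<lambda>y. f (\<Psi> y)) x)"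
    by (simp add: euclidean_representation)
qed

lemma surface_divergence_chart:
  assumes x: "x \<in> U" and X: "X differentiable (at (\<Psi> x) within M)"
    and X': "((\<lambda>y. X (\<Psi> y)) has_derivative X') (at x)"
  shows "surface_divergence M X (\<Psi> x) = (1 / (lam x)\<^sup>2) * (\<Sum>b\<in>Basis. X' b \<bullet> D\<Psi> x b)"
proof -
  let ?X' = "frechet_derivative X (at (\<Psi> x) within M)"
  have l: "linear ?X'" by (rule linear_frechet[OF X])
  have "surface_divergence M X (\<Psi> x) = (\<Sum>b\<in>Basis. (1 / (lam x)\<^sup>2) *\<^sub>R (?X' (D\<Psi> x b) \<bullet> D\<Psi> x b))"
    unfolding surface_divergence_def
    by (rule sum_tangent_frame[OF x])
      (auto intro!: linearI simp: linear_add[OF l] linear_cmul[OF l] inner_add_left inner_add_right)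
  then show ?thesis by (simp add: frechet_pullback[OF x X X'] sum_distrib_left)
qed

text \<open>The normal in \<open>second_fundamental_form\<close> is chosen arbitrarily. In
  codimension one it equals the given normal up to a sign, which by continuity is constant near x;
  so it is differentiable, and the sign disappears in the squares.\<close>

lemma norm_second_fundamental_form_chart:
  assumes x: "x \<in> U" and dim: "DIM('b) = Suc DIM('a)"
    and nu: "\<And>y. y \<in> U \<Longrightarrow> (\<nu> has_derivative D\<nu> y) (at y)"
      "\<And>y. y \<in> U \<Longrightarrow> norm (\<nu> y) = 1" "\<And>y v. y \<in> U \<Longrightarrow> \<nu> y \<bullet> D\<Psi> y v = 0"
  shows "(norm_second_fundamental_form M (\<Psi> x))\<^sup>2
    = (\<Sum>b\<in>Basis. \<Sum>c\<in>Basis. (D\<nu> x b \<bullet> D\<Psi> x c)\<^sup>2) / (lam x)^4"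
proof -
  define N where "N = (SOME N. unit_normal_near M (\<Psi> x) N)"
  have "unit_normal_near M (\<Psi> x) (\<lambda>p. \<nu> (coord p))"
    unfolding unit_normal_near_def
  proof (intro exI[of _ UNIV] conjI ballI)
    have "continuous_on U \<nu>" using nu(1)
      by (auto intro!: continuous_at_imp_continuous_on has_derivative_continuous)
    then show "continuous_on (M \<inter> UNIV) (\<lambda>p. \<nu> (coord p))"
      using coord_in continuous_coord by (auto intro: continuous_on_compose2)
    fix p assume "p \<in> M \<inter> UNIV"
    then have p: "coord p \<in> U" "\<Psi> (coord p) = p" using coord_in by auto
    show "norm (\<nu> (coord p)) = 1" using nu(2) p by simp
    show "\<nu> (coord p) \<bullet> v = 0" if "v \<in> tangent_space M p" for v
      using that tangent_space_chart[OF p(1)] nu(3)[OF p(1)] p(2) by auto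
  qed auto
  then have "unit_normal_near M (\<Psi> x) N" unfolding N_def by (rule someI[of "unit_normal_near M (\<Psi> x)"])
  then obtain W where W: "open W" "\<Psi> x \<in> W" "continuous_on (M \<inter> W) N"
    "\<And>q. q \<in> M \<inter> W \<Longrightarrow> norm (N q) = 1" "\<And>q v. q \<in> M \<inter> W \<Longrightarrow> v \<in> tangent_space M q \<Longrightarrow> N q \<bullet> v = 0"
    unfolding unit_normal_near_def by blast
  define V where "V = U \<inter> \<Psi> -` W"
  have V: "open V" "x \<in> V" unfolding V_def
    using continuous_open_preimage[OF continuous_\<Psi> U W(1)] x W(2) by auto
  have VU: "y \<in> V \<Longrightarrow> y \<in> U \<and> \<Psi> y \<in> M \<inter> W" for y unfolding V_def using \<Psi>_in by auto
  define s where "s y = N (\<Psi> y) \<bullet> \<nu> y" for y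
  have Ns: "N (\<Psi> y) = s y *\<^sub>R \<nu> y" if "y \<in> V" for y
  proof -
    have y: "y \<in> U" "\<Psi> y \<in> M \<inter> W" using VU[OF that] by auto
    let ?B = "insert (\<nu> y) (frame y)"
    note fr = frame_is_tangent_frame[OF y(1)]
    have tf: "e \<in> tangent_space M (\<Psi> y)" if "e \<in> frame y" for e
      using fr that span_base unfolding is_tangent_frame_def by metis
    have ne: "\<nu> y \<bullet> e = 0" if "e \<in> frame y" for e
      using tf[OF that] nu(3)[OF y(1)] tangent_space_chart[OF y(1)] by auto
    have nin: "\<nu> y \<notin> frame y" using ne[of "\<nu> y"] nu(2)[OF y(1)] by (auto simp flip: norm_eq_1)
    have card: "card (frame y) = DIM('a)" unfolding frame_def using card_image[OF inj_frame[OF y(1)]] by simp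
    have fin: "finite (frame y)" by (rule is_tangent_frame_finite[OF fr])
    have po: "pairwise orthogonal ?B"
      using fr ne unfolding is_tangent_frame_def pairwise_insert by (auto simp: orthogonal_def inner_commute)
    have un: "\<forall>e\<in>?B. norm e = 1" using fr nu(2)[OF y(1)] unfolding is_tangent_frame_def by auto
    have ind: "independent ?B" using po un by (intro pairwise_orthogonal_independent) force+
    have "card ?B = DIM('b)" using card nin fin dim by simp
    then have "span ?B = UNIV" using ind
      by (metis dim_eq_card_independent dim_eq_full)
    then have "N (\<Psi> y) = (\<Sum>c\<in>?B. (N (\<Psi> y) \<bullet> c) *\<^sub>R c)"
      using orthonormal_expansion[of ?B "N (\<Psi> y)"] po un fin by simp
    also have "\<dots> = s y *\<^sub>R \<nu> y + (\<Sum>c\<in>frame y. (N (\<Psi> y) \<bullet> c) *\<^sub>R c)"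
      using fin nin by (simp add: s_def)
    also have "(\<Sum>c\<in>frame y. (N (\<Psi> y) \<bullet> c) *\<^sub>R c) = 0"
      using W(5)[OF y(2) tf] by (intro sum.neutral) simp
    finally show ?thesis by simp
  qed
  have s1: "s y = 1 \<or> s y = -1" if "y \<in> V" for y
  proof -
    have "norm (N (\<Psi> y)) = \<bar>s y\<bar> * norm (\<nu> y)" using Ns[OF that] by simp
    then show ?thesis using W(4) nu(2) VU[OF that] by auto
  qed
  have cs: "continuous_on V s"
    unfolding s_def
  proof (intro continuous_on_inner)
    show "continuous_on V (\<lambda>y. N (\<Psi> y))"
      by (rule continuous_on_compose2[OF W(3) continuous_on_subset[OF continuous_\<Psi>]]) (use VU in auto)
    show "continuous_on V \<nu>" using nu(1) VU
      by (auto intro!: continuous_at_imp_continuous_on has_derivative_continuous)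
  qed
  \<comment> \<open>A neighbourhood on which \<open>s\<close> differs from \<open>s x\<close> by
    less than 1; since its only values are 1 and -1, it is constant there.\<close>
  define V' where "V' = V \<inter> s -` {s x - 1 <..< s x + 1}"
  have V': "open V'" "x \<in> V'" unfolding V'_def
    using continuous_open_preimage[OF cs V(1)] V(2) by auto
  have sx: "s y = s x" if "y \<in> V'" for y
    using that s1[of y] s1[OF V(2)] unfolding V'_def by auto
  have hd: "((\<lambda>y. N (\<Psi> y)) has_derivative (\<lambda>v. s x *\<^sub>R D\<nu> x v)) (at x)"
  proof (rule has_derivative_transform_within_open)
    show "((\<lambda>y. s x *\<^sub>R \<nu> y) has_derivative (\<lambda>v. s x *\<^sub>R D\<nu> x v)) (at x)"
      using nu(1)[OF x] by (auto intro!: derivative_eq_intros)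
    show "s x *\<^sub>R \<nu> y = N (\<Psi> y)" if "y \<in> V'" for y
      using Ns[of y] sx[OF that] that unfolding V'_def by simp
  qed (use V' in auto)
  have ND: "N differentiable (at (\<Psi> x) within M)"
    by (rule pushforward_differentiable[OF x]) (use hd in \<open>auto simp: differentiable_def\<close>)
  define A where "A u v = second_fundamental_form M (\<Psi> x) u v" for u v
  have A: "A u v = - (frechet_derivative N (at (\<Psi> x) within M) u \<bullet> v)" for u v
    unfolding A_def second_fundamental_form_def N_def ..
  have lN: "linear (frechet_derivative N (at (\<Psi> x) within M))" by (rule linear_frechet[OF ND])
  have AD: "(A (D\<Psi> x v) (D\<Psi> x w))\<^sup>2 = (D\<nu> x v \<bullet> D\<Psi> x w)\<^sup>2" for v w
    unfolding A frechet_pullback[OF x ND hd] using s1[OF V(2)] by auto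
  have Al: "A (a *\<^sub>R u + b *\<^sub>R v) w = a * A u w + b * A v w" "A w (a *\<^sub>R u + b *\<^sub>R v) = a * A w u + b * A w v" for a b u v w
    unfolding A by (simp_all add: linear_add[OF lN] linear_cmul[OF lN] inner_add_left inner_add_right)
  have Al1: "A (u + v) w = A u w + A v w" "A (a *\<^sub>R u) w = a * A u w"
    "A w (u + v) = A w u + A w v" "A w (a *\<^sub>R u) = a * A w u" for a u v w
    using Al[where a=1 and b=1 and u=u and v=v and w=w] Al[where a=a and b=0 and u=u and v=0 and w=w] by simp_all
  have "(\<Sum>e\<in>tangent_frame M (\<Psi> x). \<Sum>e'\<in>tangent_frame M (\<Psi> x). (A e e')\<^sup>2)
     = (\<Sum>e\<in>tangent_frame M (\<Psi> x). \<Sum>c\<in>Basis. (1 / (lam x)\<^sup>2) *\<^sub>R (A e (D\<Psi> x c) * A e (D\<Psi> x c)))"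
    unfolding power2_eq_square[of "A _ _"]
    by (intro sum.cong HOL.refl sum_tangent_frame[OF x])
      (auto intro!: linearI simp: Al1 algebra_simps)
  also have "\<dots> = (\<Sum>b\<in>Basis. (1 / (lam x)\<^sup>2) *\<^sub>R (\<Sum>c\<in>Basis. (1 / (lam x)\<^sup>2) *\<^sub>R (A (D\<Psi> x b) (D\<Psi> x c) * A (D\<Psi> x b) (D\<Psi> x c))))"
    by (rule sum_tangent_frame[OF x, where \<beta>="\<lambda>u v. \<Sum>c\<in>Basis. (1 / (lam x)\<^sup>2) *\<^sub>R (A u (D\<Psi> x c) * A v (D\<Psi> x c))"])
      (auto intro!: linearI simp: Al1 algebra_simps sum.distrib sum_distrib_left add_divide_distrib)
  also have "\<dots> = (\<Sum>b\<in>Basis. \<Sum>c\<in>Basis. (D\<nu> x b \<bullet> D\<Psi> x c)\<^sup>2) / (lam x)^4"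
    unfolding power2_eq_square[of "A _ _", symmetric] AD
    by (simp add: sum_distrib_left sum_divide_distrib power_numeral_reduce mult.commute mult.left_commute)
  finally show ?thesis
    unfolding norm_second_fundamental_form_def A_def by (simp add: sum_nonneg)
qed

end

section \<open>The Laplacian in a minimal conformal chart\<close>

text \<open>The last assumption expresses that the coordinate functions are harmonic, i.e. minimality: in a
  conformal chart the Laplacian is \<open>lam\<^sup>-\<^sup>n div (lam\<^sup>n\<^sup>-\<^sup>2 grad)\<close>.\<close>

locale minimal_chart = conformal_chart M U \<Psi> D\<Psi> lam coord
  for M :: "'b::euclidean_space set" and U :: "'a::euclidean_space set"
    and \<Psi> :: "'a \<Rightarrow> 'b" and D\<Psi> :: "'a \<Rightarrow> 'a \<Rightarrow> 'b" and lam :: "'a \<Rightarrow> real" and coord :: "'b \<Rightarrow> 'a" +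
  fixes P :: "'a \<Rightarrow> real"
  assumes P_pos: "x \<in> U \<Longrightarrow> P x > 0" and C1_P: "C1_on U P" and C1_lam: "C1_on U lam"
    and C1_D: "C1_on U (\<lambda>x. D\<Psi> x c \<bullet> b)"
    and harmonic: "x \<in> U \<Longrightarrow> (\<Sum>c\<in>Basis. gr (\<lambda>y. P y * (D\<Psi> y c \<bullet> b)) x \<bullet> c) = 0"
begin

lemma continuous_D: "continuous_on U (\<lambda>x. D\<Psi> x v)"
  by (subst continuous_on_componentwise) (auto intro: C1_on_imp_continuous_on C1_D)

text \<open>The surface gradient X satisfies P X . D\<Psi> c = P grad u . c. Differentiating the
  left-hand side along c and summing gives P times the trace that defines the divergence of X, plus
  the product of X with the divergence of P D\<Psi>. The latter is zero by \<open>harmonic\<close>,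
  so no derivative of \<open>lam\<close> enters.\<close>

lemma laplacian_chart:
  assumes \<Omega>: "open \<Omega>" "\<Omega> \<subseteq> U" and D: "D = \<Psi> ` \<Omega>" and x: "x \<in> \<Omega>"
    and f: "surface_Ck_on 2 M D f"
  shows "surface_laplacian M f (\<Psi> x) = dv (\<lambda>y. P y *\<^sub>R gr (\<lambda>y. f (\<Psi> y)) y) x / (P x * (lam x)\<^sup>2)"
proof -
  let ?g = "gr (\<lambda>y. f (\<Psi> y))" and ?X = "surface_gradient M f"
  have xU: "x \<in> U" using x \<Omega> by auto
  have fd: "f differentiable (at (\<Psi> y) within M)" if "y \<in> \<Omega>" for y
    using f that D by (auto simp: numeral_2_eq_2)
  have Xb: "(\<lambda>p. ?X p \<bullet> b) differentiable (at (\<Psi> x) within M)" if "b \<in> Basis" for b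
    using f x D that by (auto simp: numeral_2_eq_2)
  then have X: "?X differentiable (at (\<Psi> x) within M)"
    by (subst differentiable_componentwise_within) auto
  define X' where "X' v = frechet_derivative ?X (at (\<Psi> x) within M) (D\<Psi> x v)" for v
  have hX: "((\<lambda>y. ?X (\<Psi> y)) has_derivative X') (at x)"
    unfolding X'_def[abs_def]
    using pullback_has_derivative[OF xU] X frechet_derivative_works by blast
  have e: "P y * (?X (\<Psi> y) \<bullet> D\<Psi> y c) = (P y *\<^sub>R ?g y) \<bullet> c" if "y \<in> \<Omega>" for y c
  proof -
    have yU: "y \<in> U" using that \<Omega> by auto
    then have "?X (\<Psi> y) \<bullet> D\<Psi> y c = ?g y \<bullet> c"
      using surface_gradient_chart(2)[OF yU fd[OF that]] conformal[OF yU] lam_pos[OF yU] by simp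
    then show ?thesis by simp
  qed
  have c: "gr (\<lambda>y. (P y *\<^sub>R ?g y) \<bullet> c) x \<bullet> c
      = P x * (X' c \<bullet> D\<Psi> x c) + (\<Sum>b\<in>Basis. (?X (\<Psi> x) \<bullet> b) * (gr (\<lambda>y. P y * (D\<Psi> y c \<bullet> b)) x \<bullet> c))"
    if "c \<in> Basis" for c
  proof -
    have d1: "((\<lambda>y. ?X (\<Psi> y) \<bullet> b) has_derivative (\<lambda>v. X' v \<bullet> b)) (at x)" for b
      using hX by (auto intro!: derivative_eq_intros)
    have d2: "((\<lambda>y. P y * (D\<Psi> y c \<bullet> b)) has_derivative (\<lambda>v. v \<bullet> gr (\<lambda>y. P y * (D\<Psi> y c \<bullet> b)) x)) (at x)" for b
      using C1_onD[OF C1_on_mult[OF C1_P C1_D] xU] by (simp add: gderiv_def)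
    have "((\<lambda>y. \<Sum>b\<in>Basis. (?X (\<Psi> y) \<bullet> b) * (P y * (D\<Psi> y c \<bullet> b))) has_derivative
      (\<lambda>v. \<Sum>b\<in>Basis. (?X (\<Psi> x) \<bullet> b) * (v \<bullet> gr (\<lambda>y. P y * (D\<Psi> y c \<bullet> b)) x) + (X' v \<bullet> b) * (P x * (D\<Psi> x c \<bullet> b)))) (at x)"
      by (intro has_derivative_sum has_derivative_mult d1 d2)
    moreover have "(\<Sum>b\<in>Basis. (?X (\<Psi> y) \<bullet> b) * (P y * (D\<Psi> y c \<bullet> b))) = P y * (?X (\<Psi> y) \<bullet> D\<Psi> y c)" for y
      by (subst (3) euclidean_inner) (simp add: sum_distrib_left mult.left_commute)
    ultimately have "((\<lambda>y. P y * (?X (\<Psi> y) \<bullet> D\<Psi> y c)) has_derivative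
      (\<lambda>v. \<Sum>b\<in>Basis. (?X (\<Psi> x) \<bullet> b) * (v \<bullet> gr (\<lambda>y. P y * (D\<Psi> y c \<bullet> b)) x) + (X' v \<bullet> b) * (P x * (D\<Psi> x c \<bullet> b)))) (at x)"
      by simp
    then have h: "((\<lambda>y. (P y *\<^sub>R ?g y) \<bullet> c) has_derivative
      (\<lambda>v. \<Sum>b\<in>Basis. (?X (\<Psi> x) \<bullet> b) * (v \<bullet> gr (\<lambda>y. P y * (D\<Psi> y c \<bullet> b)) x) + (X' v \<bullet> b) * (P x * (D\<Psi> x c \<bullet> b)))) (at x)"
      by (rule has_derivative_transform_within_open[OF _ \<Omega>(1) x]) (rule e)
    then have "GDERIV (\<lambda>y. (P y *\<^sub>R ?g y) \<bullet> c) x :> gr (\<lambda>y. (P y *\<^sub>R ?g y) \<bullet> c) x"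
      using gderiv_gr differentiable_def by blast
    from has_derivative_unique[OF this[unfolded gderiv_def] h, THEN fun_cong, of c]
    have "gr (\<lambda>y. (P y *\<^sub>R ?g y) \<bullet> c) x \<bullet> c
      = (\<Sum>b\<in>Basis. (?X (\<Psi> x) \<bullet> b) * (c \<bullet> gr (\<lambda>y. P y * (D\<Psi> y c \<bullet> b)) x) + (X' c \<bullet> b) * (P x * (D\<Psi> x c \<bullet> b)))"
      by (simp add: inner_commute)
    also have "\<dots> = P x * (X' c \<bullet> D\<Psi> x c) + (\<Sum>b\<in>Basis. (?X (\<Psi> x) \<bullet> b) * (gr (\<lambda>y. P y * (D\<Psi> y c \<bullet> b)) x \<bullet> c))"
      unfolding sum.distrib
      by (subst (4) euclidean_inner) (simp add: sum_distrib_left mult.left_commute inner_commute add.commute)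
    finally show ?thesis .
  qed
  have "dv (\<lambda>y. P y *\<^sub>R ?g y) x = P x * (\<Sum>c\<in>Basis. X' c \<bullet> D\<Psi> x c)
      + (\<Sum>c\<in>Basis. \<Sum>b\<in>Basis. (?X (\<Psi> x) \<bullet> b) * (gr (\<lambda>y. P y * (D\<Psi> y c \<bullet> b)) x \<bullet> c))"
    unfolding dv_def by (simp add: c sum.distrib sum_distrib_left del: inner_scaleR_left)
  also have "(\<Sum>c\<in>Basis. \<Sum>b\<in>Basis. (?X (\<Psi> x) \<bullet> b) * (gr (\<lambda>y. P y * (D\<Psi> y c \<bullet> b)) x \<bullet> c)) = 0"
    by (subst sum.swap) (simp add: harmonic[OF xU] flip: sum_distrib_left)
  finally have "dv (\<lambda>y. P y *\<^sub>R ?g y) x = P x * (\<Sum>c\<in>Basis. X' c \<bullet> D\<Psi> x c)" by simp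
  then show ?thesis
    unfolding surface_laplacian_def surface_divergence_chart[OF xU X hX]
    using P_pos[OF xU] by simp
qed

text \<open>The relation X . D\<Psi> c = grad u . c, with X the surface gradient, expresses the
  partial derivatives of the pullback through the ambient components of X, and these are C1 by
  assumption.\<close>

lemma Ck_pullback:
  assumes \<Omega>: "open \<Omega>" "\<Omega> \<subseteq> U" and D: "D = \<Psi> ` \<Omega>" and f: "surface_Ck_on 2 M D f"
  shows "C1_on \<Omega> (\<lambda>y. f (\<Psi> y))" "C1_field \<Omega> (gr (\<lambda>y. f (\<Psi> y)))"
proof -
  let ?g = "gr (\<lambda>y. f (\<Psi> y))" and ?X = "surface_gradient M f"
  have fd: "f differentiable (at (\<Psi> y) within M)" if "y \<in> \<Omega>" for y
    using f that D by (auto simp: numeral_2_eq_2)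
  have XC: "C1_on \<Omega> (\<lambda>y. ?X (\<Psi> y) \<bullet> b)" if b: "b \<in> Basis" for b
  proof -
    let ?h = "\<lambda>p. ?X p \<bullet> b"
    have hd: "?h differentiable (at (\<Psi> y) within M)" if "y \<in> \<Omega>" for y
      using f that D b by (auto simp: numeral_2_eq_2)
    have hc: "continuous_on D (\<lambda>p. surface_gradient M ?h p \<bullet> b')" if "b' \<in> Basis" for b'
      using f b that by (auto simp: numeral_2_eq_2)
    then have hc': "continuous_on D (surface_gradient M ?h)"
      by (subst continuous_on_componentwise) auto
    have g: "gr (\<lambda>y. ?h (\<Psi> y)) y \<bullet> c = surface_gradient M ?h (\<Psi> y) \<bullet> D\<Psi> y c" if "y \<in> \<Omega>" for y c
    proof -
      have yU: "y \<in> U" using that \<Omega> by auto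
      show ?thesis
        using surface_gradient_chart(2)[OF yU hd[OF that]] conformal[OF yU] lam_pos[OF yU] by simp
    qed
    have "continuous_on \<Omega> (gr (\<lambda>y. ?h (\<Psi> y)))"
    proof (subst continuous_on_componentwise, rule ballI)
      fix c :: 'a assume "c \<in> Basis"
      have "continuous_on \<Omega> (\<lambda>y. surface_gradient M ?h (\<Psi> y) \<bullet> D\<Psi> y c)"
        by (intro continuous_on_inner continuous_on_compose2[OF hc']
            continuous_on_subset[OF continuous_\<Psi>] continuous_on_subset[OF continuous_D] \<Omega>) (simp add: D)
      then show "continuous_on \<Omega> (\<lambda>y. gr (\<lambda>y. ?h (\<Psi> y)) y \<bullet> c)"
        by (rule continuous_on_eq) (simp add: g)
    qed
    then show ?thesis
      unfolding C1_on_def using surface_gradient_chart(1) hd \<Omega> by blast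
  qed
  show F: "C1_field \<Omega> ?g"
    unfolding C1_field_def
  proof
    fix c :: 'a assume "c \<in> Basis"
    have a: "C1_on \<Omega> (\<lambda>y. \<Sum>b\<in>Basis. (?X (\<Psi> y) \<bullet> b) * (D\<Psi> y c \<bullet> b))"
      by (intro C1_on_sum C1_on_mult XC C1_on_subset[OF C1_D \<Omega>(2)]) auto
    have b: "(\<Sum>b\<in>Basis. (?X (\<Psi> y) \<bullet> b) * (D\<Psi> y c \<bullet> b)) = ?g y \<bullet> c" if "y \<in> \<Omega>" for y
    proof -
      have yU: "y \<in> U" using that \<Omega> by auto
      have "(\<Sum>b\<in>Basis. (?X (\<Psi> y) \<bullet> b) * (D\<Psi> y c \<bullet> b)) = ?X (\<Psi> y) \<bullet> D\<Psi> y c"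
        by (rule euclidean_inner[symmetric])
      also have "\<dots> = ?g y \<bullet> c"
        using surface_gradient_chart(2)[OF yU fd[OF that]] conformal[OF yU] lam_pos[OF yU] by simp
      finally show ?thesis .
    qed
    show "C1_on \<Omega> (\<lambda>y. ?g y \<bullet> c)" by (rule C1_on_cong[OF \<Omega>(1) b a])
  qed
  show "C1_on \<Omega> (\<lambda>y. f (\<Psi> y))"
    unfolding C1_on_def using surface_gradient_chart(1) fd \<Omega> C1_field_continuous_on[OF F] by blast
qed

text \<open>Conversely X is lam^(-2) times the sum of the partial derivatives of the pullback times
  D\<Psi> c, a C1 expression on the chart that is carried to \<open>M\<close> by
  \<open>coord\<close>.\<close>

lemma Ck_pushforward:
  assumes \<Omega>: "open \<Omega>" "\<Omega> \<subseteq> U" and D: "D = \<Psi> ` \<Omega>"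
    and f: "C1_on \<Omega> (\<lambda>y. f (\<Psi> y))" "C1_field \<Omega> (gr (\<lambda>y. f (\<Psi> y)))"
  shows "surface_Ck_on 2 M D f"
proof -
  let ?g = "gr (\<lambda>y. f (\<Psi> y))" and ?X = "surface_gradient M f"
  have fd: "f differentiable (at (\<Psi> y) within M)" if "y \<in> \<Omega>" for y
    using f(1) that \<Omega> by (intro pushforward_differentiable) (auto simp: C1_on_def)
  have pc: "continuous_on D coord" "\<And>p. p \<in> D \<Longrightarrow> coord p \<in> \<Omega> \<and> \<Psi> (coord p) = p"
    using continuous_on_subset[OF continuous_coord, of D] D \<Omega> image coord by auto
  have l2: "C1_on \<Omega> (\<lambda>y. 1 / (lam y)\<^sup>2)"
  proof (rule C1_on_compose[where h="\<lambda>s. 1 / s\<^sup>2" and h'="\<lambda>s. - 2 / s ^ 3"])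
    show "C1_on \<Omega> lam" by (rule C1_on_subset[OF C1_lam \<Omega>(2)])
    show "((\<lambda>s. 1 / s\<^sup>2) has_real_derivative - 2 / (lam x) ^ 3) (at (lam x))" if "x \<in> \<Omega>" for x
    proof -
      have "lam x \<noteq> 0" using lam_pos[of x] that \<Omega> by auto
      then show ?thesis
        by (auto intro!: derivative_eq_intros simp: field_simps power_numeral_reduce)
    qed
    show "continuous_on (lam ` \<Omega>) (\<lambda>s. - 2 / s ^ 3)"
      using lam_pos \<Omega> by (force intro!: continuous_intros)
  qed
  have XC: "C1_on \<Omega> (\<lambda>y. ?X (\<Psi> y) \<bullet> b)" for b
  proof -
    have a: "C1_on \<Omega> (\<lambda>y. \<Sum>c\<in>Basis. (1 / (lam y)\<^sup>2) * ((?g y \<bullet> c) * (D\<Psi> y c \<bullet> b)))"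
      using f(2) by (intro C1_on_sum C1_on_mult l2 C1_on_subset[OF C1_D \<Omega>(2)]) (auto simp: C1_field_def)
    have e: "(\<Sum>c\<in>Basis. (1 / (lam y)\<^sup>2) * ((?g y \<bullet> c) * (D\<Psi> y c \<bullet> b))) = ?X (\<Psi> y) \<bullet> b" if "y \<in> \<Omega>" for y
    proof -
      have yU: "y \<in> U" using that \<Omega> by auto
      have "D\<Psi> y (?g y) = D\<Psi> y (\<Sum>c\<in>Basis. (?g y \<bullet> c) *\<^sub>R c)" by (simp add: euclidean_representation)
      also have "\<dots> = (\<Sum>c\<in>Basis. (?g y \<bullet> c) *\<^sub>R D\<Psi> y c)"
        by (simp add: linear_sum[OF linear_D[OF yU]] linear_cmul[OF linear_D[OF yU]])
      finally show ?thesis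
        unfolding surface_gradient_chart(2)[OF yU fd[OF that]]
        by (simp add: inner_sum_left sum_distrib_left)
    qed
    show ?thesis by (rule C1_on_cong[OF \<Omega>(1) e a])
  qed
  have Xd: "(\<lambda>p. ?X p \<bullet> b) differentiable (at (\<Psi> y) within M)" if "y \<in> \<Omega>" for y b
    using XC that \<Omega> by (intro pushforward_differentiable) (auto simp: C1_on_def)
  have Xc: "continuous_on D (\<lambda>p. surface_gradient M (\<lambda>p. ?X p \<bullet> b) p \<bullet> b')" for b b'
  proof -
    let ?h = "gr (\<lambda>y. ?X (\<Psi> y) \<bullet> b)"
    have "continuous_on \<Omega> (\<lambda>y. (1 / (lam y)\<^sup>2) * (\<Sum>c\<in>Basis. (?h y \<bullet> c) * (D\<Psi> y c \<bullet> b')))"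
      by (intro continuous_on_mult continuous_on_sum continuous_on_inner continuous_on_const C1_on_gr[OF XC]
          C1_on_imp_continuous_on[OF l2] continuous_on_subset[OF continuous_D \<Omega>(2)])
    then have "continuous_on D (\<lambda>p. (1 / (lam (coord p))\<^sup>2) * (\<Sum>c\<in>Basis. (?h (coord p) \<bullet> c) * (D\<Psi> (coord p) c \<bullet> b')))"
      by (rule continuous_on_compose2[OF _ pc(1)]) (use pc(2) in auto)
    moreover have "(1 / (lam (coord p))\<^sup>2) * (\<Sum>c\<in>Basis. (?h (coord p) \<bullet> c) * (D\<Psi> (coord p) c \<bullet> b'))
      = surface_gradient M (\<lambda>p. ?X p \<bullet> b) p \<bullet> b'" if "p \<in> D" for p
    proof -
      define y where "y = coord p"
      have y: "y \<in> \<Omega>" "\<Psi> y = p" "y \<in> U" using pc(2)[OF that] \<Omega> by (auto simp: y_def)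
      have "D\<Psi> y (?h y) = D\<Psi> y (\<Sum>c\<in>Basis. (?h y \<bullet> c) *\<^sub>R c)" by (simp add: euclidean_representation)
      also have "\<dots> = (\<Sum>c\<in>Basis. (?h y \<bullet> c) *\<^sub>R D\<Psi> y c)"
        by (simp add: linear_sum[OF linear_D[OF y(3)]] linear_cmul[OF linear_D[OF y(3)]])
      finally show ?thesis
        using surface_gradient_chart(2)[OF y(3) Xd[OF y(1), of b]]
        unfolding y_def[symmetric] y(2) by (simp add: inner_sum_left sum_distrib_left)
    qed
    ultimately show ?thesis by (rule continuous_on_eq) 
  qed
  show ?thesis using fd Xd Xc D by (simp add: numeral_2_eq_2)
qed

end

section \<open>The profile of the catenoid\<close>

text \<open>The catenoid in the conformal parameter \<open>t\<close>: the first integral of the profile equation gives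
  \<open>\<phi> = \<phi>\<^sub>0 cosh (m t)\<^bsup>1/m\<^esup>\<close> with \<open>m = n - 1\<close>, when \<open>dt = \<phi>\<^sup>-\<^sup>1\<close> times arc length.\<close>

locale catenoid_param =
  fixes m :: nat and \<phi>\<^sub>0 :: real
  assumes m2: "m \<ge> 2" and \<phi>\<^sub>0: "\<phi>\<^sub>0 > 0"
begin

definition csh :: "real \<Rightarrow> real" where "csh t = cosh (real m * t)"
definition T :: "real \<Rightarrow> real" where "T t = tanh (real m * t)"
definition Phi :: "real \<Rightarrow> real" where "Phi t = \<phi>\<^sub>0 * csh t powr (1 / real m)"
text \<open>The derivative of the height in t: the profile curve has speed Phi in this parameter,
  and 1 / csh is the vertical component of its unit tangent.\<close>

definition dsig :: "real \<Rightarrow> real" where "dsig t = Phi t / csh t"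

lemma csh_ge_1: "csh t \<ge> 1" unfolding csh_def by (rule cosh_real_ge_1)
lemma csh_pos: "csh t > 0" using csh_ge_1[of t] by linarith
lemma Phi_pos: "Phi t > 0" unfolding Phi_def using \<phi>\<^sub>0 csh_pos[of t] by simp
lemma dsig_pos: "dsig t > 0" unfolding dsig_def using Phi_pos[of t] csh_pos[of t] by simp

lemma m0: "real m > 0" using m2 by simp

lemma csh_0 [simp]: "csh 0 = 1" by (simp add: csh_def)
lemma T_0 [simp]: "T 0 = 0" by (simp add: T_def)
lemma Phi_0 [simp]: "Phi 0 = \<phi>\<^sub>0" by (simp add: Phi_def)
lemma dsig_0 [simp]: "dsig 0 = \<phi>\<^sub>0" by (simp add: dsig_def)
lemma csh_minus [simp]: "csh (- t) = csh t" by (simp add: csh_def)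
lemma T_minus [simp]: "T (- t) = - T t" by (simp add: T_def)
lemma Phi_minus [simp]: "Phi (- t) = Phi t" by (simp add: Phi_def)
lemma dsig_minus [simp]: "dsig (- t) = dsig t" by (simp add: dsig_def)

lemma T_square: "1 - (T t)\<^sup>2 = 1 / (csh t)\<^sup>2"
proof -
  have "(cosh (real m * t))\<^sup>2 - (sinh (real m * t))\<^sup>2 = 1" by (rule hyperbolic_pythagoras)
  moreover have "1 - (a / b)\<^sup>2 = (b\<^sup>2 - a\<^sup>2) / b\<^sup>2" if "b \<noteq> 0" for a b :: real
    using that by (simp add: power_divide diff_divide_distrib)
  ultimately show ?thesis using csh_pos[of t] unfolding T_def csh_def tanh_def by simp
qed

lemma deriv_csh: "(csh has_real_derivative real m * (T t * csh t)) (at t)"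
proof -
  have "(csh has_real_derivative real m * sinh (real m * t)) (at t)"
    unfolding csh_def[abs_def] by (auto intro!: derivative_eq_intros)
  then show ?thesis using csh_pos[of t] by (simp add: T_def csh_def tanh_def)
qed

lemma deriv_T: "(T has_real_derivative real m * (1 - (T t)\<^sup>2)) (at t)"
  unfolding T_def[abs_def] by (rule has_real_derivative_tanh_scaled)

lemma deriv_Phi: "(Phi has_real_derivative Phi t * T t) (at t)"
proof -
  have "((\<lambda>t. csh t powr (1 / real m)) has_real_derivative
      1 / real m * csh t powr (1 / real m - 1) * (real m * (T t * csh t))) (at t)"
    using csh_pos[of t]
    by (intro DERIV_chain2[OF has_real_derivative_powr deriv_csh, THEN DERIV_cong]) (auto simp: mult_ac)
  moreover have "csh t powr (1 / real m - 1) * csh t = csh t powr (1 / real m)"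
    using csh_pos[of t] by (simp add: powr_diff)
  ultimately have "((\<lambda>t. csh t powr (1 / real m)) has_real_derivative csh t powr (1 / real m) * T t) (at t)"
    using m0 by (simp add: mult_ac)
  from DERIV_cmult[OF this, of \<phi>\<^sub>0] show ?thesis by (simp add: Phi_def[abs_def] mult_ac)
qed

lemma deriv_dsig: "(dsig has_real_derivative - (real m - 1) * T t * dsig t) (at t)"
proof -
  have "(dsig has_real_derivative ((Phi t * T t) * csh t - Phi t * (real m * (T t * csh t))) / (csh t * csh t)) (at t)"
    unfolding dsig_def[abs_def] using csh_pos[of t] by (intro DERIV_divide deriv_Phi deriv_csh) auto
  moreover have "((Phi t * T t) * csh t - Phi t * (real m * (T t * csh t))) / (csh t * csh t) = - (real m - 1) * T t * dsig t"
    using csh_pos[of t] by (simp add: dsig_def field_simps)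
  ultimately show ?thesis by simp
qed

lemma isCont_dsig: "isCont dsig t" using deriv_dsig by (rule DERIV_isCont)

text \<open>The height as a function of t, zero at the waist. It is an antiderivative without closed
  form, known only through its derivative.\<close>

definition sig :: "real \<Rightarrow> real" where
  "sig = (SOME F. F 0 = 0 \<and> (\<forall>t. (F has_real_derivative dsig t) (at t)))"

lemma sig: "sig 0 = 0" "(sig has_real_derivative dsig t) (at t)"
proof -
  obtain F where F: "\<And>t. (F has_vector_derivative dsig t) (at t)"
    using einterval_antiderivative[of "-\<infinity>" "\<infinity>" dsig] isCont_dsig by auto
  have "((\<lambda>t. F t - F 0) has_real_derivative dsig t) (at t)" for t
    using F[of t] by (auto simp: has_real_derivative_iff_has_vector_derivative intro!: derivative_eq_intros)
  then have "\<exists>F. F 0 = 0 \<and> (\<forall>t. (F has_real_derivative dsig t) (at t))"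
    by (intro exI[of _ "\<lambda>t. F t - F 0"]) auto
  from someI_ex[OF this] show "sig 0 = 0" "(sig has_real_derivative dsig t) (at t)"
    unfolding sig_def by auto
qed

lemma isCont_sig: "isCont sig t" using sig(2) by (rule DERIV_isCont)

lemma sig_strict: "s < t \<Longrightarrow> sig s < sig t"
  by (rule DERIV_pos_imp_increasing) (use sig(2) dsig_pos in blast)+

lemma sig_inj: "sig s = sig t \<Longrightarrow> s = t"
  using sig_strict[of s t] sig_strict[of t s] by (metis less_irrefl linorder_neqE_linordered_idom)

lemma sig_minus: "sig (- t) = - sig t"
proof -
  have "((\<lambda>t. sig (- t) + sig t) has_real_derivative 0) (at t)" for t
  proof -
    have "((\<lambda>t. sig (- t)) has_real_derivative dsig (- t) * (-1)) (at t)"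
      by (rule DERIV_chain2[where f=sig and g=uminus, OF sig(2)]) (auto intro!: derivative_eq_intros)
    from DERIV_add[OF this sig(2)[of t]] show ?thesis by simp
  qed
  then have "sig (- t) + sig t = sig (- 0) + sig 0"
    by (intro DERIV_isconst_all[of "\<lambda>t. sig (- t) + sig t"]) auto
  then show ?thesis by (simp add: sig(1))
qed

text \<open>\<open>dsig\<close> is a multiple of csh to the negative power 1 / m - 1, and csh is at
  least exp (m t) / 2. For m \<ge> 2 this gives decay at least like exp (- t), so the height is
  finite; for m = 1 \<open>dsig\<close> would be constant. The factor 2 bounds 2^(1 - 1 /
  m).\<close>

lemma dsig_le: "t \<ge> 0 \<Longrightarrow> dsig t \<le> 2 * \<phi>\<^sub>0 * exp (- t)"
proof -
  assume t: "t \<ge> 0"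
  have "exp (real m * t) / 2 \<le> csh t" unfolding csh_def cosh_def by simp
  then have "csh t powr (1 / real m - 1) \<le> (exp (real m * t) / 2) powr (1 / real m - 1)"
    using m2 by (intro powr_mono2') (auto simp: field_simps)
  also have "\<dots> = exp (real m * t) powr (1 / real m - 1) / 2 powr (1 / real m - 1)"
    by (simp add: powr_divide)
  also have "exp (real m * t) powr (1 / real m - 1) = exp (- (real m - 1) * t)"
    using m0 by (simp add: powr_def field_simps)
  also have "exp (- (real m - 1) * t) / 2 powr (1 / real m - 1) \<le> exp (- t) * 2"
  proof -
    have "t * 2 \<le> t * real m" using t m2 by (intro mult_left_mono) auto
    then have "exp (- (real m - 1) * t) \<le> exp (- t)" by (simp add: algebra_simps)
    moreover have "1 / 2 powr (1 / real m - 1) \<le> (2::real)"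
    proof -
      have "(2::real) powr (-1) \<le> 2 powr (1 / real m - 1)" by (intro powr_mono) auto
      then show ?thesis by (simp add: field_simps powr_minus)
    qed
    ultimately have "exp (- (real m - 1) * t) * (1 / 2 powr (1 / real m - 1)) \<le> exp (- t) * 2"
      by (intro mult_mono) auto
    then show ?thesis by simp
  qed
  finally have "csh t powr (1 / real m - 1) \<le> exp (- t) * 2" .
  moreover have "dsig t = \<phi>\<^sub>0 * csh t powr (1 / real m - 1)"
    using csh_pos[of t] by (simp add: dsig_def Phi_def powr_diff)
  ultimately show ?thesis using \<phi>\<^sub>0 by (simp add: mult_ac)
qed

lemma dsig_tendsto_0: "(dsig \<longlongrightarrow> 0) at_top"
proof (rule tendsto_sandwich)
  show "\<forall>\<^sub>F t in at_top. 0 \<le> dsig t" by (intro always_eventually allI less_imp_le dsig_pos)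
  show "\<forall>\<^sub>F t in at_top. dsig t \<le> 2 * \<phi>\<^sub>0 * exp (- t)"
    using dsig_le by (auto simp: eventually_at_top_linorder intro!: exI[of _ 0])
  have "((\<lambda>t::real. 2 * \<phi>\<^sub>0 * exp (- t)) \<longlongrightarrow> 2 * \<phi>\<^sub>0 * 0) at_top"
    by (intro tendsto_intros filterlim_compose[OF exp_at_bot] filterlim_uminus_at_bot_at_top)
  then show "((\<lambda>t::real. 2 * \<phi>\<^sub>0 * exp (- t)) \<longlongrightarrow> 0) at_top" by simp
qed simp

lemma sig_bounded: "sig t \<le> 2 * \<phi>\<^sub>0"
proof (cases "t \<ge> 0")
  case True
  have "\<exists>y. ((\<lambda>t. sig t + 2 * \<phi>\<^sub>0 * exp (- t)) has_real_derivative y) (at s) \<and> y \<le> 0" if "0 \<le> s" "s \<le> t" for s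
    using dsig_le[OF that(1)]
    by (intro exI[of _ "dsig s - 2 * \<phi>\<^sub>0 * exp (- s)"] conjI) (auto intro!: derivative_eq_intros sig)
  then have "sig t + 2 * \<phi>\<^sub>0 * exp (- t) \<le> sig 0 + 2 * \<phi>\<^sub>0 * exp (- 0)"
    using True by (intro DERIV_nonpos_imp_nonincreasing[of 0 t "\<lambda>t. sig t + 2 * \<phi>\<^sub>0 * exp (- t)"]) auto
  moreover have "0 \<le> 2 * \<phi>\<^sub>0 * exp (- t)" using \<phi>\<^sub>0 by simp
  ultimately show ?thesis using sig(1) by simp
next
  case False
  then show ?thesis using sig_strict[of t 0] sig(1) \<phi>\<^sub>0 by simp
qed

section \<open>The height of the catenoid\<close>

definition S :: real where "S = Sup (range sig)"

lemma bdd_sig: "bdd_above (range sig)"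
  by (rule bdd_aboveI[of _ "2 * \<phi>\<^sub>0"]) (use sig_bounded in auto)

lemma sig_exceeds: "a < S \<Longrightarrow> \<exists>t. a < sig t"
  unfolding S_def using less_cSup_iff[of "range sig" a] bdd_sig by auto

lemma sig_tendsto: "(sig \<longlongrightarrow> S) at_top"
proof (rule order_tendstoI)
  fix a assume "a < S"
  then obtain t where t: "a < sig t" using sig_exceeds by blast
  show "\<forall>\<^sub>F s in at_top. a < sig s"
    using eventually_gt_at_top[of t] by eventually_elim (use sig_strict t in force)
next
  fix a assume a: "S < a"
  have "sig t \<le> S" for t
    unfolding S_def by (intro cSup_upper bdd_sig) auto
  then show "\<forall>\<^sub>F s in at_top. sig s < a" using a by (auto intro!: always_eventually intro: le_less_trans)
qed

lemma sig_less: "sig t < S"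
proof -
  have "sig t < sig (t + 1)" by (rule sig_strict) simp
  also have "\<dots> \<le> S" unfolding S_def by (intro cSup_upper bdd_sig) auto
  finally show ?thesis .
qed

lemma range_sig: "range sig = {-S<..<S}"
proof (intro equalityI subsetI)
  fix s assume "s \<in> range sig"
  then obtain t where "s = sig t" by auto
  then show "s \<in> {-S<..<S}" using sig_less[of t] sig_less[of "- t"] sig_minus[of t] by simp
next
  fix s assume s: "s \<in> {-S<..<S}"
  obtain t1 where t1: "s < sig t1" using sig_exceeds[of s] s by auto
  obtain t2 where t2: "- s < sig t2" using sig_exceeds[of "- s"] s by auto
  have "sig (- t2) \<le> s" "s \<le> sig t1" using t1 t2 sig_minus by auto
  moreover from this have "- t2 \<le> t1" using sig_strict[of t1 "- t2"] by force
  ultimately obtain t where "sig t = s" using IVT[of sig "- t2" s t1] isCont_sig by auto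
  then show "s \<in> range sig" by auto
qed

lemma S_pos: "S > 0" using sig_less[of 0] sig(1) by simp

text \<open>The substitution \<tau> = Phi t, inverted by t = arcosh ((\<tau> /
  \<open>\<phi>\<^sub>0\<close>)^m) / m, makes \<open>F\<close> the height as a function of the
  radius. It is a primitive of the nonnegative integrand and runs from 0 at the waist to
  \<open>S\<close> at infinity, so the fundamental theorem for improper integrals applies.\<close>

lemma half_height: "catenoid_half_height (Suc m) \<phi>\<^sub>0 = S"
proof -
  define c where "c \<tau> = (\<tau> / \<phi>\<^sub>0) ^ m" for \<tau>
  define f where "f \<tau> = 1 / sqrt (1 / \<phi>\<^sub>0 ^ (2 * m) * \<tau> ^ (2 * m) - 1)" for \<tau>
  define F where "F \<tau> = sig (arcosh (c \<tau>) / real m)" for \<tau>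
  have c2: "1 / \<phi>\<^sub>0 ^ (2 * m) * \<tau> ^ (2 * m) = (c \<tau>)\<^sup>2" for \<tau>
    by (simp add: c_def power_divide power_mult power2_eq_square flip: power_mult_distrib)
  have c1: "c \<tau> > 1" if "\<tau> > \<phi>\<^sub>0" for \<tau>
    unfolding c_def using that \<phi>\<^sub>0 m2 by (intro one_less_power) auto
  have cs: "csh (arcosh (c \<tau>) / real m) = c \<tau>" if "\<tau> > \<phi>\<^sub>0" for \<tau>
    using c1[OF that] m0 by (simp add: csh_def)
  have Ph: "Phi (arcosh (c \<tau>) / real m) = \<tau>" if "\<tau> > \<phi>\<^sub>0" for \<tau>
  proof -
    have "c \<tau> powr (1 / real m) = \<tau> / \<phi>\<^sub>0"
      using that \<phi>\<^sub>0 m0 by (simp add: c_def powr_powr flip: powr_realpow)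
    then show ?thesis using \<phi>\<^sub>0 by (simp add: Phi_def cs[OF that])
  qed
  have dF: "DERIV F \<tau> :> f \<tau>" if t: "\<tau> > \<phi>\<^sub>0" for \<tau>
  proof -
    have "(c has_real_derivative real m * (\<tau> / \<phi>\<^sub>0) ^ (m - 1) / \<phi>\<^sub>0) (at \<tau>)"
      unfolding c_def[abs_def] using \<phi>\<^sub>0 by (auto intro!: derivative_eq_intros)
    from DERIV_chain2[OF arcosh_real_has_field_derivative[OF c1[OF t]] this]
    have "((\<lambda>\<tau>. arcosh (c \<tau>)) has_real_derivative 1 / sqrt ((c \<tau>)\<^sup>2 - 1) * (real m * (\<tau> / \<phi>\<^sub>0) ^ (m - 1) / \<phi>\<^sub>0)) (at \<tau>)" .
    from DERIV_cdivide[OF this, of "real m"]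
    have "((\<lambda>\<tau>. arcosh (c \<tau>) / real m) has_real_derivative 1 / sqrt ((c \<tau>)\<^sup>2 - 1) * ((\<tau> / \<phi>\<^sub>0) ^ (m - 1) / \<phi>\<^sub>0)) (at \<tau>)"
      using m0 by (simp add: field_simps)
    from DERIV_chain2[OF sig(2) this]
    have "(F has_real_derivative dsig (arcosh (c \<tau>) / real m) * (1 / sqrt ((c \<tau>)\<^sup>2 - 1) * ((\<tau> / \<phi>\<^sub>0) ^ (m - 1) / \<phi>\<^sub>0))) (at \<tau>)"
      unfolding F_def .
    moreover have "dsig (arcosh (c \<tau>) / real m) * ((\<tau> / \<phi>\<^sub>0) ^ (m - 1) / \<phi>\<^sub>0) = 1"
    proof -
      have "c \<tau> = (\<tau> / \<phi>\<^sub>0) * (\<tau> / \<phi>\<^sub>0) ^ (m - 1)"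
        unfolding c_def using m2 by (metis One_nat_def Suc_1 Suc_le_D diff_Suc_1 power_Suc)
      moreover have "\<tau> * ((\<tau> / \<phi>\<^sub>0) ^ (m - 1) / \<phi>\<^sub>0) = (\<tau> / \<phi>\<^sub>0) * (\<tau> / \<phi>\<^sub>0) ^ (m - 1)"
        by (simp only: times_divide_eq_right times_divide_eq_left)
      ultimately have "\<tau> * ((\<tau> / \<phi>\<^sub>0) ^ (m - 1) / \<phi>\<^sub>0) = c \<tau>" by (simp only:)
      then have "\<tau> / c \<tau> * ((\<tau> / \<phi>\<^sub>0) ^ (m - 1) / \<phi>\<^sub>0) = c \<tau> / c \<tau>"
        by (simp only: times_divide_eq_left)
      moreover have "c \<tau> / c \<tau> = 1" using c1[OF t] by simp
      ultimately show ?thesis unfolding dsig_def cs[OF t] Ph[OF t] by (simp only:)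
    qed
    moreover have "a * (b * d) = b" if "a * d = 1" for a b d :: real
      using that by (simp add: mult.left_commute)
    ultimately have "(F has_real_derivative 1 / sqrt ((c \<tau>)\<^sup>2 - 1)) (at \<tau>)"
      by simp
    then show ?thesis unfolding f_def c2 .
  qed
  have cf: "isCont f \<tau>" if "\<tau> > \<phi>\<^sub>0" for \<tau>
  proof -
    have "(c \<tau>)\<^sup>2 > 1" using c1[OF that] by (simp add: one_less_power)
    then show ?thesis unfolding f_def using c2[of \<tau>] by (intro continuous_intros) auto
  qed
  have ccont: "isCont c \<tau>" for \<tau> unfolding c_def using \<phi>\<^sub>0 by (intro continuous_intros) auto
  have A: "(F \<longlongrightarrow> 0) (at_right \<phi>\<^sub>0)"
  proof -
    have "(c \<longlongrightarrow> c \<phi>\<^sub>0) (at_right \<phi>\<^sub>0)"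
      using ccont[of \<phi>\<^sub>0] by (auto simp: isCont_def intro: tendsto_mono[OF at_le])
    then have "(c \<longlongrightarrow> 1) (at_right \<phi>\<^sub>0)" using \<phi>\<^sub>0 by (simp add: c_def)
    moreover have "\<forall>\<^sub>F \<tau> in at_right \<phi>\<^sub>0. c \<tau> > 1"
      using c1 by (auto simp: eventually_at_right_field intro!: exI[of _ "\<phi>\<^sub>0 + 1"])
    ultimately have "filterlim c (at_right 1) (at_right \<phi>\<^sub>0)"
      by (auto simp: filterlim_at elim: eventually_mono)
    from filterlim_compose[OF tendsto_arcosh_at_left_1 this]
    have "((\<lambda>\<tau>. arcosh (c \<tau>) / real m) \<longlongrightarrow> 0 / real m) (at_right \<phi>\<^sub>0)"
      by (intro tendsto_intros) (use m0 in auto)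
    then have "((\<lambda>\<tau>. sig (arcosh (c \<tau>) / real m)) \<longlongrightarrow> sig 0) (at_right \<phi>\<^sub>0)"
      using isCont_tendsto_compose[OF isCont_sig[of 0]] by simp
    then show ?thesis by (simp add: F_def[abs_def] sig(1))
  qed
  have B: "(F \<longlongrightarrow> S) at_top"
  proof -
    have "filterlim c at_top at_top"
    proof -
      have "filterlim (\<lambda>\<tau>. \<tau> / \<phi>\<^sub>0) at_top at_top"
        using \<phi>\<^sub>0 filterlim_tendsto_pos_mult_at_top[OF tendsto_const[of "1 / \<phi>\<^sub>0"] _ filterlim_ident]
        by simp
      then show ?thesis unfolding c_def using m2 by (intro filterlim_pow_at_top) auto
    qed
    from filterlim_compose[OF arcosh_real_at_top this]
    have "filterlim (\<lambda>\<tau>. (1 / real m) * arcosh (c \<tau>)) at_top at_top"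
      using m0 by (intro filterlim_tendsto_pos_mult_at_top[OF tendsto_const]) auto
    then have "filterlim (\<lambda>\<tau>. arcosh (c \<tau>) / real m) at_top at_top" by simp
    from filterlim_compose[OF sig_tendsto this] show ?thesis by (simp add: F_def[abs_def])
  qed
  have fnn: "0 \<le> f \<tau>" if "\<tau> > \<phi>\<^sub>0" for \<tau>
  proof -
    have "(c \<tau>)\<^sup>2 > 1" using c1[OF that] by (simp add: one_less_power)
    then show ?thesis unfolding f_def c2 by simp
  qed
  have "set_integrable lborel (einterval (ereal \<phi>\<^sub>0) \<infinity>) f"
    by (rule interval_integral_FTC_nonneg(1)[of "ereal \<phi>\<^sub>0" \<infinity> F f 0 S])
      (use dF cf fnn A B in \<open>auto simp: ereal_tendsto_simps\<close>)
  moreover have "(LBINT x=ereal \<phi>\<^sub>0..\<infinity>. f x) = S - 0"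
    by (rule interval_integral_FTC_nonneg(2)[of "ereal \<phi>\<^sub>0" \<infinity> F f 0 S])
      (use dF cf fnn A B in \<open>auto simp: ereal_tendsto_simps\<close>)
  moreover have "einterval (ereal \<phi>\<^sub>0) \<infinity> = {\<phi>\<^sub>0<..}" by (auto simp: einterval_def)
  ultimately have "set_integrable lborel {\<phi>\<^sub>0<..} f" "(LINT x : {\<phi>\<^sub>0<..} | lborel. f x) = S"
    by (auto simp: interval_integral_to_infinity_eq)
  then have "integral {\<phi>\<^sub>0<..} f = S" using set_borel_integral_eq_integral(2) by metis
  then show ?thesis unfolding catenoid_half_height_def f_def by (simp add: Let_def)
qed

text \<open>Uniqueness: \<open>v = (\<phi>/\<phi>\<^sub>0)\<^sup>m\<close> and \<open>\<phi>'\<close> solve a linear system in the parameter \<open>t\<close>.\<close>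

lemma profile_unique:
  assumes "catenoid_profile (Suc m) \<phi>\<^sub>0 S' \<phi>"
  shows "S' = S" "\<phi> (sig t) = Phi t"
    "\<exists>\<tau>. \<forall>t. \<tau> (sig t) = t \<and> (\<tau> has_real_derivative 1 / dsig t) (at (sig t))"
proof -
  show S': "S' = S" using assms half_height by (simp add: catenoid_profile_def)
  note prof = assms[unfolded catenoid_profile_def S']
  note p0 = prof[THEN conjunct2, THEN conjunct1] and ex = prof[THEN conjunct2, THEN conjunct2]
  obtain \<phi>' \<phi>'' where h0: "\<phi> 0 = \<phi>\<^sub>0" "\<phi>' 0 = 0" and
    hh: "\<forall>s\<in>{-S<..<S}. \<phi> s > 0 \<and> (\<phi> has_real_derivative \<phi>' s) (at s) \<and>
      (\<phi>' has_real_derivative \<phi>'' s) (at s) \<and>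
      \<phi>'' s / (1 + (\<phi>' s)\<^sup>2) powr (3 / 2) - (real (Suc m) - 1) / (\<phi> s * (1 + (\<phi>' s)\<^sup>2) powr (1 / 2)) = 0"
    using p0 ex by blast
  have h: "\<phi> s > 0" "(\<phi> has_real_derivative \<phi>' s) (at s)" "(\<phi>' has_real_derivative \<phi>'' s) (at s)"
      "\<phi>'' s / (1 + (\<phi>' s)\<^sup>2) powr (3 / 2) - (real (Suc m) - 1) / (\<phi> s * (1 + (\<phi>' s)\<^sup>2) powr (1 / 2)) = 0"
    if "s \<in> {-S<..<S}" for s
    using hh that by blast+
  have z: "0 \<in> {-S<..<S}" using S_pos by simp
  have ode: "\<phi>'' s = real m * (1 + (\<phi>' s)\<^sup>2) / \<phi> s" if s: "s \<in> {-S<..<S}" for s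
  proof -
    define w where "w = 1 + (\<phi>' s)\<^sup>2"
    have w: "w > 0" unfolding w_def by (simp add: add_pos_nonneg)
    define r where "r = w powr (1/2)"
    have r: "r > 0" using w by (simp add: r_def)
    have "w powr (3/2) = w * r" unfolding r_def using w powr_add[of w 1 "1/2"] by simp
    then have "\<phi>'' s / (w * r) = real m / (\<phi> s * r)"
      using h(4)[OF s] by (simp add: w_def[symmetric] r_def[symmetric])
    then have "\<phi>'' s = real m * w / \<phi> s" using w r h(1)[OF s] by (simp add: field_simps)
    then show ?thesis by (simp add: w_def)
  qed
  define v where "v s = (\<phi> s / \<phi>\<^sub>0) ^ m" for s
  \<comment> \<open>This will be dt/ds, the rate of the conformal parameter t with respect to the
    height s; note that v' = m \<phi>' g.\<close>
  define g where "g s = v s / \<phi> s" for s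
  have v_pos: "v s > 0" if "s \<in> {-S<..<S}" for s using h(1)[OF that] \<phi>\<^sub>0 by (simp add: v_def)
  have dv: "(v has_real_derivative real m * \<phi>' s * g s) (at s)" if s: "s \<in> {-S<..<S}" for s
  proof -
    have "(v has_real_derivative real m * (\<phi> s / \<phi>\<^sub>0) ^ (m - 1) * (\<phi>' s / \<phi>\<^sub>0)) (at s)"
      unfolding v_def[abs_def] using \<phi>\<^sub>0 by (auto intro!: derivative_eq_intros h(2)[OF s])
    moreover have "(\<phi> s / \<phi>\<^sub>0) ^ (m - 1) / \<phi>\<^sub>0 = g s"
    proof -
      have "v s = (\<phi> s / \<phi>\<^sub>0) * (\<phi> s / \<phi>\<^sub>0) ^ (m - 1)"
        unfolding v_def using m2 by (metis One_nat_def Suc_1 Suc_le_D diff_Suc_1 power_Suc)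
      then show ?thesis unfolding g_def using h(1)[OF s] by simp
    qed
    moreover have "real m * (\<phi> s / \<phi>\<^sub>0) ^ (m - 1) * (\<phi>' s / \<phi>\<^sub>0) = real m * \<phi>' s * ((\<phi> s / \<phi>\<^sub>0) ^ (m - 1) / \<phi>\<^sub>0)"
      by simp
    ultimately show ?thesis by (simp only:)
  qed
  have v2: "1 + (\<phi>' s)\<^sup>2 = (v s)\<^sup>2" if s: "s \<in> {-S<..<S}" for s
  proof -
    \<comment> \<open>The first integral of the profile equation: this quotient has derivative zero
      and equals 1 at the waist.\<close>
    define e where "e s = (1 + (\<phi>' s)\<^sup>2) / (v s)\<^sup>2" for s
    have "(e has_real_derivative 0) (at s)" if s: "s \<in> {-S<..<S}" for s
    proof -
      have "(e has_real_derivative ((2 * \<phi>' s * \<phi>'' s) * (v s)\<^sup>2 - (1 + (\<phi>' s)\<^sup>2) * (2 * v s * (real m * \<phi>' s * g s))) / ((v s)\<^sup>2 * (v s)\<^sup>2)) (at s)"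
        unfolding e_def[abs_def] using v_pos[OF s]
        by (intro DERIV_divide) (auto intro!: derivative_eq_intros h(3)[OF s] dv[OF s])
      moreover have "(2 * \<phi>' s * \<phi>'' s) * (v s)\<^sup>2 - (1 + (\<phi>' s)\<^sup>2) * (2 * v s * (real m * \<phi>' s * g s)) = 0"
        unfolding ode[OF s] g_def using h(1)[OF s] by (simp add: field_simps power2_eq_square)
      ultimately show ?thesis by simp
    qed
    then have "e s = e 0" using s z S_pos by (intro DERIV_isconst3[of "-S" S]) auto
    also have "e 0 = 1" using h0 \<phi>\<^sub>0 by (simp add: e_def v_def)
    finally show ?thesis using v_pos[OF s] by (simp add: e_def field_simps)
  qed
  have "\<exists>F. \<forall>x. ereal (- S) < ereal x \<longrightarrow> ereal x < ereal S \<longrightarrow> (F has_vector_derivative g x) (at x)"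
  proof (rule einterval_antiderivative)
    fix x assume "ereal (- S) < ereal x" "ereal x < ereal S"
    then have x: "x \<in> {-S<..<S}" by simp
    show "isCont g x" unfolding g_def
      using DERIV_isCont[OF dv[OF x]] DERIV_isCont[OF h(2)[OF x]] h(1)[OF x] by (intro continuous_intros) auto
  qed (use S_pos in simp)
  then obtain F where F: "\<And>s. s \<in> {-S<..<S} \<Longrightarrow> (F has_real_derivative g s) (at s)"
    by (auto simp: has_real_derivative_iff_has_vector_derivative)
  define \<tau> where "\<tau> s = F s - F 0" for s
  have d\<tau>: "(\<tau> has_real_derivative g s) (at s)" if "s \<in> {-S<..<S}" for s
    unfolding \<tau>_def using F[OF that] by (auto intro!: derivative_eq_intros)
  have \<tau>0: "\<tau> 0 = 0" by (simp add: \<tau>_def)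
  \<comment> \<open>With respect to \<tau> the derivatives of v and \<phi>' are m \<phi>' and m v.
    For a = 1 and a = -1 the combinations v + a \<phi>' diagonalize this system, and their sum gives
    the hyperbolic cosine.\<close>
  have lin: "(v s + a * \<phi>' s) = exp (a * real m * \<tau> s)" if s: "s \<in> {-S<..<S}" and a: "a\<^sup>2 = 1" for s a
  proof -
    define e where "e s = (v s + a * \<phi>' s) * exp (- a * real m * \<tau> s)" for s
    have "(e has_real_derivative 0) (at s)" if s: "s \<in> {-S<..<S}" for s
    proof -
      have "\<phi>'' s = real m * v s * g s"
        unfolding ode[OF s] v2[OF s] g_def by (simp add: power2_eq_square)
      moreover have "(e has_real_derivative (real m * \<phi>' s * g s + a * \<phi>'' s) * exp (- a * real m * \<tau> s)
          + (v s + a * \<phi>' s) * (exp (- a * real m * \<tau> s) * (- a * real m * g s))) (at s)"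
        unfolding e_def[abs_def]
        by (auto intro!: derivative_eq_intros dv[OF s] h(3)[OF s] d\<tau>[OF s] simp: algebra_simps)
      moreover have "a * (a * x) = x" for x using a by (simp add: power2_eq_square flip: mult.assoc)
      ultimately show ?thesis by (simp add: algebra_simps)
    qed
    then have "e s = e 0" using s z S_pos by (intro DERIV_isconst3[of "-S" S]) auto
    also have "e 0 = 1" using h0 \<tau>0 \<phi>\<^sub>0 by (simp add: e_def v_def)
    finally show ?thesis by (simp add: e_def exp_minus field_simps)
  qed
  have vc: "v s = csh (\<tau> s)" if "s \<in> {-S<..<S}" for s
    using lin[OF that, of 1] lin[OF that, of "-1"] by (simp add: csh_def cosh_def)
  have \<phi>P: "\<phi> s = Phi (\<tau> s)" if "s \<in> {-S<..<S}" for s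
  proof -
    have "v s powr (1 / real m) = \<phi> s / \<phi>\<^sub>0"
      using h(1)[OF that] \<phi>\<^sub>0 m0 by (simp add: v_def powr_powr flip: powr_realpow)
    then show ?thesis using \<phi>\<^sub>0 vc[OF that] by (simp add: Phi_def)
  qed
  have sig\<tau>: "sig (\<tau> s) = s" if s: "s \<in> {-S<..<S}" for s
  proof -
    have "((\<lambda>s. sig (\<tau> s) - s) has_real_derivative 0) (at s)" if s: "s \<in> {-S<..<S}" for s
    proof -
      have "dsig (\<tau> s) * g s = 1"
        unfolding dsig_def g_def vc[OF s] \<phi>P[OF s] using csh_pos[of "\<tau> s"] Phi_pos[of "\<tau> s"] by simp
      then show ?thesis using DERIV_diff[OF DERIV_chain2[OF sig(2) d\<tau>[OF s]] DERIV_ident] by simp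
    qed
    then have "sig (\<tau> s) - s = sig (\<tau> 0) - 0" using s z S_pos
      by (intro DERIV_isconst3[of "-S" S, where f="\<lambda>s. sig (\<tau> s) - s"]) auto
    then show ?thesis by (simp add: \<tau>0 sig(1))
  qed
  have in_S: "sig t \<in> {-S<..<S}" for t using range_sig by auto
  have \<tau>sig: "\<tau> (sig t) = t" for t by (rule sig_inj) (rule sig\<tau>[OF in_S])
  show "\<phi> (sig t) = Phi t" using \<phi>P[OF in_S] \<tau>sig by simp
  have "g (sig t) = 1 / dsig t" for t
    unfolding g_def vc[OF in_S] \<phi>P[OF in_S] \<tau>sig dsig_def by simp
  then show "\<exists>\<tau>. \<forall>t. \<tau> (sig t) = t \<and> (\<tau> has_real_derivative 1 / dsig t) (at (sig t))"
    using \<tau>sig d\<tau>[OF in_S] by metis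
qed

end

section \<open>A radial eigenfunction\<close>

text \<open>The signed integral from 0 to t. The integral over an interval with reversed endpoints
  is zero, so the fixed lower limit -R is used to cover negative t.\<close>

definition primitive :: "real \<Rightarrow> (real \<Rightarrow> real) \<Rightarrow> real \<Rightarrow> real" where
  "primitive R g t = integral {-R..t} g - integral {-R..0} g"

lemma primitive:
  assumes R: "R > 0" and g: "continuous_on {-R..R} g"
  shows "primitive R g 0 = 0" "continuous_on {-R..R} (primitive R g)"
    "-R < t \<Longrightarrow> t < R \<Longrightarrow> (primitive R g has_real_derivative g t) (at t)"
proof -
  show "primitive R g 0 = 0" by (simp add: primitive_def)
  show "continuous_on {-R..R} (primitive R g)"
    unfolding primitive_def[abs_def] using g
    by (intro continuous_intros indefinite_integral_continuous_1 integrable_continuous_interval)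
  assume t: "-R < t" "t < R"
  have "((\<lambda>x. integral {-R..x} g) has_real_derivative g t) (at t within {-R..R})"
    using t by (intro integral_has_real_derivative g) auto
  then have "((\<lambda>x. integral {-R..x} g) has_real_derivative g t) (at t)"
    using t at_within_Icc_at[of "-R" t R] by simp
  then show "(primitive R g has_real_derivative g t) (at t)"
    unfolding primitive_def[abs_def] by (auto intro!: derivative_eq_intros)
qed

lemma primitive_diff_le:
  assumes R: "R > 0" and g: "continuous_on {-R..R} g" "continuous_on {-R..R} h"
    and B: "\<And>s. s \<in> {-R..R} \<Longrightarrow> \<bar>g s - h s\<bar> \<le> B" and t: "t \<in> {-R..R}"
  shows "\<bar>primitive R g t - primitive R h t\<bar> \<le> 4 * R * B"
proof -
  have i: "\<bar>integral {-R..s} g - integral {-R..s} h\<bar> \<le> 2 * R * B" if s: "s \<in> {-R..R}" for s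
  proof -
    have B0: "B \<ge> 0" using B[of 0] R by force
    have c: "continuous_on {-R..s} g" "continuous_on {-R..s} h"
      using g s by (auto elim: continuous_on_subset)
    have "norm (integral {-R..s} (\<lambda>x. g x - h x)) \<le> B * (s - - R)"
      using s B c by (intro integral_bound continuous_intros) auto
    also have "\<dots> \<le> B * (2 * R)" using s B0 by (intro mult_left_mono) auto
    finally show ?thesis
      using integral_diff[OF integrable_continuous_interval[OF c(1)] integrable_continuous_interval[OF c(2)]]
      by (simp add: mult_ac)
  qed
  have "0 \<in> {-R..R}" using R by simp
  then show ?thesis using i[OF t] i[of 0] unfolding primitive_def by linarith
qed

text \<open>A perturbation of the solution \<open>k\<close> of a linear second order equation by a small eigenvalue:
  \<open>a\<^sub>1\<close>, \<open>b\<^sub>1\<close> are solutions and \<open>a\<^sub>2\<close>, \<open>b\<^sub>2\<close> the weights of variation of parameters.\<close>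

lemma volterra_perturbation:
  fixes k a1 a2 b1 b2 :: "real \<Rightarrow> real"
  assumes R: "R > 0" and c: "continuous_on UNIV k" "continuous_on UNIV a1" "continuous_on UNIV a2"
    "continuous_on UNIV b1" "continuous_on UNIV b2"
    and neg: "k R < 0" "k (-R) < 0"
  shows "\<exists>e>0. \<exists>f. continuous_on UNIV f \<and> f R < 0 \<and> f (-R) < 0 \<and>
    (\<forall>t\<in>{-R..R}. f t = k t + e * (a1 t * primitive R (\<lambda>s. a2 s * f s) t - b1 t * primitive R (\<lambda>s. b2 s * f s) t))"
proof -
  define I where "I = {-R..R}"
  have cs: "continuous_on I k" "continuous_on I a1" "continuous_on I a2" "continuous_on I b1" "continuous_on I b2"
    using c continuous_on_subset by blast+
  have "\<exists>B>0. \<forall>x\<in>I. \<bar>g x\<bar> \<le> B" if "continuous_on I g" for g :: "real \<Rightarrow> real"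
  proof -
    have "bounded (g ` I)" using that compact_continuous_image[of I g] by (intro compact_imp_bounded) (auto simp: I_def)
    then obtain B where "\<forall>y\<in>g ` I. norm y \<le> B" using bounded_iff by metis
    then show ?thesis by (intro exI[of _ "max B 1"]) force
  qed
  from this[OF cs(1)] this[OF cs(2)] this[OF cs(3)] this[OF cs(4)] this[OF cs(5)]
  obtain K A1 A2 B1 B2 where bd: "K > 0" "\<And>x. x \<in> I \<Longrightarrow> \<bar>k x\<bar> \<le> K" "A1 > 0" "\<And>x. x \<in> I \<Longrightarrow> \<bar>a1 x\<bar> \<le> A1"
    "A2 > 0" "\<And>x. x \<in> I \<Longrightarrow> \<bar>a2 x\<bar> \<le> A2" "B1 > 0" "\<And>x. x \<in> I \<Longrightarrow> \<bar>b1 x\<bar> \<le> B1" "B2 > 0" "\<And>x. x \<in> I \<Longrightarrow> \<bar>b2 x\<bar> \<le> B2"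
    by (elim exE conjE) (rule that; blast)
  \<comment> \<open>A bound for the integral operator \<open>G\<close> below in the supremum norm;
    the factors 4 R come from \<open>primitive_diff_le\<close>.\<close>
  define C where "C = A1 * (4 * R * A2) + B1 * (4 * R * B2)"
  have C: "C > 0" unfolding C_def using R bd by (intro add_pos_pos mult_pos_pos) auto
  define \<delta> where "\<delta> = min (- k R) (- k (-R))"
  have \<delta>: "\<delta> > 0" using neg by (simp add: \<delta>_def)
  \<comment> \<open>The first bound makes the map a contraction with factor 1/2. The second keeps
    the fixed point within \<delta> of k, hence negative at both ends.\<close>
  define e where "e = min (1 / (2 * C)) (\<delta> / (4 * K * C))"
  have e: "e > 0" unfolding e_def using C \<delta> bd(1) by simp
  have eC: "e * C \<le> 1/2" "e * C * (2 * K) < \<delta>"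
  proof -
    have "e * C \<le> 1 / (2 * C) * C" using C unfolding e_def by (intro mult_right_mono) auto
    then show "e * C \<le> 1/2" using C by simp
    have le: "e * C \<le> \<delta> / (4 * K * C) * C" using C unfolding e_def by (intro mult_right_mono) auto
    have "e * C * (2 * K) \<le> \<delta> / (4 * K * C) * C * (2 * K)"
      by (rule mult_right_mono[OF le]) (use bd(1) in simp)
    also have "\<dots> = \<delta> / 2" using C bd(1) by simp
    also have "\<dots> < \<delta>" using \<delta> by simp
    finally show "e * C * (2 * K) < \<delta>" .
  qed
  \<comment> \<open>Clamping extends functions from [-R, R] to the line, so that the contraction
    acts on the complete space of bounded continuous functions on the whole line.\<close>
  define cl where "cl t = max (-R) (min R t)" for t
  have cl: "cl t \<in> I" "t \<in> I \<Longrightarrow> cl t = t" "continuous_on UNIV cl" for t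
    using R by (auto simp: cl_def I_def intro!: continuous_intros)
  define G where "G f t = a1 t * primitive R (\<lambda>s. a2 s * f s) t - b1 t * primitive R (\<lambda>s. b2 s * f s) t" for f t
  have G_cont: "continuous_on I (G f)" if "continuous_on UNIV f" for f
    unfolding G_def[abs_def] I_def using that cs[unfolded I_def]
    by (intro continuous_intros primitive(2)[OF R]) (auto elim: continuous_on_subset)
  have G_diff: "\<bar>G f t - G g t\<bar> \<le> C * B"
    if f: "continuous_on UNIV f" "continuous_on UNIV g" "\<And>s. \<bar>f s - g s\<bar> \<le> B" and t: "t \<in> I" for f g t B
  proof -
    have fI: "continuous_on I f" "continuous_on I g" using f continuous_on_subset by blast+
    have p: "\<bar>primitive R (\<lambda>s. w s * f s) t - primitive R (\<lambda>s. w s * g s) t\<bar> \<le> 4 * R * (W * B)"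
      if w: "continuous_on I w" "\<And>x. x \<in> I \<Longrightarrow> \<bar>w x\<bar> \<le> W" for w W
    proof (rule primitive_diff_le[OF R])
      show "\<bar>w s * f s - w s * g s\<bar> \<le> W * B" if "s \<in> {-R..R}" for s
      proof -
        have "\<bar>w s * f s - w s * g s\<bar> = \<bar>w s\<bar> * \<bar>f s - g s\<bar>" by (simp add: abs_mult flip: right_diff_distrib)
        also have "\<dots> \<le> W * B" using w(2)[of s] that f(3)[of s] unfolding I_def by (intro mult_mono) force+
        finally show ?thesis .
      qed
      show "t \<in> {-R..R}" using t by (simp add: I_def)
    qed (use w(1) fI in \<open>auto intro!: continuous_intros simp: I_def\<close>)
    have "\<bar>G f t - G g t\<bar> \<le> \<bar>a1 t\<bar> * \<bar>primitive R (\<lambda>s. a2 s * f s) t - primitive R (\<lambda>s. a2 s * g s) t\<bar>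
        + \<bar>b1 t\<bar> * \<bar>primitive R (\<lambda>s. b2 s * f s) t - primitive R (\<lambda>s. b2 s * g s) t\<bar>"
      unfolding G_def abs_mult[symmetric] by (simp add: right_diff_distrib)
    also have "\<dots> \<le> A1 * (4 * R * (A2 * B)) + B1 * (4 * R * (B2 * B))"
      using p[OF cs(3) bd(6)] p[OF cs(5) bd(10)] bd(3,7) bd(4)[OF t] bd(8)[OF t]
      by (intro add_mono mult_mono) auto
    also have "\<dots> = C * B" by (simp add: C_def algebra_simps)
    finally show ?thesis .
  qed
  define \<Phi> :: "(real \<Rightarrow>\<^sub>C real) \<Rightarrow> (real \<Rightarrow>\<^sub>C real)" where
    "\<Phi> f = Bcontfun (\<lambda>t. k (cl t) + e * G (apply_bcontfun f) (cl t))" for f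
  have fc: "continuous_on UNIV (apply_bcontfun f)" for f :: "real \<Rightarrow>\<^sub>C real"
    by (rule continuous_on_apply_bcontfun)
  have \<Phi>: "apply_bcontfun (\<Phi> f) = (\<lambda>t. k (cl t) + e * G (apply_bcontfun f) (cl t))" for f
    unfolding \<Phi>_def
  proof (rule Bcontfun_inverse)
    have cI: "continuous_on I (\<lambda>t. k t + e * G (apply_bcontfun f) t)"
      by (intro continuous_intros cs G_cont fc)
    then have "compact ((\<lambda>t. k t + e * G (apply_bcontfun f) t) ` I)"
      by (intro compact_continuous_image) (auto simp: I_def)
    then have "bounded ((\<lambda>t. k t + e * G (apply_bcontfun f) t) ` I)" by (rule compact_imp_bounded)
    then have "bounded (range (\<lambda>t. k (cl t) + e * G (apply_bcontfun f) (cl t)))"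
      by (rule bounded_subset) (use cl in auto)
    moreover have "continuous_on UNIV (\<lambda>t. k (cl t) + e * G (apply_bcontfun f) (cl t))"
      by (rule continuous_on_compose2[OF cI cl(3)]) (use cl in auto)
    ultimately show "(\<lambda>t. k (cl t) + e * G (apply_bcontfun f) (cl t)) \<in> bcontfun"
      by (simp add: bcontfun_def)
  qed
  have "dist (\<Phi> f) (\<Phi> g) \<le> 1/2 * dist f g" for f g
  proof (rule dist_bound)
    fix t
    have "\<bar>G (apply_bcontfun f) (cl t) - G (apply_bcontfun g) (cl t)\<bar> \<le> C * dist f g"
      using dist_bounded[of f _ g] by (intro G_diff fc cl) (auto simp: dist_real_def)
    then have "e * \<bar>G (apply_bcontfun f) (cl t) - G (apply_bcontfun g) (cl t)\<bar> \<le> e * (C * dist f g)"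
      using e by (intro mult_left_mono) auto
    also have "\<dots> \<le> 1/2 * dist f g" using eC(1) by (simp only: mult.assoc[symmetric]) (intro mult_right_mono, auto)
    finally show "dist (\<Phi> f t) (\<Phi> g t) \<le> 1/2 * dist f g"
      using e unfolding \<Phi> dist_real_def by (simp add: abs_mult flip: right_diff_distrib)
  qed
  then obtain F where F: "\<Phi> F = F" using banach_fix_type[of "1/2" \<Phi>] by auto
  define f where "f = apply_bcontfun F"
  have f: "f t = k (cl t) + e * G f (cl t)" for t
    using \<Phi>[of F] unfolding F f_def by metis
  have fcont: "continuous_on UNIV f" unfolding f_def by (rule fc)
  have G0: "G (\<lambda>_. 0) t = 0" for t by (simp add: G_def primitive_def)
  obtain Mf where Mf: "\<And>t. \<bar>f t\<bar> \<le> Mf" using apply_bcontfun[of F] unfolding f_def bcontfun_def bounded_iff by auto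
  \<comment> \<open>The fixed-point equation gives N \<le> K + N / 2, hence the a priori bound N
    \<le> 2 K used to compare f with k.\<close>
  define N where "N = Sup (range (\<lambda>t. \<bar>f t\<bar>))"
  have N: "\<bar>f t\<bar> \<le> N" for t unfolding N_def using Mf by (intro cSup_upper bdd_aboveI[of _ Mf]) auto
  have GN: "\<bar>G f t\<bar> \<le> C * N" if "t \<in> I" for t
    using G_diff[OF fcont continuous_on_const _ that, of 0 N] N G0 by simp
  have "\<bar>f t\<bar> \<le> K + 1/2 * N" for t
  proof -
    have "N \<ge> 0" using N[of 0] by linarith
    then have "e * (C * N) \<le> 1/2 * N" using eC(1) by (simp only: mult.assoc[symmetric]) (intro mult_right_mono, auto)
    moreover have "e * \<bar>G f (cl t)\<bar> \<le> e * (C * N)" using GN[OF cl(1)] e by (intro mult_left_mono) auto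
    moreover have "\<bar>f t\<bar> \<le> \<bar>k (cl t)\<bar> + e * \<bar>G f (cl t)\<bar>"
      unfolding f[of t] using e abs_triangle_ineq[of "k (cl t)" "e * G f (cl t)"] by (simp add: abs_mult)
    ultimately show ?thesis using bd(2)[OF cl(1)[of t]] by linarith
  qed
  then have "N \<le> K + 1/2 * N" unfolding N_def by (intro cSup_least) auto
  then have N2: "N \<le> 2 * K" by simp
  have close: "\<bar>f t - k t\<bar> < \<delta>" if t: "t \<in> I" for t
  proof -
    have "\<bar>f t - k t\<bar> = e * \<bar>G f t\<bar>" using f[of t] cl(2)[OF t] e by (simp add: abs_mult)
    also have "\<dots> \<le> e * (C * (2 * K))"
    proof -
      have "C * N \<le> C * (2 * K)" using N2 C by (intro mult_left_mono) auto
      then show ?thesis using GN[OF t] e by (intro mult_left_mono) auto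
    qed
    also have "\<dots> < \<delta>" using eC(2) by (simp add: mult.assoc)
    finally show ?thesis .
  qed
  have "f R < 0" "f (-R) < 0" using close[of R] close[of "-R"] R unfolding I_def \<delta>_def by auto
  moreover have "\<forall>t\<in>{-R..R}. f t = k t + e * (a1 t * primitive R (\<lambda>s. a2 s * f s) t - b1 t * primitive R (\<lambda>s. b2 s * f s) t)"
    using f cl(2) unfolding I_def G_def by metis
  ultimately show ?thesis using e fcont by blast
qed

lemma first_zero:
  fixes f :: "real \<Rightarrow> real"
  assumes c: "continuous_on UNIV f" and f0: "f 0 > 0" and R: "R > 0" "f R < 0"
  shows "\<exists>\<tau>. 0 < \<tau> \<and> \<tau> < R \<and> f \<tau> = 0 \<and> (\<forall>t. 0 \<le> t \<and> t < \<tau> \<longrightarrow> f t > 0)"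
proof -
  define Z where "Z = {0..R} \<inter> {t. f t \<le> 0}"
  have "closed {t. f t \<le> 0}" using c by (intro closed_Collect_le continuous_intros)
  then have Z: "compact Z" unfolding Z_def by (intro compact_Int_closed) auto
  have "R \<in> Z" using R by (simp add: Z_def)
  then obtain \<tau> where \<tau>: "\<tau> \<in> Z" "\<And>t. t \<in> Z \<Longrightarrow> \<tau> \<le> t"
    using compact_attains_inf[OF Z] by blast
  have pos: "f t > 0" if "0 \<le> t" "t < \<tau>" for t
    using \<tau>(2)[of t] \<tau>(1) that by (force simp: Z_def)
  have \<tau>0: "\<tau> > 0" using \<tau>(1) f0 by (cases "\<tau> = 0") (auto simp: Z_def)
  have "f \<tau> \<ge> 0"
  proof (rule ccontr)
    assume "\<not> f \<tau> \<ge> 0"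
    then obtain s where "0 \<le> s" "s \<le> \<tau>" "f s = 0"
      using IVT2'[of f \<tau> 0 0] f0 \<tau>0 continuous_on_subset[OF c] by (metis less_eq_real_def not_le subset_UNIV)
    then show False using pos[of s] \<open>\<not> f \<tau> \<ge> 0\<close> by (cases "s = \<tau>") auto
  qed
  then have "f \<tau> = 0" using \<tau>(1) by (simp add: Z_def)
  moreover have "\<tau> \<noteq> R" using R(2) \<open>f \<tau> = 0\<close> by auto
  ultimately show ?thesis using \<tau>(1) \<tau>0 pos by (intro exI[of _ \<tau>]) (auto simp: Z_def)
qed

context catenoid_param
begin

text \<open>The support function of the catenoid, the Jacobi field generated by dilations; it changes sign.\<close>

definition k0 :: "real \<Rightarrow> real" where "k0 t = (dsig t - sig t * T t) / \<phi>\<^sub>0"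

definition dk0 :: "real \<Rightarrow> real" where
  "dk0 t = - real m * (T t * dsig t + sig t * (1 - (T t)\<^sup>2)) / \<phi>\<^sub>0"

lemma deriv_k0: "(k0 has_real_derivative dk0 t) (at t)"
  unfolding k0_def[abs_def] dk0_def using \<phi>\<^sub>0
  by (auto intro!: derivative_eq_intros deriv_dsig sig(2) deriv_T simp: field_simps)

lemma deriv_dk0:
  "(dk0 has_real_derivative - (real m - 1) * T t * dk0 t - real m * (real m + 1) * (1 - (T t)\<^sup>2) * k0 t) (at t)"
proof -
  have "(dk0 has_real_derivative - real m * ((real m * (1 - (T t)\<^sup>2)) * dsig t + T t * (- (real m - 1) * T t * dsig t)
      + (dsig t * (1 - (T t)\<^sup>2) + sig t * (- 2 * T t * (real m * (1 - (T t)\<^sup>2))))) / \<phi>\<^sub>0) (at t)"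
    unfolding dk0_def[abs_def] using \<phi>\<^sub>0
    by (auto intro!: derivative_eq_intros deriv_dsig sig(2) deriv_T simp: field_simps power2_eq_square)
  moreover have "- real m * ((real m * (1 - (T t)\<^sup>2)) * dsig t + T t * (- (real m - 1) * T t * dsig t)
      + (dsig t * (1 - (T t)\<^sup>2) + sig t * (- 2 * T t * (real m * (1 - (T t)\<^sup>2))))) / \<phi>\<^sub>0
      = - (real m - 1) * T t * dk0 t - real m * (real m + 1) * (1 - (T t)\<^sup>2) * k0 t"
    unfolding dk0_def k0_def using \<phi>\<^sub>0 by (simp add: field_simps power2_eq_square)
  ultimately show ?thesis by (simp only:)
qed

definition dT :: "real \<Rightarrow> real" where "dT t = real m * (1 - (T t)\<^sup>2)"

lemma deriv_dT:
  "(dT has_real_derivative - (real m - 1) * T t * dT t - real m * (real m + 1) * (1 - (T t)\<^sup>2) * T t) (at t)"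
proof -
  have "(dT has_real_derivative real m * (- 2 * T t * dT t)) (at t)"
    unfolding dT_def[abs_def] by (auto intro!: derivative_eq_intros deriv_T)
  moreover have "real m * (- 2 * T t * dT t) = - (real m - 1) * T t * dT t - real m * (real m + 1) * (1 - (T t)\<^sup>2) * T t"
    unfolding dT_def by (simp add: algebra_simps)
  ultimately show ?thesis by (simp only:)
qed

text \<open>Abel's formula for the two radial Jacobi fields \<open>k0\<close> and \<open>T\<close>:
  the first-order coefficient is (m - 1) T, and Phi' = T Phi makes Phi^(m - 1) its integrating
  factor. The constant is read off at t = 0, where k0 = 1, T = 0 and dT = m.\<close>

lemma wronskian: "(k0 t * dT t - dk0 t * T t) * (Phi t) ^ (m - 1) = real m * \<phi>\<^sub>0 ^ (m - 1)"
proof -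
  define w where "w t = (k0 t * dT t - dk0 t * T t) * (Phi t) ^ (m - 1)" for t
  have "(w has_real_derivative 0) (at t)" for t
  proof -
    have p: "((\<lambda>t. (Phi t) ^ (m - 1)) has_real_derivative (real m - 1) * T t * (Phi t) ^ (m - 1)) (at t)"
    proof -
      have "((\<lambda>t. (Phi t) ^ (m - 1)) has_real_derivative real (m - 1) * (Phi t) ^ (m - 1 - 1) * (Phi t * T t)) (at t)"
        by (auto intro!: derivative_eq_intros deriv_Phi)
      moreover have "(Phi t) ^ (m - 1) = (Phi t) ^ (m - 1 - 1) * Phi t"
        using m2 by (metis One_nat_def Suc_1 Suc_diff_le Suc_leD diff_Suc_Suc diff_zero le_Suc_ex power_Suc2 plus_1_eq_Suc add_diff_cancel_left')
      moreover have "real (m - 1) = real m - 1" using m2 by simp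
      ultimately show ?thesis by (simp add: mult_ac)
    qed
    have "(w has_real_derivative
      ((dk0 t * dT t + k0 t * (- (real m - 1) * T t * dT t - real m * (real m + 1) * (1 - (T t)\<^sup>2) * T t))
       - ((- (real m - 1) * T t * dk0 t - real m * (real m + 1) * (1 - (T t)\<^sup>2) * k0 t) * T t + dk0 t * dT t)) * (Phi t) ^ (m - 1)
      + (k0 t * dT t - dk0 t * T t) * ((real m - 1) * T t * (Phi t) ^ (m - 1))) (at t)"
      unfolding w_def[abs_def]
      by (rule DERIV_cong[OF DERIV_mult[OF DERIV_diff[OF DERIV_mult[OF deriv_k0 deriv_dT]
          DERIV_mult[OF deriv_dk0 deriv_T[folded dT_def]]] p]]) (simp add: algebra_simps)
    then show ?thesis by (rule DERIV_cong) (simp add: algebra_simps)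
  qed
  then have "w t = w 0" by (intro DERIV_isconst_all) auto
  then show ?thesis using \<phi>\<^sub>0 by (simp add: w_def k0_def dk0_def dT_def sig(1))
qed

text \<open>At infinity dsig tends to 0, sig to S and T to 1, so \<open>k0\<close> tends to the
  negative number \<open>- S / \<phi>\<^sub>0\<close>.\<close>

lemma k0_negative: "\<exists>R>0. k0 R < 0"
proof -
  have "((\<lambda>t. dsig t - sig t * T t) \<longlongrightarrow> 0 - S * 1) at_top"
  proof (intro tendsto_intros dsig_tendsto_0 sig_tendsto)
    have "filterlim (\<lambda>t. real m * t) at_top at_top"
      using m0 by (intro filterlim_tendsto_pos_mult_at_top[OF tendsto_const] filterlim_ident) auto
    from filterlim_compose[OF tanh_real_at_top this] show "(T \<longlongrightarrow> 1) at_top" by (simp add: T_def[abs_def])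
  qed
  then have "\<forall>\<^sub>F t in at_top. dsig t - sig t * T t < 0" using S_pos by (intro order_tendstoD(2)) auto
  then have "\<forall>\<^sub>F t in at_top. dsig t - sig t * T t < 0 \<and> t > 0"
    using eventually_gt_at_top by (rule eventually_conj)
  then obtain R where "dsig R - sig R * T R < 0" "R > 0"
    using eventually_happens'[OF trivial_limit_at_top_linorder] by blast
  then show ?thesis unfolding k0_def using \<phi>\<^sub>0 by (auto simp: divide_less_0_iff)
qed

text \<open>Variation of parameters on the pair \<open>k0\<close>, \<open>T\<close>. A small e > 0
  leaves the solution negative at R and -R and equal to 1 at 0, so it vanishes once on each side
  before R; between these zeros it solves the radial equation of an eigenfunction with eigenvalue
  -e.\<close>

theorem radial_eigenfunction:
  "\<exists>e>0. \<exists>\<tau>1<0. \<exists>\<tau>2>0. \<exists>y y' y''. continuous_on UNIV y \<and> y \<tau>1 = 0 \<and> y \<tau>2 = 0 \<and> y 0 > 0 \<and>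
    (\<forall>t. \<tau>1 < t \<and> t < \<tau>2 \<longrightarrow> (y has_real_derivative y' t) (at t) \<and> (y' has_real_derivative y'' t) (at t) \<and>
      y'' t + (real m - 1) * T t * y' t + real m * (real m + 1) * (1 - (T t)\<^sup>2) * y t = e * (Phi t)\<^sup>2 * y t) \<and>
    continuous_on {\<tau>1<..<\<tau>2} y''"
proof -
  obtain R where R: "R > 0" "k0 R < 0" using k0_negative by blast
  have R': "k0 (-R) < 0" using R by (simp add: k0_def sig_minus)
  \<comment> \<open>Phi^2 divided by the Wronskian of \<open>k0\<close> and \<open>T\<close>, as
    variation of parameters prescribes for the right-hand side e Phi^2 y.\<close>
  define w where "w t = (Phi t)\<^sup>2 * (Phi t) ^ (m - 1) / (real m * \<phi>\<^sub>0 ^ (m - 1))" for t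
  have ct: "continuous_on A k0" "continuous_on A T" "continuous_on A Phi" "continuous_on A dk0" "continuous_on A dT" for A
    using DERIV_isCont[OF deriv_k0] DERIV_isCont[OF deriv_T] DERIV_isCont[OF deriv_Phi] DERIV_isCont[OF deriv_dk0]
      DERIV_isCont[OF deriv_dT] by (auto intro!: continuous_at_imp_continuous_on)
  have cw: "continuous_on A w" for A unfolding w_def using m0 \<phi>\<^sub>0 by (intro continuous_intros ct) auto
  have c1: "continuous_on UNIV (\<lambda>s. k0 s * w s)" and c2: "continuous_on UNIV (\<lambda>s. T s * w s)"
    by (intro continuous_intros ct cw)+
  obtain e f where e: "e > 0" and f: "continuous_on UNIV f" "f R < 0" "f (-R) < 0"
    and eq: "\<And>t. t \<in> {-R..R} \<Longrightarrow> f t = k0 t + e * (T t * primitive R (\<lambda>s. (k0 s * w s) * f s) t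
      - k0 t * primitive R (\<lambda>s. (T s * w s) * f s) t)"
    using volterra_perturbation[OF R(1) ct(1) ct(2) c1 ct(1) c2 R(2) R'] by blast
  define A where "A = primitive R (\<lambda>s. (k0 s * w s) * f s)"
  define B where "B = primitive R (\<lambda>s. (T s * w s) * f s)"
  have fI: "continuous_on J f" for J using f(1) continuous_on_subset by blast
  have A: "A 0 = 0" "-R < t \<Longrightarrow> t < R \<Longrightarrow> (A has_real_derivative (k0 t * w t) * f t) (at t)" for t
    unfolding A_def by (intro primitive R continuous_intros ct cw fI; assumption)+
  have B: "B 0 = 0" "-R < t \<Longrightarrow> t < R \<Longrightarrow> (B has_real_derivative (T t * w t) * f t) (at t)" for t
    unfolding B_def by (intro primitive R continuous_intros ct cw fI; assumption)+
  have f0: "f 0 = 1" using eq[of 0] R \<phi>\<^sub>0 A(1) B(1) by (simp add: k0_def A_def[symmetric] B_def[symmetric])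
  obtain \<tau>2 where \<tau>2: "0 < \<tau>2" "\<tau>2 < R" "f \<tau>2 = 0" using first_zero[OF f(1) _ R(1) f(2)] f0 by auto
  have "continuous_on UNIV (\<lambda>t. f (- t))" by (rule continuous_on_compose2[OF f(1)]) (auto intro!: continuous_intros)
  from first_zero[OF this _ R(1)] obtain \<tau>1 where \<tau>1: "0 < \<tau>1" "\<tau>1 < R" "f (- \<tau>1) = 0" using f0 f(3) by auto
  define y' where "y' t = dk0 t + e * (dT t * A t - dk0 t * B t)" for t
  define y'' where "y'' t = - (real m - 1) * T t * y' t - real m * (real m + 1) * (1 - (T t)\<^sup>2) * f t + e * (Phi t)\<^sup>2 * f t" for t
  have dy: "(f has_real_derivative y' t) (at t)" if t: "-R < t" "t < R" for t
  proof -
    have "((\<lambda>t. k0 t + e * (T t * A t - k0 t * B t)) has_real_derivative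
      dk0 t + e * ((dT t * A t + ((k0 t * w t) * f t) * T t) - (dk0 t * B t + ((T t * w t) * f t) * k0 t))) (at t)"
      by (intro DERIV_add DERIV_cmult DERIV_diff DERIV_mult deriv_k0 deriv_T[folded dT_def] A B t)
    then have "((\<lambda>t. k0 t + e * (T t * A t - k0 t * B t)) has_real_derivative y' t) (at t)"
      by (rule DERIV_cong) (simp add: y'_def algebra_simps)
    then show ?thesis
      by (rule has_field_derivative_transform_within_open[of _ _ _ "{-R<..<R}"])
        (use t eq in \<open>auto simp: A_def B_def\<close>)
  qed
  have ddy: "(y' has_real_derivative y'' t) (at t)" if t: "-R < t" "t < R" for t
  proof -
    let ?dd = "\<lambda>u v. - (real m - 1) * T t * u - real m * (real m + 1) * (1 - (T t)\<^sup>2) * v"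
    have "(y' has_real_derivative ?dd (dk0 t) (k0 t)
      + e * ((?dd (dT t) (T t) * A t + ((k0 t * w t) * f t) * dT t) - (?dd (dk0 t) (k0 t) * B t + ((T t * w t) * f t) * dk0 t))) (at t)"
      unfolding y'_def[abs_def]
      by (intro DERIV_add DERIV_cmult DERIV_diff DERIV_mult deriv_dk0 deriv_dT A B t)
    moreover have "?dd (dk0 t) (k0 t)
      + e * ((?dd (dT t) (T t) * A t + X) - (?dd (dk0 t) (k0 t) * B t + Y))
      = ?dd (dk0 t + e * (dT t * A t - dk0 t * B t)) (k0 t + e * (T t * A t - k0 t * B t)) + e * (X - Y)" for X Y
      by (simp add: algebra_simps)
    moreover have "k0 t + e * (T t * A t - k0 t * B t) = f t" using eq[of t] t by (simp add: A_def B_def)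
    moreover have "e * (((k0 t * w t) * f t) * dT t - ((T t * w t) * f t) * dk0 t) = e * (Phi t)\<^sup>2 * f t"
    proof -
      have "((k0 t * w t) * f t) * dT t - ((T t * w t) * f t) * dk0 t = ((k0 t * dT t - dk0 t * T t) * w t) * f t"
        by (simp add: algebra_simps)
      also have "(k0 t * dT t - dk0 t * T t) * w t
          = (Phi t)\<^sup>2 * ((k0 t * dT t - dk0 t * T t) * (Phi t) ^ (m - 1)) / (real m * \<phi>\<^sub>0 ^ (m - 1))"
        by (simp add: w_def)
      also have "\<dots> = (Phi t)\<^sup>2" unfolding wronskian using m0 \<phi>\<^sub>0 by simp
      finally show ?thesis by simp
    qed
    ultimately show ?thesis unfolding y''_def y'_def[symmetric] by (simp only:)
  qed
  have "continuous_on {- \<tau>1<..<\<tau>2} y'"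
    using \<tau>1 \<tau>2 DERIV_isCont[OF ddy] by (intro continuous_at_imp_continuous_on) auto
  then have cont: "continuous_on {- \<tau>1<..<\<tau>2} y''"
    unfolding y''_def by (intro continuous_intros ct fI)
  have all: "\<forall>t. - \<tau>1 < t \<and> t < \<tau>2 \<longrightarrow> (f has_real_derivative y' t) (at t) \<and> (y' has_real_derivative y'' t) (at t) \<and>
      y'' t + (real m - 1) * T t * y' t + real m * (real m + 1) * (1 - (T t)\<^sup>2) * f t = e * (Phi t)\<^sup>2 * f t"
  proof (intro allI impI)
    fix t assume "- \<tau>1 < t \<and> t < \<tau>2"
    then have t: "-R < t" "t < R" using \<tau>1(2) \<tau>2(2) by auto
    have "y'' t + (real m - 1) * T t * y' t + real m * (real m + 1) * (1 - (T t)\<^sup>2) * f t = e * (Phi t)\<^sup>2 * f t"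
      by (simp add: y''_def algebra_simps)
    with dy[OF t] ddy[OF t]
    show "(f has_real_derivative y' t) (at t) \<and> (y' has_real_derivative y'' t) (at t) \<and>
      y'' t + (real m - 1) * T t * y' t + real m * (real m + 1) * (1 - (T t)\<^sup>2) * f t = e * (Phi t)\<^sup>2 * f t"
      by (intro conjI)
  qed
  have signs: "- \<tau>1 < 0" "f 0 > 0" using \<tau>1(1) f0 by auto
  show ?thesis
    by (intro exI[of _ e] exI[of _ "- \<tau>1"] exI[of _ \<tau>2] exI[of _ f] exI[of _ y'] exI[of _ y''] conjI
        e signs \<tau>2(1) f(1) \<tau>1(3) \<tau>2(3) all cont)
qed

end

section \<open>The conformal chart of the catenoid\<close>

lemma C1_on_radial':
  assumes "\<And>t. (h has_real_derivative h' t) (at t)" "continuous_on UNIV h'"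
  shows "C1_on (- {0}) (\<lambda>x. h (ln (norm x)))"
  by (rule C1_on_radial[where h'=h']) (use assms in \<open>auto elim: continuous_on_subset\<close>)

lemma C1_field_subset: "C1_field S \<xi> \<Longrightarrow> R \<subseteq> S \<Longrightarrow> C1_field R \<xi>"
  unfolding C1_field_def using C1_on_subset by blast

text \<open>\<open>c0\<close> and \<open>R\<close> form the rigid motion, and \<tau> inverts the
  height function; \<open>profile_unique\<close> supplies it together with its derivative.\<close>

locale catenoid_chart = catenoid_param m \<phi>\<^sub>0 for m :: nat and \<phi>\<^sub>0 :: real +
  fixes c0 :: "'a::euclidean_space \<times> real" and R :: "'a \<times> real \<Rightarrow> 'a \<times> real" and \<tau> :: "real \<Rightarrow> real"
  assumes dimension: "DIM('a) = Suc m" and R: "orthogonal_transformation R"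
    and \<tau>: "\<tau> (sig t) = t" "(\<tau> has_real_derivative 1 / dsig t) (at (sig t))"
begin

text \<open>The conformal factor Phi / |x|. Written with an exponential it is a function of
  \<open>ln (norm x)\<close>, to which the radial differentiation rules apply, and it is positive at
  the origin as well.\<close>

definition lm :: "'a \<Rightarrow> real" where "lm x = Phi (ln (norm x)) * exp (- ln (norm x))"
definition Psi0 :: "'a \<Rightarrow> 'a \<times> real" where "Psi0 x = (lm x *\<^sub>R x, sig (ln (norm x)))"
definition k1 :: "'a \<Rightarrow> real" where "k1 x = lm x * (T (ln (norm x)) - 1) / (norm x)\<^sup>2"
definition k2 :: "'a \<Rightarrow> real" where "k2 x = dsig (ln (norm x)) / (norm x)\<^sup>2"
definition DPsi0 :: "'a \<Rightarrow> 'a \<Rightarrow> 'a \<times> real" where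
  "DPsi0 x v = (lm x *\<^sub>R v + (k1 x * (x \<bullet> v)) *\<^sub>R x, k2 x * (x \<bullet> v))"
definition Psi :: "'a \<Rightarrow> 'a \<times> real" where "Psi x = c0 + R (Psi0 x)"
definition DPsi :: "'a \<Rightarrow> 'a \<Rightarrow> 'a \<times> real" where "DPsi x v = R (DPsi0 x v)"
definition crd :: "'a \<times> real \<Rightarrow> 'a" where
  "crd p = (let z = inv R (p - c0) in exp (\<tau> (snd z)) *\<^sub>R (fst z /\<^sub>R norm (fst z)))"
text \<open>The weight lam^(n - 2) of the Dirichlet energy in dimension n = m + 1.\<close>

definition W :: "'a \<Rightarrow> real" where "W x = lm x ^ (m - 1)"
definition M :: "('a \<times> real) set" where "M = Psi ` (- {0})"

lemma lm_pos: "lm x > 0" unfolding lm_def using Phi_pos by simp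

lemma lm_eq: "x \<noteq> 0 \<Longrightarrow> lm x = Phi (ln (norm x)) / norm x"
  by (simp add: lm_def exp_minus divide_inverse)

lemma deriv_h: "((\<lambda>t. Phi t * exp (- t)) has_real_derivative Phi t * exp (- t) * (T t - 1)) (at t)"
  by (auto intro!: derivative_eq_intros deriv_Phi simp: algebra_simps)

lemma cont_TPhi: "continuous_on A T" "continuous_on A Phi" "continuous_on A dsig" "continuous_on A csh"
  using DERIV_isCont[OF deriv_T] DERIV_isCont[OF deriv_Phi] isCont_dsig DERIV_isCont[OF deriv_csh]
  by (auto intro!: continuous_at_imp_continuous_on)

lemma GDERIV_lm: "x \<noteq> 0 \<Longrightarrow> GDERIV lm x :> k1 x *\<^sub>R x"
  using GDERIV_radial[OF _ deriv_h, of x] by (simp add: lm_def[abs_def] k1_def)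

lemma C1_lm: "C1_on (- {0}) lm"
  unfolding lm_def[abs_def]
  by (rule C1_on_radial'[OF deriv_h]) (intro continuous_intros cont_TPhi)

lemma C1_k1: "C1_on (- {0}) k1"
proof -
  have "C1_on (- {0}) (\<lambda>x::'a. T (ln (norm x)) - 1)"
    by (intro C1_on_diff C1_on_const C1_on_radial'[OF deriv_T]) (intro continuous_intros cont_TPhi)
  from C1_on_mult[OF C1_on_mult[OF C1_lm this] C1_on_inverse_norm_square] show ?thesis
    by (simp add: k1_def[abs_def])
qed

lemma C1_k2: "C1_on (- {0}) k2"
proof -
  have "C1_on (- {0}) (\<lambda>x::'a. dsig (ln (norm x)))"
    by (intro C1_on_radial'[OF deriv_dsig]) (intro continuous_intros cont_TPhi)
  from C1_on_mult[OF this C1_on_inverse_norm_square] show ?thesis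
    by (simp add: k2_def[abs_def])
qed

lemma GDERIV_W: "x \<noteq> 0 \<Longrightarrow> GDERIV W x :> ((real m - 1) * W x * (T (ln (norm x)) - 1) / (norm x)\<^sup>2) *\<^sub>R x"
proof -
  assume x: "x \<noteq> 0"
  have "((\<lambda>s. s ^ (m - 1)) has_real_derivative (real m - 1) * lm x ^ (m - 1) / lm x) (at (lm x))"
  proof -
    have "((\<lambda>s. s ^ (m - 1)) has_real_derivative real (m - 1) * lm x ^ (m - 1 - 1)) (at (lm x))"
      by (auto intro!: derivative_eq_intros)
    moreover obtain k where "m = Suc (Suc k)" using m2 by (metis Suc_le_D numeral_2_eq_2 Suc_le_mono)
    ultimately show ?thesis using lm_pos[of x] by simp
  qed
  from GDERIV_DERIV_compose[OF GDERIV_lm[OF x] this] show ?thesis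
    using lm_pos[of x] by (simp add: W_def[abs_def] k1_def mult.assoc)
qed

lemma W_pos: "W x > 0" unfolding W_def using lm_pos by simp

sublocale weight: catenoid_weight m W
proof
  show "DIM('a) = Suc m" by (rule dimension)
  show "1 \<le> m" using m2 by simp
  show "0 < W x" for x by (rule W_pos)
  show "W x = W y" if "norm x = norm y" for x y using that by (simp add: W_def lm_def)
  show "GDERIV W x :> ((real m - 1) * W x * (tanh (real m * ln (norm x)) - 1) / (norm x)\<^sup>2) *\<^sub>R x" if "x \<noteq> 0" for x
    using GDERIV_W[OF that] by (simp add: T_def)
qed

lemma th_eq: "weight.th x = T (ln (norm x))"
  by (simp add: weight.th_def T_def)

lemma inner_R: "R u \<bullet> R v = u \<bullet> v"
  using R unfolding orthogonal_transformation_def by blast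

lemma linear_R: "linear R" using R by (rule orthogonal_transformation_linear)

lemma bounded_linear_R: "bounded_linear R"
  using linear_R by (simp add: linear_conv_bounded_linear)

lemma inv_R: "inv R (R z) = z" "R (inv R z) = z" "linear (inv R)"
  using orthogonal_transformation_inj[OF R] orthogonal_transformation_surj[OF R]
    orthogonal_transformation_linear[OF orthogonal_transformation_inv[OF R]]
  by (simp_all add: surj_f_inv_f)

lemma inner_R_inv: "R u \<bullet> b = u \<bullet> inv R b"
  using inner_R[of u "inv R b"] inv_R(2)[of b] by simp

lemma derivative_Psi:
  assumes x: "x \<noteq> 0" shows "(Psi has_derivative DPsi x) (at x)"
proof -
  have 1: "(lm has_derivative (\<lambda>v. v \<bullet> (k1 x *\<^sub>R x))) (at x)"
    using GDERIV_lm[OF x] by (simp add: gderiv_def)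
  have 2: "((\<lambda>x. sig (ln (norm x))) has_derivative (\<lambda>v. v \<bullet> (k2 x *\<^sub>R x))) (at x)"
    using GDERIV_radial[OF x sig(2)] by (simp add: gderiv_def k2_def)
  have "((\<lambda>x. lm x *\<^sub>R x) has_derivative (\<lambda>v. lm x *\<^sub>R v + (v \<bullet> (k1 x *\<^sub>R x)) *\<^sub>R x)) (at x)"
    using has_derivative_scaleR[OF 1 has_derivative_ident] by simp
  from has_derivative_Pair[OF this 2]
  have "(Psi0 has_derivative DPsi0 x) (at x)"
    by (simp add: Psi0_def[abs_def] DPsi0_def[abs_def] inner_commute)
  then have "((\<lambda>x. R (Psi0 x)) has_derivative (\<lambda>v. R (DPsi0 x v))) (at x)"
    by (rule bounded_linear.has_derivative[OF bounded_linear_R])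
  then show ?thesis unfolding Psi_def[abs_def] DPsi_def[abs_def] by (auto intro!: derivative_eq_intros)
qed

text \<open>Apart from the conformal term, the coefficient of (x . v) (x . w) is a multiple of T^2 -
  1 + 1 / csh^2. It vanishes because the profile curve has speed Phi in t, the same as the radius of
  the horizontal sphere.\<close>

lemma conformal_Psi:
  assumes x: "x \<noteq> 0" shows "DPsi x v \<bullet> DPsi x w = (lm x)\<^sup>2 * (v \<bullet> w)"
proof -
  define r where "r = norm x"
  define t where "t = T (ln r)"
  define C where "C = csh (ln r)"
  define F where "F = Phi (ln r)"
  have r: "r > 0" using x by (simp add: r_def)
  have C: "C > 0" unfolding C_def by (rule csh_pos)
  have xx: "x \<bullet> x = r\<^sup>2" by (simp add: r_def power2_norm_eq_inner)
  have t2: "t\<^sup>2 = 1 - 1 / C\<^sup>2" using T_square[of "ln r"] by (simp add: t_def C_def)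
  have l: "lm x = F / r" using lm_eq[OF x] by (simp add: F_def r_def)
  have k1: "k1 x = F / r * (t - 1) / r\<^sup>2" by (simp add: k1_def l t_def r_def)
  have k2: "k2 x = F / C / r\<^sup>2" by (simp add: k2_def dsig_def F_def C_def r_def)
  have "DPsi x v \<bullet> DPsi x w = (lm x)\<^sup>2 * (v \<bullet> w)
    + (2 * lm x * k1 x + (k1 x)\<^sup>2 * r\<^sup>2 + (k2 x)\<^sup>2) * ((x \<bullet> v) * (x \<bullet> w))"
    unfolding DPsi_def inner_R DPsi0_def
    by (simp add: inner_add_left inner_add_right inner_commute[of v x] inner_commute[of w x] xx power2_eq_square algebra_simps)
  also have "2 * lm x * k1 x + (k1 x)\<^sup>2 * r\<^sup>2 + (k2 x)\<^sup>2 = F\<^sup>2 / r^4 * (t\<^sup>2 - 1 + 1 / C\<^sup>2)"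
    unfolding k1 k2 l using r C by (simp add: field_simps power2_eq_square power_numeral_reduce)
  also have "t\<^sup>2 - 1 + 1 / C\<^sup>2 = 0" using t2 by simp
  finally show ?thesis by simp
qed

lemma crd_Psi: assumes x: "x \<noteq> 0" shows "crd (Psi x) = x"
proof -
  have "inv R (Psi x - c0) = Psi0 x" by (simp add: Psi_def inv_R)
  moreover have "norm x * (inverse (lm x) * inverse (norm x)) * lm x = 1"
    using x lm_pos[of x] by (simp add: field_simps)
  ultimately show ?thesis using x lm_pos[of x]
    by (simp add: crd_def Psi0_def \<tau>(1) Let_def)
qed

lemma crd_differentiable: assumes x: "x \<noteq> 0" shows "crd differentiable (at (Psi x) within A)"
proof -
  define G where "G z = exp (\<tau> (snd z)) *\<^sub>R (fst z /\<^sub>R norm (fst z))" for z :: "'a \<times> real"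
  have f0: "fst (Psi0 x) \<noteq> 0" using x lm_pos[of x] by (simp add: Psi0_def)
  have sn: "((\<lambda>z. \<tau> (snd z)) has_derivative (\<lambda>v. (1 / dsig (ln (norm x))) * snd v)) (at (Psi0 x))"
  proof -
    have "(\<tau> has_derivative (*) (1 / dsig (ln (norm x)))) (at (snd (Psi0 x)))"
      using \<tau>(2) by (simp add: Psi0_def has_field_derivative_def)
    from has_derivative_compose[OF has_derivative_snd[OF has_derivative_ident] this] show ?thesis by simp
  qed
  have 1: "(\<lambda>z. exp (\<tau> (snd z))) differentiable (at (Psi0 x))"
    using has_derivative_exp[OF sn] by (auto simp: differentiable_def)
  have 2: "(\<lambda>z. fst z :: 'a) differentiable (at (Psi0 x))"
    using has_derivative_fst[OF has_derivative_ident] by (auto simp: differentiable_def)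
  have 3: "(\<lambda>z. norm (fst z :: 'a)) differentiable (at (Psi0 x))"
    using differentiable_chain_at[OF 2 differentiable_norm_at[OF f0]] by (simp add: o_def)
  have 4: "(\<lambda>z. inverse (norm (fst z :: 'a))) differentiable (at (Psi0 x))"
    using f0 by (intro differentiable_inverse 3) auto
  have "G differentiable (at (Psi0 x))"
    unfolding G_def by (intro differentiable_scaleR 1 2 4)
  then obtain G' where G': "(G has_derivative G') (at (Psi0 x))" by (auto simp: differentiable_def)
  have "((\<lambda>p. inv R (p - c0)) has_derivative (\<lambda>v. inv R v)) (at (Psi x))"
    using inv_R(3)
    by (intro bounded_linear.has_derivative[of "inv R"])
      (auto simp: linear_conv_bounded_linear intro!: derivative_eq_intros)
  moreover have "inv R (Psi x - c0) = Psi0 x" by (simp add: Psi_def inv_R)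
  ultimately have "((\<lambda>p. G (inv R (p - c0))) has_derivative (\<lambda>v. G' (inv R v))) (at (Psi x))"
    using has_derivative_compose[of "\<lambda>p. inv R (p - c0)" "inv R" "Psi x" UNIV G G'] G' by simp
  then have "(crd has_derivative (\<lambda>v. G' (inv R v))) (at (Psi x))"
    by (simp add: crd_def[abs_def] G_def Let_def)
  then show ?thesis using differentiable_at_withinI differentiable_def by blast
qed

lemma C1_DPsi: "C1_on (- {0}) (\<lambda>x. DPsi x v \<bullet> b)"
proof -
  obtain w s where ws: "inv R b = (w, s)" by force
  have "C1_on (- {0}) (\<lambda>x. lm x * (v \<bullet> w) + k1 x * (x \<bullet> v) * (x \<bullet> w) + k2 x * (x \<bullet> v) * s)"
    by (intro C1_on_add C1_on_mult C1_lm C1_k1 C1_k2 C1_on_inner C1_on_const)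
  then show ?thesis
    by (simp add: DPsi_def inner_R_inv ws DPsi0_def inner_add_left)
qed

lemma C1_W: "C1_on (- {0}) W" by (rule weight.C1_on_P)

text \<open>Pulling b back by the rotation to (w, s) splits the coordinate function into lm x (x .
  w) and s times the height. The weighted gradient is the field \<open>Y\<close>, whose horizontal
  part (\<alpha>, \<beta>) and vertical part (\<gamma>) are separately divergence free.\<close>

lemma harmonic_Psi:
  assumes x: "x \<noteq> 0"
  shows "(\<Sum>c\<in>Basis. gr (\<lambda>y. W y * (DPsi y c \<bullet> b)) x \<bullet> c) = 0"
proof -
  obtain w s where ws: "inv R b = (w, s)" by force
  define \<alpha> where "\<alpha> x = W x * lm x" for x
  define \<beta> where "\<beta> x = W x * k1 x" for x
  define \<gamma> where "\<gamma> x = W x * k2 x" for x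
  define r where "r = norm x"
  define t where "t = T (ln r)"
  have r: "r > 0" using x by (simp add: r_def)
  have xx: "x \<bullet> x = r\<^sup>2" by (simp add: r_def power2_norm_eq_inner)
  note CW = C1_W
  have S: "C1_on (- {0}) \<alpha>" "C1_on (- {0}) \<beta>" "C1_on (- {0}) \<gamma>"
    unfolding \<alpha>_def \<beta>_def \<gamma>_def by (intro C1_on_mult CW C1_lm C1_k1 C1_k2)+
  have d: "W differentiable (at x)" "lm differentiable (at x)"
    "(\<lambda>x::'a. T (ln (norm x)) - 1) differentiable (at x)" "(\<lambda>x::'a. 1 / (norm x)\<^sup>2) differentiable (at x)"
    "(\<lambda>x::'a. dsig (ln (norm x))) differentiable (at x)"
    using gderiv_differentiable[OF GDERIV_W[OF x]] gderiv_differentiable[OF GDERIV_lm[OF x]]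
      gderiv_differentiable[OF GDERIV_inverse_norm_square[OF x]]
      gderiv_differentiable[OF GDERIV_radial[OF x deriv_dsig]]
      gderiv_differentiable[OF GDERIV_radial[OF x deriv_T]] by auto
  have gW: "gr W x = ((real m - 1) * W x * (t - 1) / r\<^sup>2) *\<^sub>R x"
    using gderiv_imp_gr[OF GDERIV_W[OF x]] by (simp add: t_def r_def)
  have gl: "gr lm x = (lm x * (t - 1) / r\<^sup>2) *\<^sub>R x"
    using gderiv_imp_gr[OF GDERIV_lm[OF x]] by (simp add: k1_def t_def r_def)
  have gT: "gr (\<lambda>x. T (ln (norm x)) - 1) x = (real m * (1 - t\<^sup>2) / r\<^sup>2) *\<^sub>R x"
    using gderiv_imp_gr[OF GDERIV_diff[OF GDERIV_radial[OF x deriv_T] GDERIV_const[of 1]]]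
    by (simp add: t_def r_def)
  have gn: "gr (\<lambda>x. 1 / (norm x)\<^sup>2) x = (- 2 / r ^ 4) *\<^sub>R x"
    using gderiv_imp_gr[OF GDERIV_inverse_norm_square[OF x]] by (simp add: r_def)
  have gs: "gr (\<lambda>x. dsig (ln (norm x))) x = (- (real m - 1) * t * dsig (ln r) / r\<^sup>2) *\<^sub>R x"
    using gderiv_imp_gr[OF GDERIV_radial[OF x deriv_dsig]] by (simp add: t_def r_def)
  have ga: "gr \<alpha> x = (real m * \<alpha> x * (t - 1) / r\<^sup>2) *\<^sub>R x"
    unfolding \<alpha>_def gr_mult[OF d(1,2)] gW gl scaleR_scaleR scaleR_add_left[symmetric]
    by (intro arg_cong[of _ _ "\<lambda>c. c *\<^sub>R x"]) (simp add: algebra_simps add_divide_distrib diff_divide_distrib)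
  have b_eq: "\<beta> = (\<lambda>x. \<alpha> x * ((T (ln (norm x)) - 1) * (1 / (norm x)\<^sup>2)))"
    by (auto simp: \<beta>_def \<alpha>_def k1_def)
  have g_eq: "\<gamma> = (\<lambda>x. W x * (dsig (ln (norm x)) * (1 / (norm x)\<^sup>2)))"
    by (auto simp: \<gamma>_def k2_def)
  have da: "\<alpha> differentiable (at x)" "\<beta> differentiable (at x)" "\<gamma> differentiable (at x)"
    using S x by (auto simp: C1_on_def)
  have dd: "(\<lambda>x::'a. (T (ln (norm x)) - 1) * (1 / (norm x)\<^sup>2)) differentiable (at x)"
    "(\<lambda>x::'a. dsig (ln (norm x)) * (1 / (norm x)\<^sup>2)) differentiable (at x)"
    by (rule differentiable_mult[OF d(3) d(4)] differentiable_mult[OF d(5) d(4)])+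
  have gb: "gr \<beta> x = (\<alpha> x * (t - 1) / r^4 * (real m * (t - 1) - real m * (1 + t) - 2)) *\<^sub>R x"
    unfolding b_eq gr_mult[OF da(1) dd(1)] gr_mult[OF d(3,4)] ga gT gn
    unfolding r_def[symmetric] t_def[symmetric] scaleR_add_right scaleR_scaleR scaleR_add_left[symmetric]
    using r by (intro arg_cong[of _ _ "\<lambda>c. c *\<^sub>R x"]) (simp add: field_simps power2_eq_square power_numeral_reduce)
  have gg: "gr \<gamma> x = (- (real m + 1) * \<gamma> x / r\<^sup>2) *\<^sub>R x"
    unfolding g_eq gr_mult[OF d(1) dd(2)] gr_mult[OF d(5,4)] gW gs gn
    unfolding r_def[symmetric] t_def[symmetric] scaleR_add_right scaleR_scaleR scaleR_add_left[symmetric]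
    using r by (intro arg_cong[of _ _ "\<lambda>c. c *\<^sub>R x"]) (simp add: field_simps power2_eq_square power_numeral_reduce)
  \<comment> \<open>The factors 1 put the sum into the shape of \<open>dv_lincomb\<close>.\<close>
  define Y where "Y y = 1 *\<^sub>R (1 *\<^sub>R (\<alpha> y *\<^sub>R w) + 1 *\<^sub>R ((\<beta> y * (y \<bullet> w)) *\<^sub>R y)) + s *\<^sub>R (\<gamma> y *\<^sub>R y)" for y
  have F1: "C1_field (- {0}) (\<lambda>y. \<alpha> y *\<^sub>R w)" by (intro C1_field_scale S C1_field_const)
  have F2: "C1_field (- {0}) (\<lambda>y. (\<beta> y * (y \<bullet> w)) *\<^sub>R y)" by (intro C1_field_scale C1_on_mult S C1_on_inner C1_field_id)
  have F3: "C1_field (- {0}) (\<lambda>y. \<gamma> y *\<^sub>R y)" by (intro C1_field_scale S C1_field_id)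
  have x': "x \<in> - {0}" using x by simp
  have did: "b \<in> Basis \<Longrightarrow> (\<lambda>y::'a. y \<bullet> b) differentiable (at x)" for b
    using C1_field_differentiable[OF C1_field_id, of x UNIV] by simp
  have diw: "(\<lambda>y::'a. y \<bullet> w) differentiable (at x)" using C1_on_inner[of UNIV w] by (auto simp: C1_on_def)
  have giw: "gr (\<lambda>y::'a. y \<bullet> w) x = w"
    by (rule gderiv_imp_gr) (auto simp: gderiv_def intro!: derivative_eq_intros)
  have "(\<Sum>c\<in>Basis. gr (\<lambda>y. W y * (DPsi y c \<bullet> b)) x \<bullet> c) = dv Y x"
  proof -
    have "W y * (DPsi y c \<bullet> b) = Y y \<bullet> c" for y c
    proof -
      have "DPsi y c \<bullet> b = DPsi0 y c \<bullet> (w, s)" by (simp add: DPsi_def inner_R_inv ws)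
      then show ?thesis
        by (simp add: Y_def \<alpha>_def \<beta>_def \<gamma>_def DPsi0_def inner_add_left inner_commute[of w c] algebra_simps)
    qed
    then show ?thesis by (simp add: dv_def)
  qed
  also have "\<dots> = dv (\<lambda>y. \<alpha> y *\<^sub>R w) x + dv (\<lambda>y. (\<beta> y * (y \<bullet> w)) *\<^sub>R y) x + s * dv (\<lambda>y. \<gamma> y *\<^sub>R y) x"
    unfolding Y_def
    by (subst dv_lincomb[OF C1_field_lincomb[OF F1 F2] F3 x'], subst dv_lincomb[OF F1 F2 x']) simp
  also have "dv (\<lambda>y. \<alpha> y *\<^sub>R w) x = gr \<alpha> x \<bullet> w"
    using da dv_has_derivative[OF has_derivative_const[of w], of x] by (subst dv_scale) auto
  also have "dv (\<lambda>y. (\<beta> y * (y \<bullet> w)) *\<^sub>R y) x = gr (\<lambda>y. \<beta> y * (y \<bullet> w)) x \<bullet> x + \<beta> x * (x \<bullet> w) * (real m + 1)"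
    using da diw did by (subst dv_scale) (auto intro!: differentiable_mult simp: dv_id dimension)
  also have "gr (\<lambda>y. \<beta> y * (y \<bullet> w)) x = \<beta> x *\<^sub>R w + (x \<bullet> w) *\<^sub>R gr \<beta> x"
    unfolding gr_mult[OF da(2) diw] giw ..
  also have "dv (\<lambda>y. \<gamma> y *\<^sub>R y) x = gr \<gamma> x \<bullet> x + \<gamma> x * (real m + 1)"
    using da did by (subst dv_scale) (auto simp: dv_id dimension)
  finally have "(\<Sum>c\<in>Basis. gr (\<lambda>y. W y * (DPsi y c \<bullet> b)) x \<bullet> c)
    = gr \<alpha> x \<bullet> w + ((\<beta> x *\<^sub>R w + (x \<bullet> w) *\<^sub>R gr \<beta> x) \<bullet> x + \<beta> x * (x \<bullet> w) * (real m + 1)) + s * (gr \<gamma> x \<bullet> x + \<gamma> x * (real m + 1))" .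
  also have "gr \<gamma> x \<bullet> x + \<gamma> x * (real m + 1) = 0" unfolding gg using r by (simp add: xx field_simps)
  also have "gr \<alpha> x \<bullet> w + ((\<beta> x *\<^sub>R w + (x \<bullet> w) *\<^sub>R gr \<beta> x) \<bullet> x + \<beta> x * (x \<bullet> w) * (real m + 1)) = 0"
  proof -
    have bx: "\<beta> x = \<alpha> x * (t - 1) / r\<^sup>2" by (simp add: b_eq t_def r_def)
    show ?thesis unfolding ga gb bx using r
      by (simp add: inner_add_left xx inner_commute[of w x]) (simp add: field_simps power2_eq_square power_numeral_reduce)
  qed
  finally show ?thesis by simp
qed

sublocale chart: minimal_chart M "- {0}" Psi DPsi lm crd W
proof
  show "Psi ` (- {0}) = M" by (simp add: M_def)
  show "(Psi has_derivative DPsi x) (at x)" if "x \<in> - {0}" for x using that derivative_Psi by simp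
  show "DPsi x v \<bullet> DPsi x w = (lm x)\<^sup>2 * (v \<bullet> w)" if "x \<in> - {0}" for x v w using that conformal_Psi by simp
  show "crd (Psi x) = x" if "x \<in> - {0}" for x using that crd_Psi by simp
  show "crd differentiable (at (Psi x) within M)" if "x \<in> - {0}" for x using that crd_differentiable by simp
  show "(\<Sum>c\<in>Basis. gr (\<lambda>y. W y * (DPsi y c \<bullet> b)) x \<bullet> c) = 0" if "x \<in> - {0}" for x b
    using that harmonic_Psi by simp
qed (use lm_pos W_pos C1_W C1_lm C1_DPsi in auto)

section \<open>The second fundamental form of the catenoid\<close>

definition nu0 :: "'a \<Rightarrow> 'a \<times> real" where
  "nu0 x = ((exp (- ln (norm x)) / csh (ln (norm x))) *\<^sub>R x, - T (ln (norm x)))"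

definition Dnu0 :: "'a \<Rightarrow> 'a \<Rightarrow> 'a \<times> real" where
  "Dnu0 x v = (let r = norm x; t = T (ln r); C = csh (ln r) in
    ((1 / (r * C)) *\<^sub>R v - ((1 + real m * t) / (r^3 * C) * (x \<bullet> v)) *\<^sub>R x, - real m * (1 - t\<^sup>2) / r\<^sup>2 * (x \<bullet> v)))"

text \<open>The unit normal at parameter t is (\<omega> / csh t, - T t). Up to sign the principal
  curvatures are 1 / (Phi csh), with multiplicity m, and -m / (Phi csh) along the profile, so their
  squares add up to m (m + 1) / (Phi csh)^2, and 1 / csh^2 is 1 - T^2.\<close>

lemma norm_A:
  assumes x: "x \<noteq> 0"
  shows "(norm_second_fundamental_form M (Psi x))\<^sup>2
    = real m * (real m + 1) * (1 - (T (ln (norm x)))\<^sup>2) / (Phi (ln (norm x)))\<^sup>2"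
proof -
  have dim: "DIM('a \<times> real) = Suc DIM('a)" by simp
  have der: "((\<lambda>x. R (nu0 x)) has_derivative (\<lambda>v. R (Dnu0 y v))) (at y)" if y: "y \<in> - {0}" for y
  proof -
    have y0: "y \<noteq> 0" using y by simp
    define r where "r = norm y"
    define t where "t = T (ln r)"
    define C where "C = csh (ln r)"
    have r: "r > 0" using y0 by (simp add: r_def)
    have C: "C > 0" unfolding C_def by (rule csh_pos)
    have "((\<lambda>t. exp (- t) / csh t) has_real_derivative - (1 + real m * T u) * (exp (- u) / csh u)) (at u)" for u
      using csh_pos[of u] by (auto intro!: derivative_eq_intros deriv_csh simp: field_simps)
    from GDERIV_radial[OF y0 this]
    have 1: "((\<lambda>x. exp (- ln (norm x)) / csh (ln (norm x))) has_derivative (\<lambda>v. v \<bullet> ((- (1 + real m * t) * (1 / (r * C)) / r\<^sup>2) *\<^sub>R y))) (at y)"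
      using r by (simp add: gderiv_def r_def[symmetric] t_def[symmetric] C_def[symmetric] exp_minus field_simps)
    have "((\<lambda>t. - T t) has_real_derivative - (real m * (1 - (T u)\<^sup>2))) (at u)" for u
      by (intro DERIV_minus deriv_T)
    from GDERIV_radial[OF y0 this]
    have 2: "((\<lambda>x. - T (ln (norm x))) has_derivative (\<lambda>v. v \<bullet> ((- (real m * (1 - t\<^sup>2)) / r\<^sup>2) *\<^sub>R y))) (at y)"
      by (simp add: gderiv_def r_def t_def)
    from has_derivative_Pair[OF has_derivative_scaleR[OF 1 has_derivative_ident] 2]
    have "(nu0 has_derivative (\<lambda>v. ((exp (- ln (norm y)) / csh (ln (norm y))) *\<^sub>R v
        + (v \<bullet> ((- (1 + real m * t) * (1 / (r * C)) / r\<^sup>2) *\<^sub>R y)) *\<^sub>R y, v \<bullet> ((- (real m * (1 - t\<^sup>2)) / r\<^sup>2) *\<^sub>R y)))) (at y)"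
      by (simp add: nu0_def[abs_def])
    moreover have "(\<lambda>v. ((exp (- ln (norm y)) / csh (ln (norm y))) *\<^sub>R v
        + (v \<bullet> ((- (1 + real m * t) * (1 / (r * C)) / r\<^sup>2) *\<^sub>R y)) *\<^sub>R y, v \<bullet> ((- (real m * (1 - t\<^sup>2)) / r\<^sup>2) *\<^sub>R y))) = Dnu0 y"
    proof
      fix v
      have e: "exp (- ln (norm y)) / csh (ln (norm y)) = 1 / (r * C)"
        using r by (simp add: r_def C_def exp_minus field_simps)
      have "v \<bullet> ((- (1 + real m * t) * (1 / (r * C)) / r\<^sup>2) *\<^sub>R y) = - ((1 + real m * t) / (r^3 * C) * (y \<bullet> v))"
        using r C by (simp add: inner_commute[of v y] field_simps power_numeral_reduce)
      then show "((exp (- ln (norm y)) / csh (ln (norm y))) *\<^sub>R v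
        + (v \<bullet> ((- (1 + real m * t) * (1 / (r * C)) / r\<^sup>2) *\<^sub>R y)) *\<^sub>R y, v \<bullet> ((- (real m * (1 - t\<^sup>2)) / r\<^sup>2) *\<^sub>R y)) = Dnu0 y v"
        unfolding Dnu0_def Let_def r_def[symmetric] t_def[symmetric] C_def[symmetric] e[unfolded r_def[symmetric]]
        by (simp add: inner_commute[of v y] r_def[symmetric] C_def[symmetric] e[unfolded r_def[symmetric] C_def[symmetric]])
    qed
    ultimately have "(nu0 has_derivative Dnu0 y) (at y)" by (simp only:)
    then show ?thesis by (rule bounded_linear.has_derivative[OF bounded_linear_R])
  qed
  have e1: "exp (- ln (norm y)) = 1 / norm y" if "y \<noteq> 0" for y :: 'a
    using that by (simp add: exp_minus inverse_eq_divide)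
  have nrm: "norm (R (nu0 y)) = 1" if "y \<in> - {0}" for y
  proof -
    have y0: "y \<noteq> 0" using that by simp
    have "R (nu0 y) \<bullet> R (nu0 y) = 1 / (csh (ln (norm y)))\<^sup>2 + (T (ln (norm y)))\<^sup>2"
    proof -
      have "(1 / norm y / csh (ln (norm y))) * (1 / norm y / csh (ln (norm y)) * (norm y)\<^sup>2) = 1 / (csh (ln (norm y)))\<^sup>2"
        using y0 by (simp add: power2_eq_square)
      then show ?thesis
        unfolding inner_R nu0_def e1[OF y0] inner_Pair unfolding inner_scaleR_left inner_scaleR_right dot_square_norm
        using y0 by (simp add: power_divide power_mult_distrib)
    qed
    then show ?thesis using T_square[of "ln (norm y)"] by (simp add: norm_eq_1)
  qed
  have nor: "R (nu0 y) \<bullet> DPsi y v = 0" if "y \<in> - {0}" for y v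
  proof -
    have y0: "y \<noteq> 0" using that by simp
    define r where "r = norm y"
    have r: "r > 0" using y0 by (simp add: r_def)
    have er: "exp (- ln r) = 1 / r" using r by (simp add: exp_minus inverse_eq_divide)
    have yy: "y \<bullet> y = r\<^sup>2" by (simp add: r_def power2_norm_eq_inner)
    show ?thesis
      unfolding DPsi_def inner_R using r csh_pos[of "ln r"]
      by (simp add: nu0_def DPsi0_def er k1_def k2_def lm_eq[OF y0] dsig_def r_def[symmetric] inner_add_right yy)
        (simp add: field_simps power2_eq_square)
  qed
  define r where "r = norm x"
  define t where "t = T (ln r)"
  define C where "C = csh (ln r)"
  define F where "F = Phi (ln r)"
  have r: "r > 0" using x by (simp add: r_def)
  have C: "C > 0" unfolding C_def by (rule csh_pos)
  have F: "F > 0" unfolding F_def by (rule Phi_pos)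
  have xx: "x \<bullet> x = r\<^sup>2" by (simp add: r_def power2_norm_eq_inner)
  have t2: "1 - t\<^sup>2 = 1 / C\<^sup>2" using T_square[of "ln r"] by (simp add: t_def C_def)
  have l: "lm x = F / r" using lm_eq[OF x] by (simp add: F_def r_def)
  have k1: "k1 x = F / r * (t - 1) / r\<^sup>2" by (simp add: k1_def l t_def r_def)
  have k2: "k2 x = F / C / r\<^sup>2" by (simp add: k2_def dsig_def F_def C_def r_def)
  have shape: "R (Dnu0 x v) \<bullet> DPsi x w = F / (r\<^sup>2 * C) * ((v \<bullet> w) - (real m + 1) / r\<^sup>2 * ((x \<bullet> v) * (x \<bullet> w)))" for v w
  proof -
    have "R (Dnu0 x v) \<bullet> DPsi x w = lm x / (r * C) * (v \<bullet> w) + (k1 x / (r * C) - (1 + real m * t) / (r^3 * C) * (lm x + k1 x * r\<^sup>2)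
       - real m * (1 - t\<^sup>2) / r\<^sup>2 * k2 x) * ((x \<bullet> v) * (x \<bullet> w))"
      unfolding DPsi_def inner_R Dnu0_def DPsi0_def Let_def r_def[symmetric] t_def[symmetric] C_def[symmetric]
      by (simp add: inner_add_right inner_diff_left xx inner_commute[of v x]) (simp add: algebra_simps add_divide_distrib diff_divide_distrib)
    also have "k1 x / (r * C) - (1 + real m * t) / (r^3 * C) * (lm x + k1 x * r\<^sup>2) - real m * (1 - t\<^sup>2) / r\<^sup>2 * k2 x
      = F / (r^4 * C) * ((t - 1) - (1 + real m * t) * t - real m * (1 - t\<^sup>2))"
      unfolding k1 k2 l using r C by (simp add: field_simps power2_eq_square power_numeral_reduce)
    also have "(t - 1) - (1 + real m * t) * t - real m * (1 - t\<^sup>2) = - (real m + 1)"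
      by (simp add: algebra_simps power2_eq_square)
    finally show ?thesis unfolding l using r C by (simp add: field_simps power2_eq_square power_numeral_reduce)
  qed
  \<comment> \<open>The squared entries of the identity minus (m + 1) times the projection onto x:
    this matrix has the eigenvalue 1 with multiplicity m and the simple eigenvalue -m.\<close>
  have sum: "(\<Sum>b\<in>Basis. \<Sum>c\<in>Basis. ((b \<bullet> c) - (real m + 1) / r\<^sup>2 * ((x \<bullet> b) * (x \<bullet> c)))\<^sup>2) = real m * (real m + 1)"
  proof -
    define \<kappa> where "\<kappa> = (real m + 1) / r\<^sup>2"
    have one: "(\<Sum>c\<in>Basis. ((b \<bullet> c) - \<kappa> * ((x \<bullet> b) * (x \<bullet> c)))\<^sup>2)
        = 1 - 2 * \<kappa> * (x \<bullet> b)\<^sup>2 + \<kappa>\<^sup>2 * (x \<bullet> b)\<^sup>2 * r\<^sup>2" if b: "b \<in> Basis" for b :: 'a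
    proof -
      have "(\<Sum>c\<in>Basis. ((b \<bullet> c) - \<kappa> * ((x \<bullet> b) * (x \<bullet> c)))\<^sup>2)
        = (\<Sum>c\<in>Basis. (b \<bullet> c) * (b \<bullet> c) - 2 * \<kappa> * (x \<bullet> b) * ((b \<bullet> c) * (x \<bullet> c)) + \<kappa>\<^sup>2 * (x \<bullet> b)\<^sup>2 * ((x \<bullet> c) * (x \<bullet> c)))"
        by (intro sum.cong HOL.refl) (simp add: power2_eq_square algebra_simps)
      also have "\<dots> = b \<bullet> b - 2 * \<kappa> * (x \<bullet> b) * (b \<bullet> x) + \<kappa>\<^sup>2 * (x \<bullet> b)\<^sup>2 * (x \<bullet> x)"
        unfolding euclidean_inner[of b b] euclidean_inner[of b x] euclidean_inner[of x x]
        by (simp add: sum.distrib sum_subtractf sum_distrib_left)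
      finally show ?thesis using b by (simp add: inner_commute[of b x] xx power2_eq_square)
    qed
    have "(\<Sum>b\<in>Basis. \<Sum>c\<in>Basis. ((b \<bullet> c) - \<kappa> * ((x \<bullet> b) * (x \<bullet> c)))\<^sup>2)
      = (\<Sum>b\<in>(Basis::'a set). 1 - 2 * \<kappa> * (x \<bullet> b)\<^sup>2 + \<kappa>\<^sup>2 * (x \<bullet> b)\<^sup>2 * r\<^sup>2)"
      by (simp add: one)
    also have "\<dots> = (real m + 1) - 2 * \<kappa> * (x \<bullet> x) + \<kappa>\<^sup>2 * (x \<bullet> x) * r\<^sup>2"
      unfolding euclidean_inner[of x x]
      by (simp add: sum.distrib sum_subtractf sum_distrib_left sum_distrib_right power2_eq_square dimension mult_ac)
    also have "\<dots> = real m * (real m + 1)"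
      unfolding xx \<kappa>_def using r by (simp add: field_simps power2_eq_square)
    finally show ?thesis by (simp add: \<kappa>_def)
  qed
  have "(norm_second_fundamental_form M (Psi x))\<^sup>2 = (\<Sum>b\<in>Basis. \<Sum>c\<in>Basis. (R (Dnu0 x b) \<bullet> DPsi x c)\<^sup>2) / (lm x)^4"
    by (rule chart.norm_second_fundamental_form_chart[where \<nu>="\<lambda>x. R (nu0 x)" and D\<nu>="\<lambda>x v. R (Dnu0 x v)"])
      (use x dim der nrm nor in auto)
  also have "\<dots> = (F / (r\<^sup>2 * C))\<^sup>2 * (real m * (real m + 1)) / (lm x)^4"
    unfolding shape power_mult_distrib[of "F / (r\<^sup>2 * C)"] sum_distrib_left[symmetric] sum ..
  also have "\<dots> = real m * (real m + 1) * (1 - t\<^sup>2) / F\<^sup>2"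
    unfolding l t2 using r C F by (simp add: field_simps power2_eq_square power_numeral_reduce)
  finally show ?thesis by (simp add: t_def F_def r_def)
qed

end

section \<open>The index\<close>

text \<open>\<open>function_space_dim\<close> speaks of \<open>module.dependent\<close> for
  pointwise scaling; interpreting this module makes the general facts on linear dependence
  available.\<close>

lemma module_fun: "module (\<lambda>(c::real) (f :: 'b \<Rightarrow> real) x. c * f x)"
  by unfold_locales (auto simp: fun_eq_iff algebra_simps)

lemma function_space_dim_ge_1:
  assumes "f \<in> V" "f p \<noteq> 0" shows "function_space_dim V \<ge> 1"
proof -
  interpret module "\<lambda>(c::real) (f :: 'a \<Rightarrow> real) x. c * f x" by (rule module_fun)
  have "\<not> dependent {f}"
  proof
    assume "dependent {f}"
    then obtain u where "u f \<noteq> 0" "(\<lambda>x. u f * f x) = 0"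
      by (auto simp: dependent_finite)
    then show False using assms(2) by (auto simp: fun_eq_iff)
  qed
  then have "enat (card {f}) \<le> function_space_dim V"
    unfolding function_space_dim_def using assms(1) by (intro SUP_upper) auto
  then show ?thesis by (simp add: one_enat_def)
qed

lemma function_space_dim_nonzero:
  assumes "function_space_dim V \<noteq> 0" shows "\<exists>f\<in>V. \<exists>p. f p \<noteq> 0"
proof -
  interpret module "\<lambda>(c::real) (f :: 'a \<Rightarrow> real) x. c * f x" by (rule module_fun)
  obtain B where B: "finite B" "B \<subseteq> V" "\<not> dependent B" "enat (card B) \<noteq> 0"
    using assms unfolding function_space_dim_def by (force simp: SUP_eq_iff bot_enat_def[symmetric] simp flip: bot_enat_def)
  then obtain f where f: "f \<in> B" by (metis card.empty ex_in_conv zero_enat_def)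
  have "f \<noteq> 0" using B(3) f dependent_zero by blast
  then show ?thesis using f B(2) by (auto simp: fun_eq_iff)
qed

lemma function_space_dim_le_1:
  assumes "\<And>f g. f \<in> V \<Longrightarrow> g \<in> V \<Longrightarrow> \<exists>a b. (a \<noteq> 0 \<or> b \<noteq> 0) \<and> (\<forall>p. a * f p + b * g p = 0)"
  shows "function_space_dim V \<le> 1"
  unfolding function_space_dim_def
proof (rule SUP_least)
  interpret module "\<lambda>(c::real) (f :: 'a \<Rightarrow> real) x. c * f x" by (rule module_fun)
  fix B assume "B \<in> {B. finite B \<and> B \<subseteq> V \<and> \<not> dependent B}"
  then have B: "finite B" "B \<subseteq> V" "\<not> dependent B" by auto
  have "card B \<le> 1"
  proof (rule ccontr)
    assume "\<not> card B \<le> 1"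
    then obtain f g where fg: "f \<in> B" "g \<in> B" "f \<noteq> g"
      using card_le_Suc0_iff_eq[OF B(1)] by auto
    obtain a b where ab: "a \<noteq> 0 \<or> b \<noteq> 0" "\<forall>p. a * f p + b * g p = 0"
      using assms fg B(2) by blast
    have "\<not> dependent {f, g}" using B(3) fg dependent_mono[of "{f, g}" B] by auto
    moreover have "dependent {f, g}"
    proof -
      have "(\<Sum>v\<in>{f, g}. (\<lambda>x. (if v = f then a else b) * v x)) = (0 :: 'a \<Rightarrow> real)"
        using fg(3) ab(2) by (auto simp: fun_eq_iff)
      moreover have "\<exists>v\<in>{f, g}. (if v = f then a else b) \<noteq> 0" using ab(1) fg(3) by auto
      ultimately show ?thesis
        unfolding dependent_finite[of "{f, g}", simplified] by (intro exI[of _ "\<lambda>v. if v = f then a else b"]) auto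
    qed
    ultimately show False by simp
  qed
  then show "enat (card B) \<le> 1" by (simp add: one_enat_def)
qed

context catenoid_chart
begin

lemma stability_eq:
  assumes \<Omega>: "open \<Omega>" "\<Omega> \<subseteq> - {0}" and D: "D = Psi ` \<Omega>" and x: "x \<in> \<Omega>" and f: "surface_Ck_on 2 M D f"
  shows "stability_operator M f (Psi x) = dv (\<lambda>y. W y *\<^sub>R gr (\<lambda>y. f (Psi y)) y) x / (W x * (lm x)\<^sup>2)
    + real m * (real m + 1) * (1 - (T (ln (norm x)))\<^sup>2) / (Phi (ln (norm x)))\<^sup>2 * f (Psi x)"
proof -
  have "x \<noteq> 0" using x \<Omega> by auto
  then show ?thesis unfolding stability_operator_def using norm_A chart.laplacian_chart[OF \<Omega> D x f] by simp
qed

text \<open>The origin lies outside the chart. The value 0 there fits the extension by zero, so the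
  pullback is a continuous function on the whole space.\<close>

definition pull :: "('a \<times> real \<Rightarrow> real) \<Rightarrow> 'a \<Rightarrow> real" where
  "pull f x = (if x = 0 then 0 else f (Psi x))"

text \<open>Transfers both eigenfunctions to the punctured space, where
  \<open>no_two_negative_directions\<close> excludes them. Independence is assumed for equal
  eigenvalues; for different ones orthogonality takes its place.\<close>

lemma two_eigenfunctions:
  assumes D: "bounded_domain M D" and \<mu>: "\<mu>1 < 0" "\<mu>2 < 0"
    and f: "f1 \<in> dirichlet_eigenspace M D \<mu>1" "f2 \<in> dirichlet_eigenspace M D \<mu>2"
    and nz: "f1 p1 \<noteq> 0" "f2 p2 \<noteq> 0"
    and indep: "\<And>a b. \<mu>1 = \<mu>2 \<Longrightarrow> \<forall>p. a * f1 p + b * f2 p = 0 \<Longrightarrow> a = 0 \<and> b = 0"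
  shows False
proof -
  define \<Omega> where "\<Omega> = - {0} \<inter> Psi -` D"
  define K where "K = crd ` closure D"
  have oD: "openin (top_of_set M) D" and cD: "compact (closure D)" and cDM: "closure D \<subseteq> M"
    using D by (auto simp: bounded_domain_def)
  obtain O' where O': "open O'" "D = M \<inter> O'" using oD by (auto simp: openin_open)
  have "\<Omega> = - {0} \<inter> Psi -` O'" unfolding \<Omega>_def O'(2) M_def by auto
  then have o\<Omega>: "open \<Omega>" using continuous_open_preimage[OF chart.continuous_\<Psi> chart.U O'(1)] by simp
  have s\<Omega>: "\<Omega> \<subseteq> - {0}" by (auto simp: \<Omega>_def)
  have DP: "D = Psi ` \<Omega>" unfolding \<Omega>_def using O'(2) by (auto simp: M_def)
  have K: "compact K" unfolding K_def
    using continuous_on_subset[OF chart.continuous_coord cDM] cD by (rule compact_continuous_image)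
  have K0: "0 \<notin> K" unfolding K_def using cDM chart.coord_in by fastforce
  have \<Omega>K: "\<Omega> \<subseteq> K"
  proof
    fix x assume x: "x \<in> \<Omega>"
    then have "Psi x \<in> D" by (simp add: DP)
    then have "Psi x \<in> closure D" by (rule subsetD[OF closure_subset])
    moreover have "x \<noteq> 0" using x s\<Omega> by blast
    then have "x = crd (Psi x)" using crd_Psi[of x] by simp
    ultimately show "x \<in> K" unfolding K_def by (rule image_eqI[rotated])
  qed
  have KP: "Psi x \<in> closure D" if "x \<in> K" for x
    using that cDM chart.coord_in unfolding K_def by auto
  have pull: "C1_on \<Omega> (pull f) \<and> C1_field \<Omega> (gr (pull f)) \<and> continuous_on UNIV (pull f) \<and> (\<forall>x. x \<notin> \<Omega> \<longrightarrow> pull f x = 0) \<and>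
    (\<forall>x\<in>\<Omega>. dv (\<lambda>x. W x *\<^sub>R gr (pull f) x) x = (- \<mu> * (W x * (lm x)\<^sup>2) - weight.q x) * pull f x)"
    if f: "f \<in> dirichlet_eigenspace M D \<mu>" for f \<mu>
  proof (intro conjI)
    have fC: "surface_Ck_on 2 M D f" and fc: "continuous_on (closure D) f" and f0: "\<And>p. p \<notin> D \<Longrightarrow> f p = 0"
      and fe: "\<And>p. p \<in> D \<Longrightarrow> stability_operator M f p = - \<mu> * f p"
      using f by (auto simp: dirichlet_eigenspace_def)
    have e: "pull f y = f (Psi y)" if "y \<in> \<Omega>" for y using that s\<Omega> by (auto simp: pull_def)
    have ge: "gr (\<lambda>y. f (Psi y)) y = gr (pull f) y" if "y \<in> \<Omega>" for y
      by (rule gr_cong_open[OF o\<Omega> that]) (simp add: e)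
    note C = chart.Ck_pullback[OF o\<Omega> s\<Omega> DP fC]
    show "C1_on \<Omega> (pull f)" by (rule C1_on_cong[OF o\<Omega> _ C(1)]) (simp add: e)
    show "C1_field \<Omega> (gr (pull f))"
      unfolding C1_field_def
    proof
      fix b :: 'a assume "b \<in> Basis"
      then have c: "C1_on \<Omega> (\<lambda>x. gr (\<lambda>y. f (Psi y)) x \<bullet> b)" using C(2) by (simp add: C1_field_def)
      show "C1_on \<Omega> (\<lambda>x. gr (pull f) x \<bullet> b)" by (rule C1_on_cong[OF o\<Omega> _ c]) (simp add: ge)
    qed
    show z: "\<forall>x. x \<notin> \<Omega> \<longrightarrow> pull f x = 0" using f0 by (auto simp: pull_def \<Omega>_def)
    \<comment> \<open>The closed sets \<open>K\<close> and \<open>- \<Omega>\<close> cover the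
      space. On the first the pullback is continuous because f is so on the closure of D; on the
      second it is zero.\<close>
    have "continuous_on K (\<lambda>x. f (Psi x))"
      using K0 KP by (intro continuous_on_compose2[OF fc] continuous_on_subset[OF chart.continuous_\<Psi>]) auto
    then have "continuous_on K (pull f)"
      by (rule continuous_on_eq) (use K0 in \<open>auto simp: pull_def\<close>)
    moreover have "continuous_on (- \<Omega>) (pull f)"
      using z by (subst continuous_on_cong[of _ "- \<Omega>" _ "\<lambda>x. 0"]) auto
    ultimately have "continuous_on (K \<union> - \<Omega>) (pull f)"
      using K o\<Omega> compact_imp_closed by (intro continuous_on_closed_Un) auto
    moreover have "K \<union> - \<Omega> = UNIV" using \<Omega>K by auto
    ultimately show "continuous_on UNIV (pull f)" by simp
    show "\<forall>x\<in>\<Omega>. dv (\<lambda>x. W x *\<^sub>R gr (pull f) x) x = (- \<mu> * (W x * (lm x)\<^sup>2) - weight.q x) * pull f x"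
    proof
      fix x assume x: "x \<in> \<Omega>"
      then have x0: "x \<noteq> 0" using s\<Omega> by auto
      define P where "P = W x"
      define F where "F = Phi (ln (norm x))"
      define r where "r = norm x"
      define a where "a = real m * (real m + 1) * (1 - (T (ln (norm x)))\<^sup>2)"
      define d where "d = dv (\<lambda>x. W x *\<^sub>R gr (pull f) x) x"
      have pos: "P > 0" "F > 0" "r > 0" unfolding P_def F_def r_def using W_pos Phi_pos x0 by auto
      have l: "(lm x)\<^sup>2 = F\<^sup>2 / r\<^sup>2" unfolding lm_eq[OF x0] F_def r_def by (simp add: power_divide)
      have dve: "dv (\<lambda>y. W y *\<^sub>R gr (\<lambda>y. f (Psi y)) y) x = d"
        unfolding d_def dv_def
      proof (intro sum.cong HOL.refl)
        fix b :: 'a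
        have "gr (\<lambda>y. (W y *\<^sub>R gr (\<lambda>y. f (Psi y)) y) \<bullet> b) x = gr (\<lambda>y. (W y *\<^sub>R gr (pull f) y) \<bullet> b) x"
          by (rule gr_cong_open[OF o\<Omega> x]) (simp add: ge)
        then show "gr (\<lambda>y. (W y *\<^sub>R gr (\<lambda>y. f (Psi y)) y) \<bullet> b) x \<bullet> b = gr (\<lambda>y. (W y *\<^sub>R gr (pull f) y) \<bullet> b) x \<bullet> b"
          by simp
      qed
      have "d / (P * (F\<^sup>2 / r\<^sup>2)) + a / F\<^sup>2 * f (Psi x) = - \<mu> * f (Psi x)"
        using stability_eq[OF o\<Omega> s\<Omega> DP x fC] fe[of "Psi x"] x DP
        unfolding dve l P_def[symmetric] F_def[symmetric] a_def[symmetric] by auto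
      then have "d = (- \<mu> * (P * (F\<^sup>2 / r\<^sup>2)) - P * a / r\<^sup>2) * f (Psi x)"
        using pos by (simp add: field_simps)
      moreover have "weight.q x = P * a / r\<^sup>2"
        by (simp add: weight.q_def th_eq P_def a_def r_def)
      ultimately show "dv (\<lambda>x. W x *\<^sub>R gr (pull f) x) x = (- \<mu> * (W x * (lm x)\<^sup>2) - weight.q x) * pull f x"
        unfolding d_def[symmetric] e[OF x] l P_def[symmetric] by simp
    qed
  qed
  note p1 = pull[OF f(1)] and p2 = pull[OF f(2)]
  \<comment> \<open>The weight is the volume density lm^(m + 1). Multiplying the eigenvalue equation
    by it puts the equation in divergence form, with positive constants -\<mu>1 and -\<mu>2.\<close>
  interpret eigen_pair m W \<Omega> K "pull f1" "pull f2" "\<lambda>x. W x * (lm x)\<^sup>2" "- \<mu>1" "- \<mu>2"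
  proof
    show "continuous_on (- {0}) (\<lambda>x. W x * (lm x)\<^sup>2)"
      by (intro continuous_intros C1_on_imp_continuous_on C1_W C1_lm)
    show "0 < W x * (lm x)\<^sup>2" for x using W_pos[of x] lm_pos[of x] by simp
  qed (use o\<Omega> K K0 \<Omega>K p1 p2 \<mu> in auto)
  have inD: "\<exists>x. pull f x = f p \<and> x \<noteq> 0" if "p \<in> D" for f p
    using that unfolding DP by (auto simp: pull_def \<Omega>_def)
  have f0: "f1 p = 0" "f2 p = 0" if "p \<notin> D" for p
    using f that unfolding dirichlet_eigenspace_def by blast+
  obtain z1 where z1: "pull f1 z1 \<noteq> 0" using inD[of p1 f1] nz(1) f0 by metis
  obtain z2 where z2: "pull f2 z2 \<noteq> 0" using inD[of p2 f2] nz(2) f0 by metis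
  show False
  proof (rule no_two_negative_directions[OF z1 z2])
    fix a b assume eq: "- \<mu>1 = - \<mu>2" and h: "\<forall>x. a * pull f1 x + b * pull f2 x = 0"
    have "a * f1 p + b * f2 p = 0" for p
    proof (cases "p \<in> D")
      case True
      then obtain x where x: "x \<in> \<Omega>" "p = Psi x" unfolding DP by (rule imageE)
      then have "x \<noteq> 0" using s\<Omega> by blast
      then show ?thesis using h[rule_format, of x] x(2) by (simp add: pull_def)
    qed (simp add: f0)
    moreover have "\<mu>1 = \<mu>2" using eq by linarith
    ultimately show "a = 0 \<and> b = 0" by (intro indep allI)
  qed
qed

text \<open>\<open>two_eigenfunctions\<close> is used twice: for one eigenvalue it bounds the
  multiplicity by 1, and for two it shows that at most one multiplicity in the sum is
  nonzero.\<close>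

lemma num_negative_le_1:
  assumes D: "bounded_domain M D"
  shows "num_negative_eigenvalues M D \<le> 1"
  unfolding num_negative_eigenvalues_def
proof (rule SUP_least)
  fix \<Lambda> :: "real set" assume "\<Lambda> \<in> {\<Lambda>. finite \<Lambda> \<and> \<Lambda> \<subseteq> {..<0}}"
  then have L: "finite \<Lambda>" "\<And>\<mu>. \<mu> \<in> \<Lambda> \<Longrightarrow> \<mu> < 0" by auto
  let ?d = "\<lambda>\<mu>. function_space_dim (dirichlet_eigenspace M D \<mu>)"
  have one: "?d \<mu> \<le> 1" if "\<mu> \<in> \<Lambda>" for \<mu>
  proof (rule function_space_dim_le_1)
    fix f g assume fg: "f \<in> dirichlet_eigenspace M D \<mu>" "g \<in> dirichlet_eigenspace M D \<mu>"
    show "\<exists>a b. (a \<noteq> 0 \<or> b \<noteq> 0) \<and> (\<forall>p. a * f p + b * g p = 0)"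
    proof (rule ccontr)
      assume no: "\<not> ?thesis"
      have "\<exists>p. f p \<noteq> 0" using no[unfolded not_ex, rule_format, of 1 0] by auto
      moreover have "\<exists>p. g p \<noteq> 0" using no[unfolded not_ex, rule_format, of 0 1] by auto
      ultimately show False
        using two_eigenfunctions[OF D L(2)[OF that] L(2)[OF that] fg] no by blast
    qed
  qed
  show "(\<Sum>\<mu>\<in>\<Lambda>. ?d \<mu>) \<le> 1"
  proof (cases "\<exists>\<mu>\<in>\<Lambda>. ?d \<mu> \<noteq> 0")
    case True
    then obtain \<mu> where \<mu>: "\<mu> \<in> \<Lambda>" "?d \<mu> \<noteq> 0" by blast
    have "?d \<nu> = 0" if "\<nu> \<in> \<Lambda> - {\<mu>}" for \<nu>
    proof (rule ccontr)
      assume "?d \<nu> \<noteq> 0"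
      then obtain f g p1 p2 where fg: "f \<in> dirichlet_eigenspace M D \<mu>" "g \<in> dirichlet_eigenspace M D \<nu>"
        "f p1 \<noteq> 0" "g p2 \<noteq> 0"
        using function_space_dim_nonzero \<mu>(2) by meson
      have "\<mu> < 0" "\<nu> < 0" using L(2) \<mu>(1) that by auto
      from two_eigenfunctions[OF D this fg] show False using that by auto
    qed
    then have "(\<Sum>\<nu>\<in>\<Lambda>. ?d \<nu>) = ?d \<mu>"
      using L(1) \<mu>(1) by (simp add: sum.remove)
    then show ?thesis using one \<mu>(1) by simp
  next
    case False
    then show ?thesis by simp
  qed
qed

text \<open>The radial solution is placed on the image of the annulus between its zeros. Its zeros
  at both ends make the extension by zero continuous on the closure of the domain.\<close>

lemma exists_negative:
  shows "\<exists>D \<mu> f p. bounded_domain M D \<and> \<mu> < 0 \<and> f \<in> dirichlet_eigenspace M D \<mu> \<and> f p \<noteq> 0"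
proof -
  obtain e \<tau>1 \<tau>2 y y' y'' where e: "e > 0" "\<tau>1 < 0" "\<tau>2 > 0"
    and yc: "continuous_on UNIV y" and yz: "y \<tau>1 = 0" "y \<tau>2 = 0" "y 0 > 0"
    and yall: "\<forall>t. \<tau>1 < t \<and> t < \<tau>2 \<longrightarrow> (y has_real_derivative y' t) (at t) \<and> (y' has_real_derivative y'' t) (at t) \<and>
      y'' t + (real m - 1) * T t * y' t + real m * (real m + 1) * (1 - (T t)\<^sup>2) * y t = e * (Phi t)\<^sup>2 * y t"
    and y''c: "continuous_on {\<tau>1<..<\<tau>2} y''"
    using radial_eigenfunction by blast
  define A where "A = {x::'a. exp \<tau>1 \<le> norm x \<and> norm x \<le> exp \<tau>2}"
  define \<Omega> where "\<Omega> = {x::'a. exp \<tau>1 < norm x \<and> norm x < exp \<tau>2}"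
  define D where "D = Psi ` \<Omega>"
  define f where "f p = (if p \<in> D then y (ln (norm (crd p))) else 0)" for p
  have o\<Omega>: "open \<Omega>" unfolding \<Omega>_def by (intro open_Collect_conj open_Collect_less continuous_intros)
  have n0: "x \<noteq> 0" if "exp \<tau>1 \<le> norm x" for x :: 'a
    using that exp_gt_zero[of \<tau>1] by (auto simp: not_le)
  have s\<Omega>: "\<Omega> \<subseteq> - {0}" and sA: "A \<subseteq> - {0}" using n0 by (auto simp: \<Omega>_def A_def)
  have \<Omega>A: "\<Omega> \<subseteq> A" by (auto simp: \<Omega>_def A_def)
  have lnr: "\<tau>1 < ln (norm x) \<and> ln (norm x) < \<tau>2" if "x \<in> \<Omega>" for x
  proof -
    have "norm x > 0" using that s\<Omega> by auto
    then show ?thesis using that unfolding \<Omega>_def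
      by (metis (mono_tags, lifting) exp_less_cancel_iff exp_ln mem_Collect_eq)
  qed
  have "closed A" unfolding A_def by (intro closed_Collect_conj closed_Collect_le continuous_intros)
  moreover have "bounded A" unfolding A_def by (rule boundedI[of _ "exp \<tau>2"]) auto
  ultimately have cA: "compact A" using compact_eq_bounded_closed by blast
  have cPA: "compact (Psi ` A)"
    by (intro compact_continuous_image continuous_on_subset[OF chart.continuous_\<Psi> sA] cA)
  have PAM: "Psi ` A \<subseteq> M" using sA by (auto simp: M_def)
  have DA: "closure D \<subseteq> Psi ` A"
    using \<Omega>A compact_imp_closed[OF cPA] unfolding D_def by (intro closure_minimal) auto
  \<comment> \<open>A unit vector corresponds to t = 0, which lies between the two zeros and where y
    is positive; so the domain is nonempty and the eigenfunction is not zero.\<close>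
  obtain b :: 'a where b: "norm b = 1" using vector_choose_size[of 1] by auto
  have b\<Omega>: "b \<in> \<Omega>" using b e by (simp add: \<Omega>_def)
  have inD: "crd p \<in> \<Omega> \<longleftrightarrow> p \<in> D" if "p \<in> M" for p
  proof
    show "p \<in> D" if "crd p \<in> \<Omega>"
      using that chart.coord_in[OF \<open>p \<in> M\<close>] unfolding D_def by (metis image_eqI)
    show "crd p \<in> \<Omega>" if "p \<in> D"
    proof -
      obtain x where "x \<in> \<Omega>" "p = Psi x" using \<open>p \<in> D\<close> unfolding D_def by blast
      moreover from this have "x \<noteq> 0" using s\<Omega> by blast
      ultimately show ?thesis using crd_Psi[of x] by simp
    qed
  qed
  have bd: "bounded_domain M D"
    unfolding bounded_domain_def
  proof (intro conjI)
    show "D \<noteq> {}" using b\<Omega> by (auto simp: D_def)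
    have "D = M \<inter> crd -` \<Omega>" using inD s\<Omega> by (auto simp: D_def M_def)
    then show "openin (top_of_set M) D"
      using continuous_openin_preimage_gen[OF chart.continuous_coord o\<Omega>] by simp
    have "2 \<le> DIM('a)" using dimension m2 by simp
    from connected_annulus(1)[OF this, of "exp \<tau>1" 0 "exp \<tau>2"]
    have "connected \<Omega>" by (simp add: \<Omega>_def)
    then show "connected D" unfolding D_def
      by (intro connected_continuous_image continuous_on_subset[OF chart.continuous_\<Psi> s\<Omega>])
    show "compact (closure D)"
      using bounded_subset[OF compact_imp_bounded[OF cPA] DA] by (simp add: compact_eq_bounded_closed)
    show "closure D \<subseteq> M" using DA PAM by auto
  qed
  have fP: "f (Psi x) = y (ln (norm x))" if "x \<in> \<Omega>" for x
  proof -
    have "x \<noteq> 0" using that s\<Omega> by blast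
    then show ?thesis using that crd_Psi[of x] by (simp add: f_def D_def)
  qed
  have gy: "GDERIV (\<lambda>x. y (ln (norm x))) x :> (y' (ln (norm x)) / (norm x)\<^sup>2) *\<^sub>R x" if "x \<in> \<Omega>" for x
    by (rule GDERIV_radial) (use that s\<Omega> lnr yall in auto)
  have gf: "gr (\<lambda>x. f (Psi x)) x = y' (ln (norm x)) *\<^sub>R ((1 / (norm x)\<^sup>2) *\<^sub>R x)" if "x \<in> \<Omega>" for x
  proof -
    have "gr (\<lambda>x. f (Psi x)) x = gr (\<lambda>x. y (ln (norm x))) x"
      by (rule gr_cong_open[OF o\<Omega> that]) (rule fP)
    also have "\<dots> = (y' (ln (norm x)) / (norm x)\<^sup>2) *\<^sub>R x" by (rule gderiv_imp_gr[OF gy[OF that]])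
    finally show ?thesis by simp
  qed
  have y'C: "C1_on \<Omega> (\<lambda>x. y' (ln (norm x)))"
    by (rule C1_on_radial[where h'=y''])
      (use s\<Omega> lnr yall in \<open>auto intro!: continuous_on_subset[OF y''c]\<close>)
  have F: "C1_field \<Omega> (\<lambda>x. y' (ln (norm x)) *\<^sub>R ((1 / (norm x)\<^sup>2) *\<^sub>R x))"
    by (intro C1_field_scale y'C C1_field_subset[OF C1_field_unit_radial s\<Omega>])
  have F': "C1_field \<Omega> (gr (\<lambda>x. f (Psi x)))"
    unfolding C1_field_def
  proof
    fix b :: 'a assume "b \<in> Basis"
    then have c: "C1_on \<Omega> (\<lambda>x. (y' (ln (norm x)) *\<^sub>R ((1 / (norm x)\<^sup>2) *\<^sub>R x)) \<bullet> b)" using F unfolding C1_field_def by blast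
    show "C1_on \<Omega> (\<lambda>x. gr (\<lambda>x. f (Psi x)) x \<bullet> b)" by (rule C1_on_cong[OF o\<Omega> _ c]) (simp add: gf)
  qed
  have fC1: "C1_on \<Omega> (\<lambda>x. f (Psi x))"
  proof (rule C1_on_cong[OF o\<Omega>])
    show "C1_on \<Omega> (\<lambda>x. y (ln (norm x)))"
    proof (rule C1_onI[OF gy])
      show "continuous_on \<Omega> (\<lambda>x. (y' (ln (norm x)) / (norm x)\<^sup>2) *\<^sub>R x)"
        using C1_field_continuous_on[OF F] by simp
    qed
  qed (simp add: fP)
  have fCk: "surface_Ck_on 2 M D f"
    by (rule chart.Ck_pushforward[OF o\<Omega> s\<Omega> D_def fC1 F'])
  have eig: "f \<in> dirichlet_eigenspace M D (- e)"
    unfolding dirichlet_eigenspace_def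
  proof (intro CollectI conjI allI impI ballI)
    show "surface_Ck_on 2 M D f" by (rule fCk)
    show "f p = 0" if "p \<notin> D" for p using that by (simp add: f_def)
    have "continuous_on (Psi ` A) (\<lambda>p. y (ln (norm (crd p))))"
    proof (rule continuous_on_compose2[OF yc])
      have "continuous_on (Psi ` A) crd" by (rule continuous_on_subset[OF chart.continuous_coord PAM])
      moreover have "crd p \<noteq> 0" if "p \<in> Psi ` A" for p using chart.coord_in[of p] that PAM by auto
      ultimately show "continuous_on (Psi ` A) (\<lambda>p. ln (norm (crd p)))"
        by (intro continuous_intros) auto
    qed auto
    moreover have "y (ln (norm (crd p))) = f p" if "p \<in> Psi ` A" for p
    proof (cases "p \<in> D")
      case False
      obtain x where x: "x \<in> A" "p = Psi x" using \<open>p \<in> Psi ` A\<close> by auto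
      have "x \<notin> \<Omega>" using False x(2) by (auto simp: D_def)
      then have "norm x = exp \<tau>1 \<or> norm x = exp \<tau>2" using x(1) by (auto simp: A_def \<Omega>_def)
      then have "y (ln (norm x)) = 0" using yz by auto
      moreover have "x \<noteq> 0" using x(1) sA by blast
      then have "crd p = x" using crd_Psi[of x] x(2) by simp
      ultimately show ?thesis using False by (simp add: f_def)
    qed (simp add: f_def)
    ultimately have "continuous_on (Psi ` A) f" by (rule continuous_on_eq)
    then show "continuous_on (closure D) f" by (rule continuous_on_subset[OF _ DA])
    fix p assume "p \<in> D"
    then obtain x where x: "x \<in> \<Omega>" "p = Psi x" by (auto simp: D_def)
    have x0: "x \<noteq> 0" using x s\<Omega> by auto
    define t where "t = ln (norm x)"
    have eq: "y'' t + (real m - 1) * T t * y' t + real m * (real m + 1) * (1 - (T t)\<^sup>2) * y t = e * (Phi t)\<^sup>2 * y t"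
      and dy': "(y' has_real_derivative y'' t) (at (ln (norm x)))"
      using yall lnr[OF x(1)] by (auto simp: t_def)
    have "dv (\<lambda>y. W y *\<^sub>R gr (\<lambda>y. f (Psi y)) y) x = dv (\<lambda>x. W x *\<^sub>R (y' (ln (norm x)) *\<^sub>R ((1 / (norm x)\<^sup>2) *\<^sub>R x))) x"
      unfolding dv_def
    proof (intro sum.cong HOL.refl)
      fix b :: 'a
      have "gr (\<lambda>y. (W y *\<^sub>R gr (\<lambda>y. f (Psi y)) y) \<bullet> b) x
        = gr (\<lambda>x. (W x *\<^sub>R (y' (ln (norm x)) *\<^sub>R ((1 / (norm x)\<^sup>2) *\<^sub>R x))) \<bullet> b) x"
        by (rule gr_cong_open[OF o\<Omega> x(1)]) (simp add: gf)
      then show "gr (\<lambda>y. (W y *\<^sub>R gr (\<lambda>y. f (Psi y)) y) \<bullet> b) x \<bullet> b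
        = gr (\<lambda>x. (W x *\<^sub>R (y' (ln (norm x)) *\<^sub>R ((1 / (norm x)\<^sup>2) *\<^sub>R x))) \<bullet> b) x \<bullet> b" by simp
    qed
    also have "\<dots> = W x / (norm x)\<^sup>2 * (y'' t + (real m - 1) * T t * y' t)"
      using weight.dv_radial[OF x0 GDERIV_radial[OF x0 dy']] by (simp add: th_eq t_def)
    finally have dvx: "dv (\<lambda>y. W y *\<^sub>R gr (\<lambda>y. f (Psi y)) y) x = W x / (norm x)\<^sup>2 * (y'' t + (real m - 1) * T t * y' t)" .
    have l: "(lm x)\<^sup>2 = (Phi t)\<^sup>2 / (norm x)\<^sup>2" unfolding lm_eq[OF x0] t_def by (simp add: power_divide)
    have "stability_operator M f p = (y'' t + (real m - 1) * T t * y' t) / (Phi t)\<^sup>2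
      + real m * (real m + 1) * (1 - (T t)\<^sup>2) / (Phi t)\<^sup>2 * y t"
      unfolding x(2) stability_eq[OF o\<Omega> s\<Omega> D_def x(1) fCk] dvx l fP[OF x(1)] t_def[symmetric]
      using W_pos[of x] x0 by simp
    also have "\<dots> = (e * (Phi t)\<^sup>2 * y t) / (Phi t)\<^sup>2"
      unfolding eq[symmetric] by (simp add: add_divide_distrib)
    also have "\<dots> = e * y t" using Phi_pos[of t] by simp
    finally show "stability_operator M f p = - (- e) * f p"
      using fP[OF x(1)] by (simp add: x(2) t_def)
  qed
  have "f (Psi b) \<noteq> 0" using fP[OF b\<Omega>] b yz(3) by simp
  then show ?thesis using bd eig e(1) by (intro exI[of _ D] exI[of _ "- e"] exI[of _ f] exI[of _ "Psi b"]) auto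
qed

theorem index_eq_1: "morse_index M = 1"
proof (rule antisym)
  show "morse_index M \<le> 1"
    unfolding morse_index_def using num_negative_le_1 by (intro SUP_least) auto
  obtain D \<mu> f p where h: "bounded_domain M D" "\<mu> < 0" "f \<in> dirichlet_eigenspace M D \<mu>" "f p \<noteq> 0"
    using exists_negative by blast
  have "1 \<le> function_space_dim (dirichlet_eigenspace M D \<mu>)"
    using function_space_dim_ge_1[OF h(3,4)] .
  also have "\<dots> = (\<Sum>\<mu>\<in>{\<mu>}. function_space_dim (dirichlet_eigenspace M D \<mu>))" by simp
  also have "\<dots> \<le> num_negative_eigenvalues M D"
    unfolding num_negative_eigenvalues_def using h(2) by (intro SUP_upper) auto
  also have "\<dots> \<le> morse_index M"
    unfolding morse_index_def using h(1) by (intro SUP_upper) auto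
  finally show "1 \<le> morse_index M" .
qed

end

theorem theorem2p1:
  fixes M :: "((real ^ 'n) \<times> real) set"
  assumes "CARD('n) \<ge> 3"
    and "catenoid M"
  shows "morse_index M = 1"
proof -
  obtain \<phi>\<^sub>0 S \<phi> tr where h: "\<phi>\<^sub>0 > 0" "catenoid_profile CARD('n) \<phi>\<^sub>0 S \<phi>" "rigid_motion tr" "M = tr ` standard_catenoid S \<phi>"
    using assms(2) unfolding catenoid_def by blast
  obtain m where m: "CARD('n) = Suc m" "m \<ge> 2" using assms(1) by (metis Suc_le_D Suc_le_mono numeral_3_eq_3 numeral_2_eq_2)
  obtain c R where R: "orthogonal_transformation R" "tr = (\<lambda>x. c + R x)"
    using h(3) unfolding rigid_motion_def by blast
  interpret P: catenoid_param m \<phi>\<^sub>0 by unfold_locales (use m h(1) in auto)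
  note prof = P.profile_unique[OF h(2)[unfolded m(1)]]
  obtain \<tau> where \<tau>: "\<And>t. \<tau> (P.sig t) = t" "\<And>t. (\<tau> has_real_derivative 1 / P.dsig t) (at (P.sig t))"
    using prof(3) by blast
  interpret C: catenoid_chart m \<phi>\<^sub>0 c R \<tau>
    by unfold_locales (use m R(1) \<tau> in auto)
  \<comment> \<open>Polar coordinates x = exp t \<omega>. By \<open>prof\<close> the given profile
    and height are those of the explicit parametrization, so a catenoid with any admissible profile
    is covered by the chart.\<close>
  have "standard_catenoid S \<phi> = C.Psi0 ` (- {0})"
  proof (intro equalityI subsetI)
    fix p :: "(real ^ 'n) \<times> real" assume "p \<in> standard_catenoid S \<phi>"
    then obtain s \<omega> where p: "s \<in> {-S<..<S}" "norm \<omega> = 1" "p = (\<phi> s *\<^sub>R \<omega>, s)"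
      unfolding standard_catenoid_def by auto
    have "s \<in> range P.sig" using p(1) P.range_sig prof(1) by simp
    then obtain t where t: "s = P.sig t" by blast
    have x: "norm (exp t *\<^sub>R \<omega>) = exp t" "exp t *\<^sub>R \<omega> \<noteq> 0" using p(2) by auto
    have "C.Psi0 (exp t *\<^sub>R \<omega>) = p"
      unfolding C.Psi0_def x(1) C.lm_def p(3) t prof(2) by (simp add: exp_minus)
    then show "p \<in> C.Psi0 ` (- {0})" using x(2) by (metis ComplI image_eqI singletonD)
  next
    fix p assume "p \<in> C.Psi0 ` (- {0})"
    then obtain x where x: "x \<noteq> 0" "p = C.Psi0 x" by auto
    define t where "t = ln (norm x)"
    have "p = (\<phi> (P.sig t) *\<^sub>R (x /\<^sub>R norm x), P.sig t)"
      unfolding x(2) C.Psi0_def C.lm_eq[OF x(1)] t_def prof(2) by (simp add: divide_inverse)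
    moreover have "P.sig t \<in> {-S<..<S}" using P.range_sig prof(1) by auto
    moreover have "norm (x /\<^sub>R norm x) = 1" using x(1) by simp
    ultimately show "p \<in> standard_catenoid S \<phi>"
      unfolding standard_catenoid_def by (intro image_eqI[of _ _ "(P.sig t, x /\<^sub>R norm x)"]) auto
  qed
  then have "M = C.M" unfolding C.M_def C.Psi_def h(4) R(2) by auto
  then show ?thesis using C.index_eq_1 by simp
qed

end
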